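(* Let $P$ be a finite connected polyhedron with $\dim P = 2$ such that $\pi_1(P)$ has a finite aspherical presentation and is weakly Hopfian. Then every homotopy domination $d: P \rightarrow P$ is a homotopy equivalence.
   Context: A map $d: X \to Y$ is a homotopy domination (of $X$ over $Y$) if there is a map $u: Y \to X$ with $d \circ u \simeq \mathrm{id}_Y$. A group presentation is aspherical if the standard $2$-dimensional CW-complex associated with it (one $0$-cell, one $1$-cell per generator, one $2$-cell per relator) is aspherical, i.e. $\pi_i = 0$ for all $i \geq 2$. A group $G$ is weakly Hopfian if, whenever $K \lhd G$ and $H \leq G$ satisfy $G = KH$, $K \cap H = 1$ (that is, $G = K \rtimes H$, so that $H$ is a retract of $G$) and $H \cong G$, then $K = 1$. *)

theory Defs
  imports "HOL-Analysis.Analysis" "HOL-Algebra.Coset"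
begin

section \<open>Homotopy dominations and homotopy equivalences\<close>

definition homotopy_domination :: "'a topology \<Rightarrow> 'b topology \<Rightarrow> ('a \<Rightarrow> 'b) \<Rightarrow> bool" where
  "homotopy_domination X Y d \<longleftrightarrow>
     continuous_map X Y d \<and>
     (\<exists>u. continuous_map Y X u \<and> homotopic_with (\<lambda>_. True) Y Y (d \<circ> u) id)"

definition homotopy_equivalence :: "'a topology \<Rightarrow> 'b topology \<Rightarrow> ('a \<Rightarrow> 'b) \<Rightarrow> bool" where
  "homotopy_equivalence X Y f \<longleftrightarrow>
     continuous_map X Y f \<and>
     (\<exists>g. continuous_map Y X g \<and>
          homotopic_with (\<lambda>_. True) X X (g \<circ> f) id \<and>
          homotopic_with (\<lambda>_. True) Y Y (f \<circ> g) id)"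

section \<open>Finite polyhedra\<close>

text \<open>The library constant \<open>polyhedron\<close> is about convex sets; here a polyhedron is the
  underlying space of a finite simplicial complex. Note that \<open>simplicial_complex\<close> includes
  finiteness, and that the empty face has affine dimension -1.\<close>

definition finite_polyhedron :: "'a::euclidean_space set \<Rightarrow> int \<Rightarrow> bool" where
  "finite_polyhedron P n \<longleftrightarrow>
     (\<exists>T. simplicial_complex T \<and> T \<noteq> {} \<and> \<Union>T = P \<and> Max (aff_dim ` T) = n)"

section \<open>Quotients of sets with an operation by a congruence\<close>

definition quotient_monoid :: "'a set \<Rightarrow> ('a \<times> 'a) set \<Rightarrow> ('a \<Rightarrow> 'a \<Rightarrow> 'a) \<Rightarrow> 'a \<Rightarrow> 'a set monoid" where
  "quotient_monoid A r f e =
     \<lparr>carrier = A // r, mult = (\<lambda>U V. \<Union>u\<in>U. \<Union>v\<in>V. r `` {f u v}), one = r `` {e}\<rparr>"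

lemma group_quotient_monoid:
  assumes eq: "equiv A r" and e: "e \<in> A"
    and closed: "\<And>a b. a \<in> A \<Longrightarrow> b \<in> A \<Longrightarrow> f a b \<in> A"
    and cong: "\<And>a a' b b'. (a, a') \<in> r \<Longrightarrow> (b, b') \<in> r \<Longrightarrow> (f a b, f a' b') \<in> r"
    and assoc: "\<And>a b c. a \<in> A \<Longrightarrow> b \<in> A \<Longrightarrow> c \<in> A \<Longrightarrow> (f (f a b) c, f a (f b c)) \<in> r"
    and unit: "\<And>a. a \<in> A \<Longrightarrow> (f e a, a) \<in> r"
    and inverse: "\<And>a. a \<in> A \<Longrightarrow> i a \<in> A \<and> (f (i a) a, e) \<in> r"
  shows "group (quotient_monoid A r f e)"
proof -
  have mult: "r `` {a} \<otimes>\<^bsub>quotient_monoid A r f e\<^esub> r `` {b} = r `` {f a b}"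
    if "a \<in> A" "b \<in> A" for a b
  proof -
    have "congruent2 r r (\<lambda>a b. r `` {f a b})"
      unfolding congruent2_def using cong eq by (auto intro!: equiv_class_eq)
    then show ?thesis
      using UN_equiv_class2[OF eq eq _ that, of "\<lambda>a b. r `` {f a b}"]
      by (simp add: quotient_monoid_def)
  qed
  have car: "x \<in> carrier (quotient_monoid A r f e) \<longleftrightarrow> (\<exists>a\<in>A. x = r `` {a})" for x
    by (auto simp: quotient_monoid_def quotient_def)
  have one: "\<one>\<^bsub>quotient_monoid A r f e\<^esub> = r `` {e}"
    by (simp add: quotient_monoid_def)
  show ?thesis
  proof (rule groupI)
    fix x y assume "x \<in> carrier (quotient_monoid A r f e)" "y \<in> carrier (quotient_monoid A r f e)"
    then show "x \<otimes>\<^bsub>quotient_monoid A r f e\<^esub> y \<in> carrier (quotient_monoid A r f e)"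
      using closed mult unfolding car by blast
  next
    show "\<one>\<^bsub>quotient_monoid A r f e\<^esub> \<in> carrier (quotient_monoid A r f e)"
      using e one unfolding car by blast
  next
    fix x y z
    assume "x \<in> carrier (quotient_monoid A r f e)" "y \<in> carrier (quotient_monoid A r f e)"
      "z \<in> carrier (quotient_monoid A r f e)"
    then obtain a b c where "a \<in> A" "b \<in> A" "c \<in> A" "x = r `` {a}" "y = r `` {b}" "z = r `` {c}"
      unfolding car by blast
    then show "x \<otimes>\<^bsub>quotient_monoid A r f e\<^esub> y \<otimes>\<^bsub>quotient_monoid A r f e\<^esub> z =
        x \<otimes>\<^bsub>quotient_monoid A r f e\<^esub> (y \<otimes>\<^bsub>quotient_monoid A r f e\<^esub> z)"
      using equiv_class_eq[OF eq assoc] by (simp add: mult closed)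
  next
    fix x assume "x \<in> carrier (quotient_monoid A r f e)"
    then obtain a where a: "a \<in> A" "x = r `` {a}"
      unfolding car by blast
    then show "\<one>\<^bsub>quotient_monoid A r f e\<^esub> \<otimes>\<^bsub>quotient_monoid A r f e\<^esub> x = x"
      using equiv_class_eq[OF eq unit] by (simp add: mult one e)
    have "r `` {i a} \<otimes>\<^bsub>quotient_monoid A r f e\<^esub> x = \<one>\<^bsub>quotient_monoid A r f e\<^esub>"
      using a inverse[of a] equiv_class_eq[OF eq] by (simp add: mult one)
    then show "\<exists>y\<in>carrier (quotient_monoid A r f e).
        y \<otimes>\<^bsub>quotient_monoid A r f e\<^esub> x = \<one>\<^bsub>quotient_monoid A r f e\<^esub>"
    proof (rule bexI)
      show "r `` {i a} \<in> carrier (quotient_monoid A r f e)"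
        using a inverse[of a] unfolding car by blast
    qed
  qed
qed

section \<open>The fundamental group\<close>

definition based_loops :: "'a::real_normed_vector set \<Rightarrow> 'a \<Rightarrow> (real \<Rightarrow> 'a) set" where
  "based_loops S x = {p. path p \<and> path_image p \<subseteq> S \<and> pathstart p = x \<and> pathfinish p = x}"

definition loop_homotopy_rel :: "'a::real_normed_vector set \<Rightarrow> 'a \<Rightarrow> ((real \<Rightarrow> 'a) \<times> (real \<Rightarrow> 'a)) set" where
  "loop_homotopy_rel S x =
     {(p, q). p \<in> based_loops S x \<and> q \<in> based_loops S x \<and> homotopic_paths S p q}"

definition fundamental_group :: "'a::real_normed_vector set \<Rightarrow> 'a \<Rightarrow> (real \<Rightarrow> 'a) set monoid" where
  "fundamental_group S x =
     quotient_monoid (based_loops S x) (loop_homotopy_rel S x) (+++) (linepath x x)"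

lemma group_fundamental_group:
  assumes "x \<in> S"
  shows "group (fundamental_group S x)"
  unfolding fundamental_group_def
proof (rule group_quotient_monoid[where i = reversepath])
  show "equiv (based_loops S x) (loop_homotopy_rel S x)"
  proof (rule equivI)
    show "loop_homotopy_rel S x \<subseteq> based_loops S x \<times> based_loops S x"
      by (auto simp: loop_homotopy_rel_def)
    show "refl_on (based_loops S x) (loop_homotopy_rel S x)"
      by (auto simp: refl_on_def loop_homotopy_rel_def based_loops_def)
    show "sym (loop_homotopy_rel S x)"
      by (simp add: sym_def loop_homotopy_rel_def homotopic_paths_sym)
    show "trans (loop_homotopy_rel S x)"
      unfolding trans_def loop_homotopy_rel_def using homotopic_paths_trans by blast
  qed
  show "linepath x x \<in> based_loops S x"
    using assms by (simp add: based_loops_def)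
  show closed: "p +++ q \<in> based_loops S x" if "p \<in> based_loops S x" "q \<in> based_loops S x" for p q
    using that by (simp add: based_loops_def subset_path_image_join)
  show "(p +++ q, p' +++ q') \<in> loop_homotopy_rel S x"
    if "(p, p') \<in> loop_homotopy_rel S x" "(q, q') \<in> loop_homotopy_rel S x" for p p' q q'
    using that closed
    by (auto simp: loop_homotopy_rel_def intro!: homotopic_paths_join) (simp add: based_loops_def)
  show "((p +++ q) +++ s, p +++ (q +++ s)) \<in> loop_homotopy_rel S x"
    if "p \<in> based_loops S x" "q \<in> based_loops S x" "s \<in> based_loops S x" for p q s
    using that closed
    by (auto simp: loop_homotopy_rel_def based_loops_def
        intro!: homotopic_paths_sym[OF homotopic_paths_assoc])
  show "(linepath x x +++ p, p) \<in> loop_homotopy_rel S x" if "p \<in> based_loops S x" for p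
    using that closed \<open>linepath x x \<in> based_loops S x\<close>
    by (auto simp: loop_homotopy_rel_def based_loops_def intro!: homotopic_paths_lid')
  show "reversepath p \<in> based_loops S x \<and> (reversepath p +++ p, linepath x x) \<in> loop_homotopy_rel S x"
    if "p \<in> based_loops S x" for p
  proof -
    have "reversepath p \<in> based_loops S x"
      using that by (simp add: based_loops_def)
    then show ?thesis
      using that closed \<open>linepath x x \<in> based_loops S x\<close> homotopic_paths_linv[of p S]
      by (simp add: loop_homotopy_rel_def based_loops_def)
  qed
qed

section \<open>Asphericity\<close>

text \<open>Elements of \<open>\<pi>\<^sub>n(X, x)\<close> are homotopy classes, relative to the boundary, of maps of
  the \<open>n\<close>-cube that send the boundary to \<open>x\<close>. Only the underlying set of \<open>\<pi>\<^sub>n\<close> is defined,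
  which is enough to say that the group is trivial. For \<open>n = 0\<close> the boundary is empty.\<close>

definition cube :: "nat \<Rightarrow> (nat \<Rightarrow> real) topology" where
  "cube n = product_topology (\<lambda>_. top_of_set {0..1}) {..<n}"

definition cube_boundary :: "nat \<Rightarrow> (nat \<Rightarrow> real) set" where
  "cube_boundary n = {p \<in> topspace (cube n). \<exists>i<n. p i = 0 \<or> p i = 1}"

definition spheroids :: "nat \<Rightarrow> 'a topology \<Rightarrow> 'a \<Rightarrow> ((nat \<Rightarrow> real) \<Rightarrow> 'a) set" where
  "spheroids n X x = {f. continuous_map (cube n) X f \<and> (\<forall>p\<in>cube_boundary n. f p = x)}"

definition homotopy_set :: "nat \<Rightarrow> 'a topology \<Rightarrow> 'a \<Rightarrow> ((nat \<Rightarrow> real) \<Rightarrow> 'a) set set" where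
  "homotopy_set n X x =
     spheroids n X x //
     {(f, g). f \<in> spheroids n X x \<and> g \<in> spheroids n X x \<and>
              homotopic_with (\<lambda>h. \<forall>p\<in>cube_boundary n. h p = x) (cube n) X f g}"

definition aspherical_space :: "'a topology \<Rightarrow> bool" where
  "aspherical_space X \<longleftrightarrow> (\<forall>n\<ge>2. \<forall>x\<in>topspace X. is_singleton (homotopy_set n X x))"

section \<open>Group presentations\<close>

text \<open>A letter \<open>(g, True)\<close> stands for the generator \<open>g\<close> and \<open>(g, False)\<close> for its inverse.\<close>

type_synonym 'g word = "('g \<times> bool) list"

definition words :: "'g set \<Rightarrow> 'g word set" where
  "words X = lists (X \<times> UNIV)"

inductive freely_equal :: "'g set \<Rightarrow> 'g word \<Rightarrow> 'g word \<Rightarrow> bool" for X where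
  refl: "w \<in> words X \<Longrightarrow> freely_equal X w w"
| sym: "freely_equal X v w \<Longrightarrow> freely_equal X w v"
| trans: "freely_equal X u v \<Longrightarrow> freely_equal X v w \<Longrightarrow> freely_equal X u w"
| cancel: "u \<in> words X \<Longrightarrow> v \<in> words X \<Longrightarrow> g \<in> X \<Longrightarrow>
    freely_equal X (u @ [(g, b), (g, \<not> b)] @ v) (u @ v)"

definition free_rel :: "'g set \<Rightarrow> ('g word \<times> 'g word) set" where
  "free_rel X = {(v, w). freely_equal X v w}"

definition free_group :: "'g set \<Rightarrow> 'g word set monoid" where
  "free_group X = quotient_monoid (words X) (free_rel X) (@) []"

definition normal_closure :: "('a, 'b) monoid_scheme \<Rightarrow> 'a set \<Rightarrow> 'a set" where
  "normal_closure G S = \<Inter>{N. N \<lhd> G \<and> S \<subseteq> N}"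

definition presented_group :: "'g set \<Rightarrow> 'g word set \<Rightarrow> 'g word set set monoid" where
  "presented_group X R =
     free_group X Mod normal_closure (free_group X) ((\<lambda>w. free_rel X `` {w}) ` R)"

lemma in_words_iff: "w \<in> words X \<longleftrightarrow> (\<forall>l\<in>set w. fst l \<in> X)"
  by (auto simp: words_def in_lists_conv_set)

lemma freely_equal_words: "freely_equal X v w \<Longrightarrow> v \<in> words X \<and> w \<in> words X"
  by (induction rule: freely_equal.induct) (auto simp: in_words_iff)

lemma freely_equal_append:
  assumes "freely_equal X v w" "p \<in> words X" "q \<in> words X"
  shows "freely_equal X (p @ v @ q) (p @ w @ q)"
  using assms
proof (induction rule: freely_equal.induct)
  case (refl w)
  then show ?case by (intro freely_equal.refl) (auto simp: in_words_iff)
next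
  case (cancel u v g b)
  then show ?case
    using freely_equal.cancel[of "p @ u" X "v @ q" g b] by (auto simp: in_words_iff)
next
  case (sym v w)
  then show ?case by (simp add: freely_equal.sym)
next
  case (trans u v w)
  then show ?case by (meson freely_equal.trans)
qed

lemma equiv_free_rel: "equiv (words X) (free_rel X)"
proof (rule equivI)
  show "free_rel X \<subseteq> words X \<times> words X"
    by (auto simp: free_rel_def dest: freely_equal_words)
  show "refl_on (words X) (free_rel X)"
    by (auto simp: refl_on_def free_rel_def intro: freely_equal.refl)
  show "sym (free_rel X)"
    by (simp add: sym_def free_rel_def freely_equal.sym)
  show "trans (free_rel X)"
    unfolding trans_def free_rel_def using freely_equal.trans by blast
qed

lemma freely_equal_inverse:
  "w \<in> words X \<Longrightarrow> freely_equal X (rev (map (apsnd Not) w) @ w) []"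
proof (induction w)
  case Nil
  then show ?case by (auto intro: freely_equal.refl)
next
  case (Cons l w)
  obtain g b where l: "l = (g, b)" by fastforce
  have w: "w \<in> words X" "rev (map (apsnd Not) w) \<in> words X" "g \<in> X"
    using Cons.prems by (auto simp: in_words_iff l)
  have "freely_equal X (rev (map (apsnd Not) w) @ [(g, \<not> b), (g, \<not> \<not> b)] @ w)
      (rev (map (apsnd Not) w) @ w)"
    by (rule freely_equal.cancel) (use w in auto)
  from freely_equal.trans[OF this Cons.IH[OF w(1)]] show ?case
    by (simp add: l)
qed

lemma group_free_group: "group (free_group X)"
  unfolding free_group_def
proof (rule group_quotient_monoid[where i = "\<lambda>w. rev (map (apsnd Not) w)"])
  show "equiv (words X) (free_rel X)" by (rule equiv_free_rel)
  show "[] \<in> words X" by (simp add: in_words_iff)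
  show closed: "v @ w \<in> words X" if "v \<in> words X" "w \<in> words X" for v w
    using that by (auto simp: in_words_iff)
  show "(v @ w, v' @ w') \<in> free_rel X"
    if "(v, v') \<in> free_rel X" "(w, w') \<in> free_rel X" for v v' w w'
  proof -
    have vw: "freely_equal X v v'" "freely_equal X w w'"
      using that by (auto simp: free_rel_def)
    have nil: "[] \<in> words X"
      by (simp add: in_words_iff)
    have "freely_equal X ([] @ v @ w) ([] @ v' @ w)"
      using freely_equal_append[OF vw(1) nil] freely_equal_words[OF vw(2)] by simp
    moreover have "freely_equal X (v' @ w @ []) (v' @ w' @ [])"
      using freely_equal_append[OF vw(2) _ nil] freely_equal_words[OF vw(1)] by simp
    ultimately have "freely_equal X (v @ w) (v' @ w')"
      using freely_equal.trans[of X "v @ w" "v' @ w" "v' @ w'"] by simp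
    then show ?thesis by (simp add: free_rel_def)
  qed
  show "((u @ v) @ w, u @ (v @ w)) \<in> free_rel X"
    if "u \<in> words X" "v \<in> words X" "w \<in> words X" for u v w
    using that by (simp add: free_rel_def freely_equal.refl closed)
  show "([] @ w, w) \<in> free_rel X" if "w \<in> words X" for w
    using that by (simp add: free_rel_def freely_equal.refl)
  show "rev (map (apsnd Not) w) \<in> words X \<and> (rev (map (apsnd Not) w) @ w, []) \<in> free_rel X"
    if "w \<in> words X" for w
  proof
    show "rev (map (apsnd Not) w) \<in> words X"
      using that by (simp add: in_words_iff)
    show "(rev (map (apsnd Not) w) @ w, []) \<in> free_rel X"
      using freely_equal_inverse[OF that] by (simp only: free_rel_def mem_Collect_eq prod.case)
  qed
qed

lemma normal_normal_closure:
  assumes "group G" "S \<subseteq> carrier G"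
  shows "normal_closure G S \<lhd> G"
proof -
  interpret group G by fact
  have "carrier G \<lhd> G"
    by (simp add: normal_inv_iff subgroup_self)
  then have ne: "{N. N \<lhd> G \<and> S \<subseteq> N} \<noteq> {}"
    using assms by blast
  have "subgroup (normal_closure G S) G"
    unfolding normal_closure_def
    by (rule subgroups_Inter) (use ne in \<open>auto intro: normal_imp_subgroup\<close>)
  moreover have "x \<otimes>\<^bsub>G\<^esub> h \<otimes>\<^bsub>G\<^esub> inv\<^bsub>G\<^esub> x \<in> normal_closure G S"
    if "x \<in> carrier G" "h \<in> normal_closure G S" for x h
    using that unfolding normal_closure_def normal_inv_iff by auto
  ultimately show ?thesis
    by (simp add: normal_inv_iff)
qed

lemma group_presented_group:
  assumes "R \<subseteq> words X"
  shows "group (presented_group X R)"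
proof -
  have "(\<lambda>w. free_rel X `` {w}) ` R \<subseteq> carrier (free_group X)"
    using assms by (auto simp: free_group_def quotient_monoid_def intro: quotientI)
  then show ?thesis
    unfolding presented_group_def
    by (intro normal.factorgroup_is_group normal_normal_closure group_free_group)
qed

section \<open>The standard 2-complex of a presentation\<close>

text \<open>The points are the vertex, the points \<open>Edge g t\<close> (\<open>0 < t < 1\<close>) of the open 1-cells, and
  the points \<open>Face r z\<close> (\<open>|z| < 1\<close>) of the open 2-cells.\<close>

datatype 'g complex_point = Vertex | Edge 'g real | Face "'g word" complex

definition complex_points :: "'g set \<Rightarrow> 'g word set \<Rightarrow> 'g complex_point set" where
  "complex_points X R =
     {Vertex} \<union> {Edge g t |g t. g \<in> X \<and> 0 < t \<and> t < 1} \<union> {Face r z |r z. r \<in> R \<and> norm z < 1}"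

text \<open>Characteristic map of the 1-cell of a generator, on \<open>[0,1]\<close>.\<close>

definition edge_map :: "'g \<Rightarrow> real \<Rightarrow> 'g complex_point" where
  "edge_map g t = (if 0 < t \<and> t < 1 then Edge g t else Vertex)"

text \<open>The loop spelled by a word, on \<open>[0,1)\<close>: its \<open>i\<close>-th letter is traversed on the \<open>i\<close>-th of
  \<open>length w\<close> equal subintervals, backwards if it is an inverse letter; the empty word gives the
  constant loop.\<close>

definition word_loop :: "'g word \<Rightarrow> real \<Rightarrow> 'g complex_point" where
  "word_loop w t =
     (if w = [] then Vertex
      else let s = real (length w) * t; (g, b) = w ! nat \<lfloor>s\<rfloor>
           in edge_map g (if b then frac s else 1 - frac s))"

text \<open>Characteristic map of the 2-cell of a relator, on the closed unit disc. Its restriction to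
  the unit circle is the attaching map.\<close>

definition face_map :: "'g word \<Rightarrow> complex \<Rightarrow> 'g complex_point" where
  "face_map r z = (if norm z < 1 then Face r z else word_loop r (Arg2pi z / (2 * pi)))"

text \<open>The weak topology: a set is open if its preimage under every characteristic map is open.\<close>

definition presentation_complex :: "'g set \<Rightarrow> 'g word set \<Rightarrow> 'g complex_point topology" where
  "presentation_complex X R = topology (\<lambda>U.
     U \<subseteq> complex_points X R \<and>
     (\<forall>g\<in>X. openin (top_of_set {0..1}) {t \<in> {0..1}. edge_map g t \<in> U}) \<and>
     (\<forall>r\<in>R. openin (top_of_set (cball 0 1)) {z \<in> cball 0 1. face_map r z \<in> U}))"

lemma openin_presentation_complex:
  "openin (presentation_complex X R) U \<longleftrightarrow>
     U \<subseteq> complex_points X R \<and>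
     (\<forall>g\<in>X. openin (top_of_set {0..1}) {t \<in> {0..1}. edge_map g t \<in> U}) \<and>
     (\<forall>r\<in>R. openin (top_of_set (cball 0 1)) {z \<in> cball 0 1. face_map r z \<in> U})"
proof -
  let ?E = "\<lambda>g U. {t \<in> {0..1}. edge_map g t \<in> U}"
  let ?F = "\<lambda>r U. {z \<in> cball 0 1. face_map r z \<in> U}"
  have "?E g (S \<inter> T) = ?E g S \<inter> ?E g T" "?E g (\<Union>K) = (\<Union>S\<in>K. ?E g S)"
    "?F r (S \<inter> T) = ?F r S \<inter> ?F r T" "?F r (\<Union>K) = (\<Union>S\<in>K. ?F r S)" for g r S T K
    by auto
  note eqs = this
  have "istopology (\<lambda>U. U \<subseteq> complex_points X R \<and>
      (\<forall>g\<in>X. openin (top_of_set {0..1}) (?E g U)) \<and>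
      (\<forall>r\<in>R. openin (top_of_set (cball 0 1)) (?F r U)))"
    unfolding istopology_def
  proof (intro conjI allI impI, goal_cases)
    case (1 S T)
    then show ?case by blast
  next
    case (2 S T)
    then show ?case unfolding eqs by (simp add: openin_Int)
  next
    case (3 S T)
    then show ?case unfolding eqs by (simp add: openin_Int)
  next
    case (4 K)
    then show ?case by blast
  next
    case (5 K)
    then show ?case unfolding eqs by (intro ballI openin_Union) blast
  next
    case (6 K)
    then show ?case unfolding eqs by (intro ballI openin_Union) blast
  qed
  then show ?thesis
    unfolding presentation_complex_def by (simp only: topology_inverse')
qed

lemma edge_map_in_points: "g \<in> X \<Longrightarrow> edge_map g t \<in> complex_points X R"
  by (auto simp: edge_map_def complex_points_def)

lemma word_loop_in_points:
  assumes "w \<in> words X" "0 \<le> t" "t < 1"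
  shows "word_loop w t \<in> complex_points X R"
proof (cases "w = []")
  case True
  then show ?thesis by (simp add: word_loop_def complex_points_def)
next
  case False
  let ?i = "nat \<lfloor>real (length w) * t\<rfloor>"
  have "real (length w) * t < real (length w)"
    using False assms by simp
  then have "?i < length w"
    using assms by (simp add: nat_less_iff floor_less_iff)
  then have "w ! ?i \<in> X \<times> UNIV"
    using assms unfolding words_def by (metis in_listsD nth_mem)
  then show ?thesis
    using False by (auto simp: word_loop_def Let_def intro!: edge_map_in_points split: prod.split)
qed

lemma face_map_in_points:
  assumes "r \<in> R" "r \<in> words X"
  shows "face_map r z \<in> complex_points X R"
proof (cases "norm z < 1")
  case True
  then show ?thesis using assms by (auto simp: face_map_def complex_points_def)
next
  case False
  have "0 \<le> Arg2pi z / (2 * pi)" "Arg2pi z / (2 * pi) < 1"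
    using Arg2pi_ge_0[of z] Arg2pi_lt_2pi[of z] by (simp_all add: divide_simps)
  then show ?thesis
    using False word_loop_in_points[OF assms(2)] unfolding face_map_def by presburger
qed

lemma topspace_presentation_complex:
  assumes "R \<subseteq> words X"
  shows "topspace (presentation_complex X R) = complex_points X R"
proof
  show "topspace (presentation_complex X R) \<subseteq> complex_points X R"
    using openin_topspace[of "presentation_complex X R"]
    unfolding openin_presentation_complex by (rule conjunct1)
  have "openin (presentation_complex X R) (complex_points X R)"
    unfolding openin_presentation_complex
  proof (intro conjI ballI)
    fix g assume "g \<in> X"
    then have "{t \<in> {0..1}. edge_map g t \<in> complex_points X R} = {0..1}"
      by (auto intro: edge_map_in_points)
    then show "openin (top_of_set {0..1}) {t \<in> {0..1}. edge_map g t \<in> complex_points X R}"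
      by simp
  next
    fix r assume "r \<in> R"
    then have "{z \<in> cball 0 1. face_map r z \<in> complex_points X R} = cball 0 1"
      using assms by (auto intro: face_map_in_points)
    then show "openin (top_of_set (cball 0 1)) {z \<in> cball 0 1. face_map r z \<in> complex_points X R}"
      by simp
  qed simp
  then show "complex_points X R \<subseteq> topspace (presentation_complex X R)"
    by (rule openin_subset)
qed

text \<open>Taking the generators from the natural numbers is no restriction, as there are only
  finitely many of them. A repeated relator would give a non-aspherical complex, so a set of
  relators is as good as a family.\<close>

definition has_finite_aspherical_presentation :: "('a, 'b) monoid_scheme \<Rightarrow> bool" where
  "has_finite_aspherical_presentation G \<longleftrightarrow>
     (\<exists>(X :: nat set) R. finite X \<and> finite R \<and> R \<subseteq> words X \<and>
        presented_group X R \<cong> G \<and> aspherical_space (presentation_complex X R))"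

section \<open>Weakly Hopfian groups\<close>

definition weakly_hopfian :: "('a, 'b) monoid_scheme \<Rightarrow> bool" where
  "weakly_hopfian G \<longleftrightarrow>
     (\<forall>K H. K \<lhd> G \<and> subgroup H G \<and> K <#>\<^bsub>G\<^esub> H = carrier G \<and> K \<inter> H = {\<one>\<^bsub>G\<^esub>} \<and>
        G\<lparr>carrier := H\<rparr> \<cong> G \<longrightarrow> K = {\<one>\<^bsub>G\<^esub>})"

end

(* A homotopy section u of d makes pi_1(P) a retract of itself, so that weak Hopficity turns d and u
   into isomorphisms of pi_1(P), inverse to each other after a change of u and d near the base point.
   Since the presentation complex X is aspherical and has the fundamental group of P, there are maps
   P -> X -> P whose composition e is the identity on the 1-skeleton and trivial on pi_2(P). The
   difference of a spherical map and its composition with e is a sum of spheres made of a triangle and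
   its image under e; hence pi_2(P) is a direct summand of the free Z[pi_1(P)]-module C_2 of 2-chains of
   the universal covering. The endomorphism x - u d x of pi_2(P) then gives an idempotent matrix over
   the group ring, whose trace is tr(1) - tr(u d) = tr(1) - tr(d u) = 0. By a theorem of
   Kaplansky it vanishes, so h = u d induces the identity on pi_1(P) and pi_2(P). As P has dimension 2,
   h is homotopic to a map that fixes the 1-skeleton and has a right homotopy inverse g, and since
   d u is homotopic to the identity, h ~ h (h g) = (h h) g ~ h g ~ 1. *)
theory Submission
  imports Defs "HOL-Library.Groups_Big_Fun" "HOL-Algebra.FiniteProduct"
begin

section \<open>Stable finiteness of integral group rings\<close>

text \<open>Weak Hopficity governs pi_1 only. A module can be isomorphic to a proper summand of
  itself, so for pi_2 some finiteness theorem is indispensable, and Kaplansky's speaks of matrices: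
  hence the effort to coordinatise pi_2. His argument projects orthogonally in a Hilbert space; here
  near-minimisers of a distance, with explicit errors, replace the projections, so that all vectors
  keep finite support. A map that is the identity on pi_1 and pi_2 need not be homotopic to the
  identity: on the wedge of a torus and a 2-sphere, pinch a bubble off the torus and wrap it around
  the sphere. This obstacle forces the detour over a one-sided inverse of h and the homotopy
  idempotence of h. pi_2 is encoded as the fundamental group of a component of the loop space, a
  subset of the normed space of bounded continuous functions. One construction, which assigns a
  group element to every path, thus serves P, its loop space and the grids of the simplicial
  approximation.\<close>

definition fin_supp :: "('b => 'c::zero) => bool" where
 "fin_supp x \<longleftrightarrow> finite {b. x b ~= 0}"

definition ip :: "('b => 'c) => ('b => 'c) => 'c::comm_ring_1" where
 "ip x y = Sum_any (%b. x b * y b)"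

lemma ip_sum:
 assumes "finite S" "!!b. x b ~= 0 ==> y b ~= 0 ==> b:S"
 shows "ip x y = (\<Sum>b\<in>S. x b * y b)"
 unfolding ip_def by (rule Sum_any.expand_superset[OF assms(1)]) (use assms(2) in force)

lemma ip_sum_left: "fin_supp x ==> ip x y = (\<Sum>b | x b ~= 0. x b * y b)"
 by (rule ip_sum) (auto simp: fin_supp_def)

lemma ip_commute: "ip x y = ip y x"
 by (simp add: ip_def mult.commute)

lemma ip_add_left:
 assumes "fin_supp x" "fin_supp y" shows "ip (%b. x b + k * y b) z = ip x z + k * ip y z"
proof -
 let ?S = "{b. x b ~= 0} \<union> {b. y b ~= 0}"
 have "finite ?S" using assms by (auto simp: fin_supp_def)
 hence "ip (%b. x b + k * y b) z = (\<Sum>b\<in>?S. (x b + k * y b) * z b)"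
  "ip x z = (\<Sum>b\<in>?S. x b * z b)" "ip y z = (\<Sum>b\<in>?S. y b * z b)"
  by (auto intro!: ip_sum)
 thus ?thesis by (simp add: sum_distrib_left sum.distrib[symmetric] algebra_simps)
qed

lemma fin_supp_add: "fin_supp x ==> fin_supp y ==> fin_supp (%b. x b + k * (y b :: 'c::comm_ring_1))"
 unfolding fin_supp_def by (rule finite_subset[of _ "{b. x b ~= 0} \<union> {b. y b ~= 0}"]) auto

lemma ip_self_ge_0: "0 <= ip x (x :: 'b => real)"
 by (simp add: ip_def Sum_any.expand_set sum_nonneg)

lemma ip_cauchy_schwarz:
 fixes x y :: "'b => real"
 assumes "fin_supp x" "fin_supp y"
 shows "\<bar>ip x y\<bar> <= sqrt (ip x x) * sqrt (ip y y)"
proof -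
 let ?S = "{b. x b ~= 0} \<union> {b. y b ~= 0}"
 have "finite ?S" using assms by (auto simp: fin_supp_def)
 hence e: "ip x y = (\<Sum>b\<in>?S. x b * y b)" "ip x x = (\<Sum>b\<in>?S. x b * x b)" "ip y y = (\<Sum>b\<in>?S. y b * y b)"
  by (auto intro!: ip_sum)
 have "\<bar>ip x y\<bar> <= (\<Sum>b\<in>?S. \<bar>x b\<bar> * \<bar>y b\<bar>)"
  unfolding e by (rule order_trans[OF sum_abs]) (simp add: abs_mult)
 also have "... <= L2_set x ?S * L2_set y ?S" by (rule L2_set_mult_ineq)
 finally show ?thesis unfolding e L2_set_def by (simp add: power2_eq_square)
qed

text \<open>Both traces expand into sums over two representatives and a group element; equivariance
  carries the group element from one factor to the other. The second parametrisation
  \<open>bb\<close> allows for maps that are equivariant only along an isomorphism of groups, as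
  \<open>ind d\<close> and \<open>ind u\<close> will be.\<close>

lemma trace_commute:
 fixes X Y :: "'b => 'b => 'c::comm_ring_1"
 assumes "finite R"
  and bA: "bij_betw (%(g,r). aa g r) (G \<times> R) B" and bB: "bij_betw (%(g,r). bb g r) (G \<times> R) B"
  and iv: "!!g. g:G ==> iv g:G & iv (iv g) = g"
  and X: "!!g r r'. g:G ==> r:R ==> r':R ==> X r (bb g r') = X (aa (iv g) r) r'"
  and Y: "!!g r r'. g:G ==> r:R ==> r':R ==> Y (bb g r') r = Y r' (aa (iv g) r)"
  and fX: "!!r. r:R ==> fin_supp (X r)" "!!r b. r:R ==> X r b ~= 0 ==> b:B"
  and fY: "!!r. r:R ==> fin_supp (Y r)" "!!r b. r:R ==> Y r b ~= 0 ==> b:B"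
 shows "(\<Sum>r\<in>R. ip (X r) (%b. Y b r)) = (\<Sum>r\<in>R. ip (Y r) (%b. X b r))"
proof -
 define P where "P = (\<Union>r\<in>R. {b. X r b ~= 0})"
 define Q where "Q = (\<Union>r\<in>R. {b. Y r b ~= 0})"
 have PQ: "finite P" "finite Q" "P \<subseteq> B" "Q \<subseteq> B"
  using assms(1) fX fY by (auto simp: P_def Q_def fin_supp_def)
 \<comment> \<open>The group elements that occur in the supports; those from \<open>Q\<close> are
   inverted because the second sum is written with \<open>iv g\<close>. So one finite set
   \<open>S\<close> serves both sums.\<close>
 define p where "p = fst ` (inv_into (G \<times> R) (%(g,r). bb g r) ` P)"
 define q where "q = iv ` fst ` (inv_into (G \<times> R) (%(g,r). aa g r) ` Q)"
 define S where "S = (p \<union> q) \<inter> G"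
 have "finite S" using PQ by (auto simp: S_def p_def q_def)
 have p: "EX g:S. EX r':R. b = bb g r'" if "b:P" for b
 proof -
  obtain g r' where gr: "inv_into (G \<times> R) (%(g,r). bb g r) b = (g,r')" by fastforce
  have "b:(%(g,r). bb g r) ` (G \<times> R)" using that PQ bB by (auto simp: bij_betw_def)
  from inv_into_into[OF this] f_inv_into_f[OF this] gr have "g:G" "r':R" "bb g r' = b" by auto
  moreover have "g:p" using that gr by (force simp: p_def)
  ultimately show ?thesis by (auto simp: S_def)
 qed
 have q: "EX g:S. EX r':R. b = aa (iv g) r'" if "b:Q" for b
 proof -
  obtain g r' where gr: "inv_into (G \<times> R) (%(g,r). aa g r) b = (g,r')" by fastforce
  have "b:(%(g,r). aa g r) ` (G \<times> R)" using that PQ bA by (auto simp: bij_betw_def)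
  from inv_into_into[OF this] f_inv_into_f[OF this] gr have "g:G" "r':R" "aa g r' = b" by auto
  moreover have "iv g:q" using that gr by (force simp: q_def)
  ultimately show ?thesis using iv by (intro bexI[of _ "iv g"] bexI[of _ r']) (auto simp: S_def)
 qed
 have iA: "inj_on (%(g,r). aa (iv g) r) (S \<times> R)"
 proof -
  have "inj_on (%(g,r). aa g r) (G \<times> R)" using bA by (simp add: bij_betw_def)
  moreover have "inj_on (%(g,r). (iv g,r)) (S \<times> R)"
   by (rule inj_on_inverseI[where g = "%(g,r). (iv g,r)"]) (use iv in "auto simp: S_def")
  ultimately have "inj_on ((%(g,r). aa g r) o (%(g,r). (iv g,r))) (S \<times> R)"
   by (intro comp_inj_on) (use iv in "auto simp: S_def elim!: inj_on_subset")
  thus ?thesis by (simp add: o_def case_prod_beta')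
 qed
 have iB: "inj_on (%(g,r). bb g r) (S \<times> R)"
  using bB by (auto simp: bij_betw_def S_def elim!: inj_on_subset)
 have 1: "ip (X r) (%b. Y b r) = (\<Sum>(g,r')\<in>S \<times> R. X r (bb g r') * Y (bb g r') r)" if "r:R" for r
 proof -
  have "ip (X r) (%b. Y b r) = (\<Sum>b\<in>(%(g,r). bb g r) ` (S \<times> R). X r b * Y b r)"
  proof (rule ip_sum)
   show "b:(%(g,r). bb g r) ` (S \<times> R)" if "X r b ~= 0" for b
    using p[of b] that `r : R` by (force simp: P_def)
  qed (use `finite S` assms(1) in auto)
  also have "... = (\<Sum>(g,r')\<in>S \<times> R. X r (bb g r') * Y (bb g r') r)"
   unfolding sum.reindex[OF iB] by (simp add: case_prod_beta')
  finally show ?thesis .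
 qed
 have 2: "ip (Y r) (%b. X b r) = (\<Sum>(g,r')\<in>S \<times> R. Y r (aa (iv g) r') * X (aa (iv g) r') r)" if "r:R" for r
 proof -
  have "ip (Y r) (%b. X b r) = (\<Sum>b\<in>(%(g,r). aa (iv g) r) ` (S \<times> R). Y r b * X b r)"
  proof (rule ip_sum)
   show "b:(%(g,r). aa (iv g) r) ` (S \<times> R)" if "Y r b ~= 0" for b
    using q[of b] that `r : R` by (force simp: Q_def)
  qed (use `finite S` assms(1) in auto)
  also have "... = (\<Sum>(g,r')\<in>S \<times> R. Y r (aa (iv g) r') * X (aa (iv g) r') r)"
   unfolding sum.reindex[OF iA] by (simp add: case_prod_beta')
  finally show ?thesis .
 qed
 have "(\<Sum>r\<in>R. ip (X r) (%b. Y b r)) = (\<Sum>r\<in>R. \<Sum>g\<in>S. \<Sum>r'\<in>R. X r (bb g r') * Y (bb g r') r)"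
  using 1 by (simp add: sum.cartesian_product)
 also have "... = (\<Sum>r\<in>R. \<Sum>g\<in>S. \<Sum>r'\<in>R. Y r' (aa (iv g) r) * X (aa (iv g) r) r')"
  by (intro sum.cong HOL.refl) (simp add: X Y S_def mult.commute)
 also have "... = (\<Sum>g\<in>S. \<Sum>r\<in>R. \<Sum>r'\<in>R. Y r' (aa (iv g) r) * X (aa (iv g) r) r')" by (rule sum.swap)
 also have "... = (\<Sum>g\<in>S. \<Sum>r'\<in>R. \<Sum>r\<in>R. Y r' (aa (iv g) r) * X (aa (iv g) r) r')"
  by (intro sum.cong HOL.refl sum.swap)
 also have "... = (\<Sum>r'\<in>R. \<Sum>g\<in>S. \<Sum>r\<in>R. Y r' (aa (iv g) r) * X (aa (iv g) r) r')" by (rule sum.swap)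
 also have "... = (\<Sum>r\<in>R. ip (Y r) (%b. X b r))"
  using 2 by (simp add: sum.cartesian_product)
 finally show ?thesis .
qed


text \<open>\<open>q v\<close> is the squared distance from the basis vector at \<open>r\<close> to
  \<open>v\<close>. For lack of completeness an almost nearest point of \<open>I\<close> replaces
  the projection; moving it along \<open>w\<close> gains at most the square of \<open>et\<close>,
  which makes the error almost orthogonal to \<open>I\<close>.\<close>

lemma near_projection:
 fixes I :: "('b => real) set"
 assumes zero: "(%_. 0):I" and add: "!!x y k. x:I ==> y:I ==> (%b. x b + k * y b):I"
  and fin: "!!x. x:I ==> fin_supp x" and et: "0 < et" "et <= 1"
 obtains v where "v:I" "sqrt (ip v v) <= 3" "!!w. w:I ==> \<bar>w r - ip v w\<bar> <= et * sqrt (ip w w)"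
proof -
 define q where "q v = 1 - 2 * v r + ip v v" for v :: "'b => real"
 have sq: "\<bar>v r\<bar> <= sqrt (ip v v)" if "fin_supp v" for v :: "'b => real"
 proof -
  have "(v r)\<^sup>2 <= ip v v"
  proof (cases "v r = 0")
   case False
   have "v r * v r <= (\<Sum>b | v b ~= 0. v b * v b)"
    by (rule member_le_sum) (use that False in "auto simp: fin_supp_def")
   thus ?thesis by (simp add: ip_sum_left[OF that] power2_eq_square)
  qed (simp add: ip_self_ge_0)
  thus ?thesis by (simp add: real_le_rsqrt abs_le_square_iff[symmetric] real_sqrt_le_mono flip: real_sqrt_abs)
 qed
 have qpos: "0 <= q v" if "v:I" for v
 proof -
  have "(v r)\<^sup>2 <= ip v v"
   using power_mono[OF sq[OF fin[OF that]] abs_ge_zero, of 2] ip_self_ge_0[of v] by simp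
  hence "(1 - v r)\<^sup>2 <= q v" by (simp add: q_def power2_eq_square algebra_simps)
  thus ?thesis using zero_le_power2 order_trans by blast
 qed
 define d where "d = Inf (q ` I)"
 have d: "d <= q v" if "v:I" for v
  unfolding d_def by (rule cInf_lower) (use that qpos in "auto intro!: bdd_belowI2[where m = 0]")
 have "EX x:q ` I. x < d + et\<^sup>2"
  unfolding d_def by (rule cInf_lessD) (use zero et in auto)
 then obtain v where v: "v:I" "q v < d + et\<^sup>2" by blast
 have *: "0 <= et\<^sup>2 - 2 * t * (w r - ip v w) + t\<^sup>2 * ip w w" if "w:I" for w t
 proof -
  have f: "fin_supp v" "fin_supp w" "fin_supp (%b. v b + t * w b)" using v that fin fin_supp_add by blast+
  have "q (%b. v b + t * w b) = q v - 2 * t * (w r - ip v w) + t\<^sup>2 * ip w w"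
   unfolding q_def ip_add_left[OF f(1,2)] ip_commute[of _ "%b. v b + t * w b"]
   using ip_commute[of v w] by (simp add: power2_eq_square algebra_simps)
  thus ?thesis using d[OF add[OF v(1) that, of t]] v(2) by linarith
 qed
 show ?thesis
 proof (rule that[OF v(1)])
  let ?n = "sqrt (ip v v)"
  have "q v <= 1 + 1"
  proof -
   have "q v <= q (%_. 0) + et\<^sup>2" using d[OF zero] v(2) by linarith
   also have "q (%_. 0) = 1" by (simp add: q_def ip_def)
   also have "et\<^sup>2 <= 1" using et by (simp add: power_le_one)
   finally show ?thesis by simp
  qed
  moreover have "v r <= ?n" using sq[OF fin[OF v(1)]] by linarith
  moreover have "?n * ?n = ip v v" using ip_self_ge_0[of v] by simp
  ultimately have "?n * ?n - 2 * ?n <= 1" by (simp add: q_def)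
  \<comment> \<open>The last inequality gives a norm of at most 1 + sqrt 2.\<close>
  show "?n <= 3"
  proof (rule ccontr)
   assume "~ ?n <= 3"
   hence "3 * 1 <= ?n * (?n - 2)" by (intro mult_mono) (auto simp: ip_self_ge_0)
   thus False using `?n * ?n - 2 * ?n <= 1` by (simp add: algebra_simps)
  qed
 next
  fix w assume w: "w:I"
  let ?x = "w r - ip v w" and ?y = "ip w w"
  have "?x\<^sup>2 <= et\<^sup>2 * ?y"
  \<comment> \<open>The quadratic in \<open>t\<close> is smallest at \<open>?x / ?y\<close>. If
    \<open>?y = 0\<close> it is linear, and at \<open>et\<^sup>2 / ?x\<close> it is negative unless
    \<open>?x = 0\<close>.\<close>
  proof (cases "?y = 0")
   case True
   have "?x = 0"
   proof (rule ccontr)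
    assume "?x ~= 0"
    thus False using *[OF w, of "et\<^sup>2 / ?x"] True et by simp
   qed
   thus ?thesis using True by simp
  next
   case False
   hence "?y > 0" using ip_self_ge_0[of w] by linarith
   have "0 <= et\<^sup>2 - ?x\<^sup>2 / ?y"
   proof -
    have "2 * (x / y) * x = 2 * (x\<^sup>2 / y)" "(x / y)\<^sup>2 * y = x\<^sup>2 / y" if "y ~= 0" for x y :: real
     using that by (simp_all add: power2_eq_square)
    from *[OF w, of "?x / ?y", unfolded this[OF False]] show ?thesis by linarith
   qed
   thus ?thesis using `?y > 0` by (simp add: field_simps)
  qed
  hence "sqrt (?x\<^sup>2) <= sqrt (et\<^sup>2 * ?y)" by (rule real_sqrt_le_mono)
  thus "\<bar>?x\<bar> <= et * sqrt ?y" using et by (simp add: real_sqrt_mult)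
 qed
qed

text \<open>Kaplansky: over a field of characteristic 0 an idempotent of trace 0 vanishes. The vectors
  \<open>v r\<close> are almost the orthogonal projections of the basis vectors to the row space, and the sum
  of the squares of their lengths is almost the trace.\<close>

lemma idempotent_trace_zero:
 fixes F :: "'b => 'b => real"
 assumes R: "finite R" "R \<subseteq> B" and bij: "bij_betw (%(g,r). aa g r) (G \<times> R) B"
  and iv: "!!g. g:G ==> iv g:G & iv (iv g) = g"
  and unit: "u:G" "iv u = u" "!!b. b:B ==> aa u b = b"
  and act: "!!g b. g:G ==> b:B ==> aa g b:B & aa (iv g) (aa g b) = b"
  and eqv: "!!g a b. g:G ==> a:B ==> b:B ==> F (aa g a) (aa g b) = F a b"
  and fin: "!!a. a:B ==> fin_supp (F a)" "!!a b. F a b ~= 0 ==> b:B"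
  and idem: "!!a b. a:B ==> b:B ==> ip (F a) (%c. F c b) = F a b"
  and tr: "(\<Sum>r\<in>R. F r r) = 0"
  and ab: "a:B" "b:B"
 shows "F a b = 0"
proof -
 \<comment> \<open>The row space of \<open>F\<close>, on which multiplication by \<open>F\<close>
   from the right is the identity.\<close>
 define I where "I = {w. fin_supp w & (ALL b. w b ~= 0 --> b:B) & (ALL b:B. ip w (%c. F c b) = w b)}"
 define tw where "tw g w c = (if c:B then w (aa g c) else 0 :: real)" for g w c
 have act': "aa g (aa (iv g) b) = b" "aa (iv g) b:B" if "g:G" "b:B" for g b
  using act[of "iv g" b] iv[OF that(1)] that by auto
 have eqv': "F a (aa g b) = F (aa (iv g) a) b" if "g:G" "a:B" "b:B" for g a b
  using eqv[of g "aa (iv g) a" b] act'[of g a] that by simp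
 have FI: "F a:I" if "a:B" for a using that fin idem by (auto simp: I_def)
 have I0: "(%_. 0):I" by (auto simp: I_def ip_def fin_supp_def)
 have Iadd: "(%b. x b + k * y b):I" if "x:I" "y:I" for x y k
  using that by (auto simp: I_def ip_add_left fin_supp_add, metis add.left_neutral mult_zero_right)
 have iptw: "ip (tw g w) z = ip w (%c. z (aa (iv g) c)) & fin_supp (tw g w)"
  if "fin_supp w" "!!b. w b ~= 0 ==> b:B" "g:G" for g w z
 proof -
  let ?S = "{c. w c ~= 0}"
  have "finite ?S" "?S \<subseteq> B" using that by (auto simp: fin_supp_def)
  have sub: "{c. tw g w c ~= 0} \<subseteq> aa (iv g) ` ?S"
  proof
   fix c assume "c:{c. tw g w c ~= 0}"
   hence "c:B" "w (aa g c) ~= 0" by (auto simp: tw_def split: if_splits)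
   thus "c:aa (iv g) ` ?S" using act[OF that(3), of c] by (intro image_eqI[of _ _ "aa g c"]) auto
  qed
  have inj: "inj_on (aa (iv g)) ?S"
   by (rule inj_on_inverseI[where g = "aa g"]) (use act' that(2,3) in auto)
  have "ip (tw g w) z = (\<Sum>b\<in>aa (iv g) ` ?S. tw g w b * z b)"
   by (rule ip_sum) (use `finite ?S` sub in auto)
  also have "... = (\<Sum>c\<in>?S. w c * z (aa (iv g) c))"
   unfolding sum.reindex[OF inj] by (rule sum.cong) (use act' that(2,3) in "auto simp: tw_def")
  also have "... = ip w (%c. z (aa (iv g) c))" by (rule ip_sum_left[OF that(1), symmetric])
  finally show ?thesis using sub `finite ?S` finite_subset by (auto simp: fin_supp_def)
 qed
 have twI: "tw g w:I" if "w:I" "g:G" for g w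
 proof -
  have w: "fin_supp w" "!!b. w b ~= 0 ==> b:B" "!!b. b:B ==> ip w (%c. F c b) = w b"
   using that by (auto simp: I_def)
  have "ip (tw g w) (%c. F c b) = tw g w b" if "b:B" for b
  proof -
   have "ip (tw g w) (%c. F c b) = ip w (%c. F (aa (iv g) c) b)"
    using iptw[OF w(1,2) `g : G`] by blast
   also have "... = ip w (%c. F c (aa g b))"
    unfolding ip_sum_left[OF w(1)] by (rule sum.cong) (use w(2) `g : G` that in "auto simp: eqv'")
   finally show ?thesis using w(3)[of "aa g b"] act[OF `g : G` that] that by (simp add: tw_def)
  qed
  thus ?thesis using iptw[OF w(1,2) `g : G`] by (auto simp: I_def tw_def)
 qed
 define nF where "nF a = sqrt (ip (F a) (F a))" for a
 define C where "C = (\<Sum>r\<in>R. 3 + 6 * (\<Sum>d | F r d ~= 0. \<bar>F r d\<bar>) + nF r)"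
 have nF: "0 <= nF a" for a by (simp add: nF_def ip_self_ge_0)
 have "0 <= C" unfolding C_def by (intro sum_nonneg add_nonneg_nonneg mult_nonneg_nonneg) (use nF in auto)
 \<comment> \<open>For the exact orthogonal projection \<open>v\<close> onto \<open>I\<close> one
   has \<open>v F = v\<close> and \<open>F v = F\<close>, so the trace of \<open>v\<close> is that
   of \<open>F\<close>, namely 0; as \<open>v\<close> is symmetric and idempotent, its trace is the
   sum of the squared norms of its rows at the representatives. Each equality is imitated here up to
   a multiple of \<open>et\<close>.\<close>
 have main: "\<bar>F a r\<bar> <= (et + sqrt (et * C)) * nF a" if "0 < et" "et <= 1" "a:B" "r:R" for et a r
 proof -
  have "EX v. v:I & sqrt (ip v v) <= 3 & (ALL w:I. \<bar>w r - ip v w\<bar> <= et * sqrt (ip w w))" for r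
  proof -
   have fI: "fin_supp x" if "x:I" for x using that by (simp add: I_def)
   show ?thesis
    by (rule near_projection[OF I0 Iadd fI `0 < et` `et <= 1`, of r]) (assumption+, blast)
  qed
  then obtain V where V: "!!r. V r:I" "!!r. sqrt (ip (V r) (V r)) <= 3"
   "!!r w. w:I ==> \<bar>w r - ip (V r) w\<bar> <= et * sqrt (ip w w)" by metis
  define dec where "dec = inv_into (G \<times> R) (%(g,r). aa g r)"
  have dec: "dec (aa g r) = (g,r)" if "g:G" "r:R" for g r
   using inv_into_f_f[of "%(g,r). aa g r" "G \<times> R" "(g,r)"] bij that by (simp add: dec_def bij_betw_def)
  \<comment> \<open>Near-projections are chosen at the representatives and then translated, so that
    \<open>v\<close> is equivariant and \<open>trace_commute\<close> applies.\<close>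
  define v where "v d = tw (iv (fst (dec d))) (V (snd (dec d)))" for d
  have v: "v (aa g r) = tw (iv g) (V r)" if "g:G" "r:R" for g r
   by (simp add: v_def dec[OF that])
  have VI: "fin_supp (V r)" "V r b ~= 0 ==> b:B" for r b using V(1)[of r] by (auto simp: I_def)
  have vR: "v r = V r" if "r:R" for r
  proof -
   have "v r = tw u (V r)" using v[OF unit(1) that] unit(2) unit(3)[of r] R(2) that by auto
   thus ?thesis using VI(2) unit(3) by (auto simp: tw_def fun_eq_iff)
  qed
  have vB: "v d:I & sqrt (ip (v d) (v d)) <= 3 & (ALL w:I. \<bar>w d - ip (v d) w\<bar> <= et * sqrt (ip w w))"
   if "d:B" for d
  proof -
   obtain g r where gr: "g:G" "r:R" "d = aa g r" using `d : B` bij by (auto simp: bij_betw_def)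
   note ig = iv[OF gr(1)]
   have n: "ip (tw g w) (tw g w) = ip w w" if "w:I" "g:G" for w g
   proof -
    have w: "fin_supp w" "!!b. w b ~= 0 ==> b:B" using that by (auto simp: I_def)
    have "ip (tw g w) (tw g w) = ip w (%c. tw g w (aa (iv g) c))" using iptw[OF w that(2)] by blast
    also have "... = ip w w"
     unfolding ip_sum_left[OF w(1)] by (rule sum.cong) (use w(2) act' that(2) in "auto simp: tw_def")
    finally show ?thesis .
   qed
   have "\<bar>w d - ip (v d) w\<bar> <= et * sqrt (ip w w)" if "w:I" for w
   proof -
    have "ip (v d) w = ip (V r) (%c. w (aa g c))"
     using iptw[OF VI, where g = "iv g"] ig v[OF gr(1,2)] gr(3) by simp
    also have "... = ip (V r) (tw g w)"
     unfolding ip_sum_left[OF VI(1)] by (rule sum.cong) (use VI(2) in "auto simp: tw_def")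
    finally have "w d - ip (v d) w = tw g w r - ip (V r) (tw g w)"
     using gr R by (auto simp: tw_def)
    thus ?thesis using V(3)[OF twI[OF that gr(1)], of r] n[OF that gr(1)] by simp
   qed
   moreover have "v d:I" "sqrt (ip (v d) (v d)) <= 3"
    using v[OF gr(1,2)] gr(3) twI[OF V(1)] n[OF V(1), where g = "iv g"] ig V(2)[of r] by auto
   ultimately show ?thesis by blast
  qed
  have 3: "et * sqrt (ip (v d) (v d)) <= 3 * et" if "d:B" for d
   using vB[OF that] `0 < et` by simp
  \<comment> \<open>Both entries are close to the inner product of the rows \<open>v d\<close> and
    \<open>v r\<close>.\<close>
  have sym: "v d r <= v r d + 6 * et & v r d <= v d r + 6 * et" if "d:B" "r:B" for d r
  proof -
   have "\<bar>v d r - ip (v r) (v d)\<bar> <= 3 * et" "\<bar>v r d - ip (v d) (v r)\<bar> <= 3 * et"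
    using vB[OF that(1)] vB[OF that(2)] 3[OF that(1)] 3[OF that(2)] order_trans by blast+
   thus ?thesis unfolding ip_commute[of "v d"] by linarith
  qed
  have fv: "fin_supp (v d)" "v d b ~= 0 ==> b:B" if "d:B" for d b
   using vB[OF that] by (auto simp: I_def)
  have t: "(\<Sum>r\<in>R. v r r) = (\<Sum>r\<in>R. ip (F r) (%d. v d r))"
  proof -
   have "(\<Sum>r\<in>R. v r r) = (\<Sum>r\<in>R. ip (v r) (%d. F d r))"
    by (rule sum.cong) (use vB R in "auto simp: I_def")
   also have "... = (\<Sum>r\<in>R. ip (F r) (%d. v d r))"
   proof (rule trace_commute[OF R(1) bij bij iv])
    fix g r r' assume g: "g:G" "r:R" "r':R"
    thus "v r (aa g r') = v (aa (iv g) r) r'"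
     using v[of "iv g" r] iv[OF g(1)] R by (auto simp: vR tw_def)
    show "F (aa g r') r = F r' (aa (iv g) r)"
     using eqv'[of "iv g" r' r] iv[OF g(1)] subsetD[OF R(2) g(2)] subsetD[OF R(2) g(3)] by simp
   qed (use R fv fin in auto)
   finally show ?thesis .
  qed
  have "ip (v r) (v r) <= et * C" if "r:R" for r
  proof -
   have "ip (v r) (v r) <= (\<Sum>r\<in>R. ip (v r) (v r))"
    by (rule member_le_sum) (use that R ip_self_ge_0 in auto)
   also have "... <= (\<Sum>r\<in>R. v r r + 3 * et)"
   proof (rule sum_mono)
    fix r assume "r:R"
    hence "r:B" using R by blast
    hence "\<bar>v r r - ip (v r) (v r)\<bar> <= 3 * et" using vB[of r] 3[of r] order_trans by blast
    thus "ip (v r) (v r) <= v r r + 3 * et" by linarith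
   qed
   also have "... = (\<Sum>r\<in>R. ip (F r) (%d. v d r) + 3 * et)" by (simp add: sum.distrib t)
   also have "... <= (\<Sum>r\<in>R. F r r + et * (3 + 6 * (\<Sum>d | F r d ~= 0. \<bar>F r d\<bar>) + nF r))"
   proof (rule sum_mono)
    fix r assume "r:R"
    hence r: "r:B" using R by blast
    have "ip (F r) (%d. v d r) <= (\<Sum>d | F r d ~= 0. F r d * v r d + 6 * et * \<bar>F r d\<bar>)"
     unfolding ip_sum_left[OF fin(1)[OF r]]
    proof (rule sum_mono)
     fix d assume "d:{d. F r d ~= 0}"
     hence d: "d:B" using fin by auto
     have "F r d * (v d r - v r d) <= \<bar>F r d\<bar> * \<bar>v d r - v r d\<bar>" by (simp flip: abs_mult)
     also have "... <= \<bar>F r d\<bar> * (6 * et)" using sym[OF d r] by (intro mult_left_mono) (auto simp: abs_le_iff)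
     finally show "F r d * v d r <= F r d * v r d + 6 * et * \<bar>F r d\<bar>" by (simp add: algebra_simps)
    qed
    also have "... = ip (v r) (F r) + et * (6 * (\<Sum>d | F r d ~= 0. \<bar>F r d\<bar>))"
     by (simp add: ip_commute[of "v r"] ip_sum_left[OF fin(1)[OF r]] sum.distrib sum_distrib_left mult_ac)
    also have "ip (v r) (F r) <= F r r + et * nF r"
     using vB[OF r] FI[OF r] by (auto simp: nF_def abs_le_iff dest!: bspec[of _ _ "F r"])
    finally show "ip (F r) (%d. v d r) + 3 * et <= F r r + et * (3 + 6 * (\<Sum>d | F r d ~= 0. \<bar>F r d\<bar>) + nF r)"
     by (simp add: algebra_simps)
   qed
   also have "... = (\<Sum>r\<in>R. F r r) + et * C"
    unfolding C_def sum_distrib_left[of et] by (rule sum.distrib)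
   finally show ?thesis by (simp add: tr)
  qed
  hence "sqrt (ip (v r) (v r)) <= sqrt (et * C)" using that by simp
  moreover have "\<bar>F a r\<bar> <= et * nF a + sqrt (ip (v r) (v r)) * nF a"
  proof -
   have r: "r:B" using that R by blast
   have "\<bar>F a r - ip (v r) (F a)\<bar> <= et * nF a" using vB[OF r] FI[OF that(3)] by (simp add: nF_def)
   moreover have "\<bar>ip (v r) (F a)\<bar> <= sqrt (ip (v r) (v r)) * nF a"
    unfolding nF_def by (rule ip_cauchy_schwarz) (use fv r fin that in auto)
   ultimately show ?thesis by linarith
  qed
  ultimately show ?thesis
   using mult_right_mono[OF _ nF, of "sqrt (ip (v r) (v r))" "sqrt (et * C)" a] by (simp add: distrib_right)
 qed
 have z: "F a r = 0" if "a:B" "r:R" for a r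
 proof (rule ccontr)
  assume "F a r ~= 0"
  define D where "D = (1 + sqrt C) * nF a"
  have "0 <= D" using `0 <= C` nF by (simp add: D_def)
  \<comment> \<open>\<open>main\<close> is used with \<open>et = ep * ep\<close>, so that its square
    root is linear in \<open>ep\<close>; the quotient makes the bound at most half of the value that
    it bounds.\<close>
  define ep where "ep = min 1 (\<bar>F a r\<bar> / (2 * (D + 1)))"
  have ep: "0 < ep" "ep <= 1" using `F a r ~= 0` `0 <= D` by (auto simp: ep_def)
  have "ep * ep <= ep * 1" using ep by (intro mult_left_mono) auto
  have "\<bar>F a r\<bar> <= (ep * ep + sqrt (ep * ep * C)) * nF a"
   by (rule main) (use ep that in "auto simp: mult_le_one")
  also have "... <= (ep + ep * sqrt C) * nF a"
   using ep `ep * ep <= ep * 1` by (intro mult_right_mono nF) (simp add: real_sqrt_mult)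
  also have "... = ep * D" by (simp add: D_def algebra_simps)
  also have "... <= ep * (D + 1)" using ep by simp
  also have "... <= \<bar>F a r\<bar> / (2 * (D + 1)) * (D + 1)"
   using `0 <= D` by (intro mult_right_mono) (auto simp: ep_def)
  also have "... = \<bar>F a r\<bar> / 2"
  proof -
   have "x / (2 * y) * y = x / 2" if "y > 0" for x y :: real using that by simp
   thus ?thesis using `0 <= D` by (metis add_nonneg_pos zero_less_one)
  qed
  finally show False using `F a r ~= 0` by simp
 qed
 obtain g r where "g:G" "r:R" "b = aa g r" using ab(2) bij by (auto simp: bij_betw_def)
 thus ?thesis using z eqv'[of g a r] act'[of g a] R ab by auto
qed

section \<open>The fundamental group as a holonomy\<close>

abbreviation (input) "cts == continuous_on"
abbreviation (input) "ctm == continuous_map"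
abbreviation (input) "tos == top_of_set"
abbreviation (input) "hps == homotopic_paths"
abbreviation (input) "lp == linepath"
abbreviation (input) "rp == reversepath"

definition cls :: "'a::real_normed_vector set => 'a => (real => 'a) => (real => 'a) set" where
 "cls S x p = loop_homotopy_rel S x `` {p}"

lemma equiv_loop_homotopy_rel: "equiv (based_loops S x) (loop_homotopy_rel S x)"
proof (rule equivI)
 show "loop_homotopy_rel S x \<subseteq> based_loops S x \<times> based_loops S x"
  by (auto simp: loop_homotopy_rel_def)
 show "refl_on (based_loops S x) (loop_homotopy_rel S x)"
  by (auto simp: refl_on_def loop_homotopy_rel_def based_loops_def)
 show "sym (loop_homotopy_rel S x)"
  by (simp add: sym_def loop_homotopy_rel_def homotopic_paths_sym)
 show "trans (loop_homotopy_rel S x)"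
  unfolding trans_def loop_homotopy_rel_def using homotopic_paths_trans by blast
qed

lemma based_loops_join: "p:based_loops S x ==> q:based_loops S x ==> p +++ q:based_loops S x"
 by (simp add: based_loops_def subset_path_image_join)

lemma carrier_fundamental_group: "carrier (fundamental_group S x) = cls S x ` based_loops S x"
 by (auto simp: fundamental_group_def quotient_monoid_def quotient_def cls_def)

lemma cls_eq_iff:
 assumes "p:based_loops S x" "q:based_loops S x"
 shows "cls S x p = cls S x q \<longleftrightarrow> hps S p q"
proof -
 have "cls S x p = cls S x q \<longleftrightarrow> (p,q):loop_homotopy_rel S x"
  unfolding cls_def by (rule eq_equiv_class_iff[OF equiv_loop_homotopy_rel assms])
 thus ?thesis using assms by (simp add: loop_homotopy_rel_def)
qed

lemma cls_mult:
 assumes "p:based_loops S x" "q:based_loops S x"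
 shows "cls S x p \<otimes>\<^bsub>fundamental_group S x\<^esub> cls S x q = cls S x (p +++ q)"
proof -
 let ?r = "loop_homotopy_rel S x"
 have "congruent2 ?r ?r (%p q. ?r `` {p +++ q})"
  unfolding congruent2_def
 proof clarify
  fix p p' q q' assume "(p,p'):?r" "(q,q'):?r"
  hence "(p +++ q,p' +++ q'):?r"
   by (auto simp: loop_homotopy_rel_def based_loops_join intro!: homotopic_paths_join) (simp add: based_loops_def)
  thus "?r `` {p +++ q} = ?r `` {p' +++ q'}" by (rule equiv_class_eq[OF equiv_loop_homotopy_rel])
 qed
 from UN_equiv_class2[OF equiv_loop_homotopy_rel equiv_loop_homotopy_rel this assms] show ?thesis
  by (simp add: fundamental_group_def quotient_monoid_def cls_def)
qed

definition pin :: "'a::topological_space set => 'a => 'a => (real => 'a) => bool" where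
 "pin S a b p \<longleftrightarrow> path p & path_image p \<subseteq> S & pathstart p = a & pathfinish p = b"

lemma pin_join: "pin S a b p ==> pin S b c q ==> pin S a c (p +++ q)"
 by (simp add: pin_def subset_path_image_join)

lemma pin_reverse: "pin S a b p ==> pin S b a (rp p)"
 by (simp add: pin_def)

lemma pin_const: "a:S ==> pin S a a (lp a a)"
 by (simp add: pin_def)

lemma pin_linepath: "closed_segment a b \<subseteq> S ==> pin S a b (lp a b)"
 by (simp add: pin_def)

lemma based_loops_iff: "p:based_loops S x \<longleftrightarrow> pin S x x p"
 by (simp add: based_loops_def pin_def)

lemma pin_mem: "pin S a b p ==> a:S & b:S"
 unfolding pin_def using pathstart_in_path_image pathfinish_in_path_image by blast

lemma pin_homotopic: "hps S p q ==> pin S a b p \<longleftrightarrow> pin S a b q"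
 unfolding pin_def
 by (metis homotopic_paths_imp_path homotopic_paths_imp_pathfinish homotopic_paths_imp_pathstart homotopic_paths_imp_subset)

lemma pin_image:
 assumes "pin S a b p" "cts S f" "f:S \<rightarrow> T" shows "pin T (f a) (f b) (f o p)"
 using assms by (auto simp: pin_def path_image_def pathstart_def pathfinish_def
   intro!: path_continuous_image elim!: continuous_on_subset)

locale pconn =
 fixes S :: "'a::real_normed_vector set" and x0 :: 'a
 assumes pc: "path_connected S" and x0: "x0:S"
begin

abbreviation G where "G == fundamental_group S x0"

sublocale G: group G by (rule group_fundamental_group[OF x0])

text \<open>The path chosen at \<open>x0\<close> is constant, so that the holonomy of a based loop
  is its own class.\<close>

definition ka where "ka x = (if x = x0 then lp x0 x0 else SOME p. pin S x0 x p)"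

lemma ka: "x:S ==> pin S x0 x (ka x)"
proof -
 assume "x:S"
 hence "EX p. pin S x0 x p" using pc x0 unfolding path_connected_def pin_def by auto
 thus ?thesis using someI_ex[of "pin S x0 x"] x0 by (simp add: ka_def pin_const)
qed

text \<open>A functor from the fundamental groupoid to the group, injective and surjective on
  homotopy classes of paths with given ends. It turns questions about homotopies of paths into
  computations in a group.\<close>

definition hl :: "(real => 'a) => (real => 'a) set" where
 "hl p = cls S x0 (ka (pathstart p) +++ (p +++ rp (ka (pathfinish p))))"

lemma hl_loop: "pin S a b p ==> pin S x0 x0 (ka a +++ (p +++ rp (ka b)))"
 by (meson ka pin_join pin_mem pin_reverse)

lemma hl_closed: "pin S a b p ==> hl p:carrier G"
 using hl_loop[of a b p] by (auto simp: hl_def carrier_fundamental_group based_loops_iff pin_def)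

lemma hl_homotopic: "hps S p q ==> hl p = hl q"
proof -
 assume h: "hps S p q"
 define a b where "a = pathstart p" and "b = pathfinish p"
 have p: "pin S a b p" using h by (simp add: pin_def a_def b_def homotopic_paths_imp_path homotopic_paths_imp_subset)
 hence q: "pin S a b q" using pin_homotopic[OF h] by simp
 have ab: "pin S x0 a (ka a)" "pin S x0 b (ka b)" using pin_mem[OF p] ka by auto
 have "hps S (ka a +++ (p +++ rp (ka b))) (ka a +++ (q +++ rp (ka b)))"
  using ab p q by (intro homotopic_paths_join h) (auto simp: pin_def)
 thus ?thesis
  using hl_loop[OF p] hl_loop[OF q] p q by (simp add: hl_def pin_def cls_eq_iff based_loops_def)
qed

lemma hl_join:
 assumes p: "pin S a b p" and q: "pin S b c q"
 shows "hl (p +++ q) = hl p \<otimes>\<^bsub>G\<^esub> hl q"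
proof -
 have abc: "pin S x0 a (ka a)" "pin S x0 b (ka b)" "pin S x0 c (ka c)"
  using pin_mem[OF p] pin_mem[OF q] ka by auto
 let ?ra = "ka a" and ?rb = "rp (ka b)" and ?rc = "rp (ka c)"
 note pi = abc p q pin_reverse[OF abc(2)] pin_reverse[OF abc(3)]
 note P = pi[unfolded pin_def]
 note J = homotopic_paths_join homotopic_paths_assoc homotopic_paths_refl[THEN iffD2]
 note simps = P subset_path_image_join path_join
 have "hps S ((?ra +++ (p +++ ?rb)) +++ (ka b +++ (q +++ ?rc))) (?ra +++ ((p +++ ?rb) +++ (ka b +++ (q +++ ?rc))))"
  by (rule homotopic_paths_sym[OF homotopic_paths_assoc]) (use P in "simp_all add: subset_path_image_join")
 also have "hps S ... (?ra +++ (p +++ (?rb +++ (ka b +++ (q +++ ?rc)))))"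
  by (rule homotopic_paths_join[OF _ homotopic_paths_sym[OF homotopic_paths_assoc]]) (use P in "simp_all add: subset_path_image_join")
 also have "hps S ... (?ra +++ (p +++ ((?rb +++ ka b) +++ (q +++ ?rc))))"
  by (rule homotopic_paths_join[OF _ homotopic_paths_join[OF _ homotopic_paths_assoc]]) (use P in "simp_all add: subset_path_image_join")
 also have "hps S ... (?ra +++ (p +++ (lp b b +++ (q +++ ?rc))))"
 proof -
  have "hps S (?rb +++ ka b) (lp b b)"
   using homotopic_paths_linv[of "ka b" S] P by simp
  thus ?thesis
   by (intro homotopic_paths_join) (use P in "simp_all add: subset_path_image_join")
 qed
 also have "hps S ... (?ra +++ (p +++ (q +++ ?rc)))"
  by (rule homotopic_paths_join[OF _ homotopic_paths_join[OF _ homotopic_paths_lid']]) (use P in "simp_all add: subset_path_image_join")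
 also have "hps S ... (?ra +++ ((p +++ q) +++ ?rc))"
  by (rule homotopic_paths_join[OF _ homotopic_paths_assoc]) (use P in "simp_all add: subset_path_image_join")
 finally have h: "hps S ((?ra +++ (p +++ ?rb)) +++ (ka b +++ (q +++ ?rc))) (?ra +++ ((p +++ q) +++ ?rc))" .
 have L: "pin S x0 x0 (?ra +++ (p +++ ?rb))" "pin S x0 x0 (ka b +++ (q +++ ?rc))" "pin S x0 x0 (?ra +++ ((p +++ q) +++ ?rc))"
  using hl_loop[OF p] hl_loop[OF q] hl_loop[OF pin_join[OF p q]] by auto
 have "hl p \<otimes>\<^bsub>G\<^esub> hl q = cls S x0 ((?ra +++ (p +++ ?rb)) +++ (ka b +++ (q +++ ?rc)))"
  using cls_mult[OF L(1,2)[folded based_loops_iff]] P by (simp add: hl_def)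
 also have "... = cls S x0 (?ra +++ ((p +++ q) +++ ?rc))"
  using cls_eq_iff[of _ S x0] h L pin_join[OF L(1,2)] by (simp add: based_loops_iff)
 finally show ?thesis using P by (simp add: hl_def)
qed

lemma hl_const: "a:S ==> hl (lp a a) = \<one>\<^bsub>G\<^esub>"
proof -
 assume a: "a:S"
 note k = pin_const[OF a]
 have "hps S (lp a a +++ lp a a) (lp a a)"
  by (rule homotopic_paths_lid') (use a in auto)
 hence "hl (lp a a) \<otimes>\<^bsub>G\<^esub> hl (lp a a) = hl (lp a a)"
  using hl_homotopic hl_join[OF k k] by metis
 thus ?thesis using hl_closed[OF k] G.r_cancel_one by blast
qed

lemma hl_reverse: "pin S a b p ==> hl (rp p) = inv\<^bsub>G\<^esub> hl p"
proof -
 assume p: "pin S a b p"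
 have "hl (p +++ rp p) = hl (lp a a)"
  by (rule hl_homotopic) (use p homotopic_paths_rinv[of p S] in "auto simp: pin_def")
 hence "hl p \<otimes>\<^bsub>G\<^esub> hl (rp p) = \<one>\<^bsub>G\<^esub>"
  using hl_join[OF p pin_reverse[OF p]] hl_const pin_mem[OF p] by simp
 thus ?thesis
  using hl_closed[OF p] hl_closed[OF pin_reverse[OF p]] by (metis G.inv_equality G.inv_inv)
qed

lemma hl_based:
 assumes "pin S x0 x0 p" shows "hl p = cls S x0 p"
proof -
 have P: "path p" "path_image p \<subseteq> S" "pathstart p = x0" "pathfinish p = x0" using assms by (auto simp: pin_def)
 have "hps S (lp x0 x0 +++ (p +++ lp x0 x0)) (p +++ lp x0 x0)"
  by (rule homotopic_paths_lid') (use P x0 in "auto simp: subset_path_image_join")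
 also have "hps S ... p"
  by (rule homotopic_paths_rid') (use P in auto)
 finally have "hps S (lp x0 x0 +++ (p +++ lp x0 x0)) p" .
 thus ?thesis
  unfolding hl_def using P hl_loop[OF assms] assms by (simp add: cls_eq_iff based_loops_iff ka_def)
qed

lemma hl_surj_based: "g:carrier G ==> EX p. pin S x0 x0 p & hl p = g"
 using hl_based by (auto simp: carrier_fundamental_group based_loops_iff)

lemma hl_inject:
 assumes p: "pin S a b p" and q: "pin S a b q" and eq: "hl p = hl q"
 shows "hps S p q"
proof -
 note P = p[unfolded pin_def] and Q = q[unfolded pin_def]
 have ab: "pin S x0 a (ka a)" "pin S x0 b (ka b)" using pin_mem[OF p] ka by auto
 let ?rb = "rp (ka b)" and ?ra = "rp (ka a)"
 have L: "pin S x0 x0 (ka a +++ (p +++ ?rb))" "pin S x0 x0 (ka a +++ (q +++ ?rb))" using hl_loop p q by auto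
 have "hps S (ka a +++ (p +++ ?rb)) (ka a +++ (q +++ ?rb))"
  using eq L P Q by (simp add: hl_def cls_eq_iff based_loops_iff)
 have red: "hps S (?ra +++ ((ka a +++ (r +++ ?rb)) +++ ka b)) r" if r: "pin S a b r" for r
 proof -
  note R = r[unfolded pin_def] ab[unfolded pin_def]
  have "hps S (?ra +++ ((ka a +++ (r +++ ?rb)) +++ ka b)) (?ra +++ (ka a +++ ((r +++ ?rb) +++ ka b)))"
   by (rule homotopic_paths_join[OF _ homotopic_paths_sym[OF homotopic_paths_assoc]]) (use R in "simp_all add: subset_path_image_join")
  also have "hps S ... ((?ra +++ ka a) +++ ((r +++ ?rb) +++ ka b))"
   by (rule homotopic_paths_assoc) (use R in "simp_all add: subset_path_image_join")
  also have "hps S ... (lp a a +++ (r +++ (?rb +++ ka b)))"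
   using R by (intro homotopic_paths_join homotopic_paths_sym[OF homotopic_paths_assoc])
    (use R homotopic_paths_linv[of "ka a" S] in "simp_all add: subset_path_image_join")
  also have "hps S ... (r +++ (?rb +++ ka b))"
   by (rule homotopic_paths_lid') (use R in "simp_all add: subset_path_image_join")
  also have "hps S ... (r +++ lp b b)"
   using R homotopic_paths_linv[of "ka b" S] by (intro homotopic_paths_join) simp_all
  also have "hps S ... r"
   by (rule homotopic_paths_rid') (use R in simp_all)
  finally show ?thesis .
 qed
 have "hps S p (?ra +++ ((ka a +++ (p +++ ?rb)) +++ ka b))" by (rule homotopic_paths_sym[OF red[OF p]])
 also have "hps S ... (?ra +++ ((ka a +++ (q +++ ?rb)) +++ ka b))"
  by (rule homotopic_paths_join[OF _ homotopic_paths_join[OF `homotopic_paths S (ka a +++ (p +++ ?rb)) _`]])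
   (use ab P Q in "auto simp: pin_def")
 also have "hps S ... q" by (rule red[OF q])
 finally show ?thesis .
qed

lemma hl_eq_iff: "pin S a b p ==> pin S a b q ==> hl p = hl q \<longleftrightarrow> hps S p q"
 using hl_inject hl_homotopic by blast

lemma hl_surj:
 assumes "g:carrier G" "a:S" "b:S" shows "EX p. pin S a b p & hl p = g"
proof -
 let ?u = "hl (ka a)" and ?w = "hl (ka b)"
 have uw: "?u:carrier G" "?w:carrier G" using hl_closed ka assms by blast+
 obtain p where p: "pin S x0 x0 p" "hl p = ?u \<otimes>\<^bsub>G\<^esub> g \<otimes>\<^bsub>G\<^esub> inv\<^bsub>G\<^esub> ?w"
  using hl_surj_based uw assms by (metis G.inv_closed G.m_closed)
 let ?q = "rp (ka a) +++ (p +++ ka b)"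
 have "hl ?q = inv\<^bsub>G\<^esub> ?u \<otimes>\<^bsub>G\<^esub> (?u \<otimes>\<^bsub>G\<^esub> g \<otimes>\<^bsub>G\<^esub> inv\<^bsub>G\<^esub> ?w \<otimes>\<^bsub>G\<^esub> ?w)"
  using hl_join[OF pin_reverse[OF ka[OF assms(2)]] pin_join[OF p(1) ka[OF assms(3)]]]
   hl_join[OF p(1) ka[OF assms(3)]] hl_reverse[OF ka[OF assms(2)]] p(2) by simp
 also have "... = g" using uw assms by (simp add: G.m_assoc) (metis G.inv_closed G.inv_solve_left G.m_closed)
 finally have "hl ?q = g" .
 moreover have "pin S a b ?q" using ka assms p by (meson pin_join pin_reverse)
 ultimately show ?thesis by blast
qed

end

lemma homotopic_through_convex:
 fixes C :: "'b::real_normed_vector set"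
 assumes C: "convex C" and f: "cts C f" "f:C \<rightarrow> S"
  and p: "pin C a b p" and q: "pin C a b q"
 shows "hps S (f o p) (f o q)"
proof (rule homotopic_paths_continuous_image[OF _ f])
 show "hps C p q"
 proof (rule homotopic_paths_linear)
  fix t :: real assume "t:{0..1}"
  hence "p t:C" "q t:C" using p q by (auto simp: pin_def path_image_def)
  thus "closed_segment (p t) (q t) \<subseteq> C" using C closed_segment_subset by blast
 qed (use p q in "auto simp: pin_def")
qed

context pconn begin

lemma hl_square:
 assumes h: "cts ({0..1} \<times> {0..1}) (%(s,t). H s t)" "!!s t. s:{0..1} ==> t:{0..1} ==> H s t:S"
 shows "hl (%s. H s 0) \<otimes>\<^bsub>G\<^esub> hl (%t. H 1 t) = hl (%t. H 0 t) \<otimes>\<^bsub>G\<^esub> hl (%s. H s 1)"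
proof -
 let ?f = "%(s,t). H s t" and ?I = "{0..1::real} \<times> {0..1::real}"
 have side: "pin ?I (a,b) (c,d) (lp (a,b) (c,d))" if "{a,b,c,d} \<subseteq> {0,1}" for a b c d :: real
  by (rule pin_linepath, rule closed_segment_subset) (use that in "auto intro: convex_Times")
 have S: "?f:?I \<rightarrow> S" using h(2) by auto
 let ?b = "lp (0::real,0::real) (1,0)" and ?r = "lp (1::real,0::real) (1,1)"
  and ?l = "lp (0::real,0::real) (0,1)" and ?t = "lp (0::real,1::real) (1,1)"
 have 1: "hps S (?f o (?b +++ ?r)) (?f o (?l +++ ?t))"
  by (rule homotopic_through_convex[where C = ?I and a = "(0,0)" and b = "(1,1)"])
   (use h(1) S in "auto intro!: pin_join side convex_Times")
 have im: "pin S (?f (a,b)) (?f (c,d)) (?f o lp (a,b) (c,d))" if "{a,b,c,d} \<subseteq> {0,1}" for a b c d :: real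
  by (rule pin_image[OF side[OF that] h(1) S])
 have "hl (?f o ?b) \<otimes>\<^bsub>G\<^esub> hl (?f o ?r) = hl (?f o ?l) \<otimes>\<^bsub>G\<^esub> hl (?f o ?t)"
  using hl_homotopic[OF 1] hl_join[OF im im, of 0 0 1 0 1 1] hl_join[OF im im, of 0 0 0 1 1 1]
  by (simp add: path_compose_join)
 moreover have "?f o ?b = (%s. H s 0)" "?f o ?r = (%t. H 1 t)" "?f o ?l = (%t. H 0 t)" "?f o ?t = (%s. H s 1)"
  by (auto simp: fun_eq_iff linepath_def)
 ultimately show ?thesis by simp
qed

lemma hl_subpath:
 assumes "pin S a b p" "u:{0..1}" "v:{0..1}" "w:{0..1}"
 shows "hl (subpath u w p) = hl (subpath u v p) \<otimes>\<^bsub>G\<^esub> hl (subpath v w p)"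
proof -
 have p: "path p" "path_image p \<subseteq> S" using assms by (auto simp: pin_def)
 have s: "pin S (p s) (p t) (subpath s t p)" if "s:{0..1}" "t:{0..1}" for s t
  using p that path_image_subpath_subset[of s t p] by (auto simp: pin_def pathstart_subpath pathfinish_subpath)
 have "hps S (subpath u v p +++ subpath v w p) (subpath u w p)"
  by (rule homotopic_join_subpaths) (use p assms in auto)
 from hl_homotopic[OF this] show ?thesis using hl_join[OF s s, of u v w] assms by simp
qed

end

section \<open>Path spaces\<close>

abbreviation I1 :: "real set" where "I1 == {0..1}"
abbreviation (input) I2 :: "(real \<times> real) set" where "I2 == I1 \<times> I1"

definition cl1 :: "real => real" where "cl1 t = max 0 (min 1 t)"

lemma cl1 [simp]: "t:I1 ==> cl1 t = t" "cl1 t:I1" "0 <= cl1 t" "cl1 t <= 1"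
 by (auto simp: cl1_def)

lemma continuous_cl1 [continuous_intros]: "cts X f ==> cts X (%x. cl1 (f x))"
 unfolding cl1_def by (intro continuous_intros)

lemma cont2:
 assumes "cts A (%(x,y). H x y)" "cts X f" "cts X g" "!!z. z:X ==> (f z,g z):A"
 shows "cts X (%z. H (f z) (g z))"
 using continuous_on_compose2[OF assms(1) continuous_on_Pair[OF assms(2,3)]] assms(4) by auto

lemma cont3:
 assumes "cts A (%(x,y,w). H x y w)" "cts X f" "cts X g" "cts X h"
  "!!z. z:X ==> (f z,g z,h z):A"
 shows "cts X (%z. H (f z) (g z) (h z))"
 using continuous_on_compose2[OF assms(1) continuous_on_Pair[OF assms(2) continuous_on_Pair[OF assms(3,4)]]] assms(5) by auto

text \<open>Clamping the parameter makes a path, of which only the values on [0,1] count, a bounded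
  continuous function. Path spaces thus become subsets of a normed space, to which
  \<open>fundamental_group\<close> applies.\<close>

definition pf :: "(real => 'a::real_normed_vector) => real \<Rightarrow>\<^sub>C 'a" where
 "pf p = Bcontfun (%t. p (cl1 t))"

lemma pf_bcontfun: "path p ==> (%t. p (cl1 t)):bcontfun"
proof -
 assume "path p"
 hence c: "cts I1 p" by (simp add: path_def)
 have "bounded (p ` I1)" using c by (simp add: compact_continuous_image compact_imp_bounded)
 hence "bounded (range (%t. p (cl1 t)))" by (rule bounded_subset) (auto intro!: image_eqI)
 moreover have "cts UNIV (%t. p (cl1 t))"
  by (rule continuous_on_compose2[OF c]) (auto intro!: continuous_intros)
 ultimately show ?thesis by (simp add: bcontfun_def)
qed

lemma pf_cl1: "path p ==> apply_bcontfun (pf p) t = p (cl1 t)"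
 by (simp add: pf_def Bcontfun_inverse pf_bcontfun)

lemma pf_apply: "path p ==> t:I1 ==> apply_bcontfun (pf p) t = p t"
 by (simp add: pf_cl1)

lemma pf_cong: "(!!t. t:I1 ==> p t = q t) ==> pf p = pf q"
 by (simp add: pf_def)

lemma pf_eqD: "pf p = pf q ==> path p ==> path q ==> t:I1 ==> p t = q t"
 by (metis pf_apply)

text \<open>With \<open>continuous_unpf\<close> this is the exponential law. Compactness of the
  interval makes the estimate uniform in \<open>t\<close>.\<close>

lemma continuous_pf:
 fixes H :: "'x::metric_space => real => 'a::real_normed_vector"
 assumes c: "cts (X \<times> I1) (%(x,t). H x t)"
 shows "cts X (%x. pf (H x))"
 unfolding continuous_on_iff
proof (intro ballI allI impI)
 fix x and e :: real assume x: "x:X" and e: "e > 0"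
 have p: "path (H y)" if "y:X" for y
  unfolding path_def by (rule cont2[OF c]) (use that in "auto intro!: continuous_intros")
 obtain X0 where X0: "x:X0" "open X0"
  "ALL y:X0 \<inter> X. ALL t:I1. dist ((%(x,t). H x t) (y,t)) ((%(x,t). H x t) (x,t)) <= e / 2"
  by (rule continuous_on_prod_compactE[OF c compact_Icc x half_gt_zero[OF e]])
 obtain d where d: "d > 0" "ball x d \<subseteq> X0" using openE[OF X0(2,1)] by blast
 show "EX d>0. ALL y:X. dist y x < d --> dist (pf (H y)) (pf (H x)) < e"
 proof (intro exI[of _ d] conjI ballI impI d)
  fix y assume y: "y:X" "dist y x < d"
  hence "y:X0" using d by (auto simp: dist_commute)
  have "dist (pf (H y)) (pf (H x)) <= e / 2"
  proof (rule dist_bound)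
   fix t
   show "dist (apply_bcontfun (pf (H y)) t) (apply_bcontfun (pf (H x)) t) <= e / 2"
    using X0(3) y `y : X0` by (auto simp: pf_cl1 p x dest!: bspec[of _ _ "cl1 t"])
  qed
  thus "dist (pf (H y)) (pf (H x)) < e" using e by linarith
 qed
qed

lemma continuous_unpf:
 fixes f :: "'x::metric_space => real \<Rightarrow>\<^sub>C 'a::real_normed_vector"
 assumes c: "cts X f"
 shows "cts (X \<times> T) (%(x,t). apply_bcontfun (f x) t)"
 unfolding continuous_on_iff
proof (intro ballI allI impI, clarify)
 fix x t and e :: real assume x: "x:X" "t:T" and e: "e > 0"
 obtain d1 where d1: "d1 > 0" "!!y. y:X ==> dist y x < d1 ==> dist (f y) (f x) < e / 2"
  using c x e unfolding continuous_on_iff by (meson half_gt_zero)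
 have "cts UNIV (apply_bcontfun (f x))" by simp
 then obtain d2 where d2: "d2 > 0" "!!s. dist s t < d2 ==> dist (f x s) (f x t) < e / 2"
  using e unfolding continuous_on_iff by (metis UNIV_I half_gt_zero)
 show "EX d>0. ALL y:X \<times> T. dist y (x,t) < d -->
   dist (case y of (x,t) => apply_bcontfun (f x) t) (apply_bcontfun (f x) t) < e"
 proof (intro exI[of _ "min d1 d2"] conjI ballI impI, use d1 d2 in simp, clarify)
  fix y s assume y: "y:X" "s:T" and d: "dist (y,s) (x,t) < min d1 d2"
  have "dist y x < d1" "dist s t < d2"
   using d dist_fst_le[of "(y,s)" "(x,t)"] dist_snd_le[of "(y,s)" "(x,t)"] by auto
  hence "dist (f y) (f x) < e / 2" "dist (f x s) (f x t) < e / 2" using d1 d2 y by auto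
  moreover have "dist (f y s) (f x s) <= dist (f y) (f x)" by (rule dist_bounded)
  moreover have "dist (f y s) (f x t) <= dist (f y s) (f x s) + dist (f x s) (f x t)" by (rule dist_triangle)
  ultimately show "dist (f y s) (f x t) < e" by linarith
 qed
qed

definition Om :: "'a::real_normed_vector set => 'a => 'a => (real \<Rightarrow>\<^sub>C 'a) set" where
 "Om S a b = pf ` {p. pin S a b p}"

definition hmap :: "'a::real_normed_vector set => 'a => 'a => (real => real => 'a) => bool" where
 "hmap S a b A \<longleftrightarrow> cts (I2) (%(s,t). A s t) &
  (ALL s:I1. ALL t:I1. A s t:S) & (ALL s:I1. A s 0 = a & A s 1 = b)"

lemma continuous_row:
 assumes "cts (X \<times> I1) (%(x,t). H x t)" "x:X" shows "path (H x)"
 unfolding path_def by (rule cont2[OF assms(1)]) (use assms(2) in "auto intro!: continuous_intros")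

lemma hmap_row: "hmap S a b A ==> s:I1 ==> pin S a b (A s)"
 using continuous_row[of I1 A s] by (auto simp: hmap_def pin_def path_image_def pathstart_def pathfinish_def)

lemma hmap_path: "hmap S a b A ==> pin (Om S a b) (pf (A 0)) (pf (A 1)) (pf o A)"
 using hmap_row[of S a b A] continuous_pf[of I1 A]
 by (auto simp: hmap_def pin_def Om_def path_def pathstart_def pathfinish_def path_image_def o_def)

lemma Om_path: "f:Om S a b ==> pin S a b (apply_bcontfun f) & pf (apply_bcontfun f) = f"
proof -
 assume "f:Om S a b"
 then obtain p where p: "pin S a b p" "f = pf p" by (auto simp: Om_def)
 hence "apply_bcontfun f t = p t" if "t:I1" for t using that by (simp add: pf_apply pin_def)
 moreover have "path (apply_bcontfun f)"
  unfolding path_def by (rule continuous_on_subset[OF continuous_on_apply_bcontfun[of UNIV]]) simp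
 ultimately show ?thesis
  using p by (auto simp: pin_def path_image_def pathstart_def pathfinish_def intro!: pf_cong)
qed

lemma path_hmap:
 assumes p: "pin (Om S a b) f g p"
 obtains A where "hmap S a b A" "!!s. s:I1 ==> pf (A s) = p s" "hps (Om S a b) p (pf o A)"
proof -
 define A where "A s = apply_bcontfun (p s)" for s
 have pm: "p s:Om S a b" if "s:I1" for s using p that by (auto simp: pin_def path_image_def)
 have "hmap S a b A"
  unfolding hmap_def
 proof (intro conjI ballI)
  show "cts (I2) (%(s,t). A s t)"
   unfolding A_def by (rule continuous_unpf) (use p in "auto simp: pin_def path_def")
 qed (use Om_path[OF pm] in "force simp: A_def pin_def path_image_def pathstart_def pathfinish_def")+
 moreover have "pf (A s) = p s" if "s:I1" for s using Om_path[OF pm[OF that]] by (simp add: A_def)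
 moreover from this have "hps (Om S a b) p (pf o A)"
  using p by (intro homotopic_paths_eq) (auto simp: pin_def)
 ultimately show ?thesis using that by blast
qed

lemma continuous_join:
 fixes p q :: "'x::metric_space => real => 'a::topological_space"
 assumes p: "cts (X \<times> I1) (%(x,t). p x t)" and q: "cts (X \<times> I1) (%(x,t). q x t)"
  and m: "!!x. x:X ==> p x 1 = q x 0"
 shows "cts (X \<times> I1) (%(x,t). (p x +++ q x) t)"
proof -
 have 1: "cts {z:X \<times> I1. snd z <= 1/2} (%z. p (fst z) (2 * snd z))"
  using continuous_on_compose2[OF p, of "{z:X \<times> I1. snd z <= 1/2}" "%z. (fst z,2 * snd z)"]
  by (force intro!: continuous_intros)
 have 2: "cts {z:X \<times> I1. 1/2 <= snd z} (%z. q (fst z) (2 * snd z - 1))"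
  using continuous_on_compose2[OF q, of "{z:X \<times> I1. 1/2 <= snd z}" "%z. (fst z,2 * snd z - 1)"]
  by (force intro!: continuous_intros)
 have "cts (X \<times> I1) (%z. if snd z <= 1/2 then p (fst z) (2 * snd z) else q (fst z) (2 * snd z - 1))"
  by (rule continuous_on_cases_le[OF 1 2]) (auto intro!: continuous_intros dest: m simp: field_simps)
 thus ?thesis by (simp add: joinpaths_def case_prod_beta')
qed

lemma hmap_join:
 assumes "hmap S a b A" "hmap S b c B" shows "hmap S a c (%s. A s +++ B s)"
 using assms continuous_join[of I1 A B] unfolding hmap_def by (auto simp: joinpaths_def)

lemma hmap_const: "pin S a b p ==> hmap S a b (%s. p)"
 by (auto simp: hmap_def pin_def path_def path_image_def pathstart_def pathfinish_def case_prod_beta'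
   intro!: continuous_on_compose2[of I1 p "I2" snd] continuous_intros)

lemma hmap_comp:
 assumes "hmap S a b A" "cts S f" "f:S \<rightarrow> T" shows "hmap T (f a) (f b) (%s. f o A s)"
 using assms by (auto simp: hmap_def case_prod_beta' intro!: continuous_on_compose2[OF assms(2), of "I2"])

lemma hmap_vjoin:
 assumes A: "hmap S a b A" and B: "hmap S a b B" and m: "!!t. t:I1 ==> A 1 t = B 0 t"
 shows "hmap S a b (A +++ B)"
proof -
 have sw: "cts (I2) (%(t,s). C s t)" if "hmap S a b C" for C
  using that unfolding hmap_def case_prod_beta'
  by (auto intro!: cont2[where H = C and A = "I2"] continuous_intros simp: case_prod_beta')
 have "cts (I2) (%(t,s). ((%s. A s t) +++ (%s. B s t)) s)"
  by (rule continuous_join) (use sw[OF A] sw[OF B] m in auto)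
 hence "cts (I2) (%(s,t). ((%s. A s t) +++ (%s. B s t)) s)"
  unfolding case_prod_beta'
  by (intro cont2[where H = "%t. (%s. A s t) +++ (%s. B s t)" and A = "I2"])
   (auto intro!: continuous_intros simp: case_prod_beta')
 moreover have "(%(s,t). ((%s. A s t) +++ (%s. B s t)) s) = (%(s,t). (A +++ B) s t)"
  by (auto simp: joinpaths_def fun_eq_iff)
 ultimately show ?thesis using A B by (auto simp: hmap_def joinpaths_def)
qed

lemma hmap_reverse: "hmap S a b A ==> hmap S a b (rp A)"
 by (auto simp: hmap_def reversepath_def case_prod_beta' intro!: cont2[where H = A and A = "I2"] continuous_intros)

locale loopspace =
 fixes P :: "'a::euclidean_space set" and v0 :: 'a
 assumes pcP: "path_connected P" and v0: "v0:P"
begin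

sublocale pconn P v0 using pcP v0 by unfold_locales

definition c0 where "c0 = lp v0 v0"

definition Om0 where "Om0 = path_component_set (Om P v0 v0) (pf c0)"

lemma pin_c0: "pin P v0 v0 c0"
 using v0 by (simp add: c0_def pin_const)

lemma pf_c0_Om0: "pf c0:Om0"
 using pin_c0 by (auto simp: Om0_def Om_def intro!: path_component_refl)

sublocale O: pconn Om0 "pf c0"
 using pf_c0_Om0 by unfold_locales (auto simp: Om0_def path_connected_path_component)

text \<open>A loop in the loop space based at the constant loop is a map of the square with boundary
  at \<open>v0\<close>; so this is the second homotopy group.\<close>

abbreviation Pi where "Pi == fundamental_group Om0 (pf c0)"

lemma Om0_sub: "Om0 \<subseteq> Om P v0 v0"
 by (simp add: Om0_def path_component_subset)

lemma pin_Om0: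
 assumes "pin (Om P v0 v0) f g p" "s:I1" "p s:Om0" shows "pin Om0 f g p"
proof -
 have "path_image p \<subseteq> path_component_set (Om P v0 v0) (p s)"
  by (rule path_component_maximal) (use assms in "auto simp: pin_def path_image_def intro!: path_connected_path_image[unfolded path_image_def]")
 moreover have "path_component_set (Om P v0 v0) (p s) = Om0"
  using assms(3) path_component_eq unfolding Om0_def by fastforce
 ultimately show ?thesis using assms by (simp add: pin_def)
qed

lemma Om0_iff:
 assumes p: "pin P v0 v0 p"
 shows "pf p:Om0 \<longleftrightarrow> hps P p c0"
proof
 assume "pf p:Om0"
 then obtain g where g: "pin (Om P v0 v0) (pf c0) (pf p) g"
  unfolding Om0_def by (auto simp: path_component_def pin_def)
 then obtain A where A: "hmap P v0 v0 A" "!!s. s:I1 ==> pf (A s) = g s" by (rule path_hmap) blast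
 have eq: "pf (A 0) = pf c0" "pf (A 1) = pf p" using A(2)[of 0] A(2)[of 1] g by (auto simp: pin_def pathstart_def pathfinish_def)
 have pA: "path (A 0)" "path (A 1)" using hmap_row[OF A(1)] by (auto simp: pin_def)
 have "hps P c0 p"
  unfolding homotopic_paths
 proof (intro exI[of _ "%(s,t). A s t"] conjI ballI)
  fix x :: real assume "x:I1"
  thus "(%(s,t). A s t) (0,x) = c0 x" "(%(s,t). A s t) (1,x) = p x"
   using pf_eqD[OF eq(1)] pf_eqD[OF eq(2)] pA pin_c0 p by (auto simp: pin_def)
 qed (use A(1) pin_c0 in "auto simp: hmap_def pathstart_def pathfinish_def pin_def")
 thus "hps P p c0" by (rule homotopic_paths_sym)
next
 assume "hps P p c0"
 hence "hps P c0 p" by (rule homotopic_paths_sym)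
 then obtain h where h: "cts (I2) h" "h:I2 \<rightarrow> P"
  "ALL x:I1. h (0,x) = c0 x" "ALL x:I1. h (1,x) = p x"
  "ALL t:I1. pathstart (h o Pair t) = pathstart c0 & pathfinish (h o Pair t) = pathfinish c0"
  unfolding homotopic_paths by blast
 let ?A = "%s t. h (s,t)"
 have A: "hmap P v0 v0 ?A"
  using h pin_c0 by (auto simp: hmap_def pin_def pathstart_def pathfinish_def)
 have e: "pf (?A 0) = pf c0" "pf (?A 1) = pf p" using h by (auto intro!: pf_cong)
 have "pin (Om P v0 v0) (pf c0) (pf p) (pf o ?A)" using hmap_path[OF A] e by simp
 thus "pf p:Om0" unfolding Om0_def path_component_def pin_def by auto
qed

text \<open>Such families are the paths in \<open>Om0\<close>: all rows are homotopic, so one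
  null-homotopic row suffices.\<close>

definition om :: "(real => real => 'a) => bool" where
 "om A \<longleftrightarrow> hmap P v0 v0 A & (EX s:I1. hps P (A s) c0)"

lemma om_path: "om A ==> pin Om0 (pf (A 0)) (pf (A 1)) (pf o A)"
 unfolding om_def using pin_Om0[OF hmap_path] Om0_iff[OF hmap_row] by auto

lemma omI: "hmap P v0 v0 A ==> s:I1 ==> hps P (A s) c0 ==> om A"
 by (auto simp: om_def)

lemma om_row: assumes "om A" "s:I1" shows "pin P v0 v0 (A s)" "hps P (A s) c0"
proof -
 show r: "pin P v0 v0 (A s)" using assms hmap_row unfolding om_def by blast
 have "pf (A s):Om0" using om_path[OF assms(1)] assms(2) by (auto simp: pin_def path_image_def)
 thus "hps P (A s) c0" using Om0_iff[OF r] by simp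
qed

text \<open>Families that are not closed have a value too, since the holonomy closes them by chosen
  paths in the loop space; this permits cutting and pasting.\<close>

definition hol :: "(real => real => 'a) => (real => real \<Rightarrow>\<^sub>C 'a) set" where
 "hol A = O.hl (pf o A)"

lemma hol_closed: "om A ==> hol A:carrier Pi"
 unfolding hol_def by (rule O.hl_closed[OF om_path])

lemma hol_cong: "(!!s t. s:I1 ==> t:I1 ==> A s t = B s t) ==> om A ==> hol A = hol B"
 unfolding hol_def using om_path[of A]
 by (intro O.hl_homotopic homotopic_paths_eq) (auto simp: pin_def intro!: pf_cong)

lemma om_cong: "(!!s t. s:I1 ==> t:I1 ==> A s t = B s t) ==> om A ==> om B"
proof -
 assume eq: "!!s t. s:I1 ==> t:I1 ==> A s t = B s t" and A: "om A"
 have "cts (I2) (%(s,t). A s t) = cts (I2) (%(s,t). B s t)"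
  by (rule continuous_on_cong) (auto simp: eq)
 hence B: "hmap P v0 v0 B" using A eq by (auto simp: om_def hmap_def)
 have "hps P (A 0) (B 0)"
  using hmap_row[of P v0 v0 A 0] A eq by (intro homotopic_paths_eq) (auto simp: om_def pin_def)
 hence "hps P (B 0) c0" using om_row(2)[OF A, of 0] homotopic_paths_sym homotopic_paths_trans by fastforce
 thus ?thesis using B by (intro omI[of _ 0]) auto
qed

lemma hol_join:
 assumes A: "om A" and B: "om B" and m: "!!t. t:I1 ==> A 1 t = B 0 t"
 shows "hol (A +++ B) = hol A \<otimes>\<^bsub>Pi\<^esub> hol B" "om (A +++ B)"
proof -
 have "pf (A 1) = pf (B 0)" by (rule pf_cong[OF m])
 hence "O.hl ((pf o A) +++ (pf o B)) = hol A \<otimes>\<^bsub>Pi\<^esub> hol B"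
  unfolding hol_def using O.hl_join om_path[OF A] om_path[OF B] by metis
 thus "hol (A +++ B) = hol A \<otimes>\<^bsub>Pi\<^esub> hol B" by (simp add: hol_def path_compose_join)
 show "om (A +++ B)"
 proof (rule omI[of _ 0])
  show "hmap P v0 v0 (A +++ B)" using A B m by (intro hmap_vjoin) (auto simp: om_def)
 qed (use om_row(2)[OF A, of 0] in "auto simp: joinpaths_def")
qed

lemma hol_reverse:
 assumes A: "om A" shows "hol (rp A) = inv\<^bsub>Pi\<^esub> hol A" "om (rp A)"
proof -
 have "pf o rp A = rp (pf o A)" by (auto simp: reversepath_def)
 thus "hol (rp A) = inv\<^bsub>Pi\<^esub> hol A"
  using O.hl_reverse[OF om_path[OF A]] by (simp add: hol_def)
 show "om (rp A)"
 proof (rule omI[of _ 0])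
  show "hmap P v0 v0 (rp A)" using A by (intro hmap_reverse) (auto simp: om_def)
 qed (use om_row(2)[OF A, of 1] in "auto simp: reversepath_def")
qed

text \<open>By the exponential law a cube in \<open>P\<close> is a square in the loop space.\<close>

lemma hol_square:
 assumes c: "cts (I1 \<times> I2) (%(x,s,t). H x s t)"
  and P: "!!x s t. x:I1 ==> s:I1 ==> t:I1 ==> H x s t:P"
  and e: "!!x s. x:I1 ==> s:I1 ==> H x s 0 = v0 & H x s 1 = v0"
  and n: "hps P (H 0 0) c0"
 shows "hol (H 0) \<otimes>\<^bsub>Pi\<^esub> hol (%x. H x 1) = hol (%x. H x 0) \<otimes>\<^bsub>Pi\<^esub> hol (H 1)"
  and "!!x. x:I1 ==> om (H x)" "!!s. s:I1 ==> om (%x. H x s)"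
proof -
 have row: "hmap P v0 v0 (H x)" if "x:I1" for x
  using that P e by (auto simp: hmap_def case_prod_beta' intro!: cont3[OF c] continuous_intros)
 have col: "hmap P v0 v0 (%x. H x s)" if "s:I1" for s
  using that P e by (auto simp: hmap_def case_prod_beta' intro!: cont3[OF c] continuous_intros)
 have o: "om (H 0)" using omI[OF row, of 0 0] n by auto
 have o2: "om (%x. H x s)" if "s:I1" for s
  using omI[OF col[OF that], of 0] om_row(2)[OF o that] by auto
 show o3: "om (H x)" if "x:I1" for x
  using omI[OF row[OF that], of 0] om_row(2)[OF o2[of 0] that] by auto
 show "om (%x. H x s)" if "s:I1" for s by (rule o2[OF that])
 have "cts ((I2) \<times> I1) (%((s,x),t). H x s t)"
  by (auto simp: case_prod_beta' intro!: cont3[OF c] continuous_intros)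
 hence "cts (I2) (%(s,x). pf (H x s))"
  using continuous_pf[of "I2" "%(s,x). H x s"] by (simp add: case_prod_beta')
 moreover have "pf (H x s):Om0" if "s:I1" "x:I1" for s x
  using om_path[OF o3[OF that(2)]] that(1) by (auto simp: pin_def path_image_def)
 ultimately show "hol (H 0) \<otimes>\<^bsub>Pi\<^esub> hol (%x. H x 1) = hol (%x. H x 0) \<otimes>\<^bsub>Pi\<^esub> hol (H 1)"
  using O.hl_square[of "%s x. pf (H x s)"] by (simp add: hol_def o_def)
qed

end

section \<open>The second homotopy group\<close>

context loopspace begin

text \<open>A closed family is a map of the sphere, with \<open>t\<close> running along the
  meridians from pole to pole and both poles at \<open>v0\<close>.\<close>

definition cl :: "(real => real => 'a) => bool" where
 "cl A \<longleftrightarrow> om A & (ALL t:I1. A 0 t = A 1 t)"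

definition sph3 :: "(real => real => real => 'a) => bool" where
 "sph3 H \<longleftrightarrow> cts (I1 \<times> I2) (%(x,s,t). H x s t) &
  (ALL x:I1. ALL s:I1. (ALL t:I1. H x s t:P) & H x s 0 = v0 & H x s 1 = v0)"

lemma sph3_square:
 assumes "sph3 H" "hps P (H 0 0) c0"
 shows "hol (H 0) \<otimes>\<^bsub>Pi\<^esub> hol (%x. H x 1) = hol (%x. H x 0) \<otimes>\<^bsub>Pi\<^esub> hol (H 1)"
  and "x:I1 ==> om (H x)" "x:I1 ==> om (%y. H y x)"
 using hol_square[of H] assms unfolding sph3_def by blast+

lemma sph3_const: "hmap P v0 v0 A ==> sph3 (%x s. A s)" "hmap P v0 v0 A ==> sph3 (%x s. A x)"
 unfolding sph3_def hmap_def case_prod_beta'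
 by (auto intro!: cont2[where H = A and A = "I2"] continuous_intros simp: case_prod_beta')

lemma sph3_row: "sph3 H ==> s:I1 ==> hmap P v0 v0 (H s)" "sph3 H ==> s:I1 ==> hmap P v0 v0 (%x. H x s)"
 by (auto simp: sph3_def hmap_def case_prod_beta' intro!: cont3[where H = H and A = "I1 \<times> I2"] continuous_intros)

lemma om_const: assumes "pin P v0 v0 p" "hps P p c0"
 shows "om (%s. p)" "hol (%s. p) = \<one>\<^bsub>Pi\<^esub>"
proof -
 show "om (%s. p)" using omI[OF hmap_const[OF assms(1)], of 0] assms(2) by auto
 have "pf o (%s::real. p) = lp (pf p) (pf p)" by (auto simp: linepath_def fun_eq_iff algebra_simps simp flip: scaleR_left_distrib)
 thus "hol (%s. p) = \<one>\<^bsub>Pi\<^esub>" using O.hl_const Om0_iff[OF assms(1)] assms(2) by (simp add: hol_def)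
qed

lemma path_hol:
 assumes g: "pin Om0 f h g"
 obtains A where "om A" "!!s. s:I1 ==> pf (A s) = g s" "hol A = O.hl g"
proof -
 have "pin (Om P v0 v0) f h g" using g Om0_sub by (auto simp: pin_def)
 then obtain A where A: "hmap P v0 v0 A" "!!s. s:I1 ==> pf (A s) = g s" by (rule path_hmap) blast
 have "pf (A 0):Om0" using A(2)[of 0] g by (auto simp: pin_def path_image_def)
 hence o: "om A" using Om0_iff[OF hmap_row[OF A(1)]] A(1) by (intro omI[of _ 0]) auto
 have "O.hl g = hol A" unfolding hol_def
  by (intro O.hl_homotopic homotopic_paths_eq) (use g A(2) in "auto simp: pin_def")
 thus ?thesis using that o A(2) by metis
qed

lemma Pi_surj:
 assumes "x:carrier Pi"
 obtains A where "cl A" "!!t. t:I1 ==> A 0 t = v0 & A 1 t = v0" "hol A = x"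
proof -
 obtain g where g: "pin Om0 (pf c0) (pf c0) g" "O.hl g = x" using O.hl_surj_based assms by blast
 obtain A where A: "om A" "!!s. s:I1 ==> pf (A s) = g s" "hol A = O.hl g" using path_hol[OF g(1)] by blast
 have "A s t = v0" if "s:{0,1}" "t:I1" for s t
 proof -
  have "pf (A s) = pf c0" using A(2)[of s] g(1) that by (auto simp: pin_def pathstart_def pathfinish_def)
  moreover have "s:I1" using that by auto
  ultimately have "A s t = c0 t"
   using om_row(1)[OF A(1)] pin_c0 that(2) unfolding pin_def by (blast intro: pf_eqD)
  thus ?thesis by (simp add: c0_def linepath_def flip: scaleR_left_distrib)
 qed
 note v = this
 show ?thesis by (rule that[of A]) (use A g(2) v[of 0] v[of 1] in "simp_all add: cl_def")
qed

lemma joinpaths_const: "(!!t. t:I1 ==> p t = a) ==> (!!t. t:I1 ==> q t = a) ==> t:I1 ==> (p +++ q) t = a"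
 by (auto simp: joinpaths_def)

lemma c0_apply [simp]: "c0 t = v0"
 by (simp add: c0_def linepath_def flip: scaleR_left_distrib)

lemma hol_pad:
 assumes A: "cl A" "!!t. t:I1 ==> A 0 t = v0 & A 1 t = v0"
  and rr: "cts I1 rr" "rr:I1 \<rightarrow> I1" "rr 0 = 0" "rr 1 = 1"
 shows "hol (%s t. A s (rr t)) = hol A" "om (%s t. A s (rr t))"
proof -
 let ?H = "%x s t. A s ((1 - x) * rr t + x * t)"
 have m: "(1 - x) * rr t + x * t:I1" if "x:I1" "t:I1" for x t
  using convexD[of I1 "rr t" t "1 - x" x] that funcset_mem[OF rr(2)] by auto
 have h: "hmap P v0 v0 A" using A by (simp add: cl_def om_def)
 have "sph3 ?H"
  unfolding sph3_def
 proof (intro conjI ballI)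
  show "cts (I1 \<times> I2) (%(x,s,t). ?H x s t)"
   using h m unfolding hmap_def case_prod_beta'
   by (intro cont2[where H = A and A = "I2"])
    (auto intro!: continuous_intros continuous_on_compose2[OF rr(1)] simp: case_prod_beta')
 qed (use h m rr in "auto simp: hmap_def")
 note s3 = this
 have z: "hps P (?H 0 0) c0"
 proof (rule homotopic_paths_sym[OF homotopic_paths_eq])
  fix t :: real assume "t:I1"
  thus "c0 t = ?H 0 0 t" using A(2)[OF funcset_mem[OF rr(2)]] by simp
 qed (use pin_c0 in "auto simp: pin_def")
 note S = sph3_square[OF s3 z]
 have e: "hol (?H 0) \<otimes>\<^bsub>Pi\<^esub> hol (%x. ?H x 1) = hol (%x. ?H x 0) \<otimes>\<^bsub>Pi\<^esub> hol (?H 1)"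
  and o: "om (?H 0)" "om (%x. ?H x 0)" "om (%x. ?H x 1)" "om (?H 1)" using S(1) S(2)[of 0] S(2)[of 1] S(3)[of 0] S(3)[of 1] by simp_all
 have n: "hps P c0 c0" using pin_c0 by (simp add: pin_def)
 have "hol (%x. ?H x i) = \<one>\<^bsub>Pi\<^esub>" if "i:{0,1}" for i
 proof -
  have "hol (%x. c0) = hol (%x. ?H x i)"
   by (rule hol_cong[OF _ om_const(1)[OF pin_c0 n]]) (use that A(2) m in auto)
  thus ?thesis using om_const(2)[OF pin_c0 n] by simp
 qed
 thus "hol (%s t. A s (rr t)) = hol A" using e o hol_closed by simp
 show "om (%s t. A s (rr t))" using o by simp
qed

text \<open>The Eckmann-Hilton argument: the square with entries \<open>A s +++ B s'\<close> has
  \<open>A\<close>, padded with constants, on two opposite sides and \<open>B\<close> on the other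
  two.\<close>

lemma Pi_comm:
 assumes "x:carrier Pi" "y:carrier Pi" shows "x \<otimes>\<^bsub>Pi\<^esub> y = y \<otimes>\<^bsub>Pi\<^esub> x"
proof -
 obtain A where A: "cl A" "!!t. t:I1 ==> A 0 t = v0 & A 1 t = v0" "hol A = x" using Pi_surj assms by blast
 obtain B where B: "cl B" "!!t. t:I1 ==> B 0 t = v0 & B 1 t = v0" "hol B = y" using Pi_surj assms by blast
 have h: "hmap P v0 v0 A" "hmap P v0 v0 B" using A B by (simp_all add: cl_def om_def)
 let ?H = "%s s'. A s +++ B s'"
 have 1: "cts ((I2) \<times> I1) (%(z,t). (A (fst z) +++ B (snd z)) t)"
  using h unfolding hmap_def by (intro continuous_join)
   (auto simp: case_prod_beta' intro!: cont2[where H = A and A = "I2"] cont2[where H = B and A = "I2"] continuous_intros)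
 have c: "cts (I1 \<times> I2) (%(x,s,t). ?H x s t)"
  using cont2[OF 1, of "I1 \<times> I2" "%z. (fst z,fst (snd z))" "%z. snd (snd z)"]
  by (force simp: case_prod_beta' intro!: continuous_intros)
 have s3: "sph3 ?H" using c h by (auto simp: sph3_def hmap_def joinpaths_def)
 have n: "hps P (?H 0 0) c0"
  by (rule homotopic_paths_sym[OF homotopic_paths_eq]) (use pin_c0 A(2) B(2) joinpaths_const[of "A 0" v0 "B 0"] in "auto simp: pin_def")
 note sq = sph3_square[OF s3 n]
 define aa where "aa t = min 1 (2 * t)" for t :: real
 define bb where "bb t = max 0 (2 * t - 1)" for t :: real
 have al: "cts I1 aa" "aa:I1 \<rightarrow> I1" "aa 0 = 0" "aa 1 = 1" "cts I1 bb" "bb:I1 \<rightarrow> I1" "bb 0 = 0" "bb 1 = 1"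
  unfolding aa_def bb_def by (auto intro!: continuous_intros)
 have e1: "A 0 s = v0" "A 1 s = v0" "A s 0 = v0" "A s 1 = v0" "B 0 s = v0" "B 1 s = v0" "B s 0 = v0" "B s 1 = v0" if "s:I1" for s
  using A(2) B(2) h that by (auto simp: hmap_def)
 have X: "hol (%s. ?H s i) = x" if "i:{0,1}" for i
 proof -
  have "hol (%s. ?H s i) = hol (%s t. A s (aa t))"
   by (rule hol_cong) (use that e1 sq(3)[of i] in "auto simp: joinpaths_def aa_def")
  thus ?thesis using hol_pad(1)[OF A(1,2) al(1-4)] A(3) by simp
 qed
 have Y: "hol (?H i) = y" if "i:{0,1}" for i
 proof -
  have "hol (?H i) = hol (%s t. B s (bb t))"
   by (rule hol_cong) (use that e1 e1(7)[of "_ :: real"] sq(2)[of i] in \<open>auto simp: joinpaths_def bb_def max_def dest!: antisym[of 1 "2 * (_ :: real)"] intro: e1(7)[symmetric]\<close>)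
  thus ?thesis using hol_pad(1)[OF B(1,2) al(5-8)] B(3) by simp
 qed
 show ?thesis using sq(1) X Y by simp
qed

sublocale CP: comm_group Pi
 using Pi_comm by (intro group.group_comm_groupI O.G.group_axioms)

definition free_eq :: "(real => real => 'a) => (real => real => 'a) => bool" where
 "free_eq A B \<longleftrightarrow> (EX H. sph3 H & (ALL x:I1. ALL t:I1. H x 0 t = H x 1 t) &
  (ALL s:I1. ALL t:I1. H 0 s t = A s t & H 1 s t = B s t))"

lemma Pi_cancel3: "[|a:carrier Pi; b:carrier Pi; k:carrier Pi; a \<otimes>\<^bsub>Pi\<^esub> k = k \<otimes>\<^bsub>Pi\<^esub> b|] ==> a = b"
 using Pi_comm[of k b] O.G.right_cancel[of k a b] by simp

text \<open>The columns at 0 and 1, common to \<open>H\<close> and \<open>K\<close>, contribute the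
  same factors, and these cancel in the difference because the group is abelian. This is the
  homotopy invariance of the relative classes \<open>Dt\<close>.\<close>

lemma hol_dif:
 assumes H: "sph3 H" "hps P (H 0 0) c0" and K: "sph3 K"
  and e: "!!x t. x:I1 ==> t:I1 ==> H x 0 t = K x 0 t & H x 1 t = K x 1 t"
 shows "hol (H 0) \<otimes>\<^bsub>Pi\<^esub> inv\<^bsub>Pi\<^esub> hol (K 0) = hol (H 1) \<otimes>\<^bsub>Pi\<^esub> inv\<^bsub>Pi\<^esub> hol (K 1)"
proof -
 have r: "pin P v0 v0 (K 0 0)" using hmap_row[OF sph3_row(1)[OF K]] by simp
 have "hps P (H 0 0) (K 0 0)"
  using e hmap_row[OF sph3_row(1)[OF H(1)]] by (intro homotopic_paths_eq) (auto simp: pin_def)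
 hence k: "hps P (K 0 0) c0" using H(2) homotopic_paths_sym homotopic_paths_trans by blast
 note h = sph3_square[OF H] and k = sph3_square[OF K k]
 have t: "hol (%x. H x i) = hol (%x. K x i)" if "i:{0,1}" for i
  by (rule hol_cong) (use that e h(3)[of i] in auto)
 define a b a' b' p q where "a = hol (H 0)" "b = hol (H 1)" "a' = hol (K 0)" "b' = hol (K 1)" "p = hol (%x. H x 0)" "q = hol (%x. H x 1)"
 have c: "a:carrier Pi" "b:carrier Pi" "a':carrier Pi" "b':carrier Pi" "p:carrier Pi" "q:carrier Pi"
  using h(2,3) k(2,3) hol_closed by (auto simp: a_b_a'_b'_p_q_def)
 have "a \<otimes>\<^bsub>Pi\<^esub> q = p \<otimes>\<^bsub>Pi\<^esub> b" "a' \<otimes>\<^bsub>Pi\<^esub> q = p \<otimes>\<^bsub>Pi\<^esub> b'"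
  using h(1) k(1) t[of 0] t[of 1] by (simp_all add: a_b_a'_b'_p_q_def)
 hence e: "a = p \<otimes>\<^bsub>Pi\<^esub> b \<otimes>\<^bsub>Pi\<^esub> inv\<^bsub>Pi\<^esub> q" "a' = p \<otimes>\<^bsub>Pi\<^esub> b' \<otimes>\<^bsub>Pi\<^esub> inv\<^bsub>Pi\<^esub> q"
  using c by (metis O.G.inv_solve_right O.G.m_closed)+
 have "a \<otimes>\<^bsub>Pi\<^esub> inv\<^bsub>Pi\<^esub> a' = b \<otimes>\<^bsub>Pi\<^esub> inv\<^bsub>Pi\<^esub> b'"
 proof -
  have "inv\<^bsub>Pi\<^esub> q \<otimes>\<^bsub>Pi\<^esub> (q \<otimes>\<^bsub>Pi\<^esub> z) = z" if "z:carrier Pi" for z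
   using c that O.G.m_assoc[of "inv\<^bsub>Pi\<^esub> q" q z] by simp
  hence "a \<otimes>\<^bsub>Pi\<^esub> inv\<^bsub>Pi\<^esub> a' = p \<otimes>\<^bsub>Pi\<^esub> (b \<otimes>\<^bsub>Pi\<^esub> inv\<^bsub>Pi\<^esub> b') \<otimes>\<^bsub>Pi\<^esub> inv\<^bsub>Pi\<^esub> p"
   unfolding e using c by (simp add: O.G.inv_mult_group O.G.m_assoc)
  also have "... = (b \<otimes>\<^bsub>Pi\<^esub> inv\<^bsub>Pi\<^esub> b') \<otimes>\<^bsub>Pi\<^esub> p \<otimes>\<^bsub>Pi\<^esub> inv\<^bsub>Pi\<^esub> p" using c Pi_comm[of p] by simp
  also have "... = b \<otimes>\<^bsub>Pi\<^esub> inv\<^bsub>Pi\<^esub> b'" using c by (simp add: O.G.m_assoc)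
  finally show ?thesis .
 qed
 thus ?thesis by (simp add: a_b_a'_b'_p_q_def)
qed

lemma hol_free:
 assumes H: "sph3 H" "hps P (H 0 0) c0" and e: "!!x t. x:I1 ==> t:I1 ==> H x 0 t = H x 1 t"
 shows "hol (H 0) = hol (H 1)"
proof -
 note h = sph3_square[OF H]
 have "hol (%x. H x 0) = hol (%x. H x 1)" by (rule hol_cong) (use e h(3) in auto)
 thus ?thesis using h hol_closed Pi_cancel3[of "hol (H 0)" "hol (H 1)" "hol (%x. H x 0)"] by simp
qed

lemma hol_free_eq: "cl A ==> free_eq A B ==> hol A = hol B & cl B"
proof -
 assume A: "cl A" and "free_eq A B"
 then obtain H where H: "sph3 H" "!!x t. x:I1 ==> t:I1 ==> H x 0 t = H x 1 t"
  "!!s t. s:I1 ==> t:I1 ==> H 0 s t = A s t & H 1 s t = B s t"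
  unfolding free_eq_def by metis
 have "hps P (A 0) (H 0 0)"
  using om_row[of A 0] A H(3) by (intro homotopic_paths_eq) (auto simp: cl_def pin_def)
 hence n: "hps P (H 0 0) c0"
  using A om_row(2)[of A 0] homotopic_paths_sym homotopic_paths_trans by (fastforce simp: cl_def)
 note o = sph3_square[OF H(1) n]
 have "hol (H 0) = hol (H 1)" by (rule hol_free[OF H(1) n H(2)])
 moreover have "hol (H 0) = hol A" "hol (H 1) = hol B" using H(3) o(2) by (auto intro!: hol_cong)
 moreover have "om B" by (rule om_cong[OF _ o(2)[of 1]]) (use H(3) in auto)
 ultimately show ?thesis using H(2)[of 1] H(3) by (auto simp: cl_def)
qed

text \<open>A path \<open>ga\<close> of trivial holonomy joins the first rows; conjugation by it
  leaves the class unchanged, so the based homotopy given by \<open>hl_inject\<close> becomes a free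
  one.\<close>

lemma free_eq_hol:
 assumes A: "cl A" and B: "cl B" and eq: "hol A = hol B" shows "free_eq A B"
proof -
 have pA: "pin Om0 (pf (A 0)) (pf (A 0)) (pf o A)" and pB: "pin Om0 (pf (B 0)) (pf (B 0)) (pf o B)"
  using om_path[of A] om_path[of B] A B pf_cong[of "A 0" "A 1"] pf_cong[of "B 0" "B 1"] by (auto simp: cl_def)
 obtain ga where ga: "pin Om0 (pf (A 0)) (pf (B 0)) ga" "O.hl ga = \<one>\<^bsub>Pi\<^esub>"
  using O.hl_surj pin_mem[OF pA] pin_mem[OF pB] O.G.one_closed by meson
 let ?q = "ga +++ ((pf o B) +++ rp ga)"
 have q: "pin Om0 (pf (A 0)) (pf (A 0)) ?q" by (meson ga(1) pB pin_join pin_reverse)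
 have "O.hl ?q = O.hl (pf o A)"
  using O.hl_join[OF ga(1) pin_join[OF pB pin_reverse[OF ga(1)]]] O.hl_join[OF pB pin_reverse[OF ga(1)]]
   O.hl_reverse[OF ga(1)] ga(2) eq O.hl_closed[OF pB] by (simp add: hol_def)
 hence "hps Om0 (pf o A) ?q" using O.hl_inject[OF pA q] by simp
 hence "homotopic_loops Om0 (pf o A) ?q"
  using pA q by (intro homotopic_paths_imp_homotopic_loops) (auto simp: pin_def)
 moreover have "homotopic_loops Om0 ?q (pf o B)"
  by (rule homotopic_loops_conjugate) (use ga pB in "auto simp: pin_def")
 ultimately have "homotopic_loops Om0 (pf o A) (pf o B)" by (rule homotopic_loops_trans)
 then obtain h where h: "cts (I2) h" "h:I2 \<rightarrow> Om0" "ALL x:I1. h (0,x) = pf (A x)"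
  "ALL x:I1. h (1,x) = pf (B x)" "ALL t:I1. h (t,1) = h (t,0)"
  unfolding homotopic_loops by (auto simp: pathfinish_def pathstart_def)
 define H where "H x s t = apply_bcontfun (h (x,s)) t" for x s t
 have "cts ((I2) \<times> I1) (%(z,t). apply_bcontfun (h z) t)" by (rule continuous_unpf[OF h(1)])
 from cont2[OF this, of "I1 \<times> I2" "%z. (fst z,fst (snd z))" "%z. snd (snd z)"]
 have c: "cts (I1 \<times> I2) (%(x,s,t). H x s t)"
  unfolding H_def by (force simp: case_prod_beta' intro!: continuous_intros)
 have m: "pin P v0 v0 (H x s)" if "x:I1" "s:I1" for x s
  using Om_path[of "h (x,s)" P v0 v0] h(2) Om0_sub that unfolding H_def by fastforce
 have ends: "H 0 s t = A s t" "H 1 s t = B s t" if "s:I1" "t:I1" for s t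
  using h(3,4) that om_row(1)[of A s] om_row(1)[of B s] A B by (auto simp: H_def cl_def pf_apply pin_def)
 show ?thesis
  unfolding free_eq_def sph3_def
 proof (intro exI[of _ H] conjI ballI)
  show "cts (I1 \<times> I2) (%(x,s,t). H x s t)" by (rule c)
  fix x s t :: real assume "x:I1" "s:I1" "t:I1"
  thus "H x s t:P" using m[of x s] by (auto simp: pin_def path_image_def)
 next
  fix x t :: real assume "x:I1" thus "H x 0 t = H x 1 t" using h(5) by (simp add: H_def)
 qed (use m ends in "auto simp: pin_def pathstart_def pathfinish_def")
qed

end

lemma hmap_homotopic: "hmap S a b A ==> hps S (A 0) (A 1)"
 unfolding homotopic_paths
 by (rule exI[of _ "%(s,t). A s t"]) (auto simp: hmap_def pathstart_def pathfinish_def)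

lemma homotopic_hmap:
 assumes "hps S p q"
 obtains A where "hmap S (pathstart p) (pathfinish p) A" "!!t. t:I1 ==> A 0 t = p t & A 1 t = q t"
proof -
 obtain h where h: "cts (I2) h" "h:I2 \<rightarrow> S"
  "ALL x:I1. h (0,x) = p x" "ALL x:I1. h (1,x) = q x"
  "ALL t:I1. pathstart (h o Pair t) = pathstart p & pathfinish (h o Pair t) = pathfinish p"
  using assms unfolding homotopic_paths by blast
 show ?thesis
  by (rule that[of "%s t. h (s,t)"]) (use h in "auto simp: hmap_def pathstart_def pathfinish_def")
qed

section \<open>Natural operations on loops and the endomorphisms of pi_2 that they induce\<close>

context loopspace begin

text \<open>The two instances in view are conjugation by a loop and composition with a self-map of
  \<open>P\<close>. The second conjunct says that only the values on [0,1] matter.\<close>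

definition natl :: "((real => 'a) => real => 'a) => bool" where
 "natl ta \<longleftrightarrow> (ALL H. sph3 H --> sph3 (%x s. ta (H x s))) &
  (ALL p q. (ALL t:I1. p t = q t) --> (ALL t:I1. ta p t = ta q t)) & hps P (ta c0) c0"

definition opn :: "((real => 'a) => real => 'a) => (real => real \<Rightarrow>\<^sub>C 'a) set => (real => real \<Rightarrow>\<^sub>C 'a) set" where
 "opn ta x = hol (%s. ta ((SOME A. cl A & hol A = x) s))"

lemma natl_om: assumes ta: "natl ta" and A: "om A" shows "om (%s. ta (A s))"
proof -
 have h: "hmap P v0 v0 (%s. ta (B s))" if "hmap P v0 v0 B" for B
  using sph3_row(1)[of "%x s. ta (B s)" 0] ta sph3_const(1)[OF that] by (auto simp: natl_def)
 have "pin P v0 v0 (A 0)" "hps P (A 0) c0" using om_row[OF A, of 0] by auto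
 then obtain B where B: "hmap P v0 v0 B" "!!t. t:I1 ==> B 0 t = A 0 t & B 1 t = c0 t"
  using homotopic_hmap[of P "A 0" c0] unfolding pin_def by metis
 have *: "hps P (ta (A 0)) (ta (B 0))" "hps P (ta (B 1)) (ta c0)"
 proof -
  have "ta (A 0) t = ta (B 0) t" "ta (B 1) t = ta c0 t" if "t:I1" for t
   using ta B(2) that unfolding natl_def by metis+
  thus "hps P (ta (A 0)) (ta (B 0))" "hps P (ta (B 1)) (ta c0)"
   using hmap_row[OF h[of A], of 0] hmap_row[OF h[OF B(1)], of 1] A unfolding om_def pin_def
   by (auto intro!: homotopic_paths_eq)
 qed
 have "hps P (ta (A 0)) c0"
  using homotopic_paths_trans[OF *(1) homotopic_paths_trans[OF hmap_homotopic[OF h[OF B(1)]] *(2)]] ta homotopic_paths_trans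
  by (auto simp: natl_def)
 thus ?thesis using h[of A] A by (intro omI[of _ 0]) (auto simp: om_def)
qed

lemma natl_cl: "natl ta ==> cl A ==> cl (%s. ta (A s))"
 using natl_om[of ta A] unfolding cl_def natl_def by blast

lemma opn_hol: assumes "natl ta" "cl A" shows "opn ta (hol A) = hol (%s. ta (A s))"
proof -
 define B where "B = (SOME B. cl B & hol B = hol A)"
 have B: "cl B" "hol B = hol A" using someI[of "%B. cl B & hol B = hol A" A] assms(2) by (auto simp: B_def)
 obtain H where H: "sph3 H" "!!x t. x:I1 ==> t:I1 ==> H x 0 t = H x 1 t"
  "!!s t. s:I1 ==> t:I1 ==> H 0 s t = B s t & H 1 s t = A s t"
  using free_eq_hol[OF B(1) assms(2) B(2)] unfolding free_eq_def by metis
 have "free_eq (%s. ta (B s)) (%s. ta (A s))"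
  unfolding free_eq_def
  by (rule exI[of _ "%x s. ta (H x s)"]) (use H assms(1) in "auto simp: natl_def")
 thus ?thesis
  using hol_free_eq natl_cl[OF assms(1) B(1)] unfolding opn_def B_def[symmetric] by blast
qed

lemma Pi_cl: "x:carrier Pi ==> EX A. cl A & hol A = x"
 using Pi_surj by metis

lemma opn_closed: "natl ta ==> x:carrier Pi ==> opn ta x:carrier Pi"
 using Pi_cl[of x] opn_hol[of ta] natl_cl[of ta] hol_closed by (metis cl_def)

lemma opn_comp: "natl ta ==> natl ss ==> x:carrier Pi ==> opn ta (opn ss x) = opn (%p. ta (ss p)) x"
proof -
 assume n: "natl ta" "natl ss" and x: "x:carrier Pi"
 obtain A where A: "cl A" "hol A = x" using Pi_cl[OF x] by blast
 have "natl (%p. ta (ss p))"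
  unfolding natl_def
 proof (intro conjI allI impI)
  have "om (%s::real. ta (ss c0))"
   using natl_om[OF n(1) natl_om[OF n(2) om_const(1)[of c0]]] pin_c0 by (simp add: pin_def)
  from om_row(2)[OF this, of 0] show "hps P (ta (ss c0)) c0" by simp
 qed (use n in "auto simp: natl_def")
 thus ?thesis using A n by (auto simp: opn_hol natl_cl simp flip: A(2))
qed

lemma opn_mult:
 assumes n: "natl ta" and x: "x:carrier Pi" and y: "y:carrier Pi"
 shows "opn ta (x \<otimes>\<^bsub>Pi\<^esub> y) = opn ta x \<otimes>\<^bsub>Pi\<^esub> opn ta y"
proof -
 obtain A where A: "cl A" "!!t. t:I1 ==> A 0 t = v0 & A 1 t = v0" "hol A = x" using Pi_surj x by blast
 obtain B where B: "cl B" "!!t. t:I1 ==> B 0 t = v0 & B 1 t = v0" "hol B = y" using Pi_surj y by blast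
 have j: "hol (A +++ B) = x \<otimes>\<^bsub>Pi\<^esub> y" "cl (A +++ B)"
  using hol_join[of A B] A B by (auto simp: cl_def joinpaths_def)
 have "(%s. ta ((A +++ B) s)) = (%s. ta (A s)) +++ (%s. ta (B s))" by (auto simp: joinpaths_def)
 moreover have "ta (A 1) t = ta (B 0) t" if "t:I1" for t
  using n A(2) B(2) that unfolding natl_def by metis
 ultimately show ?thesis
  using opn_hol[OF n j(2)] opn_hol[OF n A(1)] opn_hol[OF n B(1)] j A(3) B(3)
   hol_join(1)[of "%s. ta (A s)" "%s. ta (B s)"] natl_cl[OF n A(1)] natl_cl[OF n B(1)]
  unfolding cl_def by metis
qed

lemma opn_hom: "natl ta ==> opn ta:hom Pi Pi"
 by (auto simp: hom_def opn_closed opn_mult)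

lemma hol_reparam:
 assumes A: "cl A" and rr: "cts I1 rr" "rr:I1 \<rightarrow> I1" "rr 0 = 0" "rr 1 = 1"
 shows "hol (%s t. A s (rr t)) = hol A"
proof -
 let ?H = "%x s t. A s ((1 - x) * t + x * rr t)"
 have m: "(1 - x) * t + x * rr t:I1" if "x:I1" "t:I1" for x t
  using convexD[of I1 t "rr t" "1 - x" x] that funcset_mem[OF rr(2)] by auto
 have h: "hmap P v0 v0 A" using A by (simp add: cl_def om_def)
 have "sph3 ?H"
  unfolding sph3_def
 proof (intro conjI ballI)
  show "cts (I1 \<times> I2) (%(x,s,t). ?H x s t)"
   using h m unfolding hmap_def case_prod_beta'
   by (intro cont2[where H = A and A = "I2"])
    (auto intro!: continuous_intros continuous_on_compose2[OF rr(1)] simp: case_prod_beta')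
 qed (use h m rr in "auto simp: hmap_def")
 hence "free_eq A (%s t. A s (rr t))"
  unfolding free_eq_def by (intro exI[of _ ?H]) (use A m in "auto simp: cl_def")
 thus ?thesis using hol_free_eq[OF A] by simp
qed

text \<open>The ends may depend on \<open>x\<close>, as they do when a homotopy drags the base
  point.\<close>

definition hm3 :: "(real => 'a) => (real => 'a) => (real => real => real => 'a) => bool" where
 "hm3 a b H \<longleftrightarrow> cts (I1 \<times> I2) (%(x,s,t). H x s t) &
  (ALL x:I1. ALL s:I1. (ALL t:I1. H x s t:P) & H x s 0 = a x & H x s 1 = b x)"

lemma sph3_hm3: "sph3 = hm3 (%_. v0) (%_. v0)"
 by (simp add: fun_eq_iff hm3_def sph3_def)

lemma hm3_join:
 assumes "hm3 a b H" "hm3 b c K" shows "hm3 a c (%x s. H x s +++ K x s)"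
proof -
 have *: "cts ((I2) \<times> I1) (%(z,t). H (fst z) (snd z) t)"
  "cts ((I2) \<times> I1) (%(z,t). K (fst z) (snd z) t)"
  using assms unfolding hm3_def case_prod_beta'
  by (auto intro!: cont3[where H = H and A = "I1 \<times> I2"] cont3[where H = K and A = "I1 \<times> I2"] continuous_intros simp: case_prod_beta')
 have "cts ((I2) \<times> I1) (%(z,t). (H (fst z) (snd z) +++ K (fst z) (snd z)) t)"
  by (rule continuous_join[OF *]) (use assms in "auto simp: hm3_def")
 from cont2[OF this, of "I1 \<times> I2" "%z. (fst z,fst (snd z))" "%z. snd (snd z)"] show ?thesis
  using assms by (force simp: hm3_def case_prod_beta' joinpaths_def intro!: continuous_intros)
qed

lemma hm3_path:
 assumes "cts (I2) (%(x,t). l x t)" "!!x t. x:I1 ==> t:I1 ==> l x t:P"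
 shows "hm3 (%x. l x 0) (%x. l x 1) (%x s. l x)"
 unfolding hm3_def case_prod_beta' using assms(2)
 by (auto intro!: cont2[OF assms(1)] continuous_intros simp: case_prod_beta')

lemma hm3_row: "hm3 a b H ==> x:I1 ==> hmap P (a x) (b x) (H x)"
 by (auto simp: hm3_def hmap_def case_prod_beta' intro!: cont3[where H = H and A = "I1 \<times> I2"] continuous_intros)

lemma hm3_const: "hmap P a b A ==> hm3 (%_. a) (%_. b) (%x. A)"
 unfolding hm3_def hmap_def case_prod_beta'
 by (auto intro!: cont2[where H = A and A = "I2"] continuous_intros simp: case_prod_beta')

text \<open>With this bracketing \<open>p\<close> occupies the parameters from 1/2 to 3/4; the
  constants in later changes of parameter come from here.\<close>

definition gr :: "(real => 'a) => (real => 'a) => (real => 'a) => real => 'a" where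
 "gr l r p = l +++ (p +++ r)"

lemma pin_gr: "pin P v0 a l ==> pin P a b p ==> pin P b v0 r ==> pin P v0 v0 (gr l r p)"
 unfolding gr_def by (intro pin_join)

lemma hl_gr: "pin P v0 a l ==> pin P a b p ==> pin P b v0 r ==> hl (gr l r p) = hl l \<otimes>\<^bsub>G\<^esub> (hl p \<otimes>\<^bsub>G\<^esub> hl r)"
 unfolding gr_def by (simp add: hl_join[OF _ pin_join] hl_join[where b = b])

lemma null_iff_hl: "pin P v0 v0 p ==> hps P p c0 \<longleftrightarrow> hl p = \<one>\<^bsub>G\<^esub>"
 using hl_eq_iff[of v0 v0 p c0] pin_c0 hl_const[OF v0] by (simp add: c0_def)

lemma hmap_gr: "pin P v0 a l ==> hmap P a b A ==> pin P b v0 r ==> hmap P v0 v0 (%s. gr l r (A s))"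
 unfolding gr_def by (intro hmap_join) (auto intro: hmap_const)

lemma cl_gr:
 assumes "pin P v0 a l" "hmap P a b A" "pin P b v0 r" "!!t. t:I1 ==> A 0 t = A 1 t"
  "hl l \<otimes>\<^bsub>G\<^esub> (hl (A 0) \<otimes>\<^bsub>G\<^esub> hl r) = \<one>\<^bsub>G\<^esub>"
 shows "cl (%s. gr l r (A s))"
proof -
 have p: "pin P a b (A 0)" using hmap_row[OF assms(2)] by simp
 have "om (%s. gr l r (A s))"
  using null_iff_hl[OF pin_gr[OF assms(1) p assms(3)]] hl_gr[OF assms(1) p assms(3)] assms(5)
  by (intro omI[OF hmap_gr[OF assms(1-3)], of 0]) auto
 thus ?thesis using assms(4) by (auto simp: cl_def gr_def joinpaths_def)
qed

lemma gr_free: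
 assumes l: "hps P l l'" and r: "hps P r r'" and H: "hm3 (%_. a) (%_. b) H"
  and lr: "pin P v0 a l" "pin P b v0 r"
 shows "EX K. sph3 K & (ALL t:I1. ALL s:I1. K 0 s t = gr l r (H 0 s) t & K 1 s t = gr l' r' (H 1 s) t) &
  (ALL x:I1. (ALL t:I1. H x 0 t = H x 1 t) --> (ALL t:I1. K x 0 t = K x 1 t))"
proof -
 obtain L where L: "hmap P v0 a L" "!!t. t:I1 ==> L 0 t = l t & L 1 t = l' t"
  using homotopic_hmap[OF l] lr(1) unfolding pin_def by metis
 obtain M where M: "hmap P b v0 M" "!!t. t:I1 ==> M 0 t = r t & M 1 t = r' t"
  using homotopic_hmap[OF r] lr(2) unfolding pin_def by metis
 have L3: "hm3 (%_. v0) (%_. a) (%x s. L x)" and M3: "hm3 (%_. b) (%_. v0) (%x s. M x)"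
  using hm3_path[of L] hm3_path[of M] L(1) M(1) by (auto simp: hmap_def hm3_def)
 have K: "sph3 (%x s. gr (L x) (M x) (H x s))"
  unfolding sph3_hm3 gr_def by (intro hm3_join[OF L3] hm3_join[OF H] M3)
 show ?thesis
  by (intro exI[of _ "%x s. gr (L x) (M x) (H x s)"] conjI K) (use L(2) M(2) in "auto simp: gr_def joinpaths_def")
qed

lemma hol_gr_cong:
 assumes "hps P l l'" "hps P r r'" "pin P v0 a l" "pin P b v0 r"
  and A: "hmap P a b A" "!!t. t:I1 ==> A 0 t = A 1 t" "hl l \<otimes>\<^bsub>G\<^esub> (hl (A 0) \<otimes>\<^bsub>G\<^esub> hl r) = \<one>\<^bsub>G\<^esub>"
 shows "hol (%s. gr l r (A s)) = hol (%s. gr l' r' (A s))"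
proof -
 from gr_free[OF assms(1,2) hm3_const[OF A(1)] assms(3,4)] A(2)
 have "free_eq (%s. gr l r (A s)) (%s. gr l' r' (A s))" unfolding free_eq_def by blast
 thus ?thesis using hol_free_eq[OF cl_gr[OF assms(3) A(1) assms(4) A(2,3)]] by simp
qed

lemma natl_gr:
 assumes p: "pin P v0 v0 p" and q: "pin P v0 v0 q" and n: "hl p \<otimes>\<^bsub>G\<^esub> hl q = \<one>\<^bsub>G\<^esub>"
 shows "natl (gr p q)"
proof -
 have c: "hm3 (%_. v0) (%_. v0) (%x s. r)" if "pin P v0 v0 r" for r
  by (rule hm3_const[OF hmap_const[OF that]])
 have "hl (gr p q c0) = \<one>\<^bsub>G\<^esub>"
  using hl_gr[OF p pin_c0 q] hl_const[OF v0] n hl_closed[OF q] by (simp add: c0_def)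
 hence "hps P (gr p q c0) c0"
  using null_iff_hl[OF pin_gr[OF p pin_c0 q]] by simp
 moreover have "sph3 (%x s. gr p q (H x s))" if "sph3 H" for H
  using that unfolding sph3_hm3 gr_def by (intro hm3_join[OF c[OF p]] hm3_join[OF _ c[OF q]])
 ultimately show ?thesis unfolding natl_def by (auto simp: gr_def joinpaths_def)
qed

section \<open>The action of pi_1 on pi_2 and the homomorphisms induced by self-maps\<close>

definition act :: "(real => 'a) set => (real => real \<Rightarrow>\<^sub>C 'a) set => (real => real \<Rightarrow>\<^sub>C 'a) set" where
 "act g = (let p = SOME p. pin P v0 v0 p & hl p = g in opn (gr p (rp p)))"

lemma natl_conj: "pin P v0 v0 p ==> natl (gr p (rp p))"
 by (rule natl_gr) (auto simp: pin_reverse hl_reverse hl_closed)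

lemma act_hol:
 assumes A: "cl A" and p: "pin P v0 v0 p" and q: "pin P v0 v0 q" and n: "hl p \<otimes>\<^bsub>G\<^esub> hl q = \<one>\<^bsub>G\<^esub>"
 shows "act (hl p) (hol A) = hol (%s. gr p q (A s))"
proof -
 define p' where "p' = (SOME p'. pin P v0 v0 p' & hl p' = hl p)"
 have p': "pin P v0 v0 p'" "hl p' = hl p"
  using someI[of "%p'. pin P v0 v0 p' & hl p' = hl p" p] p by (auto simp: p'_def)
 have h: "hmap P v0 v0 A" "om A" using A by (auto simp: cl_def om_def)
 have a0: "hl (A 0) = \<one>\<^bsub>G\<^esub>" using om_row[OF h(2), of 0] null_iff_hl by auto
 have "hl (rp p') = hl q"
  using hl_reverse[OF p'(1)] p'(2) G.inv_equality[of "hl q" "hl p"] n hl_closed[OF p] hl_closed[OF q]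
  by (metis G.inv_equality G.inv_inv)
 hence "hps P (rp p') q" by (rule hl_inject[OF pin_reverse[OF p'(1)] q])
 moreover have "hps P p' p" by (rule hl_inject[OF p'(1) p p'(2)])
 ultimately have "hol (%s. gr p' (rp p') (A s)) = hol (%s. gr p q (A s))"
  using A a0 p'(1) hl_closed[OF p'(1)] hl_reverse[OF p'(1)]
  by (intro hol_gr_cong[OF _ _ p'(1) pin_reverse[OF p'(1)] h(1)]) (auto simp: cl_def)
 thus ?thesis unfolding act_def p'_def[symmetric] by (simp add: opn_hol[OF natl_conj[OF p'(1)] A])
qed

lemma act_hom: "g:carrier G ==> act g:hom Pi Pi"
 unfolding act_def Let_def using someI_ex[OF hl_surj_based[of g]] opn_hom[OF natl_conj] by blast

lemma act_one: "x:carrier Pi ==> act \<one>\<^bsub>G\<^esub> x = x"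
proof -
 assume "x:carrier Pi"
 then obtain A where A: "cl A" "!!t. t:I1 ==> A 0 t = v0 & A 1 t = v0" "hol A = x" using Pi_surj by blast
 have c: "hl c0 = \<one>\<^bsub>G\<^esub>" using hl_const[OF v0] by (simp add: c0_def)
 have h: "hmap P v0 v0 A" "om A" using A by (auto simp: cl_def om_def)
 have "act \<one>\<^bsub>G\<^esub> x = hol (%s. gr c0 c0 (A s))"
  using act_hol[OF A(1) pin_c0 pin_c0] c A(3) by simp
 \<comment> \<open>\<open>A s\<close> is run through between 1/2 and 3/4; the clamp accounts for the
   constant parts before and after.\<close>
 also have "... = hol (%s t. A s (cl1 (4 * t - 2)))"
 proof (rule hol_cong)
  show "om (%s. gr c0 c0 (A s))" by (rule natl_om[OF natl_gr h(2)]) (use pin_c0 c in auto)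
 next
  fix s t :: real assume "s:I1" "t:I1"
  thus "gr c0 c0 (A s) t = A s (cl1 (4 * t - 2))"
  proof -
   have "A s (t * 4 - 2) = v0" if "t * 2 = 1" proof -
    have "t * 4 - 2 = 0" using that by simp
    hence "A s (t * 4 - 2) = A s 0" by (simp only:)
    also have "A s 0 = v0" using h(1) `s : I1` by (simp add: hmap_def)
    finally show ?thesis .
   qed
   thus ?thesis
    using h(1) `s : I1` `t : I1` by (auto simp: gr_def joinpaths_def hmap_def cl1_def max_def min_def algebra_simps)
  qed
 qed
 also have "... = x"
  using A(3) by (subst hol_reparam[OF A(1)]) (auto intro!: continuous_intros simp: cl1_def)
 finally show ?thesis .
qed

definition ind :: "('a => 'a) => (real => real \<Rightarrow>\<^sub>C 'a) set => (real => real \<Rightarrow>\<^sub>C 'a) set" where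
 "ind f = opn (%p. f o p)"

definition selfmap :: "('a => 'a) => bool" where
 "selfmap f \<longleftrightarrow> cts P f & f:P \<rightarrow> P & f v0 = v0"

lemma natl_selfmap: assumes "selfmap f" shows "natl (%p. f o p)"
proof -
 have "f o c0 = c0" using assms by (auto simp: selfmap_def fun_eq_iff)
 thus ?thesis
  using assms pin_c0 unfolding natl_def sph3_def selfmap_def pin_def case_prod_beta'
  by (auto intro!: continuous_on_compose2[of P f "I1 \<times> I2"])
qed

lemma ind_hol: "selfmap f ==> cl A ==> ind f (hol A) = hol (%s. f o A s)"
 unfolding ind_def by (rule opn_hol[OF natl_selfmap])

lemma ind_hom: "selfmap f ==> ind f:hom Pi Pi"
 unfolding ind_def by (rule opn_hom[OF natl_selfmap])

lemma selfmap_path: "selfmap f ==> pin P a b p ==> pin P (f a) (f b) (f o p)"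
 by (auto simp: selfmap_def intro: pin_image)

lemma selfmap_cl: "selfmap f ==> cl A ==> cl (%s. f o A s)"
 by (rule natl_cl[OF natl_selfmap])

lemma ind_comp: "selfmap f ==> selfmap g ==> x:carrier Pi ==> ind f (ind g x) = ind (f o g) x"
 unfolding ind_def using opn_comp[OF natl_selfmap natl_selfmap] by (simp add: o_assoc)

definition ind1 :: "('a => 'a) => (real => 'a) set => (real => 'a) set" where
 "ind1 f g = hl (f o (SOME p. pin P v0 v0 p & hl p = g))"

lemma ind1_hl: assumes f: "selfmap f" and p: "pin P v0 v0 p" shows "ind1 f (hl p) = hl (f o p)"
proof -
 define q where "q = (SOME q. pin P v0 v0 q & hl q = hl p)"
 have q: "pin P v0 v0 q" "hl q = hl p"
  using someI[of "%q. pin P v0 v0 q & hl q = hl p" p] p by (auto simp: q_def)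
 have "hps P (f o q) (f o p)"
  using hl_inject[OF q(1) p q(2)] f by (intro homotopic_paths_continuous_image) (auto simp: selfmap_def)
 thus ?thesis unfolding ind1_def q_def[symmetric] by (rule hl_homotopic)
qed

lemma ind1_hom: assumes f: "selfmap f" shows "ind1 f:hom G G"
proof (rule homI)
 have f0: "f v0 = v0" using f by (simp add: selfmap_def)
 fix x y assume "x:carrier G" "y:carrier G"
 then obtain p q where p: "pin P v0 v0 p" "hl p = x" and q: "pin P v0 v0 q" "hl q = y"
  using hl_surj_based by meson
 have fp: "pin P v0 v0 (f o p)" "pin P v0 v0 (f o q)" using selfmap_path[OF f] p q f0 by metis+
 show "ind1 f x:carrier G" using ind1_hl[OF f p(1)] hl_closed[OF fp(1)] p(2) by simp
 have "ind1 f (hl (p +++ q)) = hl (f o p) \<otimes>\<^bsub>G\<^esub> hl (f o q)"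
  using ind1_hl[OF f pin_join[OF p(1) q(1)]] hl_join[OF fp] by (simp add: path_compose_join)
 thus "ind1 f (x \<otimes>\<^bsub>G\<^esub> y) = ind1 f x \<otimes>\<^bsub>G\<^esub> ind1 f y"
  using hl_join[OF p(1) q(1)] ind1_hl[OF f p(1)] ind1_hl[OF f q(1)] p q by simp
qed

lemma ind_act:
 assumes f: "selfmap f" and g: "g:carrier G" and x: "x:carrier Pi"
 shows "ind f (act g x) = act (ind1 f g) (ind f x)"
proof -
 obtain p where p: "pin P v0 v0 p" "hl p = g" using hl_surj_based[OF g] by blast
 obtain A where A: "cl A" "hol A = x" using Pi_cl[OF x] by blast
 have fp: "pin P v0 v0 (f o p)" using selfmap_path[OF f p(1)] f by (simp add: selfmap_def)
 have "act g x = hol (%s. gr p (rp p) (A s))"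
  using act_hol[OF A(1) p(1) pin_reverse[OF p(1)]] hl_reverse[OF p(1)] hl_closed[OF p(1)] p A by simp
 hence "ind f (act g x) = hol (%s. f o gr p (rp p) (A s))"
  using ind_hol[OF f natl_cl[OF natl_conj[OF p(1)] A(1)]] by simp
 moreover have "act (ind1 f g) (ind f x) = hol (%s. gr (f o p) (rp (f o p)) (f o A s))"
  using act_hol[OF selfmap_cl[OF f A(1)] fp pin_reverse[OF fp]] hl_reverse[OF fp] hl_closed[OF fp]
   ind1_hl[OF f p(1)] p(2) ind_hol[OF f A(1)] A(2) by simp
 moreover have "f o gr p (rp p) (A s) = gr (f o p) (rp (f o p)) (f o A s)" for s
  by (auto simp: gr_def joinpaths_def reversepath_def fun_eq_iff)
 ultimately show ?thesis by simp
qed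

text \<open>A homotopy of self-maps moves the base point along a loop \<open>aa\<close>.\<close>

lemma homotopy_track:
 assumes F: "cts (I1 \<times> P) (%(x,y). F x y)" "!!x y. x:I1 ==> y:P ==> F x y:P"
  and f: "selfmap (F 0)" "selfmap (F 1)" and null: "hps P (%x. F x v0) c0"
 shows "x:carrier Pi ==> ind (F 0) x = ind (F 1) x" and "pin P v0 v0 p ==> hl (F 0 o p) = hl (F 1 o p)"
proof -
 let ?aa = "%x. F x v0"
 have aa: "pin P v0 v0 ?aa" using f homotopic_paths_imp_path[OF null] homotopic_paths_imp_subset[OF null] by (auto simp: pin_def pathstart_def pathfinish_def selfmap_def)
 have haa: "hl ?aa = \<one>\<^bsub>G\<^esub>" using null_iff_hl[OF aa] null by simp
 show "hl (F 0 o p) = hl (F 1 o p)" if p: "pin P v0 v0 p"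
 proof -
  have P: "path p" "!!t. t:I1 ==> p t:P" "p 0 = v0" "p 1 = v0"
   using p by (auto simp: pin_def path_image_def pathstart_def pathfinish_def)
  have c: "cts (I2) (%(x,t). F x (p t))"
   unfolding case_prod_beta' using P
   by (intro cont2[OF F(1)]) (auto simp: path_def intro!: continuous_intros continuous_on_compose2[of I1 p "I2" snd])
  have "hl ?aa \<otimes>\<^bsub>G\<^esub> hl (F 1 o p) = hl (F 0 o p) \<otimes>\<^bsub>G\<^esub> hl ?aa"
   using hl_square[OF c] F(2) P by (auto simp: o_def)
  thus ?thesis using haa hl_closed[OF selfmap_path[OF f(1) p]] hl_closed[OF selfmap_path[OF f(2) p]] by simp
 qed
 show "ind (F 0) x = ind (F 1) x" if x: "x:carrier Pi"
 proof -
  obtain A where A: "cl A" "hol A = x" using Pi_cl[OF x] by blast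
  have h: "hmap P v0 v0 A" using A by (auto simp: cl_def om_def)
  \<comment> \<open>\<open>?l x\<close> follows the track of the base point up to time
    \<open>x\<close> and \<open>?r x\<close> returns along it, which turns the rows with moving ends
    into loops at \<open>v0\<close>.\<close>
  let ?l = "%x t. F (x * t) v0" and ?r = "%x t. F (x * (1 - t)) v0"
  have xt: "x * t:I1" "x * (1 - t):I1" if "x:I1" "t:I1" for x t :: real
   using that by (auto simp: mult_le_one)
  have l: "hm3 (%_. v0) (%x. F x v0) (%x s. ?l x)" "hm3 (%x. F x v0) (%_. v0) (%x s. ?r x)"
  proof -
   have "cts (I2) (%(x,t). ?l x t)" "cts (I2) (%(x,t). ?r x t)"
    unfolding case_prod_beta' using xt v0 by (auto intro!: cont2[OF F(1)] continuous_intros)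
   thus "hm3 (%_. v0) (%x. F x v0) (%x s. ?l x)" "hm3 (%x. F x v0) (%_. v0) (%x s. ?r x)"
    using hm3_path[of ?l] hm3_path[of ?r] xt F(2) v0 f(1) by (auto simp: hm3_def selfmap_def)
  qed
  have m: "hm3 (%x. F x v0) (%x. F x v0) (%x s t. F x (A s t))"
   using h F(2) unfolding hm3_def hmap_def case_prod_beta'
   by (auto intro!: cont2[OF F(1)] cont2[where H = A and A = "I2"] continuous_intros simp: case_prod_beta')
  let ?K = "%x s. gr (?l x) (?r x) (%t. F x (A s t))"
  have K: "sph3 ?K" unfolding sph3_hm3 gr_def by (intro hm3_join[OF l(1)] hm3_join[OF m] l(2))
  have rev: "?r 1 = rp ?aa" "?l 1 = ?aa" "?l 0 = c0" "?r 0 = c0"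
   using f(1) by (auto simp: reversepath_def fun_eq_iff selfmap_def)
  have c0e: "(%t. F 0 v0) = c0" using f(1) by (auto simp: fun_eq_iff selfmap_def)
  have c: "cl (%s. F 0 o A s)" "cl (%s. F 1 o A s)" by (rule selfmap_cl[OF _ A(1)], rule f)+
  have c': "hl c0 = \<one>\<^bsub>G\<^esub>" using hl_const[OF v0] by (simp add: c0_def)
  have 0: "cl (?K 0)" using natl_cl[OF natl_gr[OF pin_c0 pin_c0] c(1)] c' by (simp add: c0e o_def)
  have "free_eq (?K 0) (?K 1)"
   unfolding free_eq_def using K A by (intro exI[of _ ?K]) (auto simp: gr_def joinpaths_def cl_def)
  hence "hol (?K 0) = hol (?K 1)" using hol_free_eq[OF 0] by simp
  moreover have "hol (?K 0) = ind (F 0) x"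
   using act_hol[OF c(1) pin_c0 pin_c0] act_one[OF hol_closed] c c' ind_hol[OF f(1) A(1)] A(2)
   by (simp add: c0e o_def cl_def)
  moreover have "hol (?K 1) = ind (F 1) x"
   using act_hol[OF c(2) aa pin_reverse[OF aa]] act_one[OF hol_closed] c haa hl_reverse[OF aa] ind_hol[OF f(2) A(1)] A(2)
   unfolding rev by (simp add: o_def cl_def)
  ultimately show ?thesis by simp
 qed
qed

end

section \<open>Sums over labelled grids\<close>

text \<open>The cell is cut along the diagonal through its lower left corner, and both triangles are
  counted with the orientation of the plane.\<close>

definition cellv :: "('l => 'l => 'l => int) => (nat => nat => 'l) => nat => nat => int" where
 "cellv f a i j = f (a i j) (a (Suc i) j) (a (Suc i) (Suc j)) - f (a i j) (a i (Suc j)) (a (Suc i) (Suc j))"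

definition corners :: "(nat => nat => 'l) => nat => nat => 'l set" where
 "corners a i j = {a i j,a (Suc i) j,a i (Suc j),a (Suc i) (Suc j)}"

text \<open>A change of labels changes a sum over the cells by a coboundary (the prism operator).\<close>

lemma grid_sum_eq:
 fixes f :: "'l => 'l => 'l => int"
 defines "T x y x' y' == f x x' y' - f x y y'"
 assumes coc: "!!i j p q r s. i < m ==> j < n ==> {p,q,r,s} \<subseteq> corners a i j \<union> corners b i j ==>
   f q r s - f p r s + f p q s - f p q r = 0"
  and bt: "!!i. i < m ==> T (a i 0) (a (Suc i) 0) (b i 0) (b (Suc i) 0) = T (a i n) (a (Suc i) n) (b i n) (b (Suc i) n)"
  and lr: "!!j. j < n ==> T (a 0 j) (a 0 (Suc j)) (b 0 j) (b 0 (Suc j)) = T (a m j) (a m (Suc j)) (b m j) (b m (Suc j))"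
 shows "(\<Sum>i<m. \<Sum>j<n. cellv f a i j) = (\<Sum>i<m. \<Sum>j<n. cellv f b i j)"
proof -
 define h where "h i j = T (a i j) (a (Suc i) j) (b i j) (b (Suc i) j)" for i j
 define v where "v i j = T (a i j) (a i (Suc j)) (b i j) (b i (Suc j))" for i j
 \<comment> \<open>A prism over a triangle consists of three tetrahedra; the cocycle condition is
   used once for each.\<close>
 have tri: "f x' y' z' - f x y z = T y z y' z' - T x z x' z' + T x y x' y'"
  if "i < m" "j < n" "{x,y,z} \<subseteq> corners a i j" "{x',y',z'} \<subseteq> corners b i j" for i j x y z x' y' z'
  using coc[OF that(1,2), of x x' y' z'] coc[OF that(1,2), of x y y' z'] coc[OF that(1,2), of x y z z'] that(3,4)
  by (simp add: T_def subset_iff)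
 have cell: "cellv f b i j - cellv f a i j = (h i j - h i (Suc j)) + (v (Suc i) j - v i j)" if "i < m" "j < n" for i j
  using tri[OF that, of "a i j" "a (Suc i) j" "a (Suc i) (Suc j)" "b i j" "b (Suc i) j" "b (Suc i) (Suc j)"]
   tri[OF that, of "a i j" "a i (Suc j)" "a (Suc i) (Suc j)" "b i j" "b i (Suc j)" "b (Suc i) (Suc j)"]
  by (simp add: cellv_def h_def v_def corners_def)
 have 1: "(\<Sum>j<n. h i j - h i (Suc j)) = 0" if "i < m" for i
  using sum_lessThan_telescope'[of "h i" n] bt[OF that] by (simp add: h_def)
 have 2: "(\<Sum>i<m. v (Suc i) j - v i j) = 0" if "j < n" for j
  using sum_lessThan_telescope[of "%i. v i j" m] lr[OF that] by (simp add: v_def)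
 have "(\<Sum>i<m. \<Sum>j<n. cellv f b i j) - (\<Sum>i<m. \<Sum>j<n. cellv f a i j)
   = (\<Sum>i<m. \<Sum>j<n. (h i j - h i (Suc j)) + (v (Suc i) j - v i j))"
  by (simp add: cell flip: sum_subtractf)
 also have "... = (\<Sum>i<m. \<Sum>j<n. h i j - h i (Suc j)) + (\<Sum>i<m. \<Sum>j<n. v (Suc i) j - v i j)"
  by (simp only: sum.distrib)
 also have "(\<Sum>i<m. \<Sum>j<n. v (Suc i) j - v i j) = (\<Sum>j<n. \<Sum>i<m. v (Suc i) j - v i j)" by (rule sum.swap)
 finally show ?thesis using 1 2 by simp
qed

lemma sum_blocks:
 fixes g :: "nat => int" assumes "k > 0"
 shows "(\<Sum>i<k * m. if Suc i mod k = 0 then g (i div k) else 0) = (\<Sum>i<m. g i)"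
proof -
 have "(\<Sum>i<k * m. if Suc i mod k = 0 then g (i div k) else 0) = (\<Sum>i\<in>{i. i < k * m & Suc i mod k = 0}. g (i div k))"
  by (rule sum.mono_neutral_cong_right) auto
 also have "... = (\<Sum>i<m. g i)"
 proof (rule sum.reindex_bij_witness[where i = "%i. k * i + (k - 1)" and j = "%i. i div k"])
  fix i assume i: "i:{i. i < k * m & Suc i mod k = 0}"
  then obtain q where q: "Suc i = k * q" by auto
  then obtain p where "q = Suc p" by (cases q) auto
  hence e: "i = k * p + (k - 1)" using q assms by simp
  hence "i div k = p" using div_mult_self4[of k p "k - 1"] assms by (simp add: div_less)
  thus "k * (i div k) + (k - 1) = i" using e by simp
  show "i div k:{..<m}" using i assms by (simp add: div_less_iff_less_mult mult.commute)
 next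
  fix i assume i: "i:{..<m}"
  show "(k * i + (k - 1)) div k = i" using div_mult_self4[of k i "k - 1"] assms by simp
  have "k * Suc i <= k * m" using i by (intro mult_le_mono2) auto
  thus "k * i + (k - 1):{i. i < k * m & Suc i mod k = 0}" using assms by auto
 qed auto
 finally show ?thesis .
qed

text \<open>With rounded labels a cell of the subdivision has only degenerate triangles, or two that
  vanish by the hypotheses on \<open>f\<close>, unless it is the last one of its block in both
  directions.\<close>

lemma rounded_grid_sum:
 fixes f :: "'l => 'l => 'l => int"
 assumes f: "!!p q. f p p q = 0" "!!p q. f p q q = 0" and k: "k > 0" "l > 0"
 shows "(\<Sum>i<k * m. \<Sum>j<l * n. cellv f (%i j. a (i div k) (j div l)) i j) = (\<Sum>i<m. \<Sum>j<n. cellv f a i j)"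
proof -
 have c: "cellv f (%i j. a (i div k) (j div l)) i j =
   (if Suc i mod k = 0 then (if Suc j mod l = 0 then cellv f a (i div k) (j div l) else 0) else 0)" for i j
  by (simp add: cellv_def div_Suc f)
 have "(\<Sum>j<l * n. cellv f (%i j. a (i div k) (j div l)) i j) =
   (if Suc i mod k = 0 then (\<Sum>j<n. cellv f a (i div k) j) else 0)" for i
  using sum_blocks[OF k(2), of "cellv f a (i div k)" n] by (simp add: c)
 thus ?thesis using sum_blocks[OF k(1), of "%i. \<Sum>j<n. cellv f a i j" m] by simp
qed

section \<open>Two-dimensional complexes\<close>

locale cplx2 =
 fixes K :: "'a::euclidean_space set set" and P :: "'a set"
 assumes finK: "finite K"
  and simp: "!!S. S:K ==> finite S & S ~= {} & ~ affine_dependent S & card S <= 3"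
  and face: "!!S F. S:K ==> F \<subseteq> S ==> F ~= {} ==> F:K"
  and inter: "!!S T. S:K ==> T:K ==> convex hull S \<inter> convex hull T = convex hull (S \<inter> T)"
  and P: "P = (\<Union>S\<in>K. convex hull S)"
begin

text \<open>The carrier: the smallest simplex that contains \<open>z\<close>.\<close>

definition car :: "'a => 'a set" where "car z = \<Inter>{S \<in> K. z:convex hull S}"

lemma hull_sub: "S:K ==> convex hull S \<subseteq> P"
 using P by blast

lemma vertex_P: "S:K ==> v:S ==> v:P"
 using hull_sub[of S] hull_inc[of v S convex] by blast

lemma car: assumes "z:P" shows "car z:K" "z:convex hull (car z)"
proof -
 have "\<Inter>F \<in> K & z:convex hull (\<Inter>F)" if "finite F" "F ~= {}" "F \<subseteq> {S \<in> K. z:convex hull S}" for F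
  using that
 proof (induction F rule: finite_ne_induct)
  case (insert S F)
  hence "z:convex hull (S \<inter> \<Inter>F)" using inter[of S "\<Inter>F"] by auto
  moreover from this have "S \<inter> \<Inter>F ~= {}" by force
  ultimately show ?case using insert face[of S "S \<inter> \<Inter>F"] by auto
 qed auto
 from this[of "{S \<in> K. z:convex hull S}"] show "car z:K" "z:convex hull (car z)"
  using finK P assms by (auto simp: car_def)
qed

lemma car_le: "S:K ==> z:convex hull S ==> car z \<subseteq> S"
 by (auto simp: car_def)

lemma car_vertex: "{v}:K ==> car v = {v}"
 using car[of v] car_le[of "{v}" v] simp[of "car v"] vertex_P[of "{v}" v] by auto

lemma compact_hull: "S:K ==> compact (convex hull S)"
 using simp by (simp add: finite_imp_compact_convex_hull)

lemma compact_P: "compact P"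
 unfolding P using finK compact_hull by (intro compact_UN) auto

text \<open>A Lebesgue number for the cover of \<open>P\<close> by the open stars of
  vertices.\<close>

lemma star_number: "EX ep>0. ALL x:P. EX v. ALL y:P. dist x y < ep --> v:car y"
proof -
 define U where "U v = - (\<Union>S\<in>{S:K. v ~: S}. convex hull S)" for v
 have U: "v:car y" if "y:U v" "y:P" for v y using car[OF that(2)] that(1) by (auto simp: U_def)
 have "closed (\<Union>S\<in>{S:K. v ~: S}. convex hull S)" for v
  using finK compact_hull compact_imp_closed by (intro closed_UN) auto
 hence op: "open (U v)" for v unfolding U_def by (rule open_Compl)
 have "P \<subseteq> \<Union>(range U)"
 proof
  fix x assume x: "x \<in> P"
  then obtain v where "v:car x" using car simp by blast
  hence "x:U v" using car_le by (auto simp: U_def)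
  thus "x:\<Union>(range U)" by blast
 qed
 then obtain ep where ep: "ep > 0" "!!x. x:P ==> EX G:range U. ball x ep \<subseteq> G"
  by (rule Heine_Borel_lemma[OF compact_P]) (use op in auto)
 thus ?thesis using U by (intro exI[of _ ep] conjI ballI) (fastforce simp: subset_iff)+
qed

definition eps where "eps = (SOME ep. ep > 0 & (ALL x:P. EX v. ALL y:P. dist x y < ep --> v:car y))"

text \<open>One vertex is good for all points within distance \<open>eps\<close>. Hence the labels
  of points that are close to each other lie in a common simplex.\<close>

definition lab :: "'a => 'a" where "lab x = (SOME v. ALL y:P. dist x y < eps --> v:car y)"

lemma eps: "eps > 0" "x:P ==> EX v. ALL y:P. dist x y < eps --> v:car y"
 using someI_ex[of "%ep. ep > 0 & (ALL x:P. EX v. ALL y:P. dist x y < ep --> v:car y)"] star_number unfolding eps_def by blast+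

lemma lab_car: "x:P ==> y:P ==> dist x y < eps ==> lab x:car y"
 using someI_ex[OF eps(2)[of x]] unfolding lab_def by blast

lemma lab_car_self: "x:P ==> lab x:car x"
 using lab_car[of x x] eps by simp

lemma lab_vertex: "{v}:K ==> lab v = v"
 using lab_car_self[of v] car_vertex vertex_P by auto

lemma segment_hull: "S:K ==> x:convex hull S ==> y:convex hull S ==> closed_segment x y \<subseteq> convex hull S"
 by (intro closed_segment_subset convex_convex_hull)

definition ord :: "'a => nat" where "ord = (SOME f. inj_on f (\<Union>K))"

lemma ord_inj: "inj_on ord (\<Union>K)"
proof -
 have "finite (\<Union>K)" using finK simp by auto
 thus ?thesis using finite_imp_inj_to_nat_seg[of "\<Union>K"] someI_ex[of "%f. inj_on f (\<Union>K)"] unfolding ord_def by blast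
qed

lemma ord_eq: "S \<in> K ==> x:S ==> y:S ==> ord x = ord y \<longleftrightarrow> x = y"
 using ord_inj by (auto simp: inj_on_def)

text \<open>The sign of the permutation that sorts the three vertices by \<open>ord\<close>, and 0
  for a repeated vertex.\<close>

definition sg :: "'a => 'a => 'a => int" where
 "sg x y z = sgn (int (ord y) - int (ord x)) * sgn (int (ord z) - int (ord y)) * sgn (int (ord z) - int (ord x))"

lemma sg_refl [simp]: "sg x x y = 0" "sg x y x = 0" "sg x y y = 0"
 by (simp_all add: sg_def)

lemma sg_swap: "sg y x z = - sg x y z" "sg x z y = - sg x y z"
 by (simp_all add: sg_def sgn_if)

text \<open>In dimension 2 there is no nondegenerate tetrahedron: two of the four vertices agree,
  and antisymmetry does the rest.\<close>

lemma sg_cocycle: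
 assumes "card S <= 3" "finite S" "{p,q,r,s} \<subseteq> S"
 shows "sg q r s - sg p r s + sg p q s - sg p q r = 0"
proof -
 have "card {p,q,r,s} <= 3" using card_mono[OF assms(2,3)] assms(1) by linarith
 hence "p = q | p = r | p = s | q = r | q = s | r = s" by (auto simp: card_insert_if split: if_splits)
 thus ?thesis
  using sg_swap(1)[of r q s] sg_swap(1)[of s q r] sg_swap(2)[of q r s] sg_swap(2)[of p r s]
  by (elim disjE) simp_all
qed

definition cor :: "'a set => 'a" where "cor S = (SOME v. v:S)"

lemma cor: "S:K ==> cor S:S"
 using simp[of S] someI_ex[of "%v. v:S"] unfolding cor_def by blast

end

locale pcplx = cplx2 K P + loopspace P v0 for K :: "'a::euclidean_space set set" and P v0 +
 assumes v0K: "{v0}:K"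
begin

definition eg :: "'a => 'a => (real => 'a) set" where "eg a b = hl (lp a b)"

lemma hl_simplex:
 assumes S: "S:K" and p: "pin (convex hull S) a b p" shows "hl p = eg a b"
proof -
 have ab: "a:convex hull S" "b:convex hull S" using pin_mem[OF p] by auto
 have "hps P (id o p) (id o lp a b)"
  by (rule homotopic_through_convex[where C = "convex hull S"])
   (use hull_sub[OF S] p pin_linepath[OF segment_hull[OF S ab]] in auto)
 thus ?thesis unfolding eg_def using hl_homotopic by simp
qed

lemma pin_edge: "S:K ==> a:convex hull S ==> b:convex hull S ==> pin P a b (lp a b)"
 using segment_hull[of S a b] hull_sub[of S] by (intro pin_linepath) auto

lemma eg_closed: "S:K ==> a:convex hull S ==> b:convex hull S ==> eg a b:carrier G"
 unfolding eg_def by (rule hl_closed[OF pin_edge])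

lemma eg_mult:
 assumes "S:K" "a:convex hull S" "b:convex hull S" "c:convex hull S"
 shows "eg a b \<otimes>\<^bsub>G\<^esub> eg b c = eg a c"
proof -
 have "pin (convex hull S) a c (lp a b +++ lp b c)"
  using segment_hull[OF assms(1)] assms by (intro pin_join[of _ a b] pin_linepath) auto
 from hl_simplex[OF assms(1) this] show ?thesis
  using hl_join[OF pin_edge[of S a b] pin_edge[of S b c]] assms by (simp add: eg_def)
qed

lemma eg_self: "a:P ==> eg a a = \<one>\<^bsub>G\<^esub>"
 unfolding eg_def by (rule hl_const)

text \<open>Lifted labels are pairs of a vertex and the class of a path to it, that is, vertices of the
  universal covering. The pair \<open>(S, g)\<close> denotes a lift of the simplex \<open>S\<close>; here \<open>g\<close> is the class
  of a path to the vertex \<open>cor S\<close>.\<close>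

definition psi :: "'a set \<times> (real => 'a) set => 'a \<times> (real => 'a) set => 'a \<times> (real => 'a) set => 'a \<times> (real => 'a) set => int" where
 "psi bb p q r = (if {fst p,fst q,fst r} = fst bb & snd p \<otimes>\<^bsub>G\<^esub> eg (fst p) (cor (fst bb)) = snd bb
  then sg (fst p) (fst q) (fst r) else 0)"

text \<open>All labels in \<open>L\<close> are vertices of one lift of \<open>S\<close> to the
  universal covering.\<close>

definition coh :: "'a set => ('a \<times> (real => 'a) set) set => bool" where
 "coh S L \<longleftrightarrow> S:K & (ALL p:L. fst p:S & snd p:carrier G & (ALL q:L. snd q = snd p \<otimes>\<^bsub>G\<^esub> eg (fst p) (fst q)))"

lemma coh_mono: "coh S L ==> M \<subseteq> L ==> coh S M"
 unfolding coh_def by blast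

lemma cohD:
 assumes "coh S L"
 shows "S:K" "p:L ==> fst p:S" "p:L ==> snd p:carrier G"
  "p:L ==> q:L ==> snd p \<otimes>\<^bsub>G\<^esub> eg (fst p) (fst q) = snd q"
 using assms unfolding coh_def by fastforce+

lemma psi_refl [simp]: "psi bb p p q = 0" "psi bb p q q = 0" "psi bb p q p = 0"
 by (simp_all add: psi_def)

lemma coh_match:
 assumes "coh S L" "p:L" "q:L" "c:S"
 shows "snd p \<otimes>\<^bsub>G\<^esub> eg (fst p) c = snd q \<otimes>\<^bsub>G\<^esub> eg (fst q) c"
proof -
 note D = cohD[OF assms(1)]
 have v: "fst p:convex hull S" "fst q:convex hull S" "c:convex hull S"
  using D(2)[OF assms(2)] D(2)[OF assms(3)] assms(4) by (auto simp: hull_inc)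
 have "snd p \<otimes>\<^bsub>G\<^esub> eg (fst p) (fst q) \<otimes>\<^bsub>G\<^esub> eg (fst q) c = snd p \<otimes>\<^bsub>G\<^esub> eg (fst p) c"
  using D(3)[OF assms(2)] eg_closed[OF D(1)] eg_mult[OF D(1)] v by (simp add: G.m_assoc)
 thus ?thesis by (simp add: D(4)[OF assms(2,3)])
qed

text \<open>A nonempty coherent set determines the lift of \<open>S\<close>, so the test in
  \<open>psi\<close> comes out alike for all its triples that span \<open>S\<close>. The cocycle
  identity and antisymmetry thus pass from \<open>sg\<close> to \<open>psi\<close>.\<close>

lemma psi_coh:
 assumes L: "coh S L" and c: "card (fst bb) = 3"
 shows "EX C. ALL p:L. ALL q:L. ALL r:L. psi bb p q r = (if C then sg (fst p) (fst q) (fst r) else 0)"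
proof (cases "fst bb = S")
 case False
 have "{fst p,fst q,fst r} ~= fst bb" if "p:L" "q:L" "r:L" for p q r
 proof
  assume "{fst p,fst q,fst r} = fst bb"
  moreover have "fst p:S" "fst q:S" "fst r:S" "S:K" using cohD[OF L] that by auto
  ultimately have "fst bb \<subseteq> S" by (metis empty_subsetI insert_subset)
  thus False using card_seteq[of S "fst bb"] simp[OF `S : K`] c False by simp
 qed
 thus ?thesis by (intro exI[of _ False]) (auto simp: psi_def)
next
 case True
 have S: "S:K" by (rule cohD[OF L])
 show ?thesis
 proof (cases "L = {}")
  case False
  then obtain p0 where p0: "p0:L" by blast
  let ?C = "snd p0 \<otimes>\<^bsub>G\<^esub> eg (fst p0) (cor S) = snd bb"
  have "psi bb p q r = (if ?C then sg (fst p) (fst q) (fst r) else 0)" if "p:L" "q:L" "r:L" for p q r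
  proof (cases "{fst p,fst q,fst r} = S")
   case True
   thus ?thesis using coh_match[OF L p0 `p : L` cor[OF S]] `fst bb = S` by (simp add: psi_def)
  next
   case F: False
   have "{fst p,fst q,fst r} \<subseteq> S" using cohD(2)[OF L] that by auto
   hence "card {fst p,fst q,fst r} ~= 3"
    using card_subset_eq[of S "{fst p,fst q,fst r}"] simp[OF S] c `fst bb = S` F by auto
   hence "sg (fst p) (fst q) (fst r) = 0" by (auto simp: card_insert_if split: if_splits)
   thus ?thesis using F `fst bb = S` by (simp add: psi_def)
  qed
  thus ?thesis by blast
 qed auto
qed

lemma psi_cocycle:
 assumes "coh S L" "card (fst bb) = 3" "{p,q,r,s} \<subseteq> L"
 shows "psi bb q r s - psi bb p r s + psi bb p q s - psi bb p q r = 0"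
proof -
 obtain C where C: "!!p q r. p:L ==> q:L ==> r:L ==> psi bb p q r = (if C then sg (fst p) (fst q) (fst r) else 0)"
  using psi_coh[OF assms(1,2)] by blast
 have "{fst p,fst q,fst r,fst s} \<subseteq> S" "card S <= 3" "finite S"
  using cohD(1,2)[OF assms(1)] assms(3) simp[of S] by auto
 from sg_cocycle[OF this(2,3,1)] show ?thesis using C assms(3) by simp
qed

lemma psi_rot:
 assumes "coh S {p,q,r}" "card (fst bb) = 3"
 shows "psi bb q p r = - psi bb p q r" "psi bb p r q = - psi bb p q r"
proof -
 obtain C where C: "ALL x:{p,q,r}. ALL y:{p,q,r}. ALL z:{p,q,r}. psi bb x y z = (if C then sg (fst x) (fst y) (fst z) else 0)"
  using psi_coh[OF assms] by metis
 hence "psi bb q p r = (if C then sg (fst q) (fst p) (fst r) else 0)"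
  "psi bb p r q = (if C then sg (fst p) (fst r) (fst q) else 0)"
  "psi bb p q r = (if C then sg (fst p) (fst q) (fst r) else 0)" by blast+
 thus "psi bb q p r = - psi bb p q r" "psi bb p r q = - psi bb p q r"
  using sg_swap(1)[of "fst p" "fst q" "fst r"] sg_swap(2)[of "fst p" "fst q" "fst r"] by auto
qed

end

section \<open>Degrees\<close>

context pcplx begin

definition clst :: "'a => 'a set" where "clst w = (\<Union>S\<in>{S:K. w:S}. convex hull S)"

lemma clst_sub: "clst w \<subseteq> P"
 using hull_sub by (auto simp: clst_def)

lemma car_clst: "z:P ==> w:car z ==> convex hull car z \<subseteq> clst w"
 using car(1) by (auto simp: clst_def)

text \<open>Closed stars are starlike, hence simply connected.\<close>

lemma hl_clst:
 assumes p: "pin (clst w) a b p" and q: "pin (clst w) a b q" shows "hl p = hl q"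
proof -
 have "starlike (clst w)"
  unfolding starlike_def
 proof (intro bexI ballI)
  fix x assume "x:clst w"
  then obtain S where S: "S:K" "w:S" "x:convex hull S" by (auto simp: clst_def)
  hence "closed_segment w x \<subseteq> convex hull S" by (intro segment_hull) (auto simp: hull_inc)
  thus "closed_segment w x \<subseteq> clst w" using S by (auto simp: clst_def)
 next
  obtain S where "S:K" "w:S" using pin_mem[OF p] by (auto simp: clst_def)
  thus "w:clst w" by (auto simp: clst_def hull_inc)
 qed
 hence "simply_connected (clst w)" by (rule starlike_imp_simply_connected)
 hence "hps (clst w) p q"
  using p q unfolding simply_connected_eq_homotopic_paths pin_def by auto
 thus ?thesis using hl_homotopic homotopic_paths_subset[OF _ clst_sub] by blast
qed

text \<open>The lift of the row to the universal covering, started at the base point, followed by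
  the segment from the point reached to its label.\<close>

definition lb :: "(real => real => 'a) => real => real => 'a \<times> (real => 'a) set" where
 "lb A s t = (lab (A s t),hl (subpath 0 t (A s)) \<otimes>\<^bsub>G\<^esub> eg (A s t) (lab (A s t)))"

abbreviation I3 :: "(real \<times> real \<times> real) set" where "I3 == I1 \<times> I2"

definition ev :: "(real => real => real => 'a) => real \<times> real \<times> real => 'a" where
 "ev H = (%(x,s,t). H x s t)"

definition lbl :: "(real => real => real => 'a) => real \<times> real \<times> real => 'a \<times> (real => 'a) set" where
 "lbl H = (%(x,s,t). lb (H x) s t)"

definition modulus :: "(real => real => real => 'a) => real => bool" where
 "modulus H dd \<longleftrightarrow> dd > 0 & (ALL z:I3. ALL z':I3. dist z z' < dd --> dist (ev H z) (ev H z') < eps)"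

lemma modulus_exists: assumes "sph3 H" shows "EX dd. modulus H dd"
proof -
 have "uniformly_continuous_on I3 (ev H)"
  using assms unfolding sph3_def ev_def by (intro compact_uniformly_continuous compact_Times) auto
 thus ?thesis
  using eps(1) unfolding uniformly_continuous_on_def modulus_def by (metis dist_commute)
qed

lemma ev_P: "sph3 H ==> z:I3 ==> ev H z:P"
 by (auto simp: sph3_def ev_def)

text \<open>Two homotopies are combined. The quadrilateral between \<open>z\<close>,
  \<open>z'\<close> and their feet at \<open>t = 0\<close>, where the map is constant, compares the
  lifted points. The segment from \<open>z\<close> to \<open>z'\<close> maps into the closed star of
  the label of \<open>z'\<close>, where paths are determined by their ends, and this compares the
  lifted labels.\<close>

lemma lbl_step:
 assumes H: "sph3 H" and m: "modulus H dd" and z: "z:I3" "z':I3" "dist z z' < dd"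
 shows "snd (lbl H z) \<otimes>\<^bsub>G\<^esub> eg (fst (lbl H z)) (fst (lbl H z')) = snd (lbl H z')"
  and "fst (lbl H z):car (ev H z')" "snd (lbl H z):carrier G"
proof -
 note HP = ev_P[OF H]
 have cont: "cts I3 (ev H)" "ev H:I3 \<rightarrow> P" using H HP by (auto simp: sph3_def ev_def)
 have near: "lab (ev H w):car (ev H w')" if "w:I3" "w':I3" "dist w w' < dd" for w w'
  using m that HP by (intro lab_car) (auto simp: modulus_def)
 obtain x s t x' s' t' where e: "z = (x,s,t)" "z' = (x',s',t')" by (metis prod_cases3)
 have c: "x:I1" "s:I1" "t:I1" "x':I1" "s':I1" "t':I1" using z e by auto
 have cv: "convex I3" by (intro convex_Times) auto
 have pi: "pin I3 a b (lp a b)" if "a:I3" "b:I3" for a b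
  using closed_segment_subset[OF that cv] by (rule pin_linepath)
 have pj: "pin P (ev H a) (ev H b) (ev H o lp a b)" if "a:I3" "b:I3" for a b
  by (rule pin_image[OF pi[OF that] cont])
 let ?seg = "ev H o lp z z'"
 let ?v = "lab (ev H z)" and ?v' = "lab (ev H z')"
 have sub: "ev H o lp (x,s,0) (x,s,t) = subpath 0 t (H x s)" for x s t
  by (auto simp: ev_def linepath_def subpath_def fun_eq_iff algebra_simps simp flip: distrib_left)
 have i3: "(x,s,0):I3" "(x',s',0):I3" using c by auto
 have bot: "hl (ev H o lp (x,s,0) (x',s',0)) = \<one>\<^bsub>G\<^esub>"
 proof -
  have "ev H (lp (x,s,0) (x',s',0) t) = v0" if "t:I1" for t
  proof -
   have "lp (x,s,0) (x',s',0) t:I3" using pi[OF i3] that by (auto simp: pin_def path_image_def)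
   moreover have "snd (snd (lp (x,s,0::real) (x',s',0) t)) = 0" by (simp add: linepath_def)
   ultimately show ?thesis using H by (auto simp: sph3_def ev_def)
  qed
  hence "hps P (ev H o lp (x,s,0) (x',s',0)) c0"
   using pj[OF i3] by (intro homotopic_paths_eq) (auto simp: pin_def)
  thus ?thesis using hl_homotopic hl_const[OF v0] by (metis c0_def)
 qed
 have "hps P (ev H o (lp (x,s,0) z +++ lp z z')) (ev H o (lp (x,s,0) (x',s',0) +++ lp (x',s',0) z'))"
  by (rule homotopic_through_convex[OF cv cont pin_join[OF pi pi] pin_join[OF pi pi]]) (use z i3 in auto)
 from hl_homotopic[OF this]
 have A: "hl (subpath 0 t (H x s)) \<otimes>\<^bsub>G\<^esub> hl ?seg = hl (subpath 0 t' (H x' s'))"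
  using hl_join[OF pj[OF i3(1) z(1)] pj[OF z(1,2)]] hl_join[OF pj[OF i3] pj[OF i3(2) z(2)]] bot hl_closed[OF pj[OF i3(2) z(2)]] sub
  by (simp add: path_compose_join e)
 have vs: "?v:car (ev H z)" "?v:car (ev H z')" "?v':car (ev H z)" "?v':car (ev H z')"
  using near z m by (auto simp: modulus_def dist_commute)
 note cz = car[OF HP[OF z(1)]] and cz' = car[OF HP[OF z(2)]]
 have segc: "pin (clst ?v') (ev H z) (ev H z') ?seg"
 proof -
  have "ev H w:clst ?v'" if w: "w:closed_segment z z'" for w
  proof -
   have "w:I3" using closed_segment_subset[OF z(1,2) cv] w by blast
   moreover have "dist w z' < dd" using z(3) segment_bound1[OF w] by (metis dist_in_closed_segment w order_le_less_trans dist_commute)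
   ultimately have "?v':car (ev H w)" using near[of z' w] z(2) by (simp add: dist_commute)
   thus ?thesis using car_clst[OF HP[OF `w : I3`]] car(2)[OF HP[OF `w : I3`]] by blast
  qed
  thus ?thesis using pj[OF z(1,2)] by (auto simp: pin_def path_image_compose)
 qed
 have ed: "pin (clst w) a b (lp a b)" if "S:K" "w:S" "a:convex hull S" "b:convex hull S" for S w a b
  using segment_hull[OF that(1,3,4)] that by (intro pin_linepath) (auto simp: clst_def)
 have B: "hl ?seg \<otimes>\<^bsub>G\<^esub> eg (ev H z') ?v' = eg (ev H z) ?v \<otimes>\<^bsub>G\<^esub> eg ?v ?v'"
 proof -
  have "hl (?seg +++ lp (ev H z') ?v') = hl (lp (ev H z) ?v +++ lp ?v ?v')"
   using vs cz cz' by (intro hl_clst[OF pin_join[OF segc ed] pin_join[OF ed ed]]) (auto intro: hull_inc)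
  thus ?thesis
   using hl_join[OF pj[OF z(1,2)] pin_edge[OF cz'(1)]] hl_join[OF pin_edge[OF cz(1)] pin_edge[OF cz(1)]] vs cz cz'
   by (simp add: eg_def hull_inc)
 qed
 let ?g = "hl (subpath 0 t (H x s))"
 have gc: "?g:carrier G" using hl_closed[OF pj[OF i3(1) z(1)]] sub e by simp
 have cl: "eg (ev H z) ?v:carrier G" "eg ?v ?v':carrier G" "eg (ev H z') ?v':carrier G" "hl ?seg:carrier G"
  using eg_closed[OF cz(1) cz(2) hull_inc[OF vs(1)]] eg_closed[OF cz(1) hull_inc[OF vs(1)] hull_inc[OF vs(3)]]
   eg_closed[OF cz'(1) cz'(2) hull_inc[OF vs(4)]] hl_closed[OF pj[OF z(1,2)]] by auto
 have l: "lbl H z = (?v,?g \<otimes>\<^bsub>G\<^esub> eg (ev H z) ?v)" "lbl H z' = (?v',hl (subpath 0 t' (H x' s')) \<otimes>\<^bsub>G\<^esub> eg (ev H z') ?v')"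
  by (simp_all add: e lbl_def lb_def ev_def)
 have "hl (subpath 0 t' (H x' s')) \<otimes>\<^bsub>G\<^esub> eg (ev H z') ?v' = ?g \<otimes>\<^bsub>G\<^esub> (hl ?seg \<otimes>\<^bsub>G\<^esub> eg (ev H z') ?v')"
  using gc cl by (simp add: G.m_assoc flip: A)
 also have "... = ?g \<otimes>\<^bsub>G\<^esub> eg (ev H z) ?v \<otimes>\<^bsub>G\<^esub> eg ?v ?v'"
  unfolding B using gc cl by (simp add: G.m_assoc)
 finally show "snd (lbl H z) \<otimes>\<^bsub>G\<^esub> eg (fst (lbl H z)) (fst (lbl H z')) = snd (lbl H z')" by (simp add: l)
 show "fst (lbl H z):car (ev H z')" "snd (lbl H z):carrier G" using vs gc cl by (simp_all add: l)
qed

lemma lbl_coh: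
 assumes H: "sph3 H" and m: "modulus H dd" and Z: "Z \<subseteq> I3" "!!z z'. z:Z ==> z':Z ==> dist z z' < dd" and z0: "z0:Z"
 shows "coh (car (ev H z0)) (lbl H ` Z)"
 unfolding coh_def
proof (intro conjI ballI)
 show "car (ev H z0):K" using car ev_P[OF H] Z z0 by blast
 fix p assume "p:lbl H ` Z"
 then obtain z where z: "z:Z" "p = lbl H z" by blast
 thus "fst p:car (ev H z0)" "snd p:carrier G" using lbl_step(2,3)[OF H m, of z z0] Z z0 by blast+
 fix q assume "q:lbl H ` Z"
 then obtain z' where z': "z':Z" "q = lbl H z'" by blast
 thus "snd q = snd p \<otimes>\<^bsub>G\<^esub> eg (fst p) (fst q)" using lbl_step(1)[OF H m, of z z'] Z z by auto
qed

definition per :: "(real => real => real => 'a) => bool" where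
 "per H \<longleftrightarrow> sph3 H & hps P (H 0 0) c0 & (ALL x:I1. ALL t:I1. H x 0 t = H x 1 t)"

lemma per_row: "per H ==> x:I1 ==> cl (H x)"
 using sph3_square(2)[of H x] by (auto simp: per_def cl_def)

lemma lb_boundary:
 assumes "om A" "s:I1" shows "lb A s 0 = (v0,\<one>\<^bsub>G\<^esub>)" "lb A s 1 = (v0,\<one>\<^bsub>G\<^esub>)"
proof -
 have r: "pin P v0 v0 (A s)" "hl (A s) = \<one>\<^bsub>G\<^esub>" using om_row[OF assms] null_iff_hl by auto
 have "A s 0 = v0" "A s 1 = v0" using r(1) by (auto simp: pin_def pathstart_def pathfinish_def)
 moreover have "subpath 0 0 (A s) = lp v0 v0" using `A s 0 = v0` by (simp add: subpath_def fun_eq_iff linepath_def flip: scaleR_left_distrib)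
 ultimately show "lb A s 0 = (v0,\<one>\<^bsub>G\<^esub>)" "lb A s 1 = (v0,\<one>\<^bsub>G\<^esub>)"
  using r(2) lab_vertex[OF v0K] eg_self[OF v0] hl_const[OF v0] by (simp_all add: lb_def)
qed

lemma lb_cong:
 assumes "om A" "s:I1" "t:I1" "!!x. 0 <= x ==> x <= t ==> A s x = B s' x" shows "lb A s t = lb B s' t"
proof -
 have p: "path (A s)" "path_image (A s) \<subseteq> P" using om_row(1)[OF assms(1,2)] by (auto simp: pin_def)
 have "hps P (subpath 0 t (A s)) (subpath 0 t (B s'))"
 proof (rule homotopic_paths_eq)
  show "path (subpath 0 t (A s))" "path_image (subpath 0 t (A s)) \<subseteq> P"
   using p assms(3) path_image_subpath_subset[of 0 t "A s"] path_subpath[of "A s" 0 t] by auto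
 qed (use assms(3,4) in "auto simp: subpath_def mult_left_le")
 thus ?thesis using assms(3,4) hl_homotopic by (simp add: lb_def)
qed

lemma lb_periodic: assumes "cl A" "t:I1" shows "lb A 0 t = lb A 1 t"
 using assms by (intro lb_cong) (auto simp: cl_def)

text \<open>The boundary terms of \<open>grid_sum_eq\<close> disappear: at \<open>t = 0\<close> and
  \<open>t = 1\<close> every lifted label is the base label, and the labels at \<open>s = 0\<close>
  and \<open>s = 1\<close> agree because the family is closed.\<close>

lemma lbl_grid_eq:
 assumes H: "per H" and m: "modulus H dd" and bb: "card (fst bb) = 3"
  and I: "!!i j. i <= m ==> j <= n ==> nn i j:I3 & nn' i j:I3"
  and near: "!!i j z z'. i < m ==> j < n ==> z:corners nn i j \<union> corners nn' i j ==> z':corners nn i j \<union> corners nn' i j ==> dist z z' < dd"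
  and bt: "!!i. i <= m ==> snd (snd (nn i 0)) = 0 & snd (snd (nn' i 0)) = 0 & snd (snd (nn i n)) = 1 & snd (snd (nn' i n)) = 1"
  and lr: "!!j. j <= n ==> (EX x t. nn 0 j = (x,0,t) & nn m j = (x,1,t)) & (EX x t. nn' 0 j = (x,0,t) & nn' m j = (x,1,t))"
 shows "(\<Sum>i<m. \<Sum>j<n. cellv (psi bb) (%i j. lbl H (nn i j)) i j) = (\<Sum>i<m. \<Sum>j<n. cellv (psi bb) (%i j. lbl H (nn' i j)) i j)"
proof (rule grid_sum_eq)
 have s3: "sph3 H" using H by (simp add: per_def)
 fix i j p q r s assume ij: "i < m" "j < n" and pq: "{p,q,r,s} \<subseteq> corners (%i j. lbl H (nn i j)) i j \<union> corners (%i j. lbl H (nn' i j)) i j"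
 let ?Z = "corners nn i j \<union> corners nn' i j"
 have "?Z \<subseteq> I3" using I[of i j] I[of "Suc i" j] I[of i "Suc j"] I[of "Suc i" "Suc j"] ij by (auto simp: corners_def)
 hence "coh (car (ev H (nn i j))) (lbl H ` ?Z)"
  by (intro lbl_coh[OF s3 m] near[OF ij]) (auto simp: corners_def)
 thus "psi bb q r s - psi bb p r s + psi bb p q s - psi bb p q r = 0"
  using psi_cocycle[OF _ bb] pq by (auto simp: corners_def)
next
 have b: "lbl H z = (v0,\<one>\<^bsub>G\<^esub>)" if "z:I3" "snd (snd z):{0,1}" for z
  using lb_boundary[of "H (fst z)" "fst (snd z)"] per_row[OF H] that by (auto simp: lbl_def cl_def)
 fix i assume "i < m"
 hence "lbl H (nn k l) = (v0,\<one>\<^bsub>G\<^esub>)" "lbl H (nn' k l) = (v0,\<one>\<^bsub>G\<^esub>)" if "k:{i,Suc i}" "l:{0,n}" for k l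
  using I[of k l] bt[of k] that by (auto intro!: b)
 thus "psi bb (lbl H (nn i 0)) (lbl H (nn' i 0)) (lbl H (nn' (Suc i) 0)) - psi bb (lbl H (nn i 0)) (lbl H (nn (Suc i) 0)) (lbl H (nn' (Suc i) 0)) =
  psi bb (lbl H (nn i n)) (lbl H (nn' i n)) (lbl H (nn' (Suc i) n)) - psi bb (lbl H (nn i n)) (lbl H (nn (Suc i) n)) (lbl H (nn' (Suc i) n))"
  by simp
next
 fix j assume j: "j < n"
 have "lbl H (nn 0 k) = lbl H (nn m k) & lbl H (nn' 0 k) = lbl H (nn' m k)" if "k:{j,Suc j}" for k
 proof -
  have "k <= n" using that j by auto
  from lr[OF this] I[OF _ this, of 0] show ?thesis using lb_periodic[OF per_row[OF H]] by (auto simp: lbl_def)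
 qed
 thus "psi bb (lbl H (nn 0 j)) (lbl H (nn' 0 j)) (lbl H (nn' 0 (Suc j))) - psi bb (lbl H (nn 0 j)) (lbl H (nn 0 (Suc j))) (lbl H (nn' 0 (Suc j))) =
  psi bb (lbl H (nn m j)) (lbl H (nn' m j)) (lbl H (nn' m (Suc j))) - psi bb (lbl H (nn m j)) (lbl H (nn m (Suc j))) (lbl H (nn' m (Suc j)))"
  by simp
qed

text \<open>The signed number of times that the simplicial approximation on an \<open>m\<close> by
  \<open>n\<close> grid, lifted to the universal covering, runs over the lifted triangle
  \<open>bb\<close>.\<close>

definition gs :: "'a set \<times> (real => 'a) set => (real => real => 'a) => nat => nat => int" where
 "gs bb A m n = (\<Sum>i<m. \<Sum>j<n. cellv (psi bb) (%i j. lb A (i / m) (j / n)) i j)"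

lemma dist_triple: "dist (x,s,t) (x',s',t') <= \<bar>x - x'\<bar> + \<bar>s - s'\<bar> + \<bar>t - t' :: real\<bar>" for x s x' s' :: real
proof -
 have "dist (x,s,t) (x',s',t') <= dist (x,s,t) (x',s,t) + dist (x',s,t) (x',s',t) + dist (x',s',t) (x',s',t')"
  by (meson dist_triangle order_trans add_mono order_refl)
 thus ?thesis by (simp add: dist_Pair_Pair dist_real_def)
qed

lemma gs_shift:
 assumes H: "per H" and m: "modulus H dd" and bb: "card (fst bb) = 3" and x: "x:I1" "x':I1"
  and mn: "m > 0" "n > 0" "\<bar>x - x'\<bar> + 1 / m + 1 / n < dd"
 shows "gs bb (H x) m n = gs bb (H x') m n"
proof -
 have "gs bb (H y) m n = (\<Sum>i<m. \<Sum>j<n. cellv (psi bb) (%i j. lbl H (y,i / m,j / n)) i j)" for y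
  by (simp add: gs_def lbl_def)
 moreover have "(\<Sum>i<m. \<Sum>j<n. cellv (psi bb) (%i j. lbl H (x,i / m,j / n)) i j) = (\<Sum>i<m. \<Sum>j<n. cellv (psi bb) (%i j. lbl H (x',i / m,j / n)) i j)"
 proof (rule lbl_grid_eq[OF H m bb])
  let ?U = "%i j. corners (%i j. (x,real i / m,real j / n)) i j \<union> corners (%i j. (x',real i / m,real j / n)) i j"
  fix i j z z' assume "i < m" "j < n" and zU: "z:?U i j" "z':?U i j"
  have b: "fst w:{x,x'} & real i / m <= fst (snd w) & fst (snd w) <= real i / m + 1 / m & real j / n <= snd (snd w) & snd (snd w) <= real j / n + 1 / n"
   if "w:?U i j" for w
   using that mn(1,2) by (auto simp: corners_def add_divide_distrib)
  obtain y s t y' s' t' where zz: "z = (y,s,t)" "z' = (y',s',t')" by (metis prod_cases3)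
  have "\<bar>y - y'\<bar> <= \<bar>x - x'\<bar>" using b[OF zU(1)] b[OF zU(2)] zz by auto
  moreover have "\<bar>s - s'\<bar> <= 1 / m" "\<bar>t - t'\<bar> <= 1 / n" using b[OF zU(1)] b[OF zU(2)] zz by auto
  ultimately show "dist z z' < dd" using dist_triple[of y s t y' s' t'] mn(3) unfolding zz by linarith
 qed (use mn x in auto)
 ultimately show ?thesis by simp
qed

lemma gs_homotopy:
 assumes H: "per H" and m: "modulus H dd" and bb: "card (fst bb) = 3"
  and mn: "m > 0" "n > 0" "1 / m + 1 / n < dd"
 shows "gs bb (H 0) m n = gs bb (H 1) m n"
proof -
 define et where "et = dd - (1 / m + 1 / n)"
 obtain M :: nat where M: "M > 0" "1 / M < et"
  using mn(3) reals_Archimedean[of et] by (metis et_def diff_gt_0_iff_gt inverse_eq_divide zero_less_Suc)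
 have "gs bb (H (real k / M)) m n = gs bb (H 0) m n" if "k <= M" for k
  using that
 proof (induction k)
  case (Suc k)
  have "\<bar>real k / M - real (Suc k) / M\<bar> = 1 / M" using M by (simp add: field_simps)
  hence "gs bb (H (real k / M)) m n = gs bb (H (real (Suc k) / M)) m n"
   using M Suc.prems by (intro gs_shift[OF H m bb _ _ mn(1,2)]) (auto simp: et_def field_simps)
  thus ?case using Suc by simp
 qed simp
 from this[of M] show ?thesis using M by simp
qed

text \<open>The coarse labels, rounded down, are an admissible labelling of the fine grid: nodes of
  one fine cell and their rounded versions all lie in one coarse cell.\<close>

lemma gs_refine:
 assumes A: "cl A" and m: "modulus (%_. A) dd" and bb: "card (fst bb) = 3"
  and mn: "m > 0" "n > 0" "1 / m + 1 / n < dd" and kl: "k > 0" "l > 0"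
 shows "gs bb A m n = gs bb A (k * m) (l * n)"
proof -
 have H: "per (%_. A)" using A sph3_const(1)[of A] om_row(2)[of A 0] by (auto simp: per_def cl_def om_def)
 let ?nn = "%i j. (0 :: real,real (i div k) / m,real (j div l) / n)"
 let ?nn' = "%i j. (0 :: real,real i / (k * m),real j / (l * n))"
 have iv: "real (i div k) / m <= y & y <= (real (i div k) + 1) / m"
  if "y:{real (i div k) / m,real (Suc i div k) / m,real i / (k * m),real (Suc i) / (k * m)}" "k > 0" "m > 0" for i y k m
 proof -
  have "i = k * (i div k) + i mod k" by simp
  hence 1: "real i = real k * real (i div k) + real (i mod k)" by (metis of_nat_add of_nat_mult)
  moreover have "real (i mod k) + 1 <= real k" using mod_less_divisor[OF `k > 0`, of i] by linarith
  moreover have "real (Suc i div k) <= real (i div k) + 1" "real (i div k) <= real (Suc i div k)" by (auto simp: div_Suc)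
  ultimately have b: "real (i div k) <= real i / k" "real i / k <= real (i div k) + 1"
   "real (i div k) <= real (Suc i) / k" "real (Suc i) / k <= real (i div k) + 1"
   "real (i div k) <= real (Suc i div k)" "real (Suc i div k) <= real (i div k) + 1"
   using `k > 0` by (auto simp: field_simps)
  have "real (i div k) / m <= w / m & w / m <= (real (i div k) + 1) / m" if "real (i div k) <= w" "w <= real (i div k) + 1" for w
   using that `m > 0` by (simp add: divide_right_mono)
  from this[OF b(1,2)] this[OF b(3,4)] this[OF b(5,6)] show ?thesis using that(1) by (auto simp: divide_right_mono)
 qed
 have "gs bb A m n = (\<Sum>i<k * m. \<Sum>j<l * n. cellv (psi bb) (%i j. lbl (%_. A) (?nn i j)) i j)"
  unfolding gs_def lbl_def using rounded_grid_sum[where f = "psi bb" and k = k and l = l and m = m and n = n and a = "%i j. lb A (real i / m) (real j / n)"] kl by simp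
 also have "... = (\<Sum>i<k * m. \<Sum>j<l * n. cellv (psi bb) (%i j. lbl (%_. A) (?nn' i j)) i j)"
 proof (rule lbl_grid_eq[OF H m bb])
  fix i j assume "i <= k * m" "j <= l * n"
  hence "i div k <= m" "j div l <= n" "real i <= real k * real m" "real j <= real l * real n"
   using kl by (auto simp: div_le_mono[of i "k * m" k, simplified] simp flip: of_nat_mult) (metis div_le_mono nonzero_mult_div_cancel_left less_numeral_extra(3))+
  thus "?nn i j:I3 & ?nn' i j:I3" using mn kl by (auto simp: field_simps)
 next
  fix i j z z' assume "i < k * m" "j < l * n" "z:corners ?nn i j \<union> corners ?nn' i j" "z':corners ?nn i j \<union> corners ?nn' i j"
  then obtain y w y' w' where zz: "z = (0,y,w)" "z' = (0,y',w')"
   and yw: "{y,y'} \<subseteq> {real (i div k) / m,real (Suc i div k) / m,real i / (k * m),real (Suc i) / (k * m)}"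
    "{w,w'} \<subseteq> {real (j div l) / n,real (Suc j div l) / n,real j / (l * n),real (Suc j) / (l * n)}"
   unfolding corners_def by auto
  have "\<bar>y - y'\<bar> <= 1 / m" "\<bar>w - w'\<bar> <= 1 / n"
  proof -
   have "real (i div k) / m <= c & c <= real (i div k) / m + 1 / m" if "c:{y,y'}" for c
    using iv[of c i k m] subsetD[OF yw(1) that] kl mn by (simp add: add_divide_distrib)
   from this[of y] this[of y'] show "\<bar>y - y'\<bar> <= 1 / m" by (simp add: abs_le_iff)
   have "real (j div l) / n <= c & c <= real (j div l) / n + 1 / n" if "c:{w,w'}" for c
    using iv[of c j l n] subsetD[OF yw(2) that] kl mn by (simp add: add_divide_distrib)
   from this[of w] this[of w'] show "\<bar>w - w'\<bar> <= 1 / n" by (simp add: abs_le_iff)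
  qed
  thus "dist z z' < dd" using dist_triple[of 0 y w 0 y' w'] mn(3) zz by simp
 qed (use mn kl in auto)
 finally show ?thesis by (simp add: gs_def lbl_def)
qed

text \<open>The coefficient at \<open>bb\<close> of the 2-cycle in the universal covering that the
  sphere represents; the counts for fine grids all agree.\<close>

definition deg :: "'a set \<times> (real => 'a) set => (real => real => 'a) => int" where
 "deg bb A = (THE d. EX N. ALL m>=N. ALL n>=N. gs bb A m n = d)"

lemma fine: assumes "dd > 0" shows "EX N>0. ALL m>=N. ALL n>=N. 1 / real m + 1 / real n < dd"
proof -
 obtain N :: nat where N: "N > 0" "1 / N < dd / 2" using assms reals_Archimedean[of "dd / 2"] by (metis half_gt_zero inverse_eq_divide zero_less_Suc)
 have "1 / real m <= 1 / N" if "m >= N" for m using that N(1) by (simp add: frac_le)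
 note N1 = this
 have "1 / real m + 1 / real n < dd" if "m >= N" "n >= N" for m n
  using N1[OF that(1)] N1[OF that(2)] N(2) by linarith
 thus ?thesis using N(1) by blast
qed

lemma deg_grid:
 assumes A: "cl A" and bb: "card (fst bb) = 3" and m: "modulus (%_. A) dd"
  and mn: "m > 0" "n > 0" "1 / m + 1 / n < dd"
 shows "gs bb A m n = deg bb A"
proof -
 have same: "gs bb A m' n' = gs bb A m n" if "m' > 0" "n' > 0" "1 / real m' + 1 / real n' < dd" for m' n'
 proof -
  have "gs bb A m n = gs bb A (m' * m) (n' * n)" using gs_refine[OF A m bb mn, of m' n'] that by simp
  also have "... = gs bb A m' n'" using gs_refine[OF A m bb that, of m n] mn by (simp add: mult.commute)
  finally show ?thesis by simp
 qed
 obtain N where N: "N > 0" "!!m n. m >= N ==> n >= N ==> 1 / real m + 1 / real n < dd" using fine m unfolding modulus_def by meson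
 have "ALL m'>=N. ALL n'>=N. gs bb A m' n' = gs bb A m n" using same N by (meson less_le_trans)
 hence "deg bb A = gs bb A m n"
  unfolding deg_def by (intro the_equality) (auto, metis nat_le_linear)
 thus ?thesis by simp
qed

lemma deg_ev: assumes A: "cl A" shows "EX N>0. ALL m>=N. ALL n>=N. ALL bb. card (fst bb) = 3 --> gs bb A m n = deg bb A"
proof -
 obtain dd where dd: "modulus (%_. A) dd" using modulus_exists[OF sph3_const(1)] A by (auto simp: cl_def om_def)
 then obtain N where "N > 0" "!!m n. m >= N ==> n >= N ==> 1 / real m + 1 / real n < dd" using fine unfolding modulus_def by meson
 thus ?thesis using deg_grid[OF A _ dd] by (intro exI[of _ N]) auto
qed

text \<open>A modulus for the whole homotopy is one for each stage, so a single grid computes the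
  degrees of both ends.\<close>

lemma deg_free:
 assumes A: "cl A" and B: "free_eq A B" and bb: "card (fst bb) = 3" shows "deg bb A = deg bb B"
proof -
 obtain H where H: "sph3 H" "!!x t. x:I1 ==> t:I1 ==> H x 0 t = H x 1 t"
  "!!s t. s:I1 ==> t:I1 ==> H 0 s t = A s t & H 1 s t = B s t"
  using B unfolding free_eq_def by metis
 have o: "om A" "om B" using A hol_free_eq[OF A B] by (auto simp: cl_def)
 have "hps P (A 0) (H 0 0)" using om_row(1)[OF o(1), of 0] H(3) by (intro homotopic_paths_eq) (auto simp: pin_def)
 hence "hps P (H 0 0) c0"
  using homotopic_paths_trans[OF homotopic_paths_sym] om_row(2)[OF o(1), of 0] by auto
 hence per: "per H" unfolding per_def using H by auto
 obtain dd where dd: "modulus H dd" using modulus_exists[OF H(1)] by blast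
 hence dd': "modulus (%_. H x) dd" if "x:I1" for x
  unfolding modulus_def
 proof (intro conjI ballI impI)
  fix z z' assume "z:I3" "z':I3" "dist z z' < dd"
  moreover from this have "dist (x,snd z) (x,snd z') < dd" using dist_snd_le[of z z'] by (simp add: dist_Pair_Pair)
  ultimately show "dist (ev (%_. H x) z) (ev (%_. H x) z') < eps"
   using dd that unfolding modulus_def by (force simp: ev_def case_prod_beta')
 qed (auto simp: modulus_def)
 obtain N where N: "N > 0" "1 / real N + 1 / real N < dd" using fine dd unfolding modulus_def by blast
 have g: "gs bb (H 0) N N = deg bb (H 0)" "gs bb (H 1) N N = deg bb (H 1)"
  using deg_grid[OF per_row[OF per] bb dd' N(1) N(1) N(2)] by auto
 have ge: "gs bb C m n = gs bb D m n" if "om C" and CD: "!!s t. s:I1 ==> t:I1 ==> C s t = D s t" and "m > 0" "n > 0" for C D m n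
 proof -
  have "lb C (real i / m) (real j / n) = lb D (real i / m) (real j / n)" if ij: "i <= m" "j <= n" for i j
  proof (rule lb_cong[OF `om C`])
   have "real i / m:I1" "real j / n:I1" using ij `m > 0` `n > 0` by auto
   thus "real i / m:I1" "real j / n:I1" by blast+
   show "C (real i / m) x = D (real i / m) x" if "0 <= x" "x <= real j / n" for x
    using that CD[of "real i / m" x] `real i / m : I1` `real j / n : I1` by auto
  qed
  thus ?thesis unfolding gs_def cellv_def by (intro sum.cong HOL.refl) (auto simp del: of_nat_Suc)
 qed
 have de: "deg bb C = deg bb D" if "om C" "!!s t. s:I1 ==> t:I1 ==> C s t = D s t" for C D
 proof -
  have "(EX N. ALL m>=N. ALL n>=N. gs bb C m n = d) \<longleftrightarrow> (EX N. ALL m>=N. ALL n>=N. gs bb D m n = d)" for d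
   using ge[OF that] by (metis Suc_leD gr_zeroI not_less_eq_eq le0)
  thus ?thesis by (simp add: deg_def)
 qed
 have "deg bb (H 0) = deg bb (H 1)" using gs_homotopy[OF per dd bb N(1) N(1) N(2)] g by simp
 thus ?thesis using de[OF o(1), of "H 0"] de[OF o(2), of "H 1"] H(3) by simp
qed

end

lemma sum_lessThan_add: "(\<Sum>i<m + n. f i) = (\<Sum>i<m. f i) + (\<Sum>i<n. f (m + i :: nat) :: int)"
 by (induction n) (auto simp: algebra_simps)

section \<open>Degrees as homomorphisms on pi_2\<close>

context pcplx begin

definition faces :: "'a set set" where "faces = {S:K. card S = 3}"

definition lifts :: "('a set \<times> (real => 'a) set) set" where "lifts = faces \<times> carrier G"

lemma lifts_card: "bb:lifts ==> card (fst bb) = 3" by (auto simp: lifts_def faces_def)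

definition dg :: "'a set \<times> (real => 'a) set => (real => real \<Rightarrow>\<^sub>C 'a) set => int" where
 "dg bb x = (if bb:lifts then deg bb (SOME A. cl A & hol A = x) else 0)"

lemma dg_hol: assumes "bb:lifts" "cl A" shows "dg bb (hol A) = deg bb A"
proof -
 define B where "B = (SOME B. cl B & hol B = hol A)"
 have B: "cl B" "hol B = hol A" using someI[of "%B. cl B & hol B = hol A" A] assms(2) by (auto simp: B_def)
 have "deg bb B = deg bb A" by (rule deg_free[OF B(1) free_eq_hol[OF B(1) assms(2) B(2)] lifts_card[OF assms(1)]])
 thus ?thesis using assms(1) by (simp add: dg_def B_def)
qed

lemma lb_carrier: assumes "om A" "s:I1" "t:I1" shows "snd (lb A s t):carrier G"
proof -
 have h: "sph3 (%_. A)" using assms(1) sph3_const(1) by (auto simp: om_def)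
 then obtain dd where "modulus (%_. A) dd" using modulus_exists by blast
 thus ?thesis using lbl_step(3)[OF h, of dd "(0,s,t)" "(0,s,t)"] assms by (auto simp: lbl_def modulus_def)
qed

lemma dg_mult:
 assumes "x:carrier Pi" "y:carrier Pi" shows "dg bb (x \<otimes>\<^bsub>Pi\<^esub> y) = dg bb x + dg bb y"
proof (cases "bb:lifts")
 case bb: True
 obtain A where A: "cl A" "!!t. t:I1 ==> A 0 t = v0 & A 1 t = v0" "hol A = x" using Pi_surj assms by blast
 obtain B where B: "cl B" "!!t. t:I1 ==> B 0 t = v0 & B 1 t = v0" "hol B = y" using Pi_surj assms by blast
 let ?C = "A +++ B"
 have j: "hol ?C = x \<otimes>\<^bsub>Pi\<^esub> y" "cl ?C"
  using hol_join[of A B] A B by (auto simp: cl_def joinpaths_def)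
 hence o: "om ?C" by (simp add: cl_def)
 note c = lifts_card[OF bb]
 obtain N1 N2 N3 where N: "N1 > 0" "!!m n. m >= N1 ==> n >= N1 ==> gs bb A m n = deg bb A" "!!m n. m >= N2 ==> n >= N2 ==> gs bb B m n = deg bb B"
  "!!m n. m >= N3 ==> n >= N3 ==> gs bb ?C m n = deg bb ?C"
  using deg_ev[OF A(1)] deg_ev[OF B(1)] deg_ev[OF j(2)] c by metis
 define N where "N = N1 + N2 + N3"
 have N0: "N > 0" using N(1) by (simp add: N_def)
 \<comment> \<open>The join gets twice as many steps in \<open>s\<close>; the first \<open>N\<close>
   of them reproduce the grid of \<open>A\<close>, the others that of \<open>B\<close>.\<close>
 define M where "M = N + N"
 have M: "i <= N ==> i <= M" "i < N ==> Suc i <= M" "i <= N ==> N + i <= M" for i by (auto simp: M_def)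
 have l1: "lb ?C (real i / real M) t = lb A (real i / N) t" if "i <= N" "t:I1" for i t
  by (rule lb_cong[OF o]) (use that N0 in "auto simp: joinpaths_def field_simps M_def")
 have l2: "lb ?C (real (N + i) / real M) t = lb B (real i / N) t" if "i <= N" "t:I1" for i t
 proof (cases "i = 0")
  case True
  have "lb A 1 t = lb B 0 t" by (rule lb_cong) (use A B that in "auto simp: cl_def")
  thus ?thesis using l1[of N t] N0 that True by simp
 next
  case False
  show ?thesis
   by (rule lb_cong[OF o]) (use False that N0 in "auto simp: joinpaths_def field_simps M_def")
 qed
 have jt: "real j / N:I1" if "j <= N" for j using that N0 by auto
 have 1: "cellv (psi bb) (%i j. lb ?C (real i / real M) (real j / N)) i j = cellv (psi bb) (%i j. lb A (real i / N) (real j / N)) i j"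
  if "i < N" "j < N" for i j
  using that jt[of j] jt[of "Suc j"] by (simp add: cellv_def l1 del: of_nat_Suc)
 have 2: "cellv (psi bb) (%i j. lb ?C (real i / real M) (real j / N)) (N + i) j = cellv (psi bb) (%i j. lb B (real i / N) (real j / N)) i j"
  if "i < N" "j < N" for i j
  unfolding cellv_def using that jt[of j] jt[of "Suc j"] l2[of "Suc i"] l2[of i] by (simp del: of_nat_Suc of_nat_add)
 have "gs bb ?C M N = gs bb A N N + gs bb B N N"
  unfolding gs_def using 1 2 by (subst (1) M_def) (simp add: sum_lessThan_add)
 moreover have "gs bb ?C M N = deg bb ?C" by (rule N(4)) (auto simp: N_def M_def)
 moreover have "gs bb A N N = deg bb A" "gs bb B N N = deg bb B" by (rule N(2) N(3); simp add: N_def)+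
 ultimately have "deg bb ?C = deg bb A + deg bb B" by simp
 thus ?thesis using dg_hol[OF bb] A B j by metis
qed (simp add: dg_def)

lemma subpath_homotopic: "pin P v0 v0 q ==> s:I1 ==> t:I1 ==> (!!x. x:I1 ==> q ((t - s) * x + s) = p x) ==> hl (subpath s t q) = hl p"
proof -
 assume q: "pin P v0 v0 q" and st: "s:I1" "t:I1" and e: "!!x. x:I1 ==> q ((t - s) * x + s) = p x"
 show ?thesis
  by (rule hl_homotopic, rule homotopic_paths_eq)
   (use q st e path_subpath[of q s t] path_image_subpath_subset[of s t q] in "auto simp: pin_def subpath_def")
qed

text \<open>In \<open>gr p q (A s)\<close> the family \<open>A\<close>, lifted after translation by
  \<open>h\<close>, occupies the parameters from 1/2 to 3/4. Before and after, the labels are the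
  same for all \<open>s\<close>, so the cells there count 0. This is why the grid has
  \<open>4 * N\<close> steps in \<open>t\<close>.\<close>

lemma dg_act:
 assumes h: "h:carrier G" and x: "x:carrier Pi" and g: "g:carrier G"
 shows "dg (S,h \<otimes>\<^bsub>G\<^esub> g) (act h x) = dg (S,g) x"
proof (cases "S:faces")
 case S: True
 obtain p where p: "pin P v0 v0 p" "hl p = h" using hl_surj_based[OF h] by blast
 define q where "q = rp p"
 have q: "pin P v0 v0 q" "hl p \<otimes>\<^bsub>G\<^esub> hl q = \<one>\<^bsub>G\<^esub>"
  using pin_reverse[OF p(1)] hl_reverse[OF p(1)] hl_closed[OF p(1)] by (auto simp: q_def)
 obtain A where A: "cl A" "hol A = x" using Pi_cl[OF x] by blast
 have o: "om A" using A by (simp add: cl_def)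
 let ?B = "%s. gr p q (A s)"
 have B: "cl ?B" "hol ?B = act h x" using natl_cl[OF natl_gr[OF p(1) q] A(1)] act_hol[OF A(1) p(1) q] p(2) A(2) by auto
 hence oB: "om ?B" by (simp add: cl_def)
 define bb bb' where "bb = (S,g)" and "bb' = (S,h \<otimes>\<^bsub>G\<^esub> g)"
 have bb: "bb:lifts" "bb':lifts" using S g h by (auto simp: bb_def bb'_def lifts_def)
 obtain N1 N2 where N: "N1 > 0" "!!m n. m >= N1 ==> n >= N1 ==> gs bb A m n = deg bb A" "!!m n. m >= N2 ==> n >= N2 ==> gs bb' ?B m n = deg bb' ?B"
  using deg_ev[OF A(1)] deg_ev[OF B(1)] lifts_card[OF bb(1)] lifts_card[OF bb(2)] by metis
 define N where "N = N1 + N2"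
 have N0: "N > 0" using N(1) by (simp add: N_def)
 have lo: "lb ?B s t = lb ?B s' t" if "s:I1" "s':I1" "t:I1" "t <= 1/2" for s s' t
  by (rule lb_cong[OF oB]) (use that in "auto simp: gr_def joinpaths_def")
 \<comment> \<open>The rest of the loop runs along \<open>q\<close> and is the same for both rows;
   as the whole loops are null-homotopic, the classes up to \<open>t\<close> agree.\<close>
 have hi: "lb ?B s t = lb ?B s' t" if st: "s:I1" "s':I1" "t:I1" "t >= 3/4" for s s' t
 proof -
  have r: "pin P v0 v0 (?B s)" "pin P v0 v0 (?B s')" "hl (?B s) = \<one>\<^bsub>G\<^esub>" "hl (?B s') = \<one>\<^bsub>G\<^esub>"
   using om_row[OF oB] st null_iff_hl by auto
  have eq: "?B s y = ?B s' y" if "y >= 3/4" for y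
  proof (cases "y = 3/4")
   case True
   have "A s 1 = v0" "A s' 1 = v0" using om_row(1)[OF o] st by (auto simp: pin_def pathfinish_def)
   thus ?thesis unfolding True by (simp add: gr_def joinpaths_def)
  qed (use that in "auto simp: gr_def joinpaths_def")
  have "(1 - t) * y + t >= 3/4" if "y:I1" for y
  proof -
   have "0 <= (1 - t) * y" using that st by simp
   thus ?thesis using st(4) by linarith
  qed
  hence "hl (subpath t 1 (?B s)) = hl (subpath t 1 (?B s'))"
   using eq by (intro subpath_homotopic[OF r(1)]) (use st in "auto simp: subpath_def")
  moreover have "hl (subpath 0 t (?B u)) \<otimes>\<^bsub>G\<^esub> hl (subpath t 1 (?B u)) = \<one>\<^bsub>G\<^esub>" if "u:{s,s'}" for u
   using hl_subpath[of v0 v0 "?B u" 0 t 1] r that st by auto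
  moreover have "hl (subpath a b (?B u)):carrier G" if "u:{s,s'}" "a:I1" "b:I1" for u a b
  proof -
   have "pin P v0 v0 (?B u)" using r that by auto
   thus ?thesis
    using that path_image_subpath_subset[of a b "?B u"] path_subpath[of "?B u" a b]
    by (intro hl_closed[of "pathstart (subpath a b (?B u))" "pathfinish (subpath a b (?B u))"]) (auto simp: pin_def)
  qed
  ultimately have "hl (subpath 0 t (?B s)) = hl (subpath 0 t (?B s'))" using st by (metis G.right_cancel atLeastAtMost_iff insertCI order_refl zero_le_one)
  thus ?thesis using eq[of t] st by (simp add: lb_def)
 qed
 have mid: "lb ?B s (1/2 + ta / 4) = (fst (lb A s ta),h \<otimes>\<^bsub>G\<^esub> snd (lb A s ta))" if st: "s:I1" "ta:I1" for s ta
 proof -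
  let ?t = "1/2 + ta / 4"
  have r: "pin P v0 v0 (?B s)" "pin P v0 v0 (A s)" using om_row(1)[OF oB] om_row(1)[OF o] st by auto
  have A0: "A s 0 = v0" "p 1 = v0" using r(2) p(1) by (auto simp: pin_def pathstart_def pathfinish_def)
  have a: "?B s (1/2 + y / 4) = A s y" if "y:I1" for y
   using that A0 by (cases "y = 0") (auto simp: gr_def joinpaths_def field_simps)
  have "hl (subpath 0 (1/2) (?B s)) = hl p"
   by (rule subpath_homotopic[OF r(1)]) (auto simp: gr_def joinpaths_def)
  moreover have "hl (subpath (1/2) ?t (?B s)) = hl (subpath 0 ta (A s))"
  proof (rule subpath_homotopic[OF r(1)])
   fix y :: real assume y: "y:I1"
   have "?B s (1/2 + (ta * y) / 4) = A s (ta * y)" using a st y by (simp add: mult_le_one)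
   thus "?B s ((?t - 1/2) * y + 1/2) = subpath 0 ta (A s) y" by (simp add: subpath_def algebra_simps)
  qed (use st in auto)
  ultimately have "hl (subpath 0 ?t (?B s)) = h \<otimes>\<^bsub>G\<^esub> hl (subpath 0 ta (A s))"
   using hl_subpath[OF r(1), of 0 "1/2" ?t] st p(2) by auto
  moreover have "hl (subpath 0 ta (A s)):carrier G"
   using r(2) st path_image_subpath_subset[of 0 ta "A s"] path_subpath[of "A s" 0 ta]
   by (intro hl_closed[of "pathstart (subpath 0 ta (A s))" "pathfinish (subpath 0 ta (A s))"]) (auto simp: pin_def)
  moreover have "A s ta:P" using r(2) st by (auto simp: pin_def path_image_def)
  hence "eg (A s ta) (lab (A s ta)):carrier G"
   using eg_closed[OF car(1) car(2) hull_inc[OF lab_car_self]] by blast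
  ultimately show ?thesis using a[OF st(2)] h by (simp add: lb_def G.m_assoc)
 qed
 let ?b = "%i j. lb ?B (real i / N) (real j / real (4 * N))"
 have it: "real i / N:I1" if "i <= N" for i using that N0 by auto
 have jt: "real j / real (4 * N):I1" if "j <= 4 * N" for j using that N0 by auto
 have flat: "cellv (psi bb') ?b i j = 0" if "i < N" "!!k. k:{j,Suc j} ==> ?b i k = ?b (Suc i) k" for i j
  using that(2)[of j] that(2)[of "Suc j"] by (simp add: cellv_def)
 have c: "cellv (psi bb') ?b i (2 * N + j) = cellv (psi bb) (%i j. lb A (real i / N) (real j / N)) i j" if "i < N" "j < N" for i j
 proof -
  have e: "?b i (2 * N + j) = (fst (lb A (real i / N) (real j / N)),h \<otimes>\<^bsub>G\<^esub> snd (lb A (real i / N) (real j / N)))" if "i <= N" "j <= N" for i j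
  proof -
   have "real (2 * N + j) / real (4 * N) = 1/2 + (real j / N) / 4" using N0 by (simp add: field_simps)
   thus ?thesis using mid[OF it[OF that(1)] it[OF that(2)]] by simp
  qed
  have ps: "psi bb' (fst u,h \<otimes>\<^bsub>G\<^esub> snd u) (fst v,h \<otimes>\<^bsub>G\<^esub> snd v) (fst w,h \<otimes>\<^bsub>G\<^esub> snd w) = psi bb u v w" if u: "snd u:carrier G" for u v w
  proof (cases "{fst u,fst v,fst w} = S")
   case True
   hence "fst u:S" by auto
   hence ec: "eg (fst u) (cor S):carrier G" using S cor[of S] by (intro eg_closed[of S]) (auto simp: faces_def hull_inc)
   have "(h \<otimes>\<^bsub>G\<^esub> snd u \<otimes>\<^bsub>G\<^esub> eg (fst u) (cor S) = h \<otimes>\<^bsub>G\<^esub> g) = (snd u \<otimes>\<^bsub>G\<^esub> eg (fst u) (cor S) = g)"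
    using u ec h g by (simp add: G.m_assoc)
   thus ?thesis by (simp add: psi_def bb_def bb'_def)
  qed (auto simp: psi_def bb_def bb'_def)
  show ?thesis
   unfolding cellv_def using e[of i j] e[of "Suc i" j] e[of i "Suc j"] e[of "Suc i" "Suc j"] that lb_carrier[OF o it[of i] it[of j]]
   by (simp add: ps del: of_nat_Suc)
 qed
 have "(\<Sum>j<4 * N. cellv (psi bb') ?b i j) = (\<Sum>j<N. cellv (psi bb) (%i j. lb A (real i / N) (real j / N)) i j)" if i: "i < N" for i
 proof -
  have "4 * N = 2 * N + (N + N)" by simp
  hence "(\<Sum>j<4 * N. cellv (psi bb') ?b i j) = (\<Sum>j<2 * N. cellv (psi bb') ?b i j) + ((\<Sum>j<N. cellv (psi bb') ?b i (2 * N + j)) + (\<Sum>j<N. cellv (psi bb') ?b i (2 * N + (N + j))))"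
   by (simp only: sum_lessThan_add)
  moreover have "cellv (psi bb') ?b i j = 0" if "j < 2 * N" for j
  proof (rule flat[OF i])
   fix k assume k: "k:{j,Suc j}"
   hence "real k / real (4 * N) <= 1/2" using that N0 by (auto simp: field_simps)
   thus "?b i k = ?b (Suc i) k" using i that k by (intro lo it jt) auto
  qed
  moreover have "cellv (psi bb') ?b i (2 * N + (N + j)) = 0" if "j < N" for j
  proof (rule flat[OF i])
   fix k assume k: "k:{2 * N + (N + j),Suc (2 * N + (N + j))}"
   hence "real k / real (4 * N) >= 3/4" using that N0 by (auto simp: field_simps)
   thus "?b i k = ?b (Suc i) k" using i that k by (intro hi it jt) auto
  qed
  ultimately show ?thesis using c[OF i] by simp
 qed
 hence "gs bb' ?B N (4 * N) = gs bb A N N" by (simp add: gs_def)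
 moreover have "gs bb' ?B N (4 * N) = deg bb' ?B" "gs bb A N N = deg bb A" by (rule N(3) N(2); simp add: N_def)+
 ultimately show ?thesis using dg_hol[OF bb(1) A(1)] dg_hol[OF bb(2) B(1)] A B by (simp add: bb_def bb'_def)
qed (simp add: dg_def lifts_def)

text \<open>Only lifted triangles spanned by the finitely many labels of one grid can be
  met.\<close>

lemma finite_deg: assumes "cl A" shows "finite {bb:lifts. deg bb A ~= 0}"
proof -
 obtain N where N: "!!bb. card (fst bb) = 3 ==> gs bb A N N = deg bb A" using deg_ev[OF assms] by (meson order_refl)
 define L where "L = (%(i,j). lb A (real i / N) (real j / N)) ` ({..N} \<times> {..N})"
 define F where "F = (%(p,q,r). ({fst p,fst q,fst r},snd p \<otimes>\<^bsub>G\<^esub> eg (fst p) (cor {fst p,fst q,fst r}))) ` (L \<times> L \<times> L)"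
 have "finite F" by (simp add: F_def L_def)
 moreover have "bb:F" if bb: "bb:lifts" "deg bb A ~= 0" for bb
 proof (rule ccontr)
  assume "bb ~: F"
  hence z: "psi bb p q r = 0" if "p:L" "q:L" "r:L" for p q r
   using that by (cases bb) (force simp: F_def psi_def image_iff)
  have "lb A (real i / N) (real j / N):L" if "i <= N" "j <= N" for i j using that by (auto simp: L_def)
  hence "gs bb A N N = 0" unfolding gs_def cellv_def by (intro sum.neutral ballI) (simp add: z del: of_nat_Suc)
  thus False using N[OF lifts_card[OF bb(1)]] bb(2) by simp
 qed
 ultimately show ?thesis using finite_subset[of "{bb:lifts. deg bb A ~= 0}" F] by blast
qed

lemma finite_dg: "x:carrier Pi ==> finite {bb. dg bb x ~= 0}"
proof -
 assume "x:carrier Pi"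
 then obtain A where A: "cl A" "hol A = x" using Pi_cl by blast
 have "{bb. dg bb x ~= 0} \<subseteq> {bb:lifts. deg bb A ~= 0}"
  using dg_hol[OF _ A(1)] A(2) by (auto simp: dg_def)
 thus ?thesis using finite_deg[OF A(1)] finite_subset by blast
qed

end

section \<open>The decomposition of spherical maps into faces\<close>

definition LIN :: "(real => 'b::real_vector) => (real => 'b) => real => real => 'b" where
 "LIN p q s t = (1 - s) *\<^sub>R p t + s *\<^sub>R q t"

lemma LIN_ends: "LIN p q 0 = p" "LIN p q 1 = q"
 by (auto simp: LIN_def fun_eq_iff)

lemma hmap_LIN:
 assumes C: "convex C" and p: "pin C u w p" and q: "pin C u w q" shows "hmap C u w (LIN p q)"
 unfolding hmap_def
proof (intro conjI ballI)
 have c: "cts (I2) (%z. r (snd z))" if "pin C u w r" for r :: "real => 'a"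
  using that by (auto simp: pin_def path_def intro!: continuous_on_compose2[of I1 r "I2" snd] continuous_intros)
 show "cts (I2) (%(s,t). LIN p q s t)"
  unfolding LIN_def case_prod_beta' by (intro continuous_intros c p q)
 show "LIN p q s t:C" if "s:I1" "t:I1" for s t
  unfolding LIN_def using that p q by (intro convexD[OF C]) (auto simp: pin_def path_image_def)
qed (use p q in "auto simp: LIN_def pin_def pathstart_def pathfinish_def algebra_simps simp flip: scaleR_left_distrib")

context loopspace begin

lemma hol_dif_reparam:
 assumes Z: "om Z" "om Z'" "!!t. t:I1 ==> Z 0 t = Z' 0 t & Z 1 t = Z' 1 t"
  and rr: "cts I1 rr" "rr:I1 \<rightarrow> I1" "rr 0 = 0" "rr 1 = 1"
 shows "hol (%s t. Z s (rr t)) \<otimes>\<^bsub>Pi\<^esub> inv\<^bsub>Pi\<^esub> hol (%s t. Z' s (rr t)) = hol Z \<otimes>\<^bsub>Pi\<^esub> inv\<^bsub>Pi\<^esub> hol Z'"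
  and "om (%s t. Z s (rr t))"
proof -
 define m where "m x t = (1 - x) * t + x * rr t" for x t
 have m: "m x t:I1" if "x:I1" "t:I1" for x t
  using convexD[of I1 t "rr t" "1 - x" x] that funcset_mem[OF rr(2)] by (auto simp: m_def)
 have s3: "sph3 (%x s t. Y s (m x t))" if "om Y" for Y
  unfolding sph3_def
 proof (intro conjI ballI)
  have h: "hmap P v0 v0 Y" using that by (simp add: om_def)
  show "cts (I1 \<times> I2) (%(x,s,t). Y s (m x t))"
   using h m unfolding hmap_def case_prod_beta' m_def
   by (intro cont2[where H = Y and A = "I2"])
    (auto intro!: continuous_intros continuous_on_compose2[OF rr(1)] simp: case_prod_beta')
 qed (use that m rr in "auto simp: hmap_def om_def m_def")
 have m01: "m 0 = (%t. t)" "m 1 = rr" by (auto simp: m_def)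
 have n: "hps P (%t. Z 0 (m 0 t)) c0" using om_row(2)[OF Z(1), of 0] by (simp add: m01)
 from hol_dif[OF s3[OF Z(1)] n s3[OF Z(2)]] Z(3) m
 show "hol (%s t. Z s (rr t)) \<otimes>\<^bsub>Pi\<^esub> inv\<^bsub>Pi\<^esub> hol (%s t. Z' s (rr t)) = hol Z \<otimes>\<^bsub>Pi\<^esub> inv\<^bsub>Pi\<^esub> hol Z'"
  by (simp add: m01)
 show "om (%s t. Z s (rr t))" using sph3_square(2)[OF s3[OF Z(1)] n, of 1] by (simp add: m01)
qed

text \<open>The analogue of \<open>natl\<close> for operations that turn paths from \<open>a\<close>
  to \<open>b\<close> into loops at \<open>v0\<close>.\<close>

definition ctx :: "'a => 'a => ((real => 'a) => real => 'a) => bool" where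
 "ctx a b ta \<longleftrightarrow> (ALL H. hm3 (%_. a) (%_. b) H --> sph3 (%x s. ta (H x s))) &
  (ALL p q. (ALL t:I1. p t = q t) --> (ALL t:I1. ta p t = ta q t))"

lemma ctx_id: "ctx v0 v0 (%p. p)"
 by (simp add: ctx_def sph3_hm3)

lemma ctx_gr: assumes "pin P v0 a l" "pin P b v0 r" shows "ctx a b (gr l r)"
proof -
 have "sph3 (%x s. gr l r (H x s))" if "hm3 (%_. a) (%_. b) H" for H
  unfolding sph3_hm3 gr_def
  by (intro hm3_join[OF hm3_const[OF hmap_const[OF assms(1)]]] hm3_join[OF that hm3_const[OF hmap_const[OF assms(2)]]])
 thus ?thesis by (auto simp: ctx_def gr_def joinpaths_def)
qed

end

context pcplx begin

definition skel1 :: "'a set" where "skel1 = (\<Union>S\<in>{S:K. card S <= 2}. convex hull S)"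

lemma skel1_P: "skel1 \<subseteq> P" using hull_sub by (auto simp: skel1_def)

lemma segment_skel1:
 assumes "S:K" "v:S" "w:S" shows "closed_segment v w \<subseteq> skel1"
proof -
 have "{v,w}:K" "card {v,w} <= 2" using face[OF assms(1)] assms by (auto simp: card_insert_if)
 thus ?thesis by (auto simp: skel1_def segment_convex_hull)
qed

end

section \<open>Relative classes of discs with boundary in the 1-skeleton\<close>

locale killing = pcplx K P v0 for K :: "'a::euclidean_space set set" and P v0 +
 fixes e :: "'a => 'a"
 assumes se: "selfmap e" and e_skel1: "!!x. x:skel1 ==> e x = x"
  and e_kills: "!!x. x:carrier Pi ==> ind e x = \<one>\<^bsub>Pi\<^esub>"
begin

text \<open>A disc \<open>X\<close> with boundary in the 1-skeleton is closed to a sphere by its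
  image under \<open>e\<close>, which has the same boundary. If \<open>X\<close> is already a
  sphere, its image has trivial class and nothing changes.\<close>

definition Dt :: "((real => 'a) => real => 'a) => (real => real => 'a) => (real => real \<Rightarrow>\<^sub>C 'a) set" where
 "Dt ta X = hol (%s. ta (X s)) \<otimes>\<^bsub>Pi\<^esub> inv\<^bsub>Pi\<^esub> hol (%s. ta (e o X s))"

definition ok :: "'a => 'a => ((real => 'a) => real => 'a) => (real => real => 'a) => bool" where
 "ok a b ta X \<longleftrightarrow> ctx a b ta & hmap P a b X & (ALL t:I1. X 0 t:skel1 & X 1 t:skel1) & hps P (ta (X 0)) c0"

lemma e_cont: "cts P e" "e:P \<rightarrow> P" using se by (auto simp: selfmap_def)

lemma hm3_e:
 assumes "hm3 (%_. a) (%_. b) H" "a:skel1" "b:skel1" shows "hm3 (%_. a) (%_. b) (%x s. e o H x s)"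
 using assms e_skel1 e_cont unfolding hm3_def case_prod_beta'
 by (auto intro!: continuous_on_compose2[OF e_cont(1), of "I1 \<times> I2"])

lemma ok_ends: "ok a b ta X ==> a:skel1 & b:skel1"
 unfolding ok_def hmap_def by (metis atLeastAtMost_iff order_refl zero_le_one)

lemma Dt_htpy:
 assumes o: "ok a b ta (H 0)" and H: "hm3 (%_. a) (%_. b) H"
  and L: "!!x t. x:I1 ==> t:I1 ==> H x 0 t:skel1 & H x 1 t:skel1"
 shows "Dt ta (H 0) = Dt ta (H 1)" "x:I1 ==> ok a b ta (H x)"
  "om (%s. ta (H 0 s))" "om (%s. ta (e o H 0 s))"
proof -
 have ab: "a:skel1" "b:skel1" using ok_ends[OF o] by auto
 have c: "ctx a b ta" using o by (simp add: ok_def)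
 have s: "sph3 (%x s. ta (H x s))" "sph3 (%x s. ta (e o H x s))"
  using c H hm3_e[OF H ab] by (auto simp: ctx_def)
 have n: "hps P (ta (H 0 0)) c0" using o by (simp add: ok_def)
 have eq: "ta (H x i) t = ta (e o H x i) t" if "x:I1" "t:I1" "i:{0,1}" for x t i
 proof -
  have "ALL t:I1. H x i t = (e o H x i) t" using L[OF that(1)] that(3) e_skel1 by auto
  thus ?thesis using c that(2) unfolding ctx_def by blast
 qed
 show "Dt ta (H 0) = Dt ta (H 1)"
  unfolding Dt_def using hol_dif[OF s(1) n s(2)] eq by simp
 have om1: "om (%s. ta (H x s))" if "x:I1" for x using sph3_square(2)[OF s(1) n that] .
 thus "om (%s. ta (H 0 s))" by simp
 have "pin P v0 v0 (ta (H 0 0))" using om_row(1)[OF om1[of 0], of 0] by simp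
 hence "hps P (ta (H 0 0)) (ta (e o H 0 0))"
  using eq[of 0 _ 0] by (intro homotopic_paths_eq) (auto simp: pin_def)
 hence "hps P (ta (e o H 0 0)) c0" using n homotopic_paths_sym homotopic_paths_trans by blast
 thus "om (%s. ta (e o H 0 s))" using sph3_square(2)[OF s(2), of 0] by simp
 show "ok a b ta (H x)" if "x:I1"
  using c hm3_row[OF H that] L[OF that] om_row(2)[OF om1[OF that], of 0] by (simp add: ok_def)
qed

lemma ok_om: assumes "ok a b ta X"
 shows "om (%s. ta (X s))" "om (%s. ta (e o X s))" "Dt ta X:carrier Pi"
  "hps P (ta (X 1)) c0"
proof -
 have "hm3 (%_. a) (%_. b) (%x. X)" using assms hm3_const by (auto simp: ok_def)
 note D = Dt_htpy(3,4)[of a b ta "%x. X", OF assms this]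
 show o: "om (%s. ta (X s))" "om (%s. ta (e o X s))" using D assms by (auto simp: ok_def)
 thus "Dt ta X:carrier Pi" unfolding Dt_def by (intro O.G.m_closed O.G.inv_closed hol_closed)
 show "hps P (ta (X 1)) c0" using om_row(2)[OF o(1), of 1] by simp
qed

lemma ctx_eq: "ctx a b ta ==> (!!t. t:I1 ==> p t = q t) ==> t:I1 ==> ta p t = ta q t"
 unfolding ctx_def by blast

lemma Dt_join:
 assumes X: "ok a b ta X" and Y: "ok a b ta Y" and m: "!!t. t:I1 ==> X 1 t = Y 0 t"
 shows "Dt ta (X +++ Y) = Dt ta X \<otimes>\<^bsub>Pi\<^esub> Dt ta Y" "ok a b ta (X +++ Y)"
proof -
 have c: "ctx a b ta" using X by (simp add: ok_def)
 have 1: "(%s. ta ((X +++ Y) s)) = (%s. ta (X s)) +++ (%s. ta (Y s))"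
  "(%s. ta (e o (X +++ Y) s)) = (%s. ta (e o X s)) +++ (%s. ta (e o Y s))"
  by (auto simp: joinpaths_def)
 have 2: "ta (X 1) t = ta (Y 0) t" "ta (e o X 1) t = ta (e o Y 0) t" if "t:I1" for t
  using m that by (auto intro!: ctx_eq[OF c])
 note oX = ok_om[OF X] and oY = ok_om[OF Y]
 have "hol (%s. ta ((X +++ Y) s)) = hol (%s. ta (X s)) \<otimes>\<^bsub>Pi\<^esub> hol (%s. ta (Y s))"
  unfolding 1 by (rule hol_join(1)[OF oX(1) oY(1) 2(1)])
 moreover have "hol (%s. ta (e o (X +++ Y) s)) = hol (%s. ta (e o X s)) \<otimes>\<^bsub>Pi\<^esub> hol (%s. ta (e o Y s))"
  unfolding 1 by (rule hol_join(1)[OF oX(2) oY(2) 2(2)])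
 ultimately show "Dt ta (X +++ Y) = Dt ta X \<otimes>\<^bsub>Pi\<^esub> Dt ta Y"
  unfolding Dt_def using hol_closed oX(1,2) oY(1,2) by (simp add: O.G.inv_mult_group CP.m_ac)
 show "ok a b ta (X +++ Y)"
  using X Y m hmap_vjoin[of P a b X Y] unfolding ok_def by (auto simp: joinpaths_def)
qed

lemma Dt_skel1: assumes X: "ok a b ta X" "!!s t. s:I1 ==> t:I1 ==> X s t:skel1" shows "Dt ta X = \<one>\<^bsub>Pi\<^esub>"
proof -
 have "hol (%s. ta (X s)) = hol (%s. ta (e o X s))"
  by (rule hol_cong[OF _ ok_om(1)[OF X(1)]], rule ctx_eq[of a b]) (use X e_skel1 in "auto simp: ok_def")
 thus ?thesis using hol_closed[OF ok_om(2)[OF X(1)]] by (simp add: Dt_def)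
qed

text \<open>The straight homotopy in \<open>C\<close> is constant on the boundary, so within a
  convex chart the class depends on the boundary only.\<close>

lemma Dt_convex:
 fixes C :: "'b::real_normed_vector set"
 assumes C: "convex C" "cts C f" "f:C \<rightarrow> P" and U: "hmap C u w U" and V: "hmap C u w V"
  and UV: "!!t. t:I1 ==> U 0 t = V 0 t & U 1 t = V 1 t" and o: "ok (f u) (f w) ta (%s. f o U s)"
 shows "Dt ta (%s. f o U s) = Dt ta (%s. f o V s)" "ok (f u) (f w) ta (%s. f o V s)"
proof -
 let ?H = "%x s t. f ((1 - x) *\<^sub>R U s t + x *\<^sub>R V s t)"
 have m: "(1 - x) *\<^sub>R U s t + x *\<^sub>R V s t:C" if "x:I1" "s:I1" "t:I1" for x s t
  using that U V by (intro convexD[OF C(1)]) (auto simp: hmap_def)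
 have "cts (I1 \<times> I2) (%z. (1 - fst z) *\<^sub>R U (fst (snd z)) (snd (snd z)) + fst z *\<^sub>R V (fst (snd z)) (snd (snd z)))"
  using U V unfolding hmap_def
  by (auto intro!: continuous_intros cont2[where H = U and A = "I2"] cont2[where H = V and A = "I2"])
 hence "cts (I1 \<times> I2) (%(x,s,t). ?H x s t)"
  unfolding case_prod_beta' by (rule continuous_on_compose2[OF C(2)]) (use m in auto)
 hence H: "hm3 (%_. f u) (%_. f w) ?H"
  unfolding hm3_def using m C(3) U V by (auto simp: hmap_def simp flip: scaleR_left_distrib)
 have ends: "?H 0 = (%s. f o U s)" "?H 1 = (%s. f o V s)" by (auto simp: fun_eq_iff)
 have "?H x i t = (f o U i) t" if "t:I1" "i:{0,1}" for x i t
  using UV[OF that(1)] that(2) by (auto simp flip: scaleR_left_distrib)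
 hence L: "?H x 0 t:skel1 & ?H x 1 t:skel1" if "t:I1" for x t using o that by (auto simp: ok_def)
 have "ok (f u) (f w) ta (?H 0)" unfolding ends by (rule o)
 note D = Dt_htpy(1,2)[of "f u" "f w" ta ?H, OF this H L]
 show "Dt ta (%s. f o U s) = Dt ta (%s. f o V s)" using D(1) unfolding ends .
 have "ok (f u) (f w) ta (?H 1)" by (rule D(2)) auto
 thus "ok (f u) (f w) ta (%s. f o V s)" unfolding ends .
qed

text \<open>Two kinds are used: a simplex with the part of the 1-skeleton in it, and the unit square
  with the lines of a grid.\<close>

definition chart :: "'b::real_normed_vector set => ('b => 'a) => 'b set => bool" where
 "chart C f Ga \<longleftrightarrow> convex C & cts C f & f:C \<rightarrow> P & Ga \<subseteq> C & f:Ga \<rightarrow> skel1"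

text \<open>The class of the region between two paths in the graph; by \<open>Dt_convex\<close> the
  straight homotopy may stand for any other.\<close>

definition DL :: "((real => 'a) => real => 'a) => ('b::real_normed_vector => 'a) => (real => 'b) => (real => 'b) => (real => real \<Rightarrow>\<^sub>C 'a) set" where
 "DL ta f p q = Dt ta (%s. f o LIN p q s)"

lemma pin_mono: "pin S a b p ==> S \<subseteq> T ==> pin T a b p" by (auto simp: pin_def)

lemma DL_ok:
 assumes ch: "chart C f Ga" and c: "ctx (f u) (f w) ta" and p: "pin Ga u w p" and q: "pin Ga u w q"
  and n: "hps P (ta (f o p)) c0"
 shows "ok (f u) (f w) ta (%s. f o LIN p q s)"
proof -
 have g: "Ga \<subseteq> C" "f:Ga \<rightarrow> skel1" "convex C" "cts C f" "f:C \<rightarrow> P" using ch by (auto simp: chart_def)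
 show ?thesis
  unfolding ok_def
 proof (intro conjI ballI)
  show "hmap P (f u) (f w) (%s. f o LIN p q s)"
   using hmap_comp[OF hmap_LIN[OF g(3) pin_mono[OF p g(1)] pin_mono[OF q g(1)]] g(4,5)] .
  fix t :: real assume "t:I1"
  hence "p t:Ga" "q t:Ga" using p q by (auto simp: pin_def path_image_def)
  thus "(f o LIN p q 0) t:skel1" "(f o LIN p q 1) t:skel1" using funcset_mem[OF g(2)] by (simp_all add: LIN_ends)
 qed (use c n in "simp_all add: LIN_ends")
qed

lemma DL_null:
 assumes "chart C f Ga" "ctx (f u) (f w) ta" "pin Ga u w p" "pin Ga u w q" "hps P (ta (f o p)) c0"
 shows "hps P (ta (f o q)) c0"
 using ok_om(4)[OF DL_ok[OF assms]] unfolding LIN_ends .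

lemma DL_closed: "chart C f Ga ==> ctx (f u) (f w) ta ==> pin Ga u w p ==> pin Ga u w q ==>
  hps P (ta (f o p)) c0 ==> DL ta f p q:carrier Pi"
 unfolding DL_def by (rule ok_om(3)[OF DL_ok])

lemma DL_chain:
 assumes ch: "chart C f Ga" and c: "ctx (f u) (f w) ta" and p: "pin Ga u w p" and q: "pin Ga u w q"
  and r: "pin Ga u w r" and n: "hps P (ta (f o p)) c0"
 shows "DL ta f p q \<otimes>\<^bsub>Pi\<^esub> DL ta f q r = DL ta f p r"
proof -
 have g: "Ga \<subseteq> C" "convex C" "cts C f" "f:C \<rightarrow> P" using ch by (auto simp: chart_def)
 note P = pin_mono[OF p g(1)] pin_mono[OF q g(1)] pin_mono[OF r g(1)]
 note D = Dt_join[OF DL_ok[OF ch c p q n] DL_ok[OF ch c q r DL_null[OF ch c p q n]]]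
 have e: "(%s. f o LIN p q s) +++ (%s. f o LIN q r s) = (%s. f o (LIN p q +++ LIN q r) s)"
  by (auto simp: joinpaths_def)
 have "DL ta f p q \<otimes>\<^bsub>Pi\<^esub> DL ta f q r = Dt ta (%s. f o (LIN p q +++ LIN q r) s)"
  using D(1) by (simp add: DL_def LIN_ends e)
 also have "... = Dt ta (%s. f o LIN p r s)"
 proof (rule Dt_convex(1)[OF g(2-4)])
  show "hmap C u w (LIN p q +++ LIN q r)"
   by (rule hmap_vjoin) (use P hmap_LIN[OF g(2)] in "auto simp: LIN_ends")
  show "hmap C u w (LIN p r)" by (rule hmap_LIN[OF g(2) P(1,3)])
  show "ok (f u) (f w) ta (%s. f o (LIN p q +++ LIN q r) s)" using D(2) by (simp add: LIN_ends e)
 qed (auto simp: joinpaths_def LIN_ends)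
 finally show ?thesis by (simp add: DL_def)
qed

text \<open>A homotopy within the graph is a disc in the 1-skeleton, where \<open>e\<close> is the
  identity.\<close>

lemma DL_homotopic:
 assumes ch: "chart C f Ga" and c: "ctx (f u) (f w) ta" and p: "pin Ga u w p"
  and h: "hps Ga p q" and n: "hps P (ta (f o p)) c0"
 shows "DL ta f p q = \<one>\<^bsub>Pi\<^esub>"
proof -
 have q: "pin Ga u w q" using pin_homotopic[OF h] p by simp
 have g: "Ga \<subseteq> C" "convex C" "cts C f" "f:C \<rightarrow> P" "f:Ga \<rightarrow> skel1" using ch by (auto simp: chart_def)
 obtain V where V: "hmap Ga u w V" "!!t. t:I1 ==> V 0 t = p t & V 1 t = q t"
  using homotopic_hmap[OF h] p unfolding pin_def by metis
 have VC: "hmap C u w V" using V(1) g(1) by (auto simp: hmap_def)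
 note U = hmap_LIN[OF g(2) pin_mono[OF p g(1)] pin_mono[OF q g(1)]]
 note D = Dt_convex[OF g(2-4) U VC _ DL_ok[OF ch c p q n]]
 have "DL ta f p q = Dt ta (%s. f o V s)" unfolding DL_def by (rule D(1)) (use V(2) in "auto simp: LIN_ends")
 also have "... = \<one>\<^bsub>Pi\<^esub>"
  by (rule Dt_skel1[OF D(2)]) (use V g(5) in "auto simp: LIN_ends hmap_def")
 finally show ?thesis .
qed

lemma DL_cong:
 assumes ch: "chart C f Ga" and c: "ctx (f u) (f w) ta" and p: "pin Ga u w p" and q: "pin Ga u w q"
  and h: "hps Ga p p'" "hps Ga q q'" and n: "hps P (ta (f o p)) c0"
 shows "DL ta f p q = DL ta f p' q'"
proof -
 have p': "pin Ga u w p'" and q': "pin Ga u w q'" using pin_homotopic[OF h(1)] pin_homotopic[OF h(2)] p q by auto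
 have n': "hps P (ta (f o p')) c0" "hps P (ta (f o q)) c0" using DL_null[OF ch c p p' n] DL_null[OF ch c p q n] by blast+
 have "DL ta f p q = DL ta f p p' \<otimes>\<^bsub>Pi\<^esub> (DL ta f p' q' \<otimes>\<^bsub>Pi\<^esub> DL ta f q' q)"
  using DL_chain[OF ch c p' q' q n'(1)] DL_chain[OF ch c p p' q n] by simp
 moreover have "DL ta f q' q = \<one>\<^bsub>Pi\<^esub>"
  by (rule DL_homotopic[OF ch c q' homotopic_paths_sym[OF h(2)] DL_null[OF ch c q q' n'(2)]])
 ultimately show ?thesis
  using DL_homotopic[OF ch c p h(1) n] DL_closed[OF ch c p' q' n'(1)] by simp
qed

lemma DL_self: "chart C f Ga ==> ctx (f u) (f w) ta ==> pin Ga u w p ==> hps P (ta (f o p)) c0 ==> DL ta f p p = \<one>\<^bsub>Pi\<^esub>"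
 by (rule DL_homotopic) (auto simp: pin_def)

lemma DL_inv:
 assumes ch: "chart C f Ga" and c: "ctx (f u) (f w) ta" and p: "pin Ga u w p" and q: "pin Ga u w q"
  and n: "hps P (ta (f o p)) c0"
 shows "DL ta f q p = inv\<^bsub>Pi\<^esub> DL ta f p q"
 using DL_chain[OF ch c q p q DL_null[OF ch c p q n]] DL_self[OF ch c q DL_null[OF ch c p q n]]
  DL_closed[OF ch c p q n] DL_closed[OF ch c q p DL_null[OF ch c p q n]] O.G.inv_equality by metis

lemma Dt_gr_cong:
 assumes h: "hps P l l'" "hps P r r'" and lr: "pin P v0 a l" "pin P b v0 r"
  and o: "ok a b (gr l r) X"
 shows "Dt (gr l r) X = Dt (gr l' r') X"
proof -
 have X: "hmap P a b X" and ab: "a:skel1" "b:skel1" using o ok_ends[OF o] by (auto simp: ok_def)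
 obtain L where L: "hmap P v0 a L" "!!t. t:I1 ==> L 0 t = l t & L 1 t = l' t"
  using homotopic_hmap[OF h(1)] lr(1) unfolding pin_def by metis
 obtain M where M: "hmap P b v0 M" "!!t. t:I1 ==> M 0 t = r t & M 1 t = r' t"
  using homotopic_hmap[OF h(2)] lr(2) unfolding pin_def by metis
 have LM: "hm3 (%_. v0) (%_. a) (%x s. L x)" "hm3 (%_. b) (%_. v0) (%x s. M x)"
  using hm3_path[of L] hm3_path[of M] L(1) M(1) by (auto simp: hmap_def hm3_def)
 let ?H = "%x s. gr (L x) (M x) (X s)" and ?K = "%x s. gr (L x) (M x) (e o X s)"
 have s3: "sph3 ?H" "sph3 ?K"
  unfolding sph3_hm3 gr_def by (intro hm3_join[OF LM(1)] hm3_join[OF _ LM(2)] hm3_const[OF X] hm3_e[OF hm3_const[OF X] ab])+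
 have eq: "gr (L i) (M i) Y t = gr l'' r'' Y t" if "!!t. t:I1 ==> L i t = l'' t & M i t = r'' t" "t:I1" for i l'' r'' Y t
  using that by (auto simp: gr_def joinpaths_def)
 have o0: "om (?H 0)" "om (?K 0)"
  by (rule om_cong[OF _ ok_om(1)[OF o]], use eq[of 0 l r] L M in simp) (rule om_cong[OF _ ok_om(2)[OF o]], use eq[of 0 l r] L M in simp)
 have n: "hps P (?H 0 0) c0" "hps P (?K 0 0) c0" using om_row(2)[OF o0(1), of 0] om_row(2)[OF o0(2), of 0] by auto
 have i1: "1:I1" by simp
 note o1 = sph3_square(2)[OF s3(1) n(1) i1] sph3_square(2)[OF s3(2) n(2) i1]
 have "hol (?H 0) \<otimes>\<^bsub>Pi\<^esub> inv\<^bsub>Pi\<^esub> hol (?K 0) = hol (?H 1) \<otimes>\<^bsub>Pi\<^esub> inv\<^bsub>Pi\<^esub> hol (?K 1)"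
  by (rule hol_dif[OF s3(1) n(1) s3(2)]) (use o e_skel1 in "auto simp: gr_def joinpaths_def ok_def")
 moreover have "hol (?H 0) = hol (%s. gr l r (X s))" "hol (?K 0) = hol (%s. gr l r (e o X s))"
  "hol (?H 1) = hol (%s. gr l' r' (X s))" "hol (?K 1) = hol (%s. gr l' r' (e o X s))"
  using L M by (auto intro!: hol_cong o0 o1 eq)
 ultimately show ?thesis by (simp add: Dt_def)
qed

lemma Dt_whisker_right:
 assumes X: "ok a b (gr l (ww +++ r)) X" and ww: "pin skel1 b b' ww"
 shows "Dt (gr l r) (%s. X s +++ ww) = Dt (gr l (ww +++ r)) X"
proof -
 \<comment> \<open>\<open>rr\<close> takes the break points 1/2, 5/8, 3/4 of
   \<open>gr l r (Y +++ ww)\<close> to the break points 1/2, 3/4, 7/8 of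
   \<open>gr l (ww +++ r) Y\<close>.\<close>
 define rr :: "real => real" where "rr t = t + min (max 0 (t - 1/2)) (1/8) - max 0 ((t - 3/4) / 2)" for t
 have rr: "cts I1 rr" "rr:I1 \<rightarrow> I1" "rr 0 = 0" "rr 1 = 1"
 proof -
  show "cts I1 rr" unfolding rr_def by (intro continuous_intros) auto
 qed (auto simp: rr_def min_def max_def field_simps)
 have e: "gr l r (Y +++ ww') t = gr l (ww +++ r) Y (rr t)" if "t:I1" "!!t. t:I1 ==> ww' t = ww t" for Y ww' t
 proof -
  consider "t <= 1/2" | "1/2 < t" "t <= 5/8" | "5/8 < t" "t <= 3/4" | "3/4 < t" by linarith
  thus ?thesis
  proof cases
   case 1
   hence r: "rr t = t" by (auto simp: rr_def)
   show ?thesis unfolding gr_def joinpaths_def r using 1 by (simp add: algebra_simps)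
  next
   case 2
   hence r: "rr t = 2 * t - 1/2" by (auto simp: rr_def)
   show ?thesis unfolding gr_def joinpaths_def r using 2 by (simp add: algebra_simps)
  next
   case 3
   hence r: "rr t = t + 1/8" by (auto simp: rr_def)
   show ?thesis unfolding gr_def joinpaths_def r using 3 that by (simp add: algebra_simps)
  next
   case 4
   hence r: "rr t = t / 2 + 1/2" by (auto simp: rr_def field_simps)
   show ?thesis unfolding gr_def joinpaths_def r using 4 by (simp add: algebra_simps)
  qed
 qed
 have w: "e (ww t) = ww t" if "t:I1" for t
 proof (rule e_skel1)
  show "ww t:skel1" using ww that by (auto simp: pin_def path_image_def)
 qed
 note oX = ok_om[OF X]
 have r: "gr l (ww +++ r) (X i) t = gr l (ww +++ r) (e o X i) t" if "t:I1" "i:{0,1}" for i t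
  by (rule ctx_eq[of a b]) (use X that e_skel1 in "auto simp: ok_def")
 note R = hol_dif_reparam[OF oX(1,2) _ rr]
 have o2: "om (%s t. gr l (ww +++ r) (X s) (rr t))" by (rule R(2)) (use r in auto)
 have o3: "om (%s t. gr l (ww +++ r) (e o X s) (rr t))" by (rule hol_dif_reparam(2)[OF oX(2,1) _ rr]) (use r in auto)
 have c: "e o (X s +++ ww) = (e o X s) +++ (e o ww)" for s by (simp add: path_compose_join)
 have "hol (%s. gr l r (X s +++ ww)) = hol (%s t. gr l (ww +++ r) (X s) (rr t))"
  by (rule hol_cong[symmetric, OF _ o2]) (simp add: e)
 moreover have "hol (%s. gr l r (e o (X s +++ ww))) = hol (%s t. gr l (ww +++ r) (e o X s) (rr t))"
  unfolding c by (rule hol_cong[symmetric, OF _ o3]) (use e[of _ "e o ww"] w in simp)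
 moreover have "hol (%s t. gr l (ww +++ r) (X s) (rr t)) \<otimes>\<^bsub>Pi\<^esub> inv\<^bsub>Pi\<^esub> hol (%s t. gr l (ww +++ r) (e o X s) (rr t)) = Dt (gr l (ww +++ r)) X"
  unfolding Dt_def by (rule R(1)) (use r in auto)
 ultimately show ?thesis by (simp add: Dt_def)
qed

lemma Dt_whisker_left:
 assumes X: "ok a b (gr (l +++ aa) r) X" and aa: "pin skel1 a' a aa"
 shows "Dt (gr l r) (%s. aa +++ X s) = Dt (gr (l +++ aa) r) X"
proof -
 \<comment> \<open>Here the break points 1/2, 5/8, 3/4 go to 1/4, 1/2, 3/4.\<close>
 define rr :: "real => real" where "rr t = max (t / 2) (min t (2 * t - 3/4))" for t
 have rr: "cts I1 rr" "rr:I1 \<rightarrow> I1" "rr 0 = 0" "rr 1 = 1"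
 proof -
  show "cts I1 rr" unfolding rr_def by (intro continuous_intros) auto
 qed (auto simp: rr_def min_def max_def field_simps)
 have e: "gr l r (aa' +++ Y) t = gr (l +++ aa) r Y (rr t)" if "t:I1" "!!t. t:I1 ==> aa' t = aa t" for Y aa' t
 proof -
  consider "t <= 1/2" | "1/2 < t" "t <= 5/8" | "5/8 < t" "t <= 3/4" | "3/4 < t" by linarith
  thus ?thesis
  proof cases
   case 1
   hence r: "rr t = t / 2" by (auto simp: rr_def)
   show ?thesis unfolding gr_def joinpaths_def r using 1 by (simp add: algebra_simps)
  next
   case 2
   hence r: "rr t = 2 * t - 3/4" by (auto simp: rr_def)
   show ?thesis unfolding gr_def joinpaths_def r using 2 that by (simp add: algebra_simps)
  next
   case 3
   hence r: "rr t = 2 * t - 3/4" by (auto simp: rr_def)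
   show ?thesis unfolding gr_def joinpaths_def r using 3 by (simp add: algebra_simps)
  next
   case 4
   hence r: "rr t = t" by (auto simp: rr_def)
   show ?thesis unfolding gr_def joinpaths_def r using 4 by (simp add: algebra_simps)
  qed
 qed
 have w: "e (aa t) = aa t" if "t:I1" for t
 proof (rule e_skel1)
  show "aa t:skel1" using aa that by (auto simp: pin_def path_image_def)
 qed
 note oX = ok_om[OF X]
 have r: "gr (l +++ aa) r (X i) t = gr (l +++ aa) r (e o X i) t" if "t:I1" "i:{0,1}" for i t
  by (rule ctx_eq[of a b]) (use X that e_skel1 in "auto simp: ok_def")
 note R = hol_dif_reparam[OF oX(1,2) _ rr]
 have o2: "om (%s t. gr (l +++ aa) r (X s) (rr t))" by (rule R(2)) (use r in auto)
 have o3: "om (%s t. gr (l +++ aa) r (e o X s) (rr t))" by (rule hol_dif_reparam(2)[OF oX(2,1) _ rr]) (use r in auto)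
 have c: "e o (aa +++ X s) = (e o aa) +++ (e o X s)" for s by (simp add: path_compose_join)
 have "hol (%s. gr l r (aa +++ X s)) = hol (%s t. gr (l +++ aa) r (X s) (rr t))"
  by (rule hol_cong[symmetric, OF _ o2]) (simp add: e)
 moreover have "hol (%s. gr l r (e o (aa +++ X s))) = hol (%s t. gr (l +++ aa) r (e o X s) (rr t))"
  unfolding c by (rule hol_cong[symmetric, OF _ o3]) (use e[of _ "e o aa"] w in simp)
 moreover have "hol (%s t. gr (l +++ aa) r (X s) (rr t)) \<otimes>\<^bsub>Pi\<^esub> inv\<^bsub>Pi\<^esub> hol (%s t. gr (l +++ aa) r (e o X s) (rr t)) = Dt (gr (l +++ aa) r) X"
  unfolding Dt_def by (rule R(1)) (use r in auto)
 ultimately show ?thesis by (simp add: Dt_def)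
qed

end

section \<open>Spheres made from lifted triangles\<close>

context killing begin

lemma chart_simplex: "S:K ==> chart (convex hull S) id (convex hull S \<inter> skel1)"
 using hull_sub[of S] by (auto simp: chart_def)

lemma simplex_edge: "S:K ==> u:S ==> v:S ==> pin (convex hull S \<inter> skel1) u v (lp u v)"
 using segment_skel1[of S u v] segment_hull[of S u v] by (intro pin_linepath) (auto simp: hull_inc)

lemma gr_null_iff:
 assumes "pin P v0 a l" "pin P a b p" "pin P b v0 r"
 shows "hps P (gr l r p) c0 \<longleftrightarrow> hl l \<otimes>\<^bsub>G\<^esub> (hl p \<otimes>\<^bsub>G\<^esub> hl r) = \<one>\<^bsub>G\<^esub>"
 using null_iff_hl[OF pin_gr[OF assms]] hl_gr[OF assms] by simp

lemma LIN_join: "LIN (p +++ w) (q +++ w) s = LIN p q s +++ w" "LIN (w +++ p) (w +++ q) s = w +++ LIN p q s"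
 by (auto simp: LIN_def joinpaths_def fun_eq_iff simp flip: scaleR_left_distrib)

lemma DL_whisker_right:
 assumes S: "S:K" and p: "pin (convex hull S \<inter> skel1) u w p" and q: "pin (convex hull S \<inter> skel1) u w q"
  and ww: "pin (convex hull S \<inter> skel1) w w' ww" and lr: "pin P v0 u l" "pin P w' v0 r"
  and n: "hps P (gr l (ww +++ r) p) c0"
 shows "DL (gr l r) id (p +++ ww) (q +++ ww) = DL (gr l (ww +++ r)) id p q"
proof -
 have wwP: "pin P w w' ww" using pin_mono[OF ww] skel1_P by blast
 have "ok u w (gr l (ww +++ r)) (%s. id o LIN p q s)"
  using DL_ok[OF chart_simplex[OF S], of u w "gr l (ww +++ r)" p q] ctx_gr[OF lr(1) pin_join[OF wwP lr(2)]] p q n by simp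
 from Dt_whisker_right[OF this pin_mono[OF ww]] show ?thesis by (simp add: DL_def LIN_join)
qed

lemma DL_whisker_left:
 assumes S: "S:K" and p: "pin (convex hull S \<inter> skel1) u w p" and q: "pin (convex hull S \<inter> skel1) u w q"
  and aa: "pin (convex hull S \<inter> skel1) u' u aa" and lr: "pin P v0 u' l" "pin P w v0 r"
  and n: "hps P (gr (l +++ aa) r p) c0"
 shows "DL (gr l r) id (aa +++ p) (aa +++ q) = DL (gr (l +++ aa) r) id p q"
proof -
 have aaP: "pin P u' u aa" using pin_mono[OF aa] skel1_P by blast
 have "ok u w (gr (l +++ aa) r) (%s. id o LIN p q s)"
  using DL_ok[OF chart_simplex[OF S], of u w "gr (l +++ aa) r" p q] ctx_gr[OF pin_join[OF lr(1) aaP] lr(2)] p q n by simp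
 from Dt_whisker_left[OF this pin_mono[OF aa]] show ?thesis by (simp add: DL_def LIN_join)
qed

text \<open>The triangle is lifted by the class \<open>g\<close> of the path to \<open>u\<close>;
  the class of the second tail is forced, since the boundary loop has to be null-homotopic.\<close>

definition Tv :: "(real => 'a) set => 'a => 'a => 'a => (real => real \<Rightarrow>\<^sub>C 'a) set" where
 "Tv g u v w = (let l = SOME l. pin P v0 u l & hl l = g;
   r = SOME r. pin P w v0 r & hl r = inv\<^bsub>G\<^esub> (g \<otimes>\<^bsub>G\<^esub> eg u w)
  in DL (gr l r) id (lp u w) (lp u v +++ lp v w))"

lemma edge_facts:
 assumes "S:K" "u:S" "v:S"
 shows "pin P u v (lp u v)" "eg u v:carrier G" "u:P" "hl (lp u v) = eg u v"
 using assms pin_edge[of S u v] eg_closed[of S u v] vertex_P by (auto simp: hull_inc eg_def)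

lemma eg_vertex_mult: "S:K ==> u:S ==> v:S ==> w:S ==> eg u v \<otimes>\<^bsub>G\<^esub> eg v w = eg u w"
 by (rule eg_mult) (auto simp: hull_inc)

lemma DL_gr_cong:
 assumes S: "S:K" and p: "pin (convex hull S \<inter> skel1) u w p" and q: "pin (convex hull S \<inter> skel1) u w q"
  and l: "pin P v0 u l" "pin P v0 u l'" "hl l = hl l'" and r: "pin P w v0 r" "pin P w v0 r'" "hl r = hl r'"
  and n: "hps P (gr l r p) c0"
 shows "DL (gr l r) id p q = DL (gr l' r') id p q"
proof -
 have "ok u w (gr l r) (%s. id o LIN p q s)"
  using DL_ok[OF chart_simplex[OF S], of u w "gr l r" p q] ctx_gr[OF l(1) r(1)] p q n by simp
 from Dt_gr_cong[OF hl_inject[OF l] hl_inject[OF r] l(1) r(1) this] show ?thesis by (simp add: DL_def)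
qed

lemma inv_r: "a:carrier G ==> b:carrier G ==> a \<otimes>\<^bsub>G\<^esub> (b \<otimes>\<^bsub>G\<^esub> inv\<^bsub>G\<^esub> (a \<otimes>\<^bsub>G\<^esub> b)) = \<one>\<^bsub>G\<^esub>"
 using G.r_inv[of "a \<otimes>\<^bsub>G\<^esub> b"] by (simp add: G.m_assoc[symmetric] del: G.r_inv)

lemma right_inverse_eq: "a \<otimes>\<^bsub>G\<^esub> b = \<one>\<^bsub>G\<^esub> ==> a:carrier G ==> b:carrier G ==> b = inv\<^bsub>G\<^esub> a"
 using G.inv_equality[OF G.inv_comm] by metis

lemma Tv_eq:
 assumes S: "S:K" "{u,v,w} \<subseteq> S" and l: "pin P v0 u l" and r: "pin P w v0 r" "hl r = inv\<^bsub>G\<^esub> (hl l \<otimes>\<^bsub>G\<^esub> eg u w)"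
 shows "Tv (hl l) u v w = DL (gr l r) id (lp u w) (lp u v +++ lp v w)"
proof -
 define l' where "l' = (SOME l'. pin P v0 u l' & hl l' = hl l)"
 define r' where "r' = (SOME r'. pin P w v0 r' & hl r' = inv\<^bsub>G\<^esub> (hl l \<otimes>\<^bsub>G\<^esub> eg u w))"
 have l': "pin P v0 u l'" "hl l' = hl l" using someI[of "%l'. pin P v0 u l' & hl l' = hl l" l] l by (auto simp: l'_def)
 have r': "pin P w v0 r'" "hl r' = hl r" using someI[of "%r'. pin P w v0 r' & hl r' = inv\<^bsub>G\<^esub> (hl l \<otimes>\<^bsub>G\<^esub> eg u w)" r] r by (auto simp: r'_def)
 have uvw: "u:S" "v:S" "w:S" using S by auto
 have "hps P (gr l' r' (lp u w)) c0"
  using gr_null_iff[OF l'(1) edge_facts(1)[OF S(1) uvw(1,3)] r'(1)] edge_facts[OF S(1) uvw(1,3)] l' r' r(2) hl_closed[OF l] inv_r by simp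
 from DL_gr_cong[OF S(1) simplex_edge pin_join[OF simplex_edge simplex_edge] l'(1) l l'(2) r'(1) r(1) r'(2) this]
 show ?thesis unfolding Tv_def l'_def[symmetric] r'_def[symmetric] Let_def using S(1) uvw by blast
qed

lemma triple_contract:
 assumes S: "S:K" "u:S" "v:S" "w:S"
 shows "hps (convex hull S \<inter> skel1) ((lp u w +++ lp w v) +++ lp v w) (lp u w)"
  and "hps (convex hull S \<inter> skel1) (lp u v +++ (lp v u +++ lp u w)) (lp u w)"
proof -
 let ?Ga = "convex hull S \<inter> skel1"
 note E = simplex_edge[OF S(1), unfolded pin_def]
 have "hps ?Ga ((lp u w +++ lp w v) +++ lp v w) (lp u w +++ (lp w v +++ lp v w))"
  by (rule homotopic_paths_sym[OF homotopic_paths_assoc]) (use E S in auto)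
 also have "hps ?Ga ... (lp u w +++ lp w w)"
  using homotopic_paths_rinv[of "lp w v" ?Ga] E[of w v] E[of u w] S by (intro homotopic_paths_join) auto
 also have "hps ?Ga ... (lp u w)" by (rule homotopic_paths_rid') (use E[of u w] S in auto)
 finally show "hps ?Ga ((lp u w +++ lp w v) +++ lp v w) (lp u w)" .
 have "hps ?Ga (lp u v +++ (lp v u +++ lp u w)) ((lp u v +++ lp v u) +++ lp u w)"
  by (rule homotopic_paths_assoc) (use E S in auto)
 also have "hps ?Ga ... (lp u u +++ lp u w)"
  using homotopic_paths_rinv[of "lp u v" ?Ga] E[of u v] E[of u w] S by (intro homotopic_paths_join) auto
 also have "hps ?Ga ... (lp u w)" by (rule homotopic_paths_lid') (use E[of u w] S in auto)
 finally show "hps ?Ga (lp u v +++ (lp v u +++ lp u w)) (lp u w)" .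
qed

lemma Tv_basic:
 assumes S: "S:K" "{u,v,w} \<subseteq> S" and g: "g:carrier G"
 obtains l r where "pin P v0 u l" "hl l = g" "pin P w v0 r" "hl r = inv\<^bsub>G\<^esub> (g \<otimes>\<^bsub>G\<^esub> eg u w)"
  "hps P (gr l r (lp u w)) c0" "ctx u w (gr l r)"
  "Tv g u v w = DL (gr l r) id (lp u w) (lp u v +++ lp v w)"
proof -
 have uvw: "u:S" "v:S" "w:S" using S by auto
 note E = edge_facts[OF S(1) uvw(1,3)]
 obtain l where l: "pin P v0 u l" "hl l = g" using hl_surj[OF g v0 E(3)] by blast
 have "inv\<^bsub>G\<^esub> (g \<otimes>\<^bsub>G\<^esub> eg u w):carrier G" using g E(2) by simp
 then obtain r where r: "pin P w v0 r" "hl r = inv\<^bsub>G\<^esub> (g \<otimes>\<^bsub>G\<^esub> eg u w)"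
  using hl_surj[OF _ edge_facts(3)[OF S(1) uvw(3,1)] v0] by blast
 have n: "hps P (gr l r (lp u w)) c0"
  using gr_null_iff[OF l(1) E(1) r(1)] l(2) r(2) E g inv_r by simp
 show ?thesis using that[OF l r n ctx_gr[OF l(1) r(1)]] Tv_eq[OF S l(1) r(1)] l(2) r(2) by simp
qed

lemma Tv_closed: assumes "S:K" "{u,v,w} \<subseteq> S" "g:carrier G" shows "Tv g u v w:carrier Pi"
proof -
 obtain l r where lr: "pin P v0 u l" "pin P w v0 r" "hps P (gr l r (lp u w)) c0" "ctx u w (gr l r)"
  and T: "Tv g u v w = DL (gr l r) id (lp u w) (lp u v +++ lp v w)"
  using Tv_basic[OF assms] by metis
 show ?thesis unfolding T
  by (rule DL_closed[OF chart_simplex[OF assms(1)]]) (use lr assms in "auto intro!: pin_join simplex_edge")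
qed

text \<open>Whiskering moves an edge from a tail into the region. A path that follows this edge
  forth and back contracts in the graph, and what remains is the same region with its two boundary
  paths exchanged.\<close>

lemma Tv_swap:
 assumes S: "S:K" "{u,v,w} \<subseteq> S" and g: "g:carrier G"
 shows "Tv g u w v = inv\<^bsub>Pi\<^esub> Tv g u v w" and "Tv (g \<otimes>\<^bsub>G\<^esub> eg u v) v u w = inv\<^bsub>Pi\<^esub> Tv g u v w"
proof -
 obtain l r where lr: "pin P v0 u l" "hl l = g" "pin P w v0 r" "hl r = inv\<^bsub>G\<^esub> (g \<otimes>\<^bsub>G\<^esub> eg u w)"
  and n: "hps P (gr l r (lp u w)) c0" and c: "ctx u w (gr l r)"
  and T: "Tv g u v w = DL (gr l r) id (lp u w) (lp u v +++ lp v w)"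
  using Tv_basic[OF assms] .
 have uvw: "u:S" "v:S" "w:S" using S by auto
 note se = simplex_edge[OF S(1)] and ef = edge_facts[OF S(1)]
 note ch = chart_simplex[OF S(1)]
 let ?uw = "lp u w" and ?uvw = "lp u v +++ lp v w"
 have cid: "ctx (id u) (id w) (gr l r)" using c by simp
 have nid: "hps P (gr l r (id o ?uw)) c0" using n by simp
 have puw: "pin (convex hull S \<inter> skel1) u w ?uw" "pin (convex hull S \<inter> skel1) u w ?uvw"
  using uvw by (auto intro!: se pin_join)
 have nuvw: "hps P (gr l r (id o ?uvw)) c0" by (rule DL_null[where f = id, OF ch cid puw nid])
 have I: "DL (gr l r) id ?uvw ?uw = inv\<^bsub>Pi\<^esub> Tv g u v w"
  unfolding T by (rule DL_inv[where f = id, OF ch cid puw nid])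
 have gc: "eg a b:carrier G" if "a:S" "b:S" for a b using ef(2) that by blast
 show "Tv g u w v = inv\<^bsub>Pi\<^esub> Tv g u v w"
 proof -
  let ?r = "lp v w +++ r"
  have r': "pin P v v0 ?r" "hl ?r = inv\<^bsub>G\<^esub> (g \<otimes>\<^bsub>G\<^esub> eg u v)"
  proof -
   show "pin P v v0 ?r" by (rule pin_join[OF ef(1) lr(3)]) (use uvw in auto)
   have "(g \<otimes>\<^bsub>G\<^esub> eg u v) \<otimes>\<^bsub>G\<^esub> (eg v w \<otimes>\<^bsub>G\<^esub> inv\<^bsub>G\<^esub> (g \<otimes>\<^bsub>G\<^esub> eg u w)) = \<one>\<^bsub>G\<^esub>"
    using g gc uvw eg_vertex_mult[OF S(1) uvw, symmetric] inv_r[of "g \<otimes>\<^bsub>G\<^esub> eg u v" "eg v w"] by (simp add: G.m_assoc)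
   moreover have "hl ?r = eg v w \<otimes>\<^bsub>G\<^esub> inv\<^bsub>G\<^esub> (g \<otimes>\<^bsub>G\<^esub> eg u w)"
    using hl_join[OF ef(1)[OF uvw(2,3)] lr(3)] lr(4) ef(4)[OF uvw(2,3)] by simp
   ultimately show "hl ?r = inv\<^bsub>G\<^esub> (g \<otimes>\<^bsub>G\<^esub> eg u v)"
    using g gc uvw by (intro right_inverse_eq) auto
  qed
  have n2: "hps P (gr l ?r (lp u v)) c0"
   using gr_null_iff[OF lr(1) ef(1)[OF uvw(1,2)] r'(1)] lr(2) r'(2) ef(4)[OF uvw(1,2)] gc uvw g inv_r by simp
  have "Tv g u w v = DL (gr l ?r) id (lp u v) (lp u w +++ lp w v)"
   using Tv_eq[OF S(1) _ lr(1) r'(1), of w] S lr(2) r'(2) by auto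
  also have "... = DL (gr l r) id ?uvw ((lp u w +++ lp w v) +++ lp v w)"
   by (rule DL_whisker_right[symmetric, OF S(1) _ _ _ lr(1,3) n2]) (use uvw in "auto intro!: se pin_join")
  also have "... = DL (gr l r) id ?uvw ?uw"
   by (rule DL_cong[where f = id, OF ch cid puw(2) pin_join[OF pin_join[OF se se] se] _ triple_contract(1)[OF S(1) uvw] nuvw])
    (use uvw puw in "auto simp: pin_def")
  finally show ?thesis using I by simp
 qed
 show "Tv (g \<otimes>\<^bsub>G\<^esub> eg u v) v u w = inv\<^bsub>Pi\<^esub> Tv g u v w"
 proof -
  let ?l = "l +++ lp u v"
  have l': "pin P v0 v ?l" "hl ?l = g \<otimes>\<^bsub>G\<^esub> eg u v"
   using pin_join[OF lr(1) ef(1)[OF uvw(1,2)]] hl_join[OF lr(1) ef(1)[OF uvw(1,2)]] lr(2) ef(4)[OF uvw(1,2)] by auto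
  have e: "g \<otimes>\<^bsub>G\<^esub> eg u v \<otimes>\<^bsub>G\<^esub> eg v w = g \<otimes>\<^bsub>G\<^esub> eg u w" using g gc uvw eg_vertex_mult[OF S(1) uvw] by (simp add: G.m_assoc)
  have n2: "hps P (gr ?l r (lp v w)) c0"
   using gr_null_iff[OF l'(1) ef(1)[OF uvw(2,3)] lr(3)] l'(2) lr(4) ef(4)[OF uvw(2,3)] gc uvw g inv_r[of "g \<otimes>\<^bsub>G\<^esub> eg u v" "eg v w"] e by simp
  have "Tv (g \<otimes>\<^bsub>G\<^esub> eg u v) v u w = DL (gr ?l r) id (lp v w) (lp v u +++ lp u w)"
   using Tv_eq[OF S(1) _ l'(1) lr(3), of u] S lr(4) l'(2) e by auto
  also have "... = DL (gr l r) id ?uvw (lp u v +++ (lp v u +++ lp u w))"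
   by (rule DL_whisker_left[symmetric, OF S(1) _ _ _ lr(1,3) n2]) (use uvw in "auto intro!: se pin_join")
  also have "... = DL (gr l r) id ?uvw ?uw"
   by (rule DL_cong[where f = id, OF ch cid puw(2) pin_join[OF se pin_join[OF se se]] _ triple_contract(2)[OF S(1) uvw] nuvw])
    (use uvw puw in "auto simp: pin_def")
  finally show ?thesis using I by simp
 qed
qed

text \<open>A triangle with a repeated vertex lies in the 1-skeleton, where \<open>e\<close> is the
  identity.\<close>

lemma Tv_degenerate:
 assumes S: "S:K" "{u,v,w} \<subseteq> S" and g: "g:carrier G" and d: "card {u,v,w} <= 2"
 shows "Tv g u v w = \<one>\<^bsub>Pi\<^esub>"
proof -
 obtain l r where lr: "pin P v0 u l" "pin P w v0 r" "hps P (gr l r (lp u w)) c0" "ctx u w (gr l r)"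
  and T: "Tv g u v w = DL (gr l r) id (lp u w) (lp u v +++ lp v w)"
  using Tv_basic[OF S g] by metis
 let ?C = "convex hull {u,v,w}"
 have F: "{u,v,w}:K" using face[OF S] by auto
 hence sk: "?C \<subseteq> skel1" using d by (auto simp: skel1_def)
 note E = segment_hull[OF F]
 have p: "pin ?C u w (lp u w)" "pin ?C u w (lp u v +++ lp v w)"
  by (auto intro!: pin_join pin_linepath[OF E] simp: hull_inc)
 have h: "hmap ?C u w (LIN (lp u w) (lp u v +++ lp v w))" by (rule hmap_LIN[OF convex_convex_hull p])
 have o: "ok u w (gr l r) (%s. id o LIN (lp u w) (lp u v +++ lp v w) s)"
  using DL_ok[OF chart_simplex[OF S(1)], of u w "gr l r" "lp u w" "lp u v +++ lp v w"] lr S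
  by (auto intro!: pin_join simplex_edge)
 show ?thesis unfolding T DL_def by (rule Dt_skel1[OF o]) (use h sk in "auto simp: hmap_def")
qed

text \<open>The sphere of a lifted face, read from its corner \<open>cor\<close> in the order of
  sign 1. These are the images of the basis of the 2-chains.\<close>

definition ec :: "'a set \<times> (real => 'a) set => (real => real \<Rightarrow>\<^sub>C 'a) set" where
 "ec bb = (case SOME (v,w). fst bb = {cor (fst bb),v,w} & sg (cor (fst bb)) v w = 1 of (v,w) => Tv (snd bb) (cor (fst bb)) v w)"

lemma face_vertices:
 assumes "S:faces"
 obtains v w where "S = {cor S,v,w}" "sg (cor S) v w = 1" "ALL g. ec (S,g) = Tv g (cor S) v w"
proof -
 have S: "S:K" "card S = 3" using assms by (auto simp: faces_def)
 have c: "cor S:S" by (rule cor[OF S(1)])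
 hence "card (S - {cor S}) = 2" using S simp[OF S(1)] by simp
 then obtain v w where vw: "S - {cor S} = {v,w}" "v ~= w" by (auto simp: card_2_iff)
 hence e: "S = {cor S,v,w}" "cor S ~= v" "cor S ~= w" "v:S" "w:S" using c by auto
 have "ord (cor S) ~= ord v" "ord (cor S) ~= ord w" "ord v ~= ord w" using ord_eq[OF S(1)] c e vw(2) by auto
 hence "sg (cor S) v w = 1 | sg (cor S) w v = 1" by (auto simp: sg_def sgn_if)
 hence "EX v w. S = {cor S,v,w} & sg (cor S) v w = 1" using e(1) by (metis insert_commute)
 hence ex: "EX p. case p of (v,w) => S = {cor S,v,w} & sg (cor S) v w = 1" by auto
 obtain v w where p: "(SOME (v,w). S = {cor S,v,w} & sg (cor S) v w = 1) = (v,w)" by fastforce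
 show ?thesis
  by (rule that[of v w]) (use someI_ex[OF ex] p in "simp_all add: ec_def")
qed

lemma ec_closed: "bb:lifts ==> ec bb:carrier Pi"
proof -
 assume bb: "bb:lifts"
 hence f: "fst bb:faces" "snd bb:carrier G" by (auto simp: lifts_def)
 obtain v w where "fst bb = {cor (fst bb),v,w}" "sg (cor (fst bb)) v w = 1" and ec: "ALL g. ec (fst bb,g) = Tv g (cor (fst bb)) v w"
  by (rule face_vertices[OF f(1)])
 thus ?thesis using Tv_closed[of "fst bb" "cor (fst bb)" v w "snd bb"] f spec[OF ec, of "snd bb"] by (auto simp: faces_def)
qed

text \<open>\<open>x\<close> is the image of the finite 2-chain with coefficients \<open>c\<close>,
  in multiplicative notation.\<close>

definition val :: "(real => real \<Rightarrow>\<^sub>C 'a) set => ('a set \<times> (real => 'a) set => int) => bool" where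
 "val x c \<longleftrightarrow> (EX F. finite F & F \<subseteq> lifts & (ALL bb. bb ~: F --> c bb = 0) & x = finprod Pi (%bb. ec bb [^]\<^bsub>Pi\<^esub> c bb) F)"

lemma ec_pow_closed: "F \<subseteq> lifts ==> (%bb. ec bb [^]\<^bsub>Pi\<^esub> (c bb :: int)):F \<rightarrow> carrier Pi"
 using ec_closed by (auto simp: O.G.int_pow_closed)

lemma val_finprod:
 assumes "val x c" "finite F" "F \<subseteq> lifts" "!!bb. bb ~: F ==> c bb = 0"
 shows "x = finprod Pi (%bb. ec bb [^]\<^bsub>Pi\<^esub> c bb) F"
proof -
 obtain F' where F': "finite F'" "F' \<subseteq> lifts" "!!bb. bb ~: F' ==> c bb = 0" "x = finprod Pi (%bb. ec bb [^]\<^bsub>Pi\<^esub> c bb) F'"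
  using assms(1) unfolding val_def by blast
 have "finprod Pi (%bb. ec bb [^]\<^bsub>Pi\<^esub> c bb) H = finprod Pi (%bb. ec bb [^]\<^bsub>Pi\<^esub> c bb) (F \<union> F')"
  if "H:{F,F'}" for H
  by (rule CP.finprod_mono_neutral_cong_left) (use that assms F' ec_pow_closed in auto)
 from this[of F] this[of F'] show ?thesis using F'(4) by simp
qed

lemma val_closed: "val x c ==> x:carrier Pi"
 unfolding val_def using CP.finprod_closed[OF ec_pow_closed] by blast

lemma val_one: "val \<one>\<^bsub>Pi\<^esub> (%_. 0)"
 unfolding val_def by (rule exI[of _ "{}"]) simp

lemma val_mult: assumes "val x c" "val y d" shows "val (x \<otimes>\<^bsub>Pi\<^esub> y) (%bb. c bb + d bb)"
proof -
 obtain F F' where F: "finite F" "F \<subseteq> lifts" "!!bb. bb ~: F ==> c bb = 0" and F': "finite F'" "F' \<subseteq> lifts" "!!bb. bb ~: F' ==> d bb = 0"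
  using assms unfolding val_def by metis
 let ?E = "F \<union> F'"
 have E: "finite ?E" "?E \<subseteq> lifts" using F F' by auto
 have "finprod Pi (%bb. ec bb [^]\<^bsub>Pi\<^esub> c bb) ?E \<otimes>\<^bsub>Pi\<^esub> finprod Pi (%bb. ec bb [^]\<^bsub>Pi\<^esub> d bb) ?E
   = finprod Pi (%bb. ec bb [^]\<^bsub>Pi\<^esub> c bb \<otimes>\<^bsub>Pi\<^esub> ec bb [^]\<^bsub>Pi\<^esub> d bb) ?E"
  by (rule CP.finprod_multf[symmetric]) (rule ec_pow_closed[OF E(2)])+
 also have "... = finprod Pi (%bb. ec bb [^]\<^bsub>Pi\<^esub> (c bb + d bb)) ?E"
  by (rule CP.finprod_cong') (use E ec_closed in "auto simp: O.G.int_pow_mult O.G.int_pow_closed")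
 finally show ?thesis
  unfolding val_def using val_finprod[OF assms(1) E] val_finprod[OF assms(2) E] F F' E by (intro exI[of _ ?E]) auto
qed

lemma val_inv: assumes "val x c" shows "val (inv\<^bsub>Pi\<^esub> x) (%bb. - c bb)"
proof -
 obtain F where F: "finite F" "F \<subseteq> lifts" "!!bb. bb ~: F ==> c bb = 0" "x = finprod Pi (%bb. ec bb [^]\<^bsub>Pi\<^esub> c bb) F"
  using assms unfolding val_def by blast
 let ?y = "finprod Pi (%bb. ec bb [^]\<^bsub>Pi\<^esub> (- c bb)) F"
 have v: "val ?y (%bb. - c bb)" unfolding val_def using F by (intro exI[of _ F]) auto
 have "?y \<otimes>\<^bsub>Pi\<^esub> x = finprod Pi (%bb. ec bb [^]\<^bsub>Pi\<^esub> (- c bb + c bb)) F"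
  using val_finprod[OF val_mult[OF v assms] F(1,2)] F(3) by simp
 also have "... = \<one>\<^bsub>Pi\<^esub>" by (rule CP.finprod_one_eqI) simp
 finally show ?thesis using v O.G.inv_equality[of ?y x] val_closed[OF v] val_closed[OF assms] by simp
qed

lemma val_ec: "bb0:lifts ==> val (ec bb0) (%bb. if bb = bb0 then 1 else 0)"
 unfolding val_def by (rule exI[of _ "{bb0}"]) (use ec_closed in "auto simp: O.G.int_pow_1")

text \<open>True for the order used in \<open>ec\<close>; the two transpositions of
  \<open>Tv_swap\<close> reach all other orders and invert the sphere while the sign changes.
  \<open>Q\<close> keeps track of the lift by carrying the group element to the corner
  \<open>c\<close>.\<close>

lemma val_Tv:
 assumes S: "S:K" "{u,v,w} \<subseteq> S" and g: "g:carrier G"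
 shows "val (Tv g u v w) (%bb. if bb:lifts then psi bb (u,g) (v,h) (w,k) else 0)"
proof (cases "card {u,v,w} <= 2")
 case True
 have "(%bb. if bb:lifts then psi bb (u,g) (v,h) (w,k) else 0) = (%_. 0)"
  using True lifts_card by (force simp: fun_eq_iff psi_def)
 thus ?thesis using Tv_degenerate[OF S g True] val_one by simp
next
 case False
 let ?F = "{u,v,w}"
 have F: "?F:K" using face[OF S] by auto
 hence fc: "?F:faces" using False simp[of ?F] by (auto simp: faces_def)
 let ?c = "cor ?F"
 obtain v' w' where F': "?F = {?c,v',w'}" "sg ?c v' w' = 1" and ec: "ALL g. ec (?F,g) = Tv g ?c v' w'"
  by (rule face_vertices[OF fc])
 define F c where "F = ?F" and "c = ?c"
 note Fc = F_def[symmetric] c_def[symmetric]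
 have FK: "F:K" "F:faces" "c:F" "F = {c,v',w'}" using F fc F' cor[OF F] by (auto simp: F_def c_def)
 have gc: "eg x y:carrier G" if "x:F" "y:F" for x y using edge_facts(2)[OF FK(1) that] .
 define Q where "Q g x y z \<longleftrightarrow> val (Tv g x y z) (%bb. if bb = (F,g \<otimes>\<^bsub>G\<^esub> eg x c) then sg x y z else 0)" for g x y z
 have c1: "sg c v' w' = 1" and ec1: "ec (F,g) = Tv g c v' w'" for g using F'(2) spec[OF ec] unfolding F_def c_def by blast+
 have base: "Q g c v' w'" if "g:carrier G" for g
 proof -
  have "(F,g):lifts" using FK(2) that by (simp add: lifts_def)
  from val_ec[OF this] show ?thesis
   unfolding Q_def c1 ec1 using eg_self[OF vertex_P[OF FK(1,3)]] that by simp
 qed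
 have s1: "Q g x z y" if "Q g x y z" "{x,y,z} \<subseteq> F" "g:carrier G" for g x y z
 proof -
  have "(%bb. - (if bb = (F,g \<otimes>\<^bsub>G\<^esub> eg x c) then sg x y z else 0)) = (%bb. if bb = (F,g \<otimes>\<^bsub>G\<^esub> eg x c) then sg x z y else 0)"
   using sg_swap(2)[of x y z] by (auto simp: fun_eq_iff)
  thus ?thesis
   using val_inv[OF that(1)[unfolded Q_def]] unfolding Q_def Tv_swap(1)[OF FK(1) that(2,3)] by (simp only:)
 qed
 have s2: "Q g x y z" if "Q (g \<otimes>\<^bsub>G\<^esub> eg x y) y x z" "{x,y,z} \<subseteq> F" "g:carrier G" for g x y z
 proof -
  have "g \<otimes>\<^bsub>G\<^esub> eg x y \<otimes>\<^bsub>G\<^esub> eg y c = g \<otimes>\<^bsub>G\<^esub> eg x c"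
   using that gc[of x y] gc[of y c] eg_vertex_mult[OF FK(1), of x y c] FK(3) by (simp add: G.m_assoc)
  hence "(%bb. - (if bb = (F,g \<otimes>\<^bsub>G\<^esub> eg x y \<otimes>\<^bsub>G\<^esub> eg y c) then sg y x z else 0)) = (%bb. if bb = (F,g \<otimes>\<^bsub>G\<^esub> eg x c) then sg x y z else 0)"
   using sg_swap(1)[of y x z] by (auto simp: fun_eq_iff)
  moreover have "inv\<^bsub>Pi\<^esub> Tv (g \<otimes>\<^bsub>G\<^esub> eg x y) y x z = Tv g x y z"
   using Tv_swap(2)[OF FK(1) that(2,3)] Tv_closed[OF FK(1) that(2,3)] by simp
  ultimately show ?thesis using val_inv[OF that(1)[unfolded Q_def]] unfolding Q_def by (simp only:)
 qed
 have cvw: "{c,v',w'} \<subseteq> F" "v':F" "w':F" using FK(4) by auto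
 have gm: "g \<otimes>\<^bsub>G\<^esub> eg x y:carrier G" if "g:carrier G" "x:F" "y:F" for g x y using that gc by simp
 have Q1: "Q g c x y" if "g:carrier G" "{x,y} = {v',w'}" for g x y
  using base[OF that(1)] s1[OF base[OF that(1)] cvw(1) that(1)] that(2) by (auto simp: doubleton_eq_iff)
 have Q2: "Q g x c y" if "g:carrier G" "{x,y} = {v',w'}" for g x y
  using that cvw FK(3) by (intro s2[OF Q1[OF gm]]) (auto simp: doubleton_eq_iff insert_commute)
 have Q3: "Q g x y c" if "g:carrier G" "{x,y} = {v',w'}" for g x y
  using that cvw FK(3) by (intro s1[OF Q2]) (auto simp: doubleton_eq_iff)
 have uF: "u:F" unfolding F_def by (rule insertI1)
 have d2: "{u,v,w} = {c,v',w'}" using FK(4) unfolding F_def .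
 have "card F = 3" using FK(2) unfolding faces_def by blast
 hence d: "card {c,v',w'} = 3" "{u,v,w} = {c,v',w'}" "card {u,v,w} = 3" using FK(4) d2 by (simp_all only:)
 have dist: "u ~= v" "u ~= w" "v ~= w" "c ~= v'" "c ~= w'" "v' ~= w'" using d(1,3) by (auto simp: card_insert_if split: if_splits)
 have m: "{u,v,w} - {c} = {v',w'}" unfolding d(2) using dist by auto
 have "u = c | v = c | w = c" using d(2) by (metis insertCI insertE singletonD)
 hence "u = c & {v,w} = {v',w'} | v = c & {u,w} = {v',w'} | w = c & {u,v} = {v',w'}"
 proof (elim disjE)
  assume e: "u = c" hence "{u,v,w} - {c} = {v,w}" using dist(1,2) by auto
  with m e show ?thesis by (simp only: simp_thms)
 next
  assume e: "v = c" hence "{u,v,w} - {c} = {u,w}" using dist(1,3) by auto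
  with m e show ?thesis by (simp only: simp_thms)
 next
  assume e: "w = c" hence "{u,v,w} - {c} = {u,v}" using dist(2,3) by auto
  with m e show ?thesis by (simp only: simp_thms)
 qed
 hence "Q g u v w"
 proof (elim disjE conjE)
  assume "u = c" and s: "{v,w} = {v',w'}" thus ?thesis using Q1[OF g s] by (simp only:)
 next
  assume "v = c" and s: "{u,w} = {v',w'}" thus ?thesis using Q2[OF g s] by (simp only:)
 next
  assume "w = c" and s: "{u,v} = {v',w'}" thus ?thesis using Q3[OF g s] by (simp only:)
 qed
 moreover have "(%bb. if bb = (F,g \<otimes>\<^bsub>G\<^esub> eg u c) then sg u v w else 0) = (%bb. if bb:lifts then psi bb (u,g) (v,h) (w,k) else 0)"
 proof
  fix bb :: "'a set \<times> (real => 'a) set"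
  have "g \<otimes>\<^bsub>G\<^esub> eg u c:carrier G" by (rule gm[OF g uF FK(3)])
  thus "(if bb = (F,g \<otimes>\<^bsub>G\<^esub> eg u c) then sg u v w else 0) = (if bb:lifts then psi bb (u,g) (v,h) (w,k) else 0)"
  proof (cases bb)
   case (Pair S a)
   have c': "cor F = c" by (simp only: F_def c_def)
   have p: "psi bb (u,g) (v,h) (w,k) = (if F = S & g \<otimes>\<^bsub>G\<^esub> eg u (cor S) = a then sg u v w else 0)"
    by (simp only: psi_def F_def Pair fst_conv snd_conv)
   show ?thesis
   proof (cases "F = S & g \<otimes>\<^bsub>G\<^esub> eg u c = a")
    case True
    hence "bb:lifts" "bb = (F,g \<otimes>\<^bsub>G\<^esub> eg u c)"
     using FK(2) `g \<otimes>\<^bsub>G\<^esub> eg u c : carrier G` Pair by (auto simp: lifts_def)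
    thus ?thesis using p True c' by simp
   next
    case False
    thus ?thesis using p Pair c' by auto
   qed
  qed
 qed
 ultimately show ?thesis unfolding Q_def by (simp only:)
qed

text \<open>The region is cut along the diagonal from \<open>q\<close> to \<open>s\<close>, where
  the two boundary paths have their ends, while the count uses the diagonal from \<open>p\<close> to
  \<open>r\<close>. The cocycle identity on the four labels, which lie in one simplex, reconciles
  them.\<close>

lemma val_cell:
 assumes L: "coh S {p,q,r,s}" and l: "pin P v0 (fst q) l" "hl l = snd q" and r: "pin P (fst s) v0 x"
  and n: "hps P (gr l x (lp (fst q) (fst p) +++ lp (fst p) (fst s))) c0"
 shows "val (DL (gr l x) id (lp (fst q) (fst p) +++ lp (fst p) (fst s)) (lp (fst q) (fst r) +++ lp (fst r) (fst s)))
  (%bb. if bb:lifts then psi bb p q r - psi bb p s r else 0)"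
proof -
 let ?a = "fst p" and ?b = "fst q" and ?c = "fst r" and ?d = "fst s"
 have S: "S:K" "?a:S" "?b:S" "?c:S" "?d:S" using cohD[OF L] by auto
 have g: "snd q:carrier G" using cohD(3)[OF L] by simp
 note se = simplex_edge[OF S(1)] and ch = chart_simplex[OF S(1)]
 have pth: "pin (convex hull S \<inter> skel1) ?b ?d (lp ?b ?d)"
  "pin (convex hull S \<inter> skel1) ?b ?d (lp ?b ?a +++ lp ?a ?d)"
  "pin (convex hull S \<inter> skel1) ?b ?d (lp ?b ?c +++ lp ?c ?d)"
  using S by (auto intro!: se pin_join)
 have c: "ctx (id ?b) (id ?d) (gr l x)" using ctx_gr[OF l(1) r] by simp
 have nid: "hps P (gr l x (id o (lp ?b ?a +++ lp ?a ?d))) c0" using n by simp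
 have nd: "hps P (gr l x (id o lp ?b ?d)) c0" by (rule DL_null[where f = id, OF ch c pth(2,1) nid])
 note ef = edge_facts[OF S(1,3,5)]
 have "snd q \<otimes>\<^bsub>G\<^esub> (eg ?b ?d \<otimes>\<^bsub>G\<^esub> hl x) = \<one>\<^bsub>G\<^esub>"
  using gr_null_iff[OF l(1) ef(1) r] nd l(2) ef(4) by simp
 hence hx: "hl x = inv\<^bsub>G\<^esub> (hl l \<otimes>\<^bsub>G\<^esub> eg ?b ?d)"
  using g ef(2) hl_closed[OF r] l(2) by (intro right_inverse_eq) (auto simp: G.m_assoc)
 have T: "Tv (snd q) ?b y ?d = DL (gr l x) id (lp ?b ?d) (lp ?b y +++ lp y ?d)" if "y:S" for y
  using Tv_eq[OF S(1) _ l(1) r hx, of y] that S l(2) by auto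
 have "DL (gr l x) id (lp ?b ?a +++ lp ?a ?d) (lp ?b ?c +++ lp ?c ?d)
   = DL (gr l x) id (lp ?b ?a +++ lp ?a ?d) (lp ?b ?d) \<otimes>\<^bsub>Pi\<^esub> DL (gr l x) id (lp ?b ?d) (lp ?b ?c +++ lp ?c ?d)"
  by (rule DL_chain[where f = id, OF ch c pth(2,1,3) nid, symmetric])
 also have "DL (gr l x) id (lp ?b ?a +++ lp ?a ?d) (lp ?b ?d) = inv\<^bsub>Pi\<^esub> Tv (snd q) ?b ?a ?d"
  unfolding T[OF S(2)] by (rule DL_inv[where f = id, OF ch c pth(1,2) nd])
 finally have D: "DL (gr l x) id (lp ?b ?a +++ lp ?a ?d) (lp ?b ?c +++ lp ?c ?d)
   = inv\<^bsub>Pi\<^esub> Tv (snd q) ?b ?a ?d \<otimes>\<^bsub>Pi\<^esub> Tv (snd q) ?b ?c ?d" unfolding T[OF S(4)] .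
 have v: "val (Tv (snd q) ?b (fst y) ?d) (%bb. if bb:lifts then psi bb q y s else 0)" if "fst y:S" for y
  using val_Tv[OF S(1) _ g, of ?b "fst y" ?d "snd y" "snd s"] that S unfolding prod.collapse by blast
 have "val (inv\<^bsub>Pi\<^esub> Tv (snd q) ?b ?a ?d \<otimes>\<^bsub>Pi\<^esub> Tv (snd q) ?b ?c ?d)
   (%bb. - (if bb:lifts then psi bb q p s else 0) + (if bb:lifts then psi bb q r s else 0))"
  by (intro val_mult val_inv v S)
 moreover have "psi bb q r s - psi bb q p s = psi bb p q r - psi bb p s r" if "bb:lifts" for bb
 proof -
  note c3 = lifts_card[OF that]
  have "psi bb q r s - psi bb p r s + psi bb p q s - psi bb p q r = 0" by (rule psi_cocycle[OF L c3]) auto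
  moreover have "psi bb q p s = - psi bb p q s" by (rule psi_rot(1)[OF coh_mono[OF L] c3]) auto
  moreover have "psi bb p s r = - psi bb p r s" by (rule psi_rot(2)[OF coh_mono[OF L] c3]) auto
  ultimately show ?thesis by linarith
 qed
 hence "(%bb. - (if bb:lifts then psi bb q p s else 0) + (if bb:lifts then psi bb q r s else 0))
   = (%bb. if bb:lifts then psi bb p q r - psi bb p s r else 0)" by (auto simp: fun_eq_iff)
 ultimately show ?thesis unfolding D by (simp only:)
qed

end

section \<open>Interpolation of the labels and staircase paths in a grid\<close>

definition hat :: "real => real" where "hat u = max 0 (1 - \<bar>u\<bar>)"

lemma hat_sum:
 fixes g :: "nat => 'b::real_vector"
 assumes "i < N" "x:I1" shows "(\<Sum>k\<le>N. hat (real i + x - real k) *\<^sub>R g k) = (1 - x) *\<^sub>R g i + x *\<^sub>R g (Suc i)"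
proof -
 have "(\<Sum>k\<le>N. hat (real i + x - real k) *\<^sub>R g k) = (\<Sum>k\<in>{i,Suc i}. hat (real i + x - real k) *\<^sub>R g k)"
 proof (rule sum.mono_neutral_right)
  show "ALL k:{..N} - {i,Suc i}. hat (real i + x - real k) *\<^sub>R g k = 0"
  proof
   fix k assume "k:{..N} - {i,Suc i}"
   hence "k + 1 <= i | i + 2 <= k" by auto
   hence "real k + 1 <= i | real i + 2 <= k" by linarith
   hence "hat (real i + x - real k) = 0" using assms(2) by (auto simp: hat_def)
   thus "hat (real i + x - real k) *\<^sub>R g k = 0" by simp
  qed
 qed (use assms in auto)
 also have "... = (1 - x) *\<^sub>R g i + x *\<^sub>R g (Suc i)" using assms(2) by (simp add: hat_def)
 finally show ?thesis .
qed

lemma hat_sum_nat: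
 fixes g :: "nat => 'b::real_vector"
 assumes "m <= N" shows "(\<Sum>k\<le>N. hat (real m - real k) *\<^sub>R g k) = g m"
proof -
 have "hat (real m - real k) = (if k = m then 1 else 0)" for k
  by (cases k m rule: linorder_cases) (auto simp: hat_def)
 hence "(\<Sum>k\<le>N. hat (real m - real k) *\<^sub>R g k) = (\<Sum>k\<le>N. if k = m then g k else 0)" by (intro sum.cong) auto
 thus ?thesis using assms by simp
qed

lemma grid_coord:
 assumes "s:I1" "N > 0" obtains i x where "i < N" "x:I1" "s = (real i + x) / real N"
proof (cases "s = 1")
 case True
 thus ?thesis using that[of "N - 1" 1] assms by (simp add: of_nat_diff)
next
 case False
 have f: "0 <= \<lfloor>real N * s\<rfloor>" using assms by simp
 have "real N * s < real N" using assms False by simp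
 hence "\<lfloor>real N * s\<rfloor> < int N" by (simp add: floor_less_iff)
 thus ?thesis
  using f assms(2) that[of "nat \<lfloor>real N * s\<rfloor>" "frac (real N * s)"] frac_lt_1[of "real N * s"]
  by (auto simp: frac_def field_simps)
qed

locale gridded = killing K P v0 e for K :: "'a::euclidean_space set set" and P v0 e +
 fixes A :: "real => real => 'a" and N :: nat and dd :: real
 assumes clA: "cl A" and A01: "!!t. t:I1 ==> A 0 t = v0 & A 1 t = v0"
  and N: "N > 0" and m: "modulus (%_. A) dd" and Ndd: "1 / N + 1 / N < dd"
begin

definition Lb where "Lb i j = lb A (real i / N) (real j / N)"

abbreviation L where "L i j == fst (Lb i j)"

text \<open>The piecewise bilinear map of the square with the labels as values at the nodes. Each
  value lies in the carrier of the corresponding value of \<open>A\<close>, so the two maps are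
  joined by a straight homotopy in \<open>P\<close>.\<close>

definition f :: "real \<times> real => 'a" where
 "f z = (\<Sum>i\<le>N. hat (real N * fst z - real i) *\<^sub>R (\<Sum>j\<le>N. hat (real N * snd z - real j) *\<^sub>R L i j))"

lemma omA: "om A" "hmap P v0 v0 A" "sph3 (%_. A)"
 using clA sph3_const(1)[of A] by (auto simp: cl_def om_def)

lemma f_cell:
 assumes "i < N" "j < N" "x:I1" "y:I1"
 shows "f ((real i + x) / N,(real j + y) / N) =
  (1 - x) *\<^sub>R ((1 - y) *\<^sub>R L i j + y *\<^sub>R L i (Suc j)) + x *\<^sub>R ((1 - y) *\<^sub>R L (Suc i) j + y *\<^sub>R L (Suc i) (Suc j))"
 using N unfolding f_def by (simp add: hat_sum[OF assms(1,3)] hat_sum[OF assms(2,4)])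

lemma f_col: assumes "i <= N" "j < N" "y:I1"
 shows "f (real i / N,(real j + y) / N) = (1 - y) *\<^sub>R L i j + y *\<^sub>R L i (Suc j)"
 using N unfolding f_def by (simp add: hat_sum_nat[OF assms(1)] hat_sum[OF assms(2,3)])

lemma f_row: assumes "i < N" "j <= N" "x:I1"
 shows "f ((real i + x) / N,real j / N) = (1 - x) *\<^sub>R L i j + x *\<^sub>R L (Suc i) j"
 using N unfolding f_def by (simp add: hat_sum_nat[OF assms(2)] hat_sum[OF assms(1,3)])

lemma f_node: assumes "i <= N" "j <= N" shows "f (real i / N,real j / N) = L i j"
 using N unfolding f_def by (simp add: hat_sum_nat[OF assms(1)] hat_sum_nat[OF assms(2)])

lemma f_cont: "cts X f"
 unfolding f_def hat_def by (intro continuous_intros)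

lemma cell_near:
 assumes "i < N" "j < N" "x:I1" "y:I1" "i':{i,Suc i}" "j':{j,Suc j}"
 shows "dist (0::real,(real i + x) / N,(real j + y) / N) (0,real i' / N,real j' / N) < dd"
  "(0::real,(real i + x) / N,(real j + y) / N):I3" "(0::real,real i' / N,real j' / N):I3"
proof -
 have d: "\<bar>(real i + x) / N - real i' / N\<bar> <= 1 / N" if "x:I1" "i':{i,Suc i}" for i x i'
 proof -
  have "\<bar>(real i + x) / N - real i' / N\<bar> = \<bar>real i + x - real i'\<bar> / N" using N by (simp add: diff_divide_distrib[symmetric])
  also have "... <= 1 / N" using that by (intro divide_right_mono) auto
  finally show ?thesis .
 qed
 have "dist (0::real,(real i + x) / N,(real j + y) / N) (0,real i' / N,real j' / N) <= 0 + 1 / N + 1 / N"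
  using dist_triple[of 0 "(real i + x) / N" "(real j + y) / N" 0 "real i' / N" "real j' / N"] d[OF assms(3,5)] d[OF assms(4,6)] by linarith
 thus "dist (0::real,(real i + x) / N,(real j + y) / N) (0,real i' / N,real j' / N) < dd" using Ndd by linarith
 have "real i + x <= N" "real j + y <= N" "real i' <= N" "real j' <= N" using assms by auto
 thus "(0::real,(real i + x) / N,(real j + y) / N):I3" "(0::real,real i' / N,real j' / N):I3"
  using assms(3,4) N by (auto simp: divide_simps)
qed

lemma lab_near:
 assumes "i < N" "j < N" "x:I1" "y:I1" "i':{i,Suc i}" "j':{j,Suc j}"
 shows "L i' j':car (A ((real i + x) / N) ((real j + y) / N))"
 using lbl_step(2)[OF omA(3) m cell_near(3,2)[OF assms]] cell_near(1)[OF assms]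
 by (simp add: lbl_def ev_def Lb_def dist_commute)

lemma cell_coh:
 assumes "i < N" "j < N"
 shows "coh (car (A (real i / N) (real j / N))) {Lb i j,Lb (Suc i) j,Lb (Suc i) (Suc j),Lb i (Suc j)}"
proof -
 let ?n = "%i j. (0::real,real i / N,real j / N)"
 let ?Z = "(%(i,j). ?n i j) ` ({i,Suc i} \<times> {j,Suc j})"
 have dn: "dist (?n a b) (?n a' b') < dd" if "a:{i,Suc i}" "a':{i,Suc i}" "b:{j,Suc j}" "b':{j,Suc j}" for a b a' b'
 proof -
  have u: "\<bar>real a / N - real a' / N\<bar> <= 1 / N" if "a:{i,Suc i}" "a':{i,Suc i}" for i a a'
   using that N by (auto simp: diff_divide_distrib[symmetric] abs_divide divide_simps)
  show ?thesis using dist_triple[of 0 "real a / N" "real b / N" 0 "real a' / N" "real b' / N"] u[OF that(1,2)] u[OF that(3,4)] Ndd by linarith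
 qed
 have d: "dist z z' < dd" if "z:?Z" "z':?Z" for z z'
  using that by (elim imageE SigmaE) (simp only: prod.case, rule dn)
 have Z: "?Z \<subseteq> I3"
 proof
  fix z assume "z:?Z"
  then obtain a b where "z = ?n a b" "a:{i,Suc i}" "b:{j,Suc j}" by (elim imageE SigmaE) (simp only: prod.case)
  thus "z:I3" using cell_near(3)[OF assms, of 0 0 a b] by simp
 qed
 have "coh (car (ev (%_. A) (?n i j))) (lbl (%_. A) ` ?Z)" by (rule lbl_coh[OF omA(3) m Z d]) auto
 moreover have "lbl (%_. A) ` ?Z = {Lb i j,Lb (Suc i) j,Lb (Suc i) (Suc j),Lb i (Suc j)}"
  by (auto simp: lbl_def Lb_def image_iff)
 ultimately show ?thesis by (simp add: ev_def)
qed

lemma cell_point: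
 assumes "s:I1" "t:I1"
 obtains i j x y where "i < N" "j < N" "x:I1" "y:I1" "s = (real i + x) / N" "t = (real j + y) / N"
 using grid_coord[OF assms(1) N] grid_coord[OF assms(2) N] by metis

lemma f_hull:
 assumes "convex C" "i < N" "j < N" "x:I1" "y:I1" "!!i' j'. i':{i,Suc i} ==> j':{j,Suc j} ==> L i' j':C"
 shows "f ((real i + x) / N,(real j + y) / N):C"
proof -
 have c: "(1 - x) *\<^sub>R a + x *\<^sub>R b:C" if "a:C" "b:C" "x:I1" for a b x
  using convexD_alt[OF assms(1) that(1,2)] that(3) by auto
 show ?thesis unfolding f_cell[OF assms(2-5)] by (intro c assms(4-6)) auto
qed

lemma f_car: assumes "s:I1" "t:I1" shows "f (s,t):convex hull (car (A s t))" "A s t:P" "A s t:convex hull (car (A s t))" "car (A s t):K"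
proof -
 obtain i j x y where ij: "i < N" "j < N" "x:I1" "y:I1" and st: "s = (real i + x) / N" "t = (real j + y) / N"
  using cell_point[OF assms] .
 show "f (s,t):convex hull (car (A s t))"
  unfolding st by (rule f_hull[OF _ ij]) (use lab_near[OF ij] in "auto intro!: hull_inc")
 show "A s t:P" using omA(2) assms unfolding hmap_def by blast
 thus "A s t:convex hull (car (A s t))" "car (A s t):K" using car by auto
qed

definition Ga :: "(real \<times> real) set" where
 "Ga = {z:I2. EX k<=N. fst z = real k / N | snd z = real k / N}"

lemma f_Ga: assumes "z:Ga" shows "f z:skel1"
proof -
 have c: "(1 - y) *\<^sub>R L i' j' + y *\<^sub>R L i'' j'':skel1"
  if "i < N" "j < N" "{i',i''} \<subseteq> {i,Suc i}" "{j',j''} \<subseteq> {j,Suc j}" "y:I1" for i j i' j' i'' j'' y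
 proof -
  note co = cell_coh[OF that(1,2)]
  let ?S = "car (A (real i / N) (real j / N))"
  have "L a b:?S" if "a:{i,Suc i}" "b:{j,Suc j}" for a b using cohD(2)[OF co, of "Lb a b"] that by auto
  hence "closed_segment (L i' j') (L i'' j'') \<subseteq> skel1"
   using that by (intro segment_skel1[OF cohD(1)[OF co]]) auto
  thus ?thesis using that(5) by (auto simp: closed_segment_def)
 qed
 obtain s t where z: "z = (s,t)" "s:I1" "t:I1" using assms by (cases z) (auto simp: Ga_def)
 from assms obtain k where k: "k <= N" "s = real k / N | t = real k / N" by (auto simp: Ga_def z(1))
 have "EX i<N. k:{i,Suc i}" using k(1) N by (intro exI[of _ "k - 1"]) auto
 then obtain i where i: "i < N" "k:{i,Suc i}" by blast
 from k(2) show ?thesis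
 proof
  assume s: "s = real k / N"
  obtain j y where "j < N" "y:I1" "t = (real j + y) / real N" using grid_coord[OF z(3) N] .
  thus ?thesis using f_col[OF k(1)] c[OF i(1), of j k k j "Suc j"] i(2) by (simp add: z s)
 next
  assume t: "t = real k / N"
  obtain j y where "j < N" "y:I1" "s = (real j + y) / real N" using grid_coord[OF z(2) N] .
  thus ?thesis using f_row[OF _ k(1)] c[OF _ i(1), of j j "Suc j" k k] i(2) by (simp add: z t)
 qed
qed

lemma f_chart: "chart (I2) f Ga"
 unfolding chart_def
proof (intro conjI)
 show "convex (I2)" by (intro convex_Times) auto
 show "cts (I2) f" by (rule f_cont)
 show "f:I2 \<rightarrow> P"
 proof
  fix z assume "z:I2"
  hence "fst z:I1" "snd z:I1" by auto
  from f_car(1,4)[OF this] show "f z:P" using hull_sub by auto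
 qed
 show "Ga \<subseteq> I2" by (auto simp: Ga_def)
 show "f:Ga \<rightarrow> skel1" using f_Ga by auto
qed

lemma f_boundary: assumes "s:I1" shows "f (s,0) = v0" "f (s,1) = v0" "f (0,s) = v0" "f (1,s) = v0"
proof -
 have lv: "lab v0 = v0" using lb_boundary(1)[OF omA(1), of 0] omA(2) by (simp add: lb_def hmap_def)
 have b: "L i 0 = v0" "L i N = v0" "L 0 i = v0" "L N i = v0" if "i <= N" for i
 proof -
  have i: "real i / N:I1" using that N by simp
  show "L i 0 = v0" "L i N = v0" using lb_boundary[OF omA(1) i] N by (simp_all add: Lb_def)
  show "L 0 i = v0" "L N i = v0" using A01[OF i] lv N by (simp_all add: Lb_def lb_def)
 qed
 obtain i x where i: "i < N" "x:I1" "s = (real i + x) / N" using grid_coord[OF assms N] .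
 show "f (s,0) = v0" "f (s,1) = v0" "f (0,s) = v0" "f (1,s) = v0"
  using f_row[OF i(1), of 0] f_row[OF i(1), of N] f_col[OF _ i(1), of 0] f_col[OF _ i(1), of N] b[of i] b[of "Suc i"] i N
  by (simp_all add: algebra_simps)
qed

abbreviation nd :: "nat => nat => real \<times> real" where "nd i j == (real i / real N,real j / real N)"

lemma lines: assumes "i <= N"
 shows "convex ({real i / N} \<times> I1)" "{real i / N} \<times> I1 \<subseteq> Ga" "convex (I1 \<times> {real i / N})" "I1 \<times> {real i / N} \<subseteq> Ga"
 using assms N by (auto intro!: convex_Times simp: Ga_def)

lemma node_I1: "i <= N ==> real i / N:I1" using N by simp

lemma pconn_Ga: "pconn Ga (0,0)"
proof
 show z0: "(0,0):Ga" using N by (auto simp: Ga_def intro!: exI[of _ 0])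
 have "path_component Ga z (0,0)" if zG: "z:Ga" for z
 proof -
  have l: "path_component Ga a b" if "convex D" "D \<subseteq> Ga" "a:D" "b:D" for D a b
   using that convex_imp_path_connected[OF that(1)] path_component_of_subset[OF that(2)] unfolding path_connected_component by blast
  obtain s t where z: "z = (s,t)" "s:I1" "t:I1" using zG by (cases z) (auto simp: Ga_def)
  from zG obtain k where k: "k <= N" "s = real k / N | t = real k / N" by (auto simp: Ga_def z(1))
  have k1: "real k / N:I1" by (rule node_I1[OF k(1)])
  note l0 = lines[OF le0[of N], simplified] and lk = lines[OF k(1)]
  from k(2) show ?thesis
  proof
   assume s: "s = real k / N"
   have "path_component Ga z (real k / N,0)" by (rule l[OF lk(1,2)]) (use z s k1 in auto)
   moreover have "path_component Ga (real k / N,0) (0,0)" by (rule l[OF l0(3,4)]) (use z s k1 in auto)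
   ultimately show ?thesis by (rule path_component_trans)
  next
   assume t: "t = real k / N"
   have "path_component Ga z (0,real k / N)" by (rule l[OF lk(3,4)]) (use z t k1 in auto)
   moreover have "path_component Ga (0,real k / N) (0,0)" by (rule l[OF l0(1,2)]) (use z t k1 in auto)
   ultimately show ?thesis by (rule path_component_trans)
  qed
 qed
 thus "path_connected Ga"
  unfolding path_connected_component by (metis path_component_sym path_component_trans)
qed

text \<open>The holonomy is applied to the grid itself, so that homotopies between paths along grid
  lines reduce to identities between products.\<close>

sublocale T: pconn Ga "(0,0)" by (rule pconn_Ga)

definition W :: "real \<times> real => real \<times> real => (real => real \<times> real) => (real => real \<times> real) set => bool" where
 "W a b p x \<longleftrightarrow> pin Ga a b p & T.hl p = x"

abbreviation H :: "real \<times> real => real \<times> real => (real => real \<times> real) set" where "H a b == T.hl (lp a b)"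

lemma W_join: "W a b p x ==> W b c q y ==> W a c (p +++ q) (x \<otimes>\<^bsub>T.G\<^esub> y)"
 unfolding W_def by (auto simp: T.hl_join pin_join)

lemma W_homotopic: "W a b p x ==> W a b q y ==> x = y ==> hps Ga p q"
 unfolding W_def by (auto intro: T.hl_inject)

lemma W_line:
 assumes "convex D" "D \<subseteq> Ga" "a:D" "b:D"
 shows "W a b (lp a b) (H a b)" "H a b:carrier T.G" "c:D ==> H a b \<otimes>\<^bsub>T.G\<^esub> H b c = H a c"
proof -
 have p: "pin D x y (lp x y)" if "x:D" "y:D" for x y
  by (rule pin_linepath[OF closed_segment_subset[OF that assms(1)]])
 have q: "pin Ga x y (lp x y)" if "x:D" "y:D" for x y by (rule pin_mono[OF p[OF that] assms(2)])
 show "W a b (lp a b) (H a b)" "H a b:carrier T.G"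
  using q[OF assms(3,4)] T.hl_closed by (auto simp: W_def)
 assume c: "c:D"
 have "hps Ga (id o (lp a b +++ lp b c)) (id o lp a c)"
  by (rule homotopic_through_convex[OF assms(1)]) (use assms c in "auto intro!: p pin_join")
 thus "H a b \<otimes>\<^bsub>T.G\<^esub> H b c = H a c"
  using T.hl_homotopic T.hl_join[OF q[OF assms(3,4)] q[OF assms(4) c]] by simp
qed

lemma W_col:
 assumes "i <= N" "j <= N" "k <= N"
 shows "W (nd i j) (nd i k) (lp (nd i j) (nd i k)) (H (nd i j) (nd i k))" "H (nd i j) (nd i k):carrier T.G"
  "l <= N ==> H (nd i j) (nd i k) \<otimes>\<^bsub>T.G\<^esub> H (nd i k) (nd i l) = H (nd i j) (nd i l)"
 using W_line[OF lines(1,2)[OF assms(1)], of "nd i j" "nd i k"] node_I1 assms by auto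

lemma W_row:
 assumes "i <= N" "j <= N" "k <= N"
 shows "W (nd j i) (nd k i) (lp (nd j i) (nd k i)) (H (nd j i) (nd k i))" "H (nd j i) (nd k i):carrier T.G"
  "l <= N ==> H (nd j i) (nd k i) \<otimes>\<^bsub>T.G\<^esub> H (nd k i) (nd l i) = H (nd j i) (nd l i)"
 using W_line[OF lines(3,4)[OF assms(1)], of "nd j i" "nd k i"] node_I1 assms by auto

definition side where
 "side i = lp (nd 0 0) (nd i 0) +++ (lp (nd i 0) (nd i N) +++ lp (nd i N) (nd N N))"

text \<open>Along the bottom to column \<open>Suc i\<close>, up to height \<open>j\<close>, back to
  column \<open>i\<close>, up, and along the top. These staircases sweep the strip between
  \<open>side i\<close> and \<open>side (Suc i)\<close>, two consecutive ones differing by one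
  cell.\<close>

definition st where
 "st i j = lp (nd 0 0) (nd (Suc i) 0) +++ (lp (nd (Suc i) 0) (nd (Suc i) j) +++
  (lp (nd (Suc i) j) (nd i j) +++ (lp (nd i j) (nd i N) +++ lp (nd i N) (nd N N))))"

definition lw where "lw i j = lp (nd 0 0) (nd (Suc i) 0) +++ lp (nd (Suc i) 0) (nd (Suc i) j)"
definition rw where "rw i j = lp (nd i (Suc j)) (nd i N) +++ lp (nd i N) (nd N N)"
definition xw where "xw i j = lp (nd (Suc i) j) (nd i j) +++ lp (nd i j) (nd i (Suc j))"
definition yw where "yw i j = lp (nd (Suc i) j) (nd (Suc i) (Suc j)) +++ lp (nd (Suc i) (Suc j)) (nd i (Suc j))"

lemma paths_Ga:
 assumes "i < N" "j < N"
 shows "pin Ga (nd 0 0) (nd (Suc i) j) (lw i j)" "pin Ga (nd i (Suc j)) (nd N N) (rw i j)"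
  "pin Ga (nd (Suc i) j) (nd i (Suc j)) (xw i j)" "pin Ga (nd (Suc i) j) (nd i (Suc j)) (yw i j)"
proof -
 have W: "W a b p x ==> pin Ga a b p" for a b p x by (simp add: W_def)
 note le = Suc_leI[OF assms(1)] Suc_leI[OF assms(2)] less_imp_le[OF assms(1)] less_imp_le[OF assms(2)] le0 le_refl
 show "pin Ga (nd 0 0) (nd (Suc i) j) (lw i j)" "pin Ga (nd i (Suc j)) (nd N N) (rw i j)"
  "pin Ga (nd (Suc i) j) (nd i (Suc j)) (xw i j)" "pin Ga (nd (Suc i) j) (nd i (Suc j)) (yw i j)"
  unfolding lw_def rw_def xw_def yw_def
  by (rule pin_join[OF W[OF W_row(1)] W[OF W_col(1)]] pin_join[OF W[OF W_col(1)] W[OF W_row(1)]]; intro le)+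
qed

lemma W_side: assumes "i <= N"
 shows "W (nd 0 0) (nd N N) (side i) (H (nd 0 0) (nd i 0) \<otimes>\<^bsub>T.G\<^esub> (H (nd i 0) (nd i N) \<otimes>\<^bsub>T.G\<^esub> H (nd i N) (nd N N)))"
 unfolding side_def by (rule W_join[OF W_row(1) W_join[OF W_col(1) W_row(1)]]) (simp_all only: assms le0 le_refl)

lemma W_st: assumes "i < N" "j <= N"
 shows "W (nd 0 0) (nd N N) (st i j) (H (nd 0 0) (nd (Suc i) 0) \<otimes>\<^bsub>T.G\<^esub> (H (nd (Suc i) 0) (nd (Suc i) j) \<otimes>\<^bsub>T.G\<^esub>
  (H (nd (Suc i) j) (nd i j) \<otimes>\<^bsub>T.G\<^esub> (H (nd i j) (nd i N) \<otimes>\<^bsub>T.G\<^esub> H (nd i N) (nd N N)))))"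
 unfolding st_def by (rule W_join[OF W_row(1) W_join[OF W_col(1) W_join[OF W_row(1) W_join[OF W_col(1) W_row(1)]]]])
  (use assms in "simp_all only: Suc_leI less_imp_le le0 le_refl")

lemma T_assoc:
 assumes "a:carrier T.G" "b:carrier T.G" "c:carrier T.G" "a \<otimes>\<^bsub>T.G\<^esub> b = d" shows "a \<otimes>\<^bsub>T.G\<^esub> (b \<otimes>\<^bsub>T.G\<^esub> c) = d \<otimes>\<^bsub>T.G\<^esub> c"
 using assms by (simp add: T.G.m_assoc[symmetric])

lemma st_homotopic: assumes "i < N"
 shows "hps Ga (side i) (st i 0)" "hps Ga (st i N) (side (Suc i))"
  "j < N ==> hps Ga (st i j) (lw i j +++ (xw i j +++ rw i j))"
  "j < N ==> hps Ga (st i (Suc j)) (lw i j +++ (yw i j +++ rw i j))"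
proof -
 have one: "H a a = \<one>\<^bsub>T.G\<^esub>" if "a:Ga" for a by (rule T.hl_const[OF that])
 have ndGa: "nd a b:Ga" if "a <= N" "b <= N" for a b using lines(2)[OF that(1)] node_I1[OF that(2)] by auto
 have cl: "H (nd a b) (nd a c):carrier T.G" "H (nd a b) (nd c b):carrier T.G" if "a <= N" "b <= N" "c <= N" for a b c
  using W_col(2) W_row(2) that by auto
 show "hps Ga (side i) (st i 0)"
 proof (rule W_homotopic[OF W_side W_st])
  have r: "H (nd 0 0) (nd (Suc i) 0) \<otimes>\<^bsub>T.G\<^esub> H (nd (Suc i) 0) (nd i 0) = H (nd 0 0) (nd i 0)" by (rule W_row(3)) (use assms in auto)
  show "H (nd 0 0) (nd i 0) \<otimes>\<^bsub>T.G\<^esub> (H (nd i 0) (nd i N) \<otimes>\<^bsub>T.G\<^esub> H (nd i N) (nd N N)) =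
   H (nd 0 0) (nd (Suc i) 0) \<otimes>\<^bsub>T.G\<^esub> (H (nd (Suc i) 0) (nd (Suc i) 0) \<otimes>\<^bsub>T.G\<^esub>
   (H (nd (Suc i) 0) (nd i 0) \<otimes>\<^bsub>T.G\<^esub> (H (nd i 0) (nd i N) \<otimes>\<^bsub>T.G\<^esub> H (nd i N) (nd N N))))"
   using assms by (simp only: one[OF ndGa] T_assoc[OF _ _ _ r] cl T.G.l_one T.G.m_closed Suc_leI less_imp_le le0 le_refl simp_thms)
 qed (use assms in auto)
 show "hps Ga (st i N) (side (Suc i))"
 proof (rule W_homotopic[OF W_st W_side])
  have r: "H (nd (Suc i) N) (nd i N) \<otimes>\<^bsub>T.G\<^esub> H (nd i N) (nd N N) = H (nd (Suc i) N) (nd N N)" by (rule W_row(3)) (use assms in auto)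
  show "H (nd 0 0) (nd (Suc i) 0) \<otimes>\<^bsub>T.G\<^esub> (H (nd (Suc i) 0) (nd (Suc i) N) \<otimes>\<^bsub>T.G\<^esub>
   (H (nd (Suc i) N) (nd i N) \<otimes>\<^bsub>T.G\<^esub> (H (nd i N) (nd i N) \<otimes>\<^bsub>T.G\<^esub> H (nd i N) (nd N N)))) =
   H (nd 0 0) (nd (Suc i) 0) \<otimes>\<^bsub>T.G\<^esub> (H (nd (Suc i) 0) (nd (Suc i) N) \<otimes>\<^bsub>T.G\<^esub> H (nd (Suc i) N) (nd N N))"
   using assms by (simp only: one[OF ndGa] r cl T.G.l_one Suc_leI less_imp_le le0 le_refl)
 qed (use assms in auto)
 assume j: "j < N"
 note le = Suc_leI[OF assms] Suc_leI[OF j] less_imp_le[OF assms] less_imp_le[OF j] le0 le_refl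
 note ab = paths_Ga[OF assms j]
 have lw: "W (nd 0 0) (nd (Suc i) j) (lw i j) (H (nd 0 0) (nd (Suc i) 0) \<otimes>\<^bsub>T.G\<^esub> H (nd (Suc i) 0) (nd (Suc i) j))"
  unfolding lw_def by (rule W_join[OF W_row(1) W_col(1)]; intro le)
 have rw: "W (nd i (Suc j)) (nd N N) (rw i j) (H (nd i (Suc j)) (nd i N) \<otimes>\<^bsub>T.G\<^esub> H (nd i N) (nd N N))"
  unfolding rw_def by (rule W_join[OF W_col(1) W_row(1)]; intro le)
 have xw: "W (nd (Suc i) j) (nd i (Suc j)) (xw i j) (H (nd (Suc i) j) (nd i j) \<otimes>\<^bsub>T.G\<^esub> H (nd i j) (nd i (Suc j)))"
  unfolding xw_def by (rule W_join[OF W_row(1) W_col(1)]; intro le)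
 have yw: "W (nd (Suc i) j) (nd i (Suc j)) (yw i j) (H (nd (Suc i) j) (nd (Suc i) (Suc j)) \<otimes>\<^bsub>T.G\<^esub> H (nd (Suc i) (Suc j)) (nd i (Suc j)))"
  unfolding yw_def by (rule W_join[OF W_col(1) W_row(1)]; intro le)
 have r: "H (nd i j) (nd i (Suc j)) \<otimes>\<^bsub>T.G\<^esub> H (nd i (Suc j)) (nd i N) = H (nd i j) (nd i N)" by (intro W_col(3) le)
 have r': "H (nd (Suc i) 0) (nd (Suc i) j) \<otimes>\<^bsub>T.G\<^esub> H (nd (Suc i) j) (nd (Suc i) (Suc j)) = H (nd (Suc i) 0) (nd (Suc i) (Suc j))"
  by (intro W_col(3) le)
 note cl' = cl(1)[OF le(1,5,2)] cl(1)[OF le(1,5,4)] cl(1)[OF le(1,4,2)] cl(1)[OF le(3,4,2)] cl(1)[OF le(3,2,6)] cl(1)[OF le(3,4,6)]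
  cl(2)[OF le(5,5,1)] cl(2)[OF le(1,4,3)] cl(2)[OF le(1,2,3)] cl(2)[OF le(3,6,6)]
 show "hps Ga (st i j) (lw i j +++ (xw i j +++ rw i j))"
  by (rule W_homotopic[OF W_st[OF assms le(4)] W_join[OF lw W_join[OF xw rw]]])
   (simp only: r[symmetric] T.G.m_assoc T.G.m_closed cl')
 show "hps Ga (st i (Suc j)) (lw i j +++ (yw i j +++ rw i j))"
  by (rule W_homotopic[OF W_st[OF assms le(2)] W_join[OF lw W_join[OF yw rw]]])
   (simp only: r'[symmetric] T.G.m_assoc T.G.m_closed cl')
qed

lemma corner_ctx: "ctx (f (0,0)) (f (1,1)) (%p. p)"
 using f_boundary(1)[of 0] f_boundary(2)[of 1] ctx_id by simp

text \<open>All paths between the two corners are homotopic in the square, and the one along the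
  left and upper sides is mapped to \<open>v0\<close>.\<close>

lemma f_null: assumes "pin Ga (0,0) (1,1) p" shows "hps P (f o p) c0"
proof -
 let ?q = "lp (0,0) (0,1) +++ lp (0,1) (1,1) :: real => real \<times> real"
 have c: "convex (I2)" and sub: "Ga \<subseteq> I2" using f_chart by (auto simp: chart_def)
 have q: "pin (I2) (0,0) (1,1) ?q"
  by (intro pin_join[of _ _ "(0,1)"] pin_linepath closed_segment_subset c) auto
 have fq: "(f o ?q) t = v0" if "t:I1" for t
  using that f_boundary(3)[of "2 * t"] f_boundary(2)[of "2 * t - 1"] by (auto simp: joinpaths_def linepath_def)
 have "hps P (f o p) (f o ?q)"
  using f_chart pin_mono[OF assms sub] q by (intro homotopic_through_convex[OF c]) (auto simp: chart_def)
 moreover have "hps P (f o ?q) c0"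
 proof (rule homotopic_paths_sym[OF homotopic_paths_eq])
  show "path c0" "path_image c0 \<subseteq> P" using pin_c0 by (auto simp: pin_def)
 qed (use fq in auto)
 ultimately show ?thesis by (rule homotopic_paths_trans)
qed

abbreviation M where "M == DL (%p. p) f"

lemmas M_cong = DL_cong[where ta = "%p. p", OF f_chart corner_ctx _ _ _ _ f_null]
lemmas M_chain = DL_chain[where ta = "%p. p", OF f_chart corner_ctx _ _ _ f_null]

lemma corner_path: "W (nd 0 0) (nd N N) p x ==> pin Ga (0,0) (1,1) p"
 using N by (simp add: W_def)

lemma f_edge:
 assumes "i < N" "j < N" "t:I1"
 shows "f (lp (nd (Suc i) j) (nd i j) t) = lp (L (Suc i) j) (L i j) t"
  "f (lp (nd i j) (nd i (Suc j)) t) = lp (L i j) (L i (Suc j)) t"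
  "f (lp (nd (Suc i) j) (nd (Suc i) (Suc j)) t) = lp (L (Suc i) j) (L (Suc i) (Suc j)) t"
  "f (lp (nd (Suc i) (Suc j)) (nd i (Suc j)) t) = lp (L (Suc i) (Suc j)) (L i (Suc j)) t"
proof -
 have col: "f (lp (nd a j) (nd a (Suc j)) t) = lp (L a j) (L a (Suc j)) t" if "a <= N" for a
 proof -
  have "lp (nd a j) (nd a (Suc j)) t = (real a / N,(real j + t) / N)"
   using N by (simp add: linepath_def field_simps scaleR_prod_def)
  thus ?thesis using f_col[OF that assms(2,3)] by (simp add: linepath_def)
 qed
 have row: "f (lp (nd (Suc i) b) (nd i b) t) = lp (L (Suc i) b) (L i b) t" if "b <= N" for b
 proof -
  have "lp (nd (Suc i) b) (nd i b) t = ((real i + (1 - t)) / N,real b / N)"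
   using N by (simp add: linepath_def field_simps scaleR_prod_def)
  thus ?thesis using f_row[OF assms(1) that, of "1 - t"] assms(3) by (simp add: linepath_def add.commute)
 qed
 show "f (lp (nd (Suc i) j) (nd i j) t) = lp (L (Suc i) j) (L i j) t"
  "f (lp (nd i j) (nd i (Suc j)) t) = lp (L i j) (L i (Suc j)) t"
  "f (lp (nd (Suc i) j) (nd (Suc i) (Suc j)) t) = lp (L (Suc i) j) (L (Suc i) (Suc j)) t"
  "f (lp (nd (Suc i) (Suc j)) (nd i (Suc j)) t) = lp (L (Suc i) (Suc j)) (L i (Suc j)) t"
  using row[of j] row[of "Suc j"] col[of i] col[of "Suc i"] assms(1,2) by simp_all
qed

lemma linear_homotopy_P: assumes "s:I1" "t:I1" "x:I1" shows "(1 - x) *\<^sub>R A s t + x *\<^sub>R f (s,t):P"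
proof -
 note c = f_car[OF assms(1,2)]
 have "(1 - x) *\<^sub>R A s t + x *\<^sub>R f (s,t):convex hull (car (A s t))"
  using convexD_alt[OF convex_convex_hull c(3,1)] assms(3) by auto
 thus ?thesis using hull_sub[OF c(4)] by blast
qed

lemma linear_homotopy_cont:
 assumes "cts X g" "cts X a" "cts X b" "!!z. z:X ==> a z:I1 & b z:I1"
 shows "cts X (%z. (1 - g z) *\<^sub>R A (a z) (b z) + g z *\<^sub>R f (a z,b z))"
proof -
 have "cts X (%z. A (a z) (b z))"
  by (rule cont2[of "I2"]) (use omA(2) assms in "auto simp: hmap_def")
 moreover have "cts X (%z. f (a z,b z))"
  by (rule continuous_on_compose2[OF f_cont[of UNIV]]) (intro continuous_intros assms, auto)
 ultimately show ?thesis using assms(1) by (intro continuous_intros)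
qed

text \<open>The straight homotopy from \<open>A\<close> to \<open>f\<close> along the column is a
  square whose bottom is constant and whose top is the segment from the point to its label.\<close>

lemma node_class:
 assumes "i <= N" "j <= N"
 shows "hl (f o lp (nd i 0) (nd i j)) = snd (Lb i j)"
proof -
 let ?s = "real i / N" and ?u = "real j / N"
 have su: "?s:I1" "?u:I1" using node_I1 assms by auto
 have tu: "t * ?u:I1" if "t:I1" for t using that su mult_le_one[of t ?u] by (simp del: times_divide_eq_right)
 define F where "F x t = (1 - x) *\<^sub>R A ?s (t * ?u) + x *\<^sub>R f (?s,t * ?u)" for x t
 have c: "cts (I2) (%(x,t). F x t)"
  unfolding F_def case_prod_unfold by (intro linear_homotopy_cont continuous_intros) (use su tu in auto)
 have FP: "F x t:P" if "x:I1" "t:I1" for x t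
  unfolding F_def by (rule linear_homotopy_P[OF su(1) tu[OF that(2)] that(1)])
 have sq: "hl (%x. F x 0) \<otimes>\<^bsub>G\<^esub> hl (%t. F 1 t) = hl (%t. F 0 t) \<otimes>\<^bsub>G\<^esub> hl (%x. F x 1)" by (rule hl_square[OF c FP])
 have z: "A ?s 0 = v0" using omA(2) su by (simp add: hmap_def)
 have F0: "(%x. F x 0) = lp v0 v0"
  using z f_boundary(1)[OF su(1)] by (auto simp: F_def linepath_def fun_eq_iff algebra_simps)
 have F1: "(%x. F x 1) = lp (A ?s ?u) (L i j)"
  using f_node[OF assms] by (auto simp: F_def linepath_def fun_eq_iff)
 have Fa: "(%t. F 0 t) = subpath 0 ?u (A ?s)" by (auto simp: F_def subpath_def fun_eq_iff mult.commute)
 have Fb: "(%t. F 1 t) = f o lp (nd i 0) (nd i j)"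
  using N by (auto simp: F_def linepath_def fun_eq_iff scaleR_prod_def field_simps)
 have "pin P (f (nd i 0)) (f (nd i j)) (f o lp (nd i 0) (nd i j))"
  using pin_image[OF _ f_cont, of Ga _ _ _ P] W_col(1)[OF assms(1) le0 assms(2)] f_Ga skel1_P unfolding W_def by blast
 hence cl: "hl (f o lp (nd i 0) (nd i j)):carrier G" by (rule hl_closed)
 have "hl (f o lp (nd i 0) (nd i j)) = hl (subpath 0 ?u (A ?s)) \<otimes>\<^bsub>G\<^esub> eg (A ?s ?u) (L i j)"
  using sq unfolding F0 F1 Fa Fb hl_const[OF v0] G.l_one[OF cl] by (simp only: eg_def)
 thus ?thesis by (simp add: Lb_def lb_def)
qed

text \<open>Common parts of the two staircases become tails, which \<open>e\<close> leaves fixed.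
  Over the cell, the interpolation and the straight homotopy between the two edge paths have the
  same boundary and lie in the same simplex, so \<open>Dt_convex\<close> exchanges them and
  \<open>val_cell\<close> evaluates the result.\<close>

lemma val_grid_cell:
 assumes "i < N" "j < N"
 shows "val (M (st i j) (st i (Suc j))) (%bb. if bb:lifts then cellv (psi bb) Lb i j else 0)"
proof -
 let ?b = "nd (Suc i) j" and ?d = "nd i (Suc j)"
 define S where "S = car (A (real i / N) (real j / N))"
 note co = cell_coh[OF assms, folded S_def]
 have S: "S:K" by (rule cohD(1)[OF co])
 have LS: "L a b:S" if "a:{i,Suc i}" "b:{j,Suc j}" for a b using cohD(2)[OF co, of "Lb a b"] that by auto
 define l r x y where "l = lw i j" and "r = rw i j" and "x = xw i j" and "y = yw i j"
 note p = paths_Ga[OF assms, folded l_def r_def x_def y_def]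
 note fP = pin_mono[OF pin_image[OF _ f_cont, of Ga _ _ _ skel1] skel1_P]
 have fGa: "f:Ga \<rightarrow> skel1" using f_Ga by auto
 have lr: "pin P v0 (f ?b) (f o l)" "pin P (f ?d) v0 (f o r)"
  using fP[OF p(1) fGa] fP[OF p(2) fGa] f_boundary(1)[of 0] f_boundary(2)[of 1] N by auto
 have le: "Suc i <= N" "i <= N" "Suc j <= N" "j <= N" using assms by auto
 have fn: "f ?b = L (Suc i) j" "f ?d = L i (Suc j)" using f_node le by blast+
 have lxr: "pin Ga (0,0) (1,1) (l +++ (x +++ r))" "pin Ga (0,0) (1,1) (l +++ (y +++ r))"
  using pin_join[OF p(1) pin_join[OF p(3,2)]] pin_join[OF p(1) pin_join[OF p(4,2)]] N by auto
 have st: "pin Ga (0,0) (1,1) (st i j)" "pin Ga (0,0) (1,1) (st i (Suc j))"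
  using corner_path[OF W_st] assms by auto
 have "M (st i j) (st i (Suc j)) = M (l +++ (x +++ r)) (l +++ (y +++ r))"
  unfolding l_def x_def y_def r_def by (rule M_cong[OF st st_homotopic(3,4)[OF assms(1) assms(2)] st(1)])
 also have "... = Dt (gr (f o l) (f o r)) (%s. f o LIN x y s)"
 proof -
  have o: "ok (f (0,0)) (f (1,1)) (%p. p) (%s. f o LIN (l +++ (x +++ r)) (l +++ (y +++ r)) s)"
   by (rule DL_ok[OF f_chart corner_ctx lxr f_null[OF lxr(1)]])
  have eq: "f o LIN (l +++ (x +++ r)) (l +++ (y +++ r)) s = gr (f o l) (f o r) (f o LIN x y s)" for s
   unfolding LIN_join path_compose_join gr_def ..
  have e: "(e o (f o w)) t = (f o w) t" if "pin Ga a b w" "t:I1" for w a b t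
  proof -
   have "w t:Ga" using that by (auto simp: pin_def path_image_def)
   thus ?thesis using f_Ga e_skel1 by simp
  qed
  have "hol (%s. e o (f o LIN (l +++ (x +++ r)) (l +++ (y +++ r)) s)) = hol (%s. gr (f o l) (f o r) (e o (f o LIN x y s)))"
  proof (rule hol_cong[OF _ ok_om(2)[OF o]])
   fix s t :: real assume "s:I1" "t:I1"
   thus "(e o (f o LIN (l +++ (x +++ r)) (l +++ (y +++ r)) s)) t = gr (f o l) (f o r) (e o (f o LIN x y s)) t"
    unfolding eq gr_def path_compose_join using e[OF p(1)] e[OF p(2)] by (auto simp: joinpaths_def)
  qed
  thus ?thesis unfolding DL_def Dt_def eq by (simp only:)
 qed
 also have "... = DL (gr (f o l) (f o r)) id (lp (L (Suc i) j) (L i j) +++ lp (L i j) (L i (Suc j)))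
   (lp (L (Suc i) j) (L (Suc i) (Suc j)) +++ lp (L (Suc i) (Suc j)) (L i (Suc j)))"
  (is "_ = DL ?ta id ?x ?y")
 proof -
  let ?Q = "{real i / N..(real i + 1) / N} \<times> {real j / N..(real j + 1) / N}"
  have Q: "convex ?Q" by (intro convex_Times) auto
  have nQ: "nd a b:?Q" if "a:{i,Suc i}" "b:{j,Suc j}" for a b using that N by (auto simp: divide_right_mono)
  have pQ: "pin ?Q ?b ?d x" "pin ?Q ?b ?d y" unfolding x_def y_def xw_def yw_def
   by (rule pin_join[OF pin_linepath pin_linepath, OF closed_segment_subset[OF nQ nQ Q] closed_segment_subset[OF nQ nQ Q]];
     simp only: insert_iff simp_thms)+
  have fQ: "f z:convex hull S" if "z:?Q" for z
  proof -
   have "f ((real i + (N * fst z - i)) / N,(real j + (N * snd z - j)) / N):convex hull S"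
    by (rule f_hull[OF convex_convex_hull assms]) (use that N LS in "auto intro!: hull_inc simp: field_simps")
   thus ?thesis using N by simp
  qed
  have U: "hmap (convex hull S) (f ?b) (f ?d) (%s. f o LIN x y s)"
   by (rule hmap_comp[OF hmap_LIN[OF Q pQ] f_cont]) (use fQ in auto)
  note sj = pin_join[OF pin_mono[OF simplex_edge[OF S LS LS] Int_lower1] pin_mono[OF simplex_edge[OF S LS LS] Int_lower1]]
  have V: "hmap (convex hull S) (f ?b) (f ?d) (LIN ?x ?y)"
   unfolding fn by (rule hmap_LIN[OF convex_convex_hull sj sj]; simp only: insert_iff simp_thms)
  have xy: "(f o x) t = ?x t" "(f o y) t = ?y t" if "t:I1" for t
   unfolding x_def y_def xw_def yw_def using f_edge[OF assms] that by (auto simp: joinpaths_def)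
  have UV: "(f o LIN x y 0) t = LIN ?x ?y 0 t & (f o LIN x y 1) t = LIN ?x ?y 1 t" if "t:I1" for t
   using xy[OF that] by (simp only: LIN_ends)
  have xx: "x t:Ga" "y t:Ga" if "t:I1" for t using p(3,4) that by (auto simp: pin_def path_image_def)
  have "hps P (gr (f o l) (f o r) (f o x)) c0"
   using f_null[OF lxr(1)] unfolding gr_def path_compose_join .
  moreover have "hmap P (f ?b) (f ?d) (%s. f o LIN x y s)" using U hull_sub[OF S] unfolding hmap_def by blast
  ultimately have o: "ok (id (f ?b)) (id (f ?d)) ?ta (%s. id o (f o LIN x y s))"
   using ctx_gr[OF lr] xx f_Ga unfolding ok_def id_o by (simp add: LIN_ends del: of_nat_Suc)
  have "Dt ?ta (%s. id o (f o LIN x y s)) = Dt ?ta (%s. id o LIN ?x ?y s)"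
   by (rule Dt_convex(1)[OF convex_convex_hull _ _ U V UV o]) (use hull_sub[OF S] in "auto intro: continuous_on_id")
  thus ?thesis by (simp add: DL_def)
 qed
 finally have eq: "M (st i j) (st i (Suc j)) = DL ?ta id ?x ?y" .
 have hl_l: "hl (f o l) = snd (Lb (Suc i) j)"
 proof -
  have "f (lp (nd 0 0) (nd (Suc i) 0) t) = v0" if "t:I1" for t
  proof -
   have "t * (real (Suc i) / N):I1" using that node_I1[OF le(1)] mult_le_one[of t "real (Suc i) / N"] by (simp del: times_divide_eq_right of_nat_Suc)
   thus ?thesis using f_boundary(1) by (simp add: linepath_def scaleR_prod_def)
  qed
  hence h: "hps P c0 (f o lp (nd 0 0) (nd (Suc i) 0))"
   using pin_c0 by (intro homotopic_paths_eq) (auto simp: pin_def)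
  have "hl (f o lp (nd 0 0) (nd (Suc i) 0)) = \<one>\<^bsub>G\<^esub>"
   using hl_homotopic[OF h] hl_const[OF v0] unfolding c0_def by simp
  moreover have "hl (f o l) = hl (f o lp (nd 0 0) (nd (Suc i) 0)) \<otimes>\<^bsub>G\<^esub> hl (f o lp (nd (Suc i) 0) (nd (Suc i) j))"
   unfolding l_def lw_def path_compose_join
   by (rule hl_join[OF fP[OF _ fGa] fP[OF _ fGa]]) (use W_row(1)[OF le0 le0 le(1)] W_col(1)[OF le(1) le0 le(4)] in "auto simp: W_def")
  ultimately show ?thesis
   using node_class[OF le(1,4)] cohD(3)[OF co, of "Lb (Suc i) j"] by simp
 qed
 have "hps P (?ta ?x) c0"
 proof -
  have h: "hps P (?ta (f o x)) c0" using f_null[OF lxr(1)] unfolding gr_def path_compose_join .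
  have "gr (f o l) (f o r) (f o x) t = gr (f o l) (f o r) ?x t" if "t:I1" for t
   using that f_edge[OF assms] unfolding gr_def x_def xw_def by (auto simp: joinpaths_def)
  hence "hps P (?ta (f o x)) (?ta ?x)"
   using homotopic_paths_imp_path[OF h] homotopic_paths_imp_subset[OF h] by (intro homotopic_paths_eq) auto
  thus ?thesis using homotopic_paths_trans[OF homotopic_paths_sym h] by blast
 qed
 hence "val (DL ?ta id ?x ?y) (%bb. if bb:lifts then psi bb (Lb i j) (Lb (Suc i) j) (Lb (Suc i) (Suc j)) - psi bb (Lb i j) (Lb i (Suc j)) (Lb (Suc i) (Suc j)) else 0)"
  using lr hl_l fn by (intro val_cell[OF co]) auto
 thus ?thesis unfolding eq cellv_def .
qed

lemma val_grid:
 assumes "i <= N"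
 shows "val (M (side 0) (side i)) (%bb. if bb:lifts then \<Sum>i'<i. \<Sum>j<N. cellv (psi bb) Lb i' j else 0)"
 using assms
proof (induction i)
 case 0
 have s: "pin Ga (0,0) (1,1) (side 0)" using corner_path[OF W_side] by blast
 have "M (side 0) (side 0) = \<one>\<^bsub>Pi\<^esub>" by (rule DL_self[OF f_chart corner_ctx s f_null[OF s]])
 thus ?case using val_one by (simp cong: if_cong)
next
 case (Suc i)
 hence i: "i < N" "i <= N" by auto
 have s: "pin Ga (0,0) (1,1) (side i')" if "i' <= N" for i' using corner_path[OF W_side[OF that]] .
 have t: "pin Ga (0,0) (1,1) (st i j)" if "j <= N" for j using corner_path[OF W_st[OF i(1) that]] .
 have "val (M (side 0) (st i j)) (%bb. if bb:lifts then (\<Sum>i'<i. \<Sum>j<N. cellv (psi bb) Lb i' j) + (\<Sum>j'<j. cellv (psi bb) Lb i j') else 0)" if "j <= N" for j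
  using that
 proof (induction j)
  case 0
  have "M (side 0) (side i) = M (side 0) (st i 0)"
   by (rule M_cong[OF s[OF le0] s[OF i(2)] _ st_homotopic(1)[OF i(1)] s[OF le0]]) (use s[OF le0] in "auto simp: pin_def")
  thus ?case using Suc.IH[OF i(2)] by (simp cong: if_cong)
 next
  case (Suc j)
  hence j: "j < N" "j <= N" "Suc j <= N" by auto
  have "M (side 0) (st i j) \<otimes>\<^bsub>Pi\<^esub> M (st i j) (st i (Suc j)) = M (side 0) (st i (Suc j))"
   by (rule M_chain[OF s[OF le0] t[OF j(2)] t[OF j(3)] s[OF le0]])
  moreover note val_mult[OF Suc.IH[OF j(2)] val_grid_cell[OF i(1) j(1)]]
  moreover have "(%bb. (if bb:lifts then (\<Sum>i'<i. \<Sum>j<N. cellv (psi bb) Lb i' j) + (\<Sum>j'<j. cellv (psi bb) Lb i j') else 0) + (if bb:lifts then cellv (psi bb) Lb i j else 0))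
    = (%bb. if bb:lifts then (\<Sum>i'<i. \<Sum>j<N. cellv (psi bb) Lb i' j) + (\<Sum>j'<Suc j. cellv (psi bb) Lb i j') else 0)"
   by (auto simp: fun_eq_iff)
  ultimately show ?case by (simp only:)
 qed
 from this[OF le_refl] have v: "val (M (side 0) (st i N)) (%bb. if bb:lifts then \<Sum>i'<Suc i. \<Sum>j<N. cellv (psi bb) Lb i' j else 0)"
  by (simp cong: if_cong)
 have "M (side 0) (st i N) = M (side 0) (side (Suc i))"
  by (rule M_cong[OF s[OF le0] t[OF le_refl] _ st_homotopic(2)[OF i(1)] s[OF le0]]) (use s[OF le0] in "auto simp: pin_def")
 with v show ?case by (simp only:)
qed

text \<open>A row of \<open>A\<close> belongs to a vertical segment; the paths \<open>R s\<close>
  complete it along the bottom and the top, where \<open>A\<close> is constant, to paths between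
  fixed corners. The parameter \<open>x\<close> deforms these paths into the straight homotopy from
  \<open>R 0\<close> to \<open>R 1\<close> and at the same time \<open>A\<close> into
  \<open>f\<close>.\<close>

lemma val_sphere: "val (hol A) (%bb. if bb:lifts then gs bb A N N else 0)"
proof -
 define R :: "real => real => real \<times> real" where
  "R s = lp (0,0) (s,0) +++ (lp (s,0) (s,1) +++ lp (s,1) (1,1))" for s
 define Z where "Z x s t = (1 - x) *\<^sub>R R s t + x *\<^sub>R LIN (R 0) (R 1) s t" for x s t
 define H where "H x s t = (1 - x) *\<^sub>R A (fst (Z x s t)) (snd (Z x s t)) + x *\<^sub>R f (fst (Z x s t),snd (Z x s t))" for x s t
 have Q: "convex (I2)" using f_chart by (simp add: chart_def)
 have Rp: "pin (I2) (0,0) (1,1) (R s)" if "s:I1" for s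
  unfolding R_def using that by (intro pin_join[of _ _ "(s,0)"] pin_join[of _ _ "(s,1)"] pin_linepath closed_segment_subset Q) auto
 have RI: "R s t:I2" if "s:I1" "t:I1" for s t using Rp[OF that(1)] that(2) unfolding pin_def path_image_def by blast
 have conv: "(1 - x) *\<^sub>R a + x *\<^sub>R b:I2" if "a:I2" "b:I2" "x:I1" for a b and x :: real
  using convexD_alt[OF Q that(1,2)] that(3) by auto
 have ZI: "Z x s t:I2" if "x:I1" "s:I1" "t:I1" for x s t
  unfolding Z_def LIN_def by (intro conv RI that) auto
 have R1: "R s 0 = (0,0)" "R s 1 = (1,1)" for s by (simp_all add: R_def joinpaths_def linepath_def)
 have R0I: "fst (R 0 t) = 0 | snd (R 0 t) = 1" "fst (R 1 t) = 1 | snd (R 1 t) = 0" for t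
  by (simp_all add: R_def joinpaths_def linepath_def)
 have Rc: "cts (I2) (%(s,t). R s t)"
  unfolding R_def
  by (intro continuous_join) (simp_all add: linepath_def joinpaths_def case_prod_unfold, (intro continuous_intros)+)
 have RcX: "cts X (%z. R (a z) (b z))" if "cts X a" "cts X b" "!!z. z:X ==> a z:I1 & b z:I1" for X :: "(real \<times> real \<times> real) set" and a b
  by (rule cont2[OF Rc]) (use that in auto)
 have "cts I3 (%z. Z (fst z) (fst (snd z)) (snd (snd z)))"
  unfolding Z_def LIN_def by (intro continuous_intros RcX) auto
 hence Hc: "cts I3 (%(x,s,t). H x s t)"
  unfolding H_def case_prod_unfold
  by (intro linear_homotopy_cont continuous_intros) (use ZI in "auto simp: mem_Times_iff")
 have HP: "H x s t:P" if "x:I1" "s:I1" "t:I1" for x s t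
  unfolding H_def by (rule linear_homotopy_P) (use ZI[OF that] that in "auto simp: mem_Times_iff")
 have bd: "(1 - x) *\<^sub>R A u v + x *\<^sub>R f (u,v) = v0" if "u:I1" "v:I1" "u = 0 | u = 1 | v = 0 | v = 1" for x u v
 proof -
  have "A u v = v0" using that A01 omA(2) unfolding hmap_def by blast
  moreover have "f (u,v) = v0" using that f_boundary by blast
  ultimately show ?thesis by (simp add: algebra_simps)
 qed
 have Hv: "H x s t = v0" if "x:I1" "s:I1" "t:I1" "s = 0 | s = 1 | t = 0 | t = 1" for x s t
 proof -
  have "Z x s t:{R 0 t,R 1 t,(0,0),(1,1)}"
   using that(4) by (auto simp: Z_def LIN_def R1 algebra_simps)
  hence "fst (Z x s t) = 0 | fst (Z x s t) = 1 | snd (Z x s t) = 0 | snd (Z x s t) = 1" using R0I[of t] by auto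
  thus ?thesis unfolding H_def by (intro bd) (use ZI[OF that(1-3)] in "auto simp: mem_Times_iff")
 qed
 have vs: "v0:skel1" using f_Ga[of "(0,0)"] f_boundary(1)[of 0] T.x0 by simp
 have hm: "hm3 (%_. v0) (%_. v0) H" unfolding hm3_def using Hc HP Hv by auto
 have "hl c0 = \<one>\<^bsub>G\<^esub>" using null_iff_hl[OF pin_c0] pin_c0 by (auto simp: pin_def)
 hence n: "hl c0 \<otimes>\<^bsub>G\<^esub> hl c0 = \<one>\<^bsub>G\<^esub>" by simp
 have og: "om (%s. gr c0 c0 (A s))" by (rule natl_om[OF natl_gr[OF pin_c0 pin_c0 n] omA(1)])
 have eq: "gr c0 c0 (A s) t = H 0 s t" if "s:I1" "t:I1" for s t
 proof -
  have lin: "lp (0,0) (s,0) u = (u * s,0)" "lp (s,0) (s,1) u = (s,u)" "lp (s,1) (1,1) u = ((1 - u) * s + u,1)" for u :: real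
   by (simp_all add: linepath_def algebra_simps)
  have "A s 0 = v0" "A s 1 = v0" using omA(2) that unfolding hmap_def by blast+
  moreover have "2 * t * s:I1" if "t <= 1/2" using mult_le_one[of "2 * t" s] that `s : I1` `t : I1` by auto
  ultimately have "A (fst (R s t)) (snd (R s t)) = gr c0 c0 (A s) t"
   using that omA(2) RI[OF that] unfolding hmap_def
   by (auto simp: R_def gr_def joinpaths_def lin mult.commute mem_Times_iff)
  thus ?thesis by (simp add: H_def Z_def)
 qed
 have o0: "om (H 0)" by (rule om_cong[OF _ og]) (rule eq)
 have "hol A = act (hl c0) (hol A)" using act_one hol_closed[OF omA(1)] `hl c0 = \<one>\<^bsub>G\<^esub>` by simp
 also have "... = hol (%s. gr c0 c0 (A s))" by (rule act_hol[OF clA pin_c0 pin_c0 n])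
 also have "... = hol (H 0)" by (rule hol_cong[OF eq og])
 \<comment> \<open>Here the assumption that \<open>e\<close> kills pi_2 enters: the absolute class
   is also the relative one.\<close>
 also have "... = Dt (%p. p) (H 0)"
 proof -
  have "cl (H 0)" using o0 Hv by (simp add: cl_def)
  hence "hol (%s. e o H 0 s) = \<one>\<^bsub>Pi\<^esub>" using ind_hol[OF se] e_kills[OF hol_closed[OF o0]] by simp
  thus ?thesis using hol_closed[OF o0] by (simp add: Dt_def)
 qed
 also have "... = Dt (%p. p) (H 1)"
 proof (rule Dt_htpy(1)[where H = H, OF _ hm])
  have "hps P (H 0 0) c0" by (rule om_row(2)[OF o0]) simp
  thus "ok v0 v0 (%p. p) (H 0)" unfolding ok_def using ctx_id hm3_row[OF hm, of 0] Hv[of 0] vs by simp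
 qed (use Hv vs in simp)
 also have "H 1 = (%s. f o LIN (R 0) (R 1) s)" by (simp add: H_def Z_def fun_eq_iff)
 finally have "hol A = DL (%p. p) f (R 0) (R 1)" unfolding DL_def .
 moreover have "R 0 = side 0" "R 1 = side N" using N by (simp_all add: R_def side_def)
 ultimately have "hol A = M (side 0) (side N)" by simp
 thus ?thesis using val_grid[OF le_refl] by (simp add: gs_def Lb_def cellv_def cong: if_cong)
qed

end

context killing begin

text \<open>The splitting: \<open>dg\<close> includes pi_2 into the 2-chains, and evaluation on the
  spheres \<open>ec\<close> is a left inverse of this inclusion.\<close>

theorem deg_expansion: assumes "x:carrier Pi" shows "val x (%bb. dg bb x)"
proof -
 obtain A where A: "cl A" "ALL t:I1. A 0 t = v0 & A 1 t = v0" "hol A = x"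
  by (rule Pi_surj[OF assms]) blast
 have "sph3 (%_. A)" using A(1) sph3_const(1) by (auto simp: cl_def om_def)
 then obtain dd where m: "modulus (%_. A) dd" using modulus_exists by blast
 then obtain N where nN: "N > 0" "1 / real N + 1 / real N < dd" using fine[of dd] unfolding modulus_def by blast
 interpret gridded K P v0 e A N dd by unfold_locales (use A m nN in auto)
 have "(%bb. if bb:lifts then gs bb A N N else 0) = (%bb. dg bb x)"
  using deg_grid[OF A(1) lifts_card m nN(1) nN(1) nN(2)] dg_hol[OF _ A(1)] A(3) by (auto simp: fun_eq_iff dg_def)
 thus ?thesis using val_sphere A(3) by simp
qed

end

section \<open>Matrices of endomorphisms of pi_2 over the group ring\<close>

context killing begin

lemma hom_inv: "f:hom Pi Pi ==> x:carrier Pi ==> f (inv\<^bsub>Pi\<^esub> x) = inv\<^bsub>Pi\<^esub> f x"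
 using group_hom.hom_inv[of Pi Pi f x] O.G.is_group by (simp add: group_hom_def group_hom_axioms_def)

lemma dg_pow: assumes "x:carrier Pi" shows "dg bb (x [^]\<^bsub>Pi\<^esub> (n::int)) = n * dg bb x"
proof -
 have one: "dg bb \<one>\<^bsub>Pi\<^esub> = 0" using dg_mult[of "\<one>\<^bsub>Pi\<^esub>" "\<one>\<^bsub>Pi\<^esub>" bb] by simp
 have nat: "dg bb (x [^]\<^bsub>Pi\<^esub> k) = int k * dg bb x" for k :: nat
  using assms one by (induction k) (auto simp: dg_mult algebra_simps)
 have neg: "dg bb (inv\<^bsub>Pi\<^esub> y) = - dg bb y" if "y:carrier Pi" for y
  using dg_mult[of y "inv\<^bsub>Pi\<^esub> y" bb] that one by simp
 show ?thesis
 proof (cases n rule: int_cases2)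
  case (nonneg k) thus ?thesis using nat[of k] by (simp add: int_pow_int)
 next
  case (nonpos k) thus ?thesis using nat[of k] neg assms by (simp add: O.G.int_pow_neg_int)
 qed
qed

lemma dg_finprod:
 assumes "finite F" "F \<subseteq> lifts" and f: "f:hom Pi Pi"
 shows "dg bb' (f (finprod Pi (%bb. ec bb [^]\<^bsub>Pi\<^esub> c bb) F)) = (\<Sum>bb\<in>F. c bb * dg bb' (f (ec bb)))"
 using assms(1,2)
proof (induction F)
 case empty
 have "f \<one>\<^bsub>Pi\<^esub> = \<one>\<^bsub>Pi\<^esub>" by (rule hom_one[OF f O.G.is_group O.G.is_group])
 thus ?case using dg_mult[of "\<one>\<^bsub>Pi\<^esub>" "\<one>\<^bsub>Pi\<^esub>" bb'] unfolding CP.finprod_empty by simp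
next
 case (insert bb F)
 have cl: "ec ga [^]\<^bsub>Pi\<^esub> c ga:carrier Pi" if "ga:insert bb F" for ga using ec_closed that insert.prems by blast
 have fp: "finprod Pi (%bb. ec bb [^]\<^bsub>Pi\<^esub> c bb) F:carrier Pi" by (rule CP.finprod_closed) (use cl in auto)
 have b: "ec bb:carrier Pi" using ec_closed insert.prems by auto
 have pw: "dg bb' (f (ec bb [^]\<^bsub>Pi\<^esub> c bb)) = c bb * dg bb' (f (ec bb))"
  using hom_int_pow[OF f b O.G.is_group O.G.is_group] dg_pow[OF hom_in_carrier[OF f b]] by simp
 have fi: "finprod Pi (%bb. ec bb [^]\<^bsub>Pi\<^esub> c bb) (insert bb F) = ec bb [^]\<^bsub>Pi\<^esub> c bb \<otimes>\<^bsub>Pi\<^esub> finprod Pi (%bb. ec bb [^]\<^bsub>Pi\<^esub> c bb) F"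
  by (rule CP.finprod_insert) (use insert cl in auto)
 have "F \<subseteq> lifts" using insert.prems by blast
 note IH = insert.IH[OF this]
 show ?case
  unfolding fi hom_mult[OF f cl[OF insertI1] fp] dg_mult[OF hom_in_carrier[OF f cl[OF insertI1]] hom_in_carrier[OF f fp]]
   IH pw sum.insert[OF insert.hyps] ..
qed

text \<open>The endomorphism \<open>f\<close> carried to the 2-chains: project by \<open>ec\<close>,
  apply \<open>f\<close>, include by \<open>dg\<close>. Because inclusion followed by projection is
  the identity of pi_2, products correspond to compositions; the identity becomes an idempotent
  matrix, in general not the unit matrix.\<close>

definition mx :: "((real => real \<Rightarrow>\<^sub>C 'a) set => (real => real \<Rightarrow>\<^sub>C 'a) set) => 'a set \<times> (real => 'a) set => 'a set \<times> (real => 'a) set => real" where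
 "mx f bb bb' = (if bb:lifts then real_of_int (dg bb' (f (ec bb))) else 0)"

lemma dg_ip:
 assumes x: "x:carrier Pi" and f: "f:hom Pi Pi"
 shows "real_of_int (dg bb' (f x)) = ip (%bb. real_of_int (dg bb x)) (%bb. mx f bb bb')"
proof -
 obtain F where F: "finite F" "F \<subseteq> lifts" "ALL bb. bb ~: F --> dg bb x = 0" "x = finprod Pi (%bb. ec bb [^]\<^bsub>Pi\<^esub> dg bb x) F"
  using deg_expansion[OF x] unfolding val_def by blast
 have "dg bb' (f x) = (\<Sum>bb\<in>F. dg bb x * dg bb' (f (ec bb)))"
  by (rule HOL.trans[OF arg_cong[OF F(4), of "%y. dg bb' (f y)"] dg_finprod[OF F(1,2) f]])
 moreover have "ip (%bb. real_of_int (dg bb x)) (%bb. mx f bb bb') = (\<Sum>bb\<in>F. real_of_int (dg bb x) * mx f bb bb')"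
  by (rule ip_sum[OF F(1)]) (use F(3) in auto)
 ultimately show ?thesis using F(2) by (simp only: mx_def of_int_sum of_int_mult) (intro sum.cong, auto)
qed

lemma dg_inject: assumes "x:carrier Pi" "!!bb. dg bb x = 0" shows "x = \<one>\<^bsub>Pi\<^esub>"
proof -
 obtain F where "finite F" "F \<subseteq> lifts" "x = finprod Pi (%bb. ec bb [^]\<^bsub>Pi\<^esub> dg bb x) F"
  using deg_expansion[OF assms(1)] unfolding val_def by blast
 thus ?thesis using CP.finprod_one_eqI[of F "%bb. ec bb [^]\<^bsub>Pi\<^esub> dg bb x"] assms(2) by simp
qed

lemma mx_supp: assumes f: "f:hom Pi Pi" shows "fin_supp (mx f bb)" "mx f bb bb' ~= 0 ==> bb':lifts"
 using finite_dg[OF hom_in_carrier[OF f ec_closed]] by (cases "bb:lifts"; simp add: mx_def fin_supp_def dg_def split: if_splits)+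

lemma mx_comp:
 assumes "f:hom Pi Pi" "g:hom Pi Pi" "bb:lifts"
 shows "ip (mx f bb) (%ga. mx g ga bb') = mx (g o f) bb bb'"
proof -
 have "mx f bb = (%ga. real_of_int (dg ga (f (ec bb))))" using assms(3) by (simp add: mx_def fun_eq_iff)
 thus ?thesis using dg_ip[OF hom_in_carrier[OF assms(1) ec_closed[OF assms(3)]] assms(2)] assms(3) by (simp add: mx_def)
qed

lemma Tv_act:
 assumes S: "S:K" "{u,v,w} \<subseteq> S" and g: "g:carrier G" and h: "h:carrier G"
 shows "Tv (h \<otimes>\<^bsub>G\<^esub> g) u v w = act h (Tv g u v w)"
proof -
 obtain l r where l: "pin P v0 u l" "hl l = g" and r: "pin P w v0 r" "hl r = inv\<^bsub>G\<^esub> (g \<otimes>\<^bsub>G\<^esub> eg u w)"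
  and n: "hps P (gr l r (lp u w)) c0" and T: "Tv g u v w = DL (gr l r) id (lp u w) (lp u v +++ lp v w)"
  by (rule Tv_basic[OF S g])
 obtain k where k: "pin P v0 v0 k" "hl k = h" using hl_surj_based[OF h] by blast
 let ?k = "rp k" and ?p = "lp u w" and ?q = "lp u v +++ lp v w"
 let ?l = "k +++ l" and ?r = "r +++ rp k"
 have uvw: "u:S" "v:S" "w:S" using S(2) by auto
 note k' = pin_reverse[OF k(1)] and hk' = hl_reverse[OF k(1)] and ef = edge_facts[OF S(1) uvw(1,3)]
 have hl2: "hl ?l = h \<otimes>\<^bsub>G\<^esub> g" "pin P v0 u ?l" using hl_join[OF k(1) l(1)] pin_join[OF k(1) l(1)] k l by auto
 have hr2: "hl ?r = inv\<^bsub>G\<^esub> (h \<otimes>\<^bsub>G\<^esub> g \<otimes>\<^bsub>G\<^esub> eg u w)" "pin P w v0 ?r"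
  using hl_join[OF r(1) k'] pin_join[OF r(1) k'] hk' k r(2) g h ef(2) by (auto simp: G.inv_mult_group G.m_assoc)
 note se = simplex_edge[OF S(1)]
 have pq: "pin (convex hull S \<inter> skel1) u w ?p" "pin (convex hull S \<inter> skel1) u w ?q"
  using se pin_join uvw by blast+
 have T2: "Tv (h \<otimes>\<^bsub>G\<^esub> g) u v w = DL (gr ?l ?r) id ?p ?q"
  using Tv_eq[OF S hl2(2) hr2(2)] hl2(1) hr2(1) by simp
 have n2: "hps P (gr ?l ?r ?p) c0"
  unfolding gr_null_iff[OF hl2(2) ef(1) hr2(2)] hl2(1) hr2(1) ef(4) using inv_r g h ef(2) by simp
 let ?X = "%s. id o LIN ?p ?q s"
 have c: "ctx (id u) (id w) (gr l r)" "ctx (id u) (id w) (gr ?l ?r)" using ctx_gr[OF l(1) r(1)] ctx_gr[OF hl2(2) hr2(2)] by auto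
 have o: "ok (id u) (id w) (gr l r) ?X" "ok (id u) (id w) (gr ?l ?r) ?X"
  using DL_ok[OF chart_simplex[OF S(1)] c(1) pq] DL_ok[OF chart_simplex[OF S(1)] c(2) pq] n n2 unfolding id_o by blast+
 define Z Z' where "Z s = gr l r (?X s)" and "Z' s = gr l r (e o ?X s)" for s
 have om: "om Z" "om Z'" using ok_om(1,2)[OF o(1)] unfolding Z_def Z'_def .
 have fixX: "(e o ?X s) t = ?X s t" if "t:I1" "s = 0 | s = 1" for s t
  using o(1) that e_skel1 unfolding ok_def by auto
 have ZZ: "Z s t = Z' s t" if "t:I1" "s = 0 | s = 1" for s t
  unfolding Z_def Z'_def by (rule ctx_eq[OF c(1) fixX[symmetric] that(1)]) (use that in auto)
 have rZ: "hol (rp Z') = inv\<^bsub>Pi\<^esub> hol Z'" "om (rp Z')" by (rule hol_reverse[OF om(2)])+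
 have m: "Z 1 t = rp Z' 0 t" if "t:I1" for t using ZZ[OF that, of 1] by (simp add: reversepath_def)
 \<comment> \<open>The relative class is realised by one closed family, to which
   \<open>act_hol\<close> applies.\<close>
 let ?W = "Z +++ rp Z'"
 have W: "hol ?W = hol Z \<otimes>\<^bsub>Pi\<^esub> inv\<^bsub>Pi\<^esub> hol Z'" "om ?W" using hol_join[OF om(1) rZ(2) m] rZ(1) by auto
 have clW: "cl ?W" using W(2) ZZ[of _ 0] by (auto simp: cl_def joinpaths_def reversepath_def)
 have hk1: "hl k \<otimes>\<^bsub>G\<^esub> hl ?k = \<one>\<^bsub>G\<^esub>" using hk' h k by simp
 let ?g = "%Z s. gr k ?k (Z s)"
 note nk = natl_om[OF natl_conj[OF k(1)]]
 have "act h (Tv g u v w) = act (hl k) (hol ?W)" unfolding T DL_def Dt_def W(1) k(2) Z_def Z'_def ..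
 also have "... = hol (?g ?W)" by (rule act_hol[OF clW k(1) k' hk1])
 also have "?g ?W = ?g Z +++ rp (?g Z')" by (auto simp: joinpaths_def reversepath_def fun_eq_iff)
 also have "hol ... = hol (?g Z) \<otimes>\<^bsub>Pi\<^esub> inv\<^bsub>Pi\<^esub> hol (?g Z')"
 proof -
  have "gr k ?k (Z 1) t = rp (?g Z') 0 t" if "t:I1" for t
   using ZZ[of _ 1] that by (auto simp: reversepath_def gr_def joinpaths_def)
  from hol_join(1)[OF nk[OF om(1)] hol_reverse(2)[OF nk[OF om(2)]] this] show ?thesis
   unfolding hol_reverse(1)[OF nk[OF om(2)]] .
 qed
 also have "... = DL (gr ?l ?r) id ?p ?q"
 proof -
  \<comment> \<open>The break points 1/2, 5/8, 11/16, 3/4 of the nested bracketing go to 1/4, 1/2,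
    3/4, 7/8, where \<open>k\<close>, \<open>l\<close>, the triangle, \<open>r\<close> and the
    reverse of \<open>k\<close> meet on the other side.\<close>
  define rr :: "real => real" where "rr t = min (t / 2 + 1 / 2) (max (t / 2) (max (2 * t - 3 / 4) (min (4 * t - 2) (2 * t - 5 / 8))))" for t
  have rr: "cts I1 rr" "rr:I1 \<rightarrow> I1" "rr 0 = 0" "rr 1 = 1"
   unfolding rr_def by (intro continuous_intros) auto
  have eq: "gr k ?k (gr l r x) t = gr ?l ?r x (rr t)" if "t:I1" for x t
  proof -
   consider "t <= 1/2" | "1/2 < t" "t <= 5/8" | "5/8 < t" "t <= 11/16" | "11/16 < t" "t <= 3/4" | "3/4 < t" by linarith
   thus ?thesis
    by (cases; use that in "simp add: gr_def joinpaths_def rr_def min_def max_def field_simps";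
      (intro conjI impI arg_cong[where f = k] arg_cong[where f = l] arg_cong[where f = r])?; (simp add: field_simps)?)
  qed
  let ?Y = "%s. gr ?l ?r (?X s)" and ?Y' = "%s. gr ?l ?r (e o ?X s)"
  have YY: "?Y 0 t = ?Y' 0 t & ?Y 1 t = ?Y' 1 t" if "t:I1" for t
   by (intro conjI ctx_eq[OF c(2) fixX[symmetric] that]) auto
  have hY: "hol (?g Z) = hol (%s t. ?Y s (rr t))" "hol (?g Z') = hol (%s t. ?Y' s (rr t))"
   by (rule hol_cong; use eq nk[OF om(1)] nk[OF om(2)] in "simp add: Z_def Z'_def")+
  show ?thesis unfolding DL_def Dt_def hY by (rule hol_dif_reparam(1)[OF ok_om(1,2)[OF o(2)] YY rr])
 qed
 finally show ?thesis unfolding T2 ..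
qed

lemma ec_act: assumes "(S,g):lifts" "h:carrier G" shows "ec (S,h \<otimes>\<^bsub>G\<^esub> g) = act h (ec (S,g))"
proof -
 have S: "S:faces" "g:carrier G" using assms(1) by (auto simp: lifts_def)
 obtain v w where vw: "S = {cor S,v,w}" and ec: "ALL g. ec (S,g) = Tv g (cor S) v w" by (rule face_vertices[OF S(1)])
 have "S:K" "{cor S,v,w} \<subseteq> S" using S(1) vw by (auto simp: faces_def)
 from Tv_act[OF this S(2) assms(2)] show ?thesis using ec by simp
qed

text \<open>\<open>ind u\<close> and \<open>ind d\<close> commute with the action only up to the
  automorphisms \<open>ind1 u\<close> and \<open>ind1 d\<close> of pi_1, so their traces are
  compared by \<open>trace_commute\<close> with the action twisted by \<open>ind1 d\<close> as its
  second parametrisation. The composite \<open>ind u o ind d\<close> is linear, and hence so is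
  \<open>f\<close>, to which Kaplansky's theorem applies.\<close>

theorem right_inverse_pi2:
 assumes u: "selfmap u" and d: "selfmap d" and du: "!!x. x:carrier Pi ==> ind d (ind u x) = x"
  and i1: "!!g. g:carrier G ==> ind1 u (ind1 d g) = g" "!!g. g:carrier G ==> ind1 d (ind1 u g) = g"
  and x: "x:carrier Pi"
 shows "ind u (ind d x) = x"
proof -
 note hu = ind_hom[OF u] and hd = ind_hom[OF d] and h1 = ind1_hom[OF d] and cu = hom_in_carrier[OF ind_hom[OF u]] and cd = hom_in_carrier[OF ind_hom[OF d]]
 have c1: "ind1 d g:carrier G" "ind1 u g:carrier G" if "g:carrier G" for g
  using hom_in_carrier[OF ind1_hom[OF d] that] hom_in_carrier[OF ind1_hom[OF u] that] .
 define f where "f y = y \<otimes>\<^bsub>Pi\<^esub> inv\<^bsub>Pi\<^esub> ind u (ind d y)" for y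
 have f: "f:hom Pi Pi"
  by (rule homI) (auto simp: f_def cu cd hom_mult[OF hu] hom_mult[OF hd] O.G.inv_mult_group CP.m_ac)
 have ud2: "ind u (ind d (ind u (ind d y))) = ind u (ind d y)" if "y:carrier Pi" for y using du[OF cd[OF that]] by simp
 have inv_hom: "ind u (ind d (inv\<^bsub>Pi\<^esub> y)) = inv\<^bsub>Pi\<^esub> ind u (ind d y)" if "y:carrier Pi" for y
  using hom_inv[OF hd that] hom_inv[OF hu cd[OF that]] by simp
 have ff: "f (f y) = f y" if y: "y:carrier Pi" for y
 proof -
  have "ind u (ind d (f y)) = \<one>\<^bsub>Pi\<^esub>"
   unfolding f_def using y ud2[OF y] inv_hom[OF cu[OF cd[OF y]]] by (simp add: hom_mult[OF hd] hom_mult[OF hu] cd cu)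
  thus ?thesis using hom_in_carrier[OF f y] by (simp add: f_def[of "f y"])
 qed
 define aa where "aa h bb = (fst bb,h \<otimes>\<^bsub>G\<^esub> snd bb)" for h and bb :: "'a set \<times> (real => 'a) set"
 define R where "R = faces \<times> {\<one>\<^bsub>G\<^esub>}"
 have finR: "finite R" using finK by (simp add: R_def faces_def)
 have RB: "R \<subseteq> lifts" by (auto simp: R_def lifts_def)
 have aal: "aa h bb:lifts" if "h:carrier G" "bb:lifts" for h bb using that by (auto simp: aa_def lifts_def)
 have aaaa: "aa g (aa h bb) = aa (g \<otimes>\<^bsub>G\<^esub> h) bb" if "g:carrier G" "h:carrier G" "bb:lifts" for g h bb
  using that by (auto simp: aa_def lifts_def G.m_assoc)
 have aa1: "aa \<one>\<^bsub>G\<^esub> bb = bb" if "bb:lifts" for bb using that by (auto simp: aa_def lifts_def)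
 have bij: "bij_betw (%(g,r). aa (fh g) r) (carrier G \<times> R) lifts" if ph: "bij_betw fh (carrier G) (carrier G)" for fh
 proof -
  have "bij_betw (%(g,r). (fst r,fh g)) (carrier G \<times> R) lifts"
   unfolding bij_betw_def
  proof
   show "inj_on (%(g,r). (fst r,fh g)) (carrier G \<times> R)"
    using ph by (auto simp: inj_on_def R_def bij_betw_def)
   show "(%(g,r). (fst r,fh g)) ` (carrier G \<times> R) = lifts"
   proof (intro equalityI subsetI)
    fix bb assume "bb:(%(g,r). (fst r,fh g)) ` (carrier G \<times> R)"
    then obtain g r where gr: "g:carrier G" "r:R" "bb = (fst r,fh g)" by (elim imageE SigmaE) (simp only: prod.case)
    have "fst r:faces" using gr(2) by (auto simp: R_def)
    thus "bb:lifts" unfolding gr(3) lifts_def using bij_betw_apply[OF ph gr(1)] by (rule SigmaI)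
   next
    fix bb assume b: "bb:lifts"
    hence "snd bb:fh ` carrier G" unfolding bij_betw_imp_surj_on[OF ph] by (auto simp: lifts_def)
    then obtain g where "g:carrier G" "snd bb = fh g" by (elim imageE)
    thus "bb:(%(g,r). (fst r,fh g)) ` (carrier G \<times> R)"
     using b by (intro image_eqI[of _ _ "(g,(fst bb,\<one>\<^bsub>G\<^esub>))"]) (auto simp: R_def lifts_def prod_eq_iff)
   qed
  qed
  moreover have "aa (fh g) r = (fst r,fh g)" if gr: "g:carrier G" "r:R" for g r
  proof -
   have "snd r = \<one>\<^bsub>G\<^esub>" using gr(2) by (auto simp: R_def)
   thus ?thesis unfolding aa_def using G.r_one[OF bij_betw_apply[OF ph gr(1)]] by (simp only:)
  qed
  ultimately show ?thesis by (subst bij_betw_cong[where g = "%(g,r). (fst r,fh g)"]) auto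
 qed
 have bid: "bij_betw (%(g,r). aa g r) (carrier G \<times> R) lifts" using bij[of "%g. g"] by (simp add: bij_betw_def)
 have bd: "bij_betw (ind1 d) (carrier G) (carrier G)"
  by (rule bij_betwI[of _ _ _ "ind1 u"]) (use c1 i1 in auto)
 have iv: "inv\<^bsub>G\<^esub> g:carrier G & inv\<^bsub>G\<^esub> (inv\<^bsub>G\<^esub> g) = g" if "g:carrier G" for g using that by simp
 have act_cancel: "aa (inv\<^bsub>G\<^esub> g) (aa g bb) = bb" "aa g (aa (inv\<^bsub>G\<^esub> g) bb) = bb" if "g:carrier G" "bb:lifts" for g bb
  using that aaaa aa1 by simp_all
 have eqv: "mx F (aa h bb) (aa h' bb') = mx F bb bb'"
  if "h:carrier G" "h':carrier G" "bb:lifts" "bb':lifts" "F:hom Pi Pi" "!!y. y:carrier Pi ==> F (act h y) = act h' (F y)" for F h h' bb bb'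
 proof -
  have "ec (aa h bb) = act h (ec bb)" using ec_act[of "fst bb" "snd bb" h] that by (simp add: aa_def)
  moreover have "dg (aa h' bb') (act h' (F (ec bb))) = dg bb' (F (ec bb))"
   using dg_act[OF that(2) hom_in_carrier[OF that(5) ec_closed[OF that(3)]], of "snd bb'" "fst bb'"] that(4)
   by (cases bb') (auto simp: aa_def lifts_def)
  ultimately show ?thesis using that aal ec_closed by (simp add: mx_def)
 qed
 have eu: "mx (ind u) (aa h bb) (aa (ind1 u h) bb') = mx (ind u) bb bb'" if "h:carrier G" "bb:lifts" "bb':lifts" for h bb bb'
  by (rule eqv[OF that(1) c1(2)[OF that(1)] that(2,3) hu ind_act[OF u that(1)]])
 have ed: "mx (ind d) (aa h bb) (aa (ind1 d h) bb') = mx (ind d) bb bb'" if "h:carrier G" "bb:lifts" "bb':lifts" for h bb bb'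
  by (rule eqv[OF that(1) c1(1)[OF that(1)] that(2,3) hd ind_act[OF d that(1)]])
 have RL: "r:lifts" if "r:R" for r using that RB by auto
 have "(\<Sum>r\<in>R. ip (mx (ind d) r) (%b. mx (ind u) b r)) = (\<Sum>r\<in>R. ip (mx (ind u) r) (%b. mx (ind d) b r))"
 proof (rule trace_commute[OF finR bid bij[OF bd] iv])
  fix g r r' assume g: "g:carrier G" "r:R" "r':R"
  have ig: "inv\<^bsub>G\<^esub> g:carrier G" using g by simp
  show "mx (ind d) r (aa (ind1 d g) r') = mx (ind d) (aa (inv\<^bsub>G\<^esub> g) r) r'"
   using ed[OF g(1) aal[OF ig RL[OF g(2)]] RL[OF g(3)]] act_cancel(2)[OF g(1) RL[OF g(2)]] by simp
  show "mx (ind u) (aa (ind1 d g) r') r = mx (ind u) r' (aa (inv\<^bsub>G\<^esub> g) r)"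
   using eu[OF c1(1)[OF g(1)] RL[OF g(3)] aal[OF ig RL[OF g(2)]]] act_cancel(2)[OF g(1) RL[OF g(2)]] i1(1)[OF g(1)] by simp
 qed (use mx_supp hu hd in auto)
 hence tr: "(\<Sum>r\<in>R. mx (ind u o ind d) r r) = (\<Sum>r\<in>R. mx (ind d o ind u) r r)"
  using mx_comp[OF hd hu] mx_comp[OF hu hd] RL by (simp cong: sum.cong)
 have mf: "mx f r r = mx (ind d o ind u) r r - mx (ind u o ind d) r r" if "r:R" for r
 proof -
  note e = ec_closed[OF RL[OF that]]
  have "dg r (ec r) = dg r (f (ec r)) + dg r (ind u (ind d (ec r)))"
   using dg_mult[OF hom_in_carrier[OF f e] cu[OF cd[OF e]], of r] e cu[OF cd[OF e]] by (simp add: f_def O.G.m_assoc)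
  thus ?thesis using RL[OF that] du[OF e] by (simp add: mx_def)
 qed
 have F0: "mx f bb bb' = 0" if "bb:lifts" "bb':lifts" for bb bb'
 proof (rule idempotent_trace_zero[OF finR RB bid iv G.one_closed _ aa1 _ _ _ _ _ _ that])
  show "inv\<^bsub>G\<^esub> \<one>\<^bsub>G\<^esub> = \<one>\<^bsub>G\<^esub>" by simp
  show "!!g b. g:carrier G ==> b:lifts ==> aa g b:lifts & aa (inv\<^bsub>G\<^esub> g) (aa g b) = b" using aal act_cancel by blast
  show "fin_supp (mx f a)" for a by (rule mx_supp(1)[OF f])
  show "mx f a b ~= 0 ==> b:lifts" for a b by (rule mx_supp(2)[OF f])
  show "(\<Sum>r\<in>R. mx f r r) = 0" using tr by (simp add: mf sum_subtractf)
  show "ip (mx f a) (%c. mx f c b) = mx f a b" if "a:lifts" for a b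
   using mx_comp[OF f f that] ff[OF ec_closed[OF that]] that by (simp add: mx_def)
  show "mx f (aa g a) (aa g b) = mx f a b" if "g:carrier G" "a:lifts" "b:lifts" for g a b
  proof (rule eqv[OF that(1,1,2,3) f])
   fix y assume y: "y:carrier Pi"
   note ag = act_hom[OF that(1)]
   have "ind u (ind d (act g y)) = act g (ind u (ind d y))"
    using ind_act[OF d that(1) y] ind_act[OF u c1(1)[OF that(1)] cd[OF y]] i1(1)[OF that(1)] by simp
   thus "f (act g y) = act g (f y)"
    using y hom_mult[OF ag y O.G.inv_closed[OF cu[OF cd[OF y]]]] hom_inv[OF ag cu[OF cd[OF y]]] by (simp add: f_def)
  qed
 qed
 have "dg bb' (f x) = 0" for bb'
 proof (cases "bb':lifts")
  case True
  have "mx f bb bb' = 0" for bb using F0[OF _ True] by (cases "bb:lifts") (auto simp: mx_def)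
  thus ?thesis using dg_ip[OF x f, of bb'] by (simp add: ip_def)
 qed (simp add: dg_def)
 hence "f x = \<one>\<^bsub>Pi\<^esub>" by (rule dg_inject[OF hom_in_carrier[OF f x]])
 thus ?thesis using O.G.inv_equality[of x "inv\<^bsub>Pi\<^esub> ind u (ind d x)"] x cu[OF cd[OF x]] unfolding f_def by simp
qed

end

section \<open>Parametrised triangles and maps defined cell by cell\<close>

lemma factor_through:
 fixes q :: "'x::t2_space => 'y::metric_space"
 assumes "compact X" "cts X q" "ctm (tos X) Z h"
  and "!!x y. x:X ==> y:X ==> q x = q y ==> h x = h y"
 shows "EX g. ctm (tos (q ` X)) Z g & (ALL x:X. g (q x) = h x)"
proof -
 have "quotient_map (tos X) (tos (q ` X)) q"
 proof (rule T1_Spaces.continuous_imp_quotient_map)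
  show "Hausdorff_space (tos (q ` X))" by (rule Hausdorff_space_subtopology[OF Hausdorff_space_euclidean])
 qed (use assms in "auto simp: compact_space_subtopology")
 then obtain g where g: "ctm (tos (q ` X)) Z g" "ALL x:topspace (tos X). g (q x) = h x"
 proof (rule quotient_map_lift_exists[OF _ assms(3)])
  show "h x = h y" if "x:topspace (tos X)" "y:topspace (tos X)" "q x = q y" for x y
   using assms(4)[of x y] that by simp
 qed blast
 thus ?thesis unfolding topspace_euclidean_subtopology by blast
qed

definition jn :: "(real => 'z) => (real => 'z) => real => 'z" where
 "jn p q t = (if t <= 1 / 2 then p (2 * t) else q (2 * t - 1))"

text \<open>A square onto the triangle: the side \<open>t = 0\<close> goes to the edge from
  \<open>a\<close> to \<open>c\<close>, the side \<open>t = 1\<close> to the broken path through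
  \<open>b\<close>, and the other two sides collapse to \<open>a\<close> and \<open>c\<close>. Maps
  of the triangle thus become homotopies of paths with fixed ends.\<close>

definition tri :: "'b::real_vector => 'b => 'b => real \<times> real => 'b" where
 "tri a b c = (%(t,y). (1 - y - t * min y (1 - y)) *\<^sub>R a + (2 * t * min y (1 - y)) *\<^sub>R b + (y - t * min y (1 - y)) *\<^sub>R c)"

lemma tri_edges:
 assumes "y:I1"
 shows "tri a b c (0,y) = lp a c y" "tri a b c (1,y / 2) = lp a b y" "tri a b c (1,(1 + y) / 2) = lp b c y"
proof -
 have m: "min (y / 2) (1 - y / 2) = y / 2" "min ((1 + y) / 2) (1 - (1 + y) / 2) = (1 - y) / 2"
  "1 - y / 2 - y / 2 = 1 - y" "1 - (1 + y) / 2 - (1 - y) / 2 = 0" "(1 + y) / 2 - (1 - y) / 2 = y"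
  using assms by (auto simp: min_def field_simps)
 show "tri a b c (0,y) = lp a c y" "tri a b c (1,y / 2) = lp a b y" "tri a b c (1,(1 + y) / 2) = lp b c y"
  unfolding tri_def prod.case m mult_1_left mult_1_right by (simp_all add: m linepath_def)
qed

lemma tri_image: "tri a b c ` (I2) = convex hull {a,b,c}"
proof
 have m: "0 <= t * min y (1 - y)" "t * min y (1 - y) <= min y (1 - y)" if "t:I1" "y:I1" for t y :: real
  by (use that in simp) (rule mult_left_le_one_le, use that in auto)
 show "tri a b c ` (I2) \<subseteq> convex hull {a,b,c}"
 proof
  fix z assume "z:tri a b c ` (I2)"
  then obtain t y where ty: "t:I1" "y:I1" "z = tri a b c (t,y)" by auto
  thus "z:convex hull {a,b,c}"
   using m[OF ty(1,2)] unfolding convex_hull_3 mem_Collect_eq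
   by (intro exI[of _ "1 - y - t * min y (1 - y)"] exI[of _ "2 * t * min y (1 - y)"] exI[of _ "y - t * min y (1 - y)"])
    (auto simp: tri_def)
 qed
 show "convex hull {a,b,c} \<subseteq> tri a b c ` (I2)"
 proof
  fix z assume "z:convex hull {a,b,c}"
  then obtain u v w where uvw: "0 <= u" "0 <= v" "0 <= w" "u + v + w = 1" "z = u *\<^sub>R a + v *\<^sub>R b + w *\<^sub>R c"
   unfolding convex_hull_3 by blast
  define y where "y = w + v / 2"
  define t where "t = v / (2 * min y (1 - y))"
  have y: "1 - y = u + v / 2" using uvw(4) by (simp add: y_def)
  have v: "v / 2 <= min y (1 - y)" using uvw(1,3) unfolding y by (simp add: y_def)
  have tm: "2 * t * min y (1 - y) = v"
  proof (cases "min y (1 - y) = 0")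
   case True thus ?thesis using v uvw(2) by simp
  qed (simp add: t_def)
  have "t:I1"
  proof -
   define M where "M = min y (1 - y)"
   have "v <= 2 * M" using v unfolding M_def[symmetric] by simp
   thus ?thesis using uvw(2) unfolding t_def M_def[symmetric] by (auto simp: divide_simps)
  qed
  moreover have "y:I1" using uvw y by (auto simp: y_def)
  moreover have "tri a b c (t,y) = z"
  proof -
   have m: "t * min y (1 - y) = v / 2" using tm by simp
   show ?thesis unfolding tri_def prod.case tm unfolding m unfolding uvw(5) y by (simp add: y_def)
  qed
  ultimately show "z:tri a b c ` (I2)" by (intro image_eqI[of _ _ "(t,y)"]) auto
 qed
qed

lemma bary_unique:
 fixes a b c :: "'a::real_vector"
 assumes "~ affine_dependent {a,b,c}" "a ~= b" "a ~= c" "b ~= c"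
  and eq: "u *\<^sub>R a + v *\<^sub>R b + w *\<^sub>R c = u' *\<^sub>R a + v' *\<^sub>R b + w' *\<^sub>R c" "u + v + w = u' + v' + w'"
 shows "u = u'" "v = v'" "w = w'"
proof -
 define U where "U x = (if x = a then u - u' else if x = b then v - v' else w - w')" for x
 have "sum U {a,b,c} = 0" "(\<Sum>x\<in>{a,b,c}. U x *\<^sub>R x) = 0"
  using assms(2-4) eq by (auto simp: U_def algebra_simps)
 hence "ALL x:{a,b,c}. U x = 0"
  using assms(1) affine_dependent_explicit_finite[of "{a,b,c}"] by blast
 thus "u = u'" "v = v'" "w = w'" using assms(2-4) by (auto simp: U_def)
qed

lemma tri_fibres:
 fixes a b c :: "'a::real_vector"
 assumes "~ affine_dependent {a,b,c}" "a ~= b" "a ~= c" "b ~= c"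
  and "t:I1" "y:I1" "t':I1" "y':I1" "tri a b c (t,y) = tri a b c (t',y')"
 shows "y = y' & (t = t' | y = 0 | y = 1)"
proof -
 note b = bary_unique[OF assms(1-4) assms(9)[unfolded tri_def prod.case]]
 have "2 * y = 2 * y'" "t * min y (1 - y) = t' * min y' (1 - y')" using b by (auto simp: algebra_simps)
 thus ?thesis by (auto simp: min_def split: if_splits)
qed

text \<open>The square \<open>{0..1} \<times> {0..1}\<close> as a quotient of itself: \<open>t = 0\<close> and \<open>t = 1\<close> are collapsed to the corners
  \<open>(0, 0)\<close> and \<open>(1, 1)\<close>, and \<open>s = 0\<close>, \<open>s = 1\<close> are mapped to the two boundary arcs between them.\<close>

definition sq :: "real \<times> real => real \<times> real" where
 "sq = (%(s,t). (t + min t (1 - t) * (1 - 2 * s),t - min t (1 - t) * (1 - 2 * s)))"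

lemma sq_edges:
 assumes "t:I1"
 shows "sq (0,t / 2) = (t,0)" "sq (0,(1 + t) / 2) = (1,t)" "sq (1,t / 2) = (0,t)" "sq (1,(1 + t) / 2) = (t,1)"
 using assms by (auto simp: sq_def min_def field_simps)

lemma sq_image: "sq ` (I2) = I2"
proof
 have m: "\<bar>min t (1 - t) * (1 - 2 * s)\<bar> <= min t (1 - t)" if "s:I1" "t:I1" for s t :: real
 proof -
  have "\<bar>min t (1 - t)\<bar> = min t (1 - t)" using that by auto
  thus ?thesis unfolding abs_mult by (simp only:) (rule mult_left_le, use that in "auto simp: abs_le_iff")
 qed
 show "sq ` (I2) \<subseteq> I2"
 proof
  fix z assume "z:sq ` (I2)"
  then obtain s t where st: "s:I1" "t:I1" "z = sq (s,t)" by auto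
  thus "z:I2" using m[OF st(1,2)] by (auto simp: sq_def)
 qed
 show "I2 \<subseteq> sq ` (I2)"
 proof
  fix z :: "real \<times> real" assume "z:I2"
  then obtain x y where xy: "z = (x,y)" "x:I1" "y:I1" by auto
  define t m where "t = (x + y) / 2" and "m = min t (1 - t)"
  define s where "s = (1 - (x - y) / (2 * m)) / 2"
  have t: "t:I1" using xy by (auto simp: t_def)
  have "2 * m = x + y | 2 * m = 2 - (x + y)" unfolding m_def t_def min_def by argo
  hence b: "\<bar>x - y\<bar> <= 2 * m" by (rule disjE; use xy in "simp add: abs_le_iff")
  have "0 <= m" using b by linarith
  hence "\<bar>(x - y) / (2 * m)\<bar> <= 1" using b by (auto simp: abs_divide divide_le_eq_1)
  hence "s:I1" unfolding s_def atLeastAtMost_iff abs_le_iff by argo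
  moreover have "1 - 2 * s = (x - y) / (2 * m)" unfolding s_def by argo
  hence "m * (1 - 2 * s) = (x - y) / 2" using b by (cases "m = 0") auto
  hence "sq (s,t) = z" unfolding sq_def prod.case m_def[symmetric] by (simp add: t_def xy(1) field_simps)
  ultimately show "z:sq ` (I2)" using t by (intro image_eqI[of _ _ "(s,t)"]) auto
 qed
qed

lemma sq_fibres:
 assumes "s:I1" "t:I1" "s':I1" "t':I1" "sq (s,t) = sq (s',t')"
 shows "t = t' & (s = s' | t = 0 | t = 1)"
proof -
 have e: "t + min t (1 - t) * (1 - 2 * s) = t' + min t' (1 - t') * (1 - 2 * s')"
  "t - min t (1 - t) * (1 - 2 * s) = t' - min t' (1 - t') * (1 - 2 * s')"
  using assms(5) by (auto simp: sq_def)
 hence "t = t'" by linarith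
 moreover have "min t (1 - t) = 0 | s = s'" using e `t = t'` by simp
 ultimately show ?thesis by (auto simp: min_def split: if_splits)
qed

context cplx2 begin

lemma glue:
 assumes c: "!!S. S:K ==> ctm (tos (convex hull S)) Z (fh S)"
  and m: "!!S T z. S:K ==> T:K ==> T \<subseteq> S ==> z:convex hull T ==> fh S z = fh T z"
 shows "EX F. ctm (tos P) Z F & (ALL S:K. ALL z:convex hull S. F z = fh S z)"
proof -
 have "EX F. ctm (tos P) Z F & (ALL z S. S:K & z:topspace (tos P) \<inter> convex hull S --> F z = fh S z)"
 proof (rule pasting_lemma_exists_closed[OF finK, where T = "%S. convex hull S"])
  show "topspace (tos P) \<subseteq> \<Union> ((%S. convex hull S) ` K)" using P by simp
  fix S assume S: "S:K"
  have "closed (convex hull S)" using compact_hull[OF S] by (rule compact_imp_closed)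
  thus "closedin (tos P) (convex hull S)" using hull_sub[OF S] by (simp add: closed_subset)
  show "ctm (subtopology (tos P) (convex hull S)) Z (fh S)"
   using c[OF S] hull_sub[OF S] by (simp add: subtopology_subtopology Int_absorb1)
  fix T z assume T: "T:K" "z:topspace (tos P) \<inter> convex hull S \<inter> convex hull T"
  have "z:convex hull (S \<inter> T)" using T inter[OF S T(1)] by auto
  moreover have ne: "S \<inter> T ~= {}" using calculation by auto
  ultimately show "fh S z = fh T z"
   using m[OF S face[OF S _ ne]] m[OF T(1) face[OF S _ ne]] by simp
 qed blast
 then obtain F where "ctm (tos P) Z F" "ALL z S. S:K & z:topspace (tos P) \<inter> convex hull S --> F z = fh S z" by blast
 thus ?thesis using hull_sub by (intro exI[of _ F]) auto
qed

definition face_tri :: "'a => 'a => 'a => bool" where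
 "face_tri a b c \<longleftrightarrow> {a,b,c}:K & ord a < ord b & ord b < ord c"

definition edge2 :: "'a => 'a => bool" where "edge2 v w \<longleftrightarrow> {v,w}:K & ord v < ord w"

lemma simplex_cases:
 assumes "S:K"
 obtains v where "S = {v}" | v w where "S = {v,w}" "edge2 v w" | a b c where "S = {a,b,c}" "face_tri a b c"
proof -
 have i: "inj_on ord S" by (rule inj_on_subset[OF ord_inj]) (use assms in auto)
 have "finite S" "card S <= 3" "card S > 0" using simp[OF assms] by (auto simp: card_gt_0_iff)
 then consider "card S = 1" | "card S = 2" | "card S = 3" by linarith
 thus ?thesis
 proof cases
  case 1 thus ?thesis using that(1) by (auto simp: card_1_singleton_iff)
 next
  case 2
  then obtain v w where vw: "S = {v,w}" "v ~= w" by (auto simp: card_2_iff)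
  hence "ord v ~= ord w" using inj_onD[OF i, of v w] by auto
  thus ?thesis using that(2)[of v w] that(2)[of w v] vw assms by (auto simp: edge2_def insert_commute neq_iff)
 next
  case 3
  then obtain u v w where uvw: "S = {u,v,w}" "u ~= v" "u ~= w" "v ~= w" by (auto simp: card_3_iff)
  have perm: "{u,w,v} = S" "{v,u,w} = S" "{v,w,u} = S" "{w,u,v} = S" "{w,v,u} = S" using uvw(1) by auto
  have "ord u ~= ord v" "ord u ~= ord w" "ord v ~= ord w"
   using uvw inj_onD[OF i, of u v] inj_onD[OF i, of u w] inj_onD[OF i, of v w] by auto
  then consider "ord u < ord v" "ord v < ord w" | "ord u < ord w" "ord w < ord v" | "ord v < ord u" "ord u < ord w"
   | "ord v < ord w" "ord w < ord u" | "ord w < ord u" "ord u < ord v" | "ord w < ord v" "ord v < ord u" by linarith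
  thus ?thesis
  proof cases
   case 1 thus ?thesis using that(3)[OF uvw(1)] assms by (simp add: face_tri_def uvw(1))
  next
   case 2 thus ?thesis using that(3)[OF perm(1)[symmetric]] assms by (simp add: face_tri_def perm(1))
  next
   case 3 thus ?thesis using that(3)[OF perm(2)[symmetric]] assms by (simp add: face_tri_def perm(2))
  next
   case 4 thus ?thesis using that(3)[OF perm(3)[symmetric]] assms by (simp add: face_tri_def perm(3))
  next
   case 5 thus ?thesis using that(3)[OF perm(4)[symmetric]] assms by (simp add: face_tri_def perm(4))
  next
   case 6 thus ?thesis using that(3)[OF perm(5)[symmetric]] assms by (simp add: face_tri_def perm(5))
  qed
 qed
qed

lemma face_tri_edges: "face_tri a b c ==> edge2 a b & edge2 b c & edge2 a c"
 using face[of "{a,b,c}" "{a,b}"] face[of "{a,b,c}" "{b,c}"] face[of "{a,b,c}" "{a,c}"]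
 by (auto simp: face_tri_def edge2_def)

text \<open>The target is an arbitrary space, since the theorem serves for maps to the presentation
  complex and to \<open>P\<close>, and, with paths as values, for homotopies.\<close>

theorem skeletal_extension:
 fixes Z :: "'z topology"
 assumes V: "!!v. {v}:K ==> zV v:topspace Z"
  and E: "!!v w. edge2 v w ==> ctm (tos I1) Z (E v w)" "!!v w. edge2 v w ==> E v w 0 = zV v & E v w 1 = zV w"
  and T: "!!a b c. face_tri a b c ==> ctm (tos (I2)) Z (Ph a b c)"
   "!!a b c y. face_tri a b c ==> y:I1 ==> Ph a b c (0,y) = E a c y & Ph a b c (1,y) = jn (E a b) (E b c) y &
    Ph a b c (y,0) = zV a & Ph a b c (y,1) = zV c"
 shows "EX F. ctm (tos P) Z F & (ALL v. {v}:K --> F v = zV v) & (ALL v w. edge2 v w --> (ALL y:I1. F (lp v w y) = E v w y)) &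
  (ALL a b c. face_tri a b c --> (ALL z:I2. F (tri a b c z) = Ph a b c z))"
proof -
 define spec where "spec S fh \<longleftrightarrow> (ALL v:S. fh v = zV v) & (ALL v:S. ALL w:S. edge2 v w --> (ALL y:I1. fh (lp v w y) = E v w y)) &
  (ALL a b c. S = {a,b,c} & face_tri a b c --> (ALL z:I2. fh (tri a b c z) = Ph a b c z))" for S and fh :: "'a => 'z"
 have vK: "{v}:K" if "S:K" "v:S" for S v using face[OF that(1), of "{v}"] that(2) by auto
 have ex: "EX fh. ctm (tos (convex hull S)) Z fh & spec S fh" if S: "S:K" for S
 proof (cases rule: simplex_cases[OF S])
  case (1 v)
  thus ?thesis using V[OF vK[OF S, of v]] by (intro exI[of _ "%_. zV v"]) (auto simp: spec_def edge2_def face_tri_def)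
 next
  case (2 v w)
  have vw: "v ~= w" "~ edge2 w v" using 2 by (auto simp: edge2_def)
  have "lp v w ` I1 = convex hull S" using path_image_linepath[of v w] by (simp add: path_image_def 2(1) segment_convex_hull)
  moreover have "EX g. ctm (tos (lp v w ` I1)) Z g & (ALL y:I1. g (lp v w y) = E v w y)"
  proof (rule factor_through[OF _ _ E(1)[OF 2(2)]])
   fix x y assume "lp v w x = lp v w y"
   hence "(x - y) *\<^sub>R (w - v) = 0" by (simp add: linepath_def algebra_simps)
   thus "E v w x = E v w y" using vw(1) by simp
  qed (auto intro: continuous_on_linepath)
  ultimately obtain g where g: "ctm (tos (convex hull S)) Z g" "ALL y:I1. g (lp v w y) = E v w y" by auto
  have "g v = zV v" "g w = zV w" using g(2)[rule_format, of 0] g(2)[rule_format, of 1] E(2)[OF 2(2)] by (auto simp: linepath_def)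
  moreover have "~ face_tri a b c" if "S = {a,b,c}" for a b c
  proof
   assume "face_tri a b c"
   hence "a ~= b" "b ~= c" "a ~= c" by (auto simp: face_tri_def)
   hence "card S = 3" unfolding that by simp
   thus False using 2(1) vw(1) by simp
  qed
  ultimately show ?thesis
   using g vw unfolding spec_def 2(1) by (intro exI[of _ g]) (auto simp: edge2_def)
 next
  case (3 a b c)
  have d: "a ~= b" "a ~= c" "b ~= c" using 3 by (auto simp: face_tri_def)
  note ed = face_tri_edges[OF 3(2)]
  have aff: "~ affine_dependent {a,b,c}" using simp[OF S] 3(1) by simp
  have "EX g. ctm (tos (tri a b c ` (I2))) Z g & (ALL z:I2. g (tri a b c z) = Ph a b c z)"
  proof (rule factor_through[OF _ _ T(1)[OF 3(2)]])
   show "compact (I2)" by (intro compact_Times) auto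
   show "cts (I2) (tri a b c)" unfolding tri_def case_prod_unfold by (intro continuous_intros)
   fix x y assume xy: "x:I2" "y:I2" and eq: "tri a b c x = tri a b c y"
   have "snd x = snd y & (fst x = fst y | snd x = 0 | snd x = 1)"
    using tri_fibres[OF aff d, of "fst x" "snd x" "fst y" "snd y"] xy eq by (auto simp: mem_Times_iff)
   thus "Ph a b c x = Ph a b c y"
    using T(2)[OF 3(2), of "fst x"] T(2)[OF 3(2), of "fst y"] xy by (cases x; cases y) auto
  qed
  then obtain g where g: "ctm (tos (convex hull S)) Z g" "ALL z:I2. g (tri a b c z) = Ph a b c z"
   unfolding tri_image 3(1) by blast
  have e: "g (lp a c y) = E a c y" "g (lp a b y) = E a b y" "g (lp b c y) = E b c y" if "y:I1" for y
  proof -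
   have y: "y / 2:I1" "(1 + y) / 2:I1" using that by auto
   show "g (lp a c y) = E a c y" unfolding tri_edges(1)[OF that, of a b c, symmetric] using g(2) T(2)[OF 3(2) that] that by auto
   show "g (lp a b y) = E a b y"
    unfolding tri_edges(2)[OF that, of a b c, symmetric] using g(2) T(2)[OF 3(2) y(1)] that y by (auto simp: jn_def)
   show "g (lp b c y) = E b c y"
    unfolding tri_edges(3)[OF that, of a b c, symmetric] using g(2) T(2)[OF 3(2) y(2)] that y E(2) ed
    by (cases "y = 0") (auto simp: jn_def field_simps)
  qed
  have v: "g a = zV a" "g b = zV b" "g c = zV c"
   using e(1)[of 0] e(2)[of 1] e(3)[of 1] E(2) ed by (auto simp: linepath_def)
  have uniq: "a' = a & b' = b & c' = c" if "{a,b,c} = {a',b',c'}" "face_tri a' b' c'" for a' b' c'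
  proof -
   have o: "ord a < ord b" "ord b < ord c" "ord a' < ord b'" "ord b' < ord c'" using 3(2) that(2) by (auto simp: face_tri_def)
   have "a':{a,b,c}" "b':{a,b,c}" "c':{a,b,c}" unfolding that(1) by auto
   thus ?thesis using o by (auto dest: less_trans)
  qed
  have nord: "~ edge2 b a" "~ edge2 c b" "~ edge2 c a" "~ edge2 x x" for x using 3(2) by (auto simp: edge2_def face_tri_def)
  have "spec S g" unfolding spec_def 3(1)
  proof (intro conjI allI impI)
   show "ALL v:{a,b,c}. g v = zV v" using v by auto
   show "ALL v:{a,b,c}. ALL w:{a,b,c}. edge2 v w --> (ALL y:I1. g (lp v w y) = E v w y)"
    using e nord by blast
   fix a' b' c' assume "{a,b,c} = {a',b',c'} & face_tri a' b' c'"
   with uniq have "a' = a" "b' = b" "c' = c" by blast+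
   thus "ALL z:I2. g (tri a' b' c' z) = Ph a' b' c' z" using g(2) by simp
  qed
  thus ?thesis using g(1) by blast
 qed
 define fh where "fh S = (SOME fh. ctm (tos (convex hull S)) Z fh & spec S fh)" for S
 have fh: "ctm (tos (convex hull S)) Z (fh S)" "spec S (fh S)" if "S:K" for S
  using someI_ex[OF ex[OF that]] unfolding fh_def by auto
 have "fh S z = fh T z" if S: "S:K" and T: "T:K" "T \<subseteq> S" and z: "z:convex hull T" for S T z
 proof (cases rule: simplex_cases[OF T(1)])
  case (1 v)
  thus ?thesis using fh(2)[OF S] fh(2)[OF T(1)] T(2) z by (auto simp: spec_def)
 next
  case (2 v w)
  then obtain y where y: "y:I1" "z = lp v w y"
   using z by (auto simp: segment_convex_hull[symmetric] path_image_linepath[symmetric] path_image_def)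
  have "v:T" "w:T" "v:S" "w:S" using 2(1) T(2) by auto
  thus ?thesis using fh(2)[OF S] fh(2)[OF T(1)] y 2(2) unfolding spec_def by metis
 next
  case (3 a b c)
  hence "card T = 3" by (auto simp: face_tri_def card_insert_if)
  hence "T = S" using simp[OF S] T(2) by (intro card_seteq) auto
  thus ?thesis by simp
 qed
 then obtain F where F: "ctm (tos P) Z F" "ALL S:K. ALL z:convex hull S. F z = fh S z" using glue[of Z fh] fh(1) by blast
 show ?thesis
 proof (intro exI[of _ F] conjI allI impI ballI)
  fix v assume v: "{v}:K"
  thus "F v = zV v" using F(2) fh(2)[OF v] by (auto simp: spec_def)
 next
  fix v w y assume e: "edge2 v w" and y: "y:I1"
  hence S: "{v,w}:K" by (simp add: edge2_def)
  have "lp v w y:convex hull {v,w}" using y path_image_linepath[of v w] by (auto simp: path_image_def segment_convex_hull[symmetric])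
  thus "F (lp v w y) = E v w y" using F(2) S fh(2)[OF S] e y by (auto simp: spec_def)
 next
  fix a b c z assume f: "face_tri a b c" and z: "z:I2"
  hence S: "{a,b,c}:K" by (simp add: face_tri_def)
  have "tri a b c z:convex hull {a,b,c}" using z tri_image[of a b c] by blast
  thus "F (tri a b c z) = Ph a b c z" using F(2) S fh(2)[OF S] f z unfolding spec_def by metis
 qed (rule F(1))
qed

end

section \<open>From equal classes to homotopies of discs\<close>

context loopspace begin

lemma loops_hm3:
 assumes H: "hm3 (%_. a) (%_. c) H" and e: "!!x t. x:I1 ==> t:I1 ==> H x 0 t = H x 1 t"
  and p: "!!s. s:I1 ==> p s = pf (H 0 s) & q s = pf (H 1 s)"
 shows "homotopic_loops (Om P a c) p q"
proof -
 have c3: "cts (I1 \<times> I2) (%(x,s,t). H x s t)" using H by (simp add: hm3_def)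
 have "cts ((I2) \<times> I1) (%((x,s),t). H x s t)"
  by (auto simp: case_prod_beta' intro!: cont3[OF c3] continuous_intros)
 hence c: "cts (I2) (%(x,s). pf (H x s))"
  using continuous_pf[of "I2" "%(x,s). H x s"] by (simp add: case_prod_beta')
 have "pf (H x s):Om P a c" if "x:I1" "s:I1" for x s
  using hmap_row[OF hm3_row[OF H that(1)] that(2)] by (auto simp: Om_def)
 thus ?thesis
  using c e p unfolding homotopic_loops
  by (intro exI[of _ "%(x,s). pf (H x s)"]) (auto simp: pathstart_def pathfinish_def intro!: pf_cong)
qed

lemma I_comb: "rr:I1 \<rightarrow> I1 ==> x:I1 ==> t:I1 ==> (1 - x) * t + x * rr t:I1"
 using convexD_alt[of I1 t "rr t" x] by (simp add: Pi_iff)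

lemma hm3_reparam:
 assumes W: "hmap P a c W" and rr: "cts I1 rr" "rr:I1 \<rightarrow> I1" "rr 0 = 0" "rr 1 = 1"
 shows "hm3 (%_. a) (%_. c) (%x s t. W s ((1 - x) * t + x * rr t))"
proof -
 note I = I_comb[OF rr(2)]
 have "cts (I1 \<times> I2) (%z. W (fst (snd z)) ((1 - fst z) * snd (snd z) + fst z * rr (snd (snd z))))"
  by (rule cont2[of "I2"]) (use W I in "auto simp: hmap_def intro!: continuous_intros continuous_on_compose2[OF rr(1)]")
 thus ?thesis using W I rr(3,4) unfolding hm3_def hmap_def by (auto simp: case_prod_beta')
qed

text \<open>Conjugation by \<open>gr l r\<close> is injective on homotopy classes since \<open>gr l\<^sup>-\<^sup>1 r\<^sup>-\<^sup>1\<close> undoes it up to a natural homotopy.\<close>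

lemma hol_rel:
 assumes X: "hmap P a c X" and Y: "hmap P a c Y" and e: "!!t. t:I1 ==> X 0 t = Y 0 t & X 1 t = Y 1 t"
  and l: "pin P v0 a l" and r: "pin P c v0 r" and n: "hps P (gr l r (X 0)) c0"
  and eq: "hol (%s. gr l r (X s)) = hol (%s. gr l r (Y s))"
 shows "EX Z. hm3 (%_. a) (%_. c) Z & (ALL s:I1. ALL t:I1. Z 0 s t = X s t & Z 1 s t = Y s t & Z s 0 t = X 0 t & Z s 1 t = X 1 t)"
proof -
 define W where "W = X +++ rp Y"
 have m: "X 1 t = rp Y 0 t" if "t:I1" for t using e[OF that] by (simp add: reversepath_def)
 have W: "hmap P a c W" unfolding W_def by (rule hmap_vjoin[OF X hmap_reverse[OF Y] m])
 have W0: "W 0 = X 0" "W 1 = Y 0" by (simp_all add: W_def joinpaths_def reversepath_def)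
 let ?g = "%X s. gr l r (X s)"
 have om: "om (?g X)" "om (?g Y)"
  using omI[OF hmap_gr[OF l X r], of 0] omI[OF hmap_gr[OF l Y r], of 0] n homotopic_paths_trans[OF homotopic_paths_eq n, of "gr l r (Y 0)"]
   pin_gr[OF l hmap_row[OF Y] r, of 0] e by (auto simp: pin_def gr_def joinpaths_def)
 have gW: "?g W = ?g X +++ rp (?g Y)" by (auto simp: W_def joinpaths_def reversepath_def fun_eq_iff)
 have gm: "?g X 1 t = rp (?g Y) 0 t" if "t:I1" for t
  using e that by (auto simp: reversepath_def gr_def joinpaths_def)
 have "hol (?g W) = \<one>\<^bsub>Pi\<^esub>" "om (?g W)"
  unfolding gW using hol_join[OF om(1) hol_reverse(2)[OF om(2)] gm] hol_reverse(1)[OF om(2)] hol_closed[OF om(2)] eq by auto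
 moreover have "?g W 0 t = ?g W 1 t" if "t:I1" for t unfolding W0 using e that by (auto simp: gr_def joinpaths_def)
 ultimately have A: "cl (?g W)" "hol (?g W) = \<one>\<^bsub>Pi\<^esub>" by (auto simp: cl_def)
 have p0: "pin P v0 v0 (gr l r (X 0))" by (rule pin_gr[OF l hmap_row[OF X] r]) simp
 have B: "cl (%s. gr l r (X 0))" using om_const(1)[OF p0 n] by (simp add: cl_def)
 have "free_eq (?g W) (%s. gr l r (X 0))" by (rule free_eq_hol[OF A(1) B]) (simp only: A(2) om_const(2)[OF p0 n])
 then obtain H where H: "sph3 H" "ALL x:I1. ALL t:I1. H x 0 t = H x 1 t" "ALL s:I1. ALL t:I1. H 0 s t = gr l r (W s) t & H 1 s t = gr l r (X 0) t"
  unfolding free_eq_def by blast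
 let ?l = "rp l" and ?r = "rp r"
 note l' = pin_reverse[OF l] and r' = pin_reverse[OF r]
 have hc: "hm3 (%_. u) (%_. w) (%x s. p)" if "pin P u w p" for u w p by (rule hm3_const[OF hmap_const[OF that]])
 \<comment> \<open>At \<open>x = 0\<close> the tails are constant; at \<open>x = 1\<close> they run
   back along all of \<open>l\<close> and \<open>r\<close> and out again, which is conjugation
   undone by its inverse.\<close>
 define N where "N x s = gr (%t. l (1 - x * t)) (%t. r (x * (1 - t))) (gr (%t. l (1 - x * (1 - t))) (%t. r (x * t)) (W s))" for x s
 have lc: "cts I1 l" "cts I1 r" "!!t. t:I1 ==> l t:P & r t:P" "l 0 = v0" "l 1 = a" "r 0 = c" "r 1 = v0"
  using l r by (auto simp: pin_def path_def path_image_def pathstart_def pathfinish_def)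
 have hp: "hm3 (%x. f (fh x 0)) (%x. f (fh x 1)) (%x s t. f (fh x t))"
  if "f = l | f = r" "cts (I2) (%(x,t). fh x t)" "!!x t. x:I1 ==> t:I1 ==> fh x t:I1" for f and fh :: "real => real => real"
 proof (rule hm3_path)
  have f: "cts I1 f" using that(1) lc by auto
  show "cts (I2) (%(x,t). f (fh x t))"
   using continuous_on_compose2[OF f that(2)] that(3) by (force simp: case_prod_beta')
 qed (use that lc in auto)
 have xt: "1 - x * t:I1" "x * (1 - t):I1" "1 - x * (1 - t):I1" "x * t:I1" if "x:I1" "t:I1" for x t :: real
  using that mult_le_one[of x t] mult_le_one[of x "1 - t"] by auto
 have cx: "cts (I2) (%(x,t). 1 - x * t)" "cts (I2) (%(x,t). x * (1 - t))"
  "cts (I2) (%(x,t). 1 - x * (1 - t))" "cts (I2) (%(x,t). x * t :: real)"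
  unfolding case_prod_beta' by (intro continuous_intros)+
 have h: "hm3 (%_. a) (%x. l (1 - x)) (%x s t. l (1 - x * t))" "hm3 (%x. l (1 - x)) (%_. a) (%x s t. l (1 - x * (1 - t)))"
  "hm3 (%_. c) r (%x s t. r (x * t))" "hm3 r (%_. c) (%x s t. r (x * (1 - t)))"
  using hp[of l "%x t. 1 - x * t", OF _ cx(1)] hp[of l "%x t. 1 - x * (1 - t)", OF _ cx(3)] hp[of r "%x t. x * t", OF _ cx(4)]
   hp[of r "%x t. x * (1 - t)", OF _ cx(2)] xt lc(5,6) by simp_all
 have "hm3 (%_. a) (%_. c) N"
  unfolding N_def gr_def by (rule hm3_join[OF h(1) hm3_join[OF hm3_join[OF h(2) hm3_join[OF hm3_const[OF W] h(3)]] h(4)]])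
 moreover have "N x 0 t = N x 1 t" if "x:I1" "t:I1" for x t
  using that e unfolding N_def W0 by (auto simp: gr_def joinpaths_def)
 ultimately have N: "hm3 (%_. a) (%_. c) N" "!!x t. x:I1 ==> t:I1 ==> N x 0 t = N x 1 t" by blast+
 \<comment> \<open>In \<open>N 0 s\<close> the row \<open>W s\<close> occupies the parameters from
   5/8 to 11/16.\<close>
 define rr :: "real => real" where "rr t = max 0 (min 1 (16 * t - 10))" for t
 have rr: "cts I1 rr" "rr:I1 \<rightarrow> I1" "rr 0 = 0" "rr 1 = 1" unfolding rr_def by (intro continuous_intros) auto
 define ga where "ga s = pf (%t. W s (rr t))" for s
 let ?p = "(pf o X) +++ rp (pf o Y)" and ?k = "pf (gr ?l ?r (gr l r (X 0)))"
 have "homotopic_loops (Om P a c) ?p ga"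
 proof (rule loops_hm3[OF hm3_reparam[OF W rr]])
  fix x t :: real assume "x:I1" "t:I1"
  hence "(1 - x) * t + x * rr t:I1" using I_comb[OF rr(2)] by simp
  thus "W 0 ((1 - x) * t + x * rr t) = W 1 ((1 - x) * t + x * rr t)" using e by (simp add: W0)
 qed (auto simp: ga_def W_def joinpaths_def reversepath_def)
 moreover have "homotopic_loops (Om P a c) ga (%s. pf (N 1 s))"
 proof (rule loops_hm3[OF N])
  fix s :: real assume s: "s:I1"
  have sm: "W s (rr t) = N 0 s t" if "t:I1" "t ~= 5 / 8" for t
   using that hmap_row[OF W s] lc by (auto simp: N_def gr_def joinpaths_def rr_def pin_def pathstart_def pathfinish_def min_def max_def)
  have "W s (rr (5 / 8)) = N 0 s (5 / 8)"
   using hmap_row[OF W s] lc by (auto simp: N_def gr_def joinpaths_def rr_def pin_def pathstart_def pathfinish_def)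
  with sm have "W s (rr t) = N 0 s t" if "t:I1" for t using that by metis
  thus "ga s = pf (N 0 s) & pf (N 1 s) = pf (N 1 s)" by (auto simp: ga_def intro: pf_cong)
 qed
 moreover have "homotopic_loops (Om P a c) (%s. pf (N 1 s)) (lp ?k ?k)"
 proof (rule loops_hm3[where H = "%x s. gr ?l ?r (H x s)"])
  show "hm3 (%_. a) (%_. c) (%x s. gr ?l ?r (H x s))"
   using H(1) unfolding sph3_hm3 gr_def by (intro hm3_join[OF hc[OF l']] hm3_join[OF _ hc[OF r']])
  show "pf (N 1 s) = pf (gr ?l ?r (H 0 s)) & lp ?k ?k s = pf (gr ?l ?r (H 1 s))" if "s:I1" for s
   using H(3) that by (auto simp: N_def gr_def joinpaths_def reversepath_def linepath_def algebra_simps intro!: pf_cong)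
 qed (use H(2) in "auto simp: gr_def joinpaths_def")
 ultimately have "homotopic_loops (Om P a c) ?p (lp ?k ?k)" by (meson homotopic_loops_trans)
 hence hp: "hps (Om P a c) (pf o X) (pf o Y)"
  by (rule homotopic_paths_loop_parts) (use hmap_path[OF Y] in "simp add: pin_def")
 obtain A where A: "hmap (Om P a c) (pathstart (pf o X)) (pathfinish (pf o X)) A" "ALL t:I1. A 0 t = (pf o X) t & A 1 t = (pf o Y) t"
  by (rule homotopic_hmap[OF hp]) blast
 have pX: "path (X s)" "path (Y s)" if "s:I1" for s using hmap_row[OF X that] hmap_row[OF Y that] by (auto simp: pin_def)
 have AO: "A x s:Om P a c" "A x 0 = pf (X 0)" "A x 1 = pf (X 1)" if "x:I1" "s:I1" for x s
  using A(1) that by (auto simp: hmap_def pathstart_def pathfinish_def)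
 have "cts (I2) (%z. A (fst z) (snd z))" using A(1) by (simp add: hmap_def case_prod_beta')
 from continuous_unpf[OF this, of I1]
 have u: "cts ((I2) \<times> I1) (%z. apply_bcontfun (A (fst (fst z)) (snd (fst z))) (snd z))" by (simp add: case_prod_beta')
 have "cts (I1 \<times> I2) (%z. apply_bcontfun (A (fst z) (fst (snd z))) (snd (snd z)))"
 proof -
  have s: "cts (I1 \<times> I2) (%z :: real \<times> real \<times> real. ((fst z,fst (snd z)),snd (snd z)))" by (intro continuous_intros)
  show ?thesis using continuous_on_compose2[OF u s] by (auto simp: image_subset_iff)
 qed
 hence "hm3 (%_. a) (%_. c) (%x s. apply_bcontfun (A x s))"
  using Om_path[OF AO(1)] unfolding hm3_def by (auto simp: case_prod_beta' pin_def path_image_def pathstart_def pathfinish_def image_subset_iff)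
 moreover have "apply_bcontfun (A 0 s) t = X s t & apply_bcontfun (A 1 s) t = Y s t & apply_bcontfun (A s 0) t = X 0 t & apply_bcontfun (A s 1) t = X 1 t"
  if "s:I1" "t:I1" for s t
  using A(2) AO(2,3)[OF that(1,1)] that pX by (simp add: pf_apply)
 ultimately show ?thesis by blast
qed

end

section \<open>Homotopy extension and maps that fix the 1-skeleton\<close>

lemma homotopic_canon_iff:
 "homotopic_with_canon (%_. True) S T f g \<longleftrightarrow>
  (EX H. cts (I1 \<times> S) (%(x,z). H x z) & (ALL x:I1. ALL z:S. H x z:T) & (ALL z:S. H 0 z = f z & H 1 z = g z))"
  (is "?L \<longleftrightarrow> (EX H. ?R H)")
proof -
 have "?L \<longleftrightarrow> (EX h. ctm (prod_topology (tos I1) (tos S)) (tos T) h &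
   (ALL z:S. h (0,z) = f z) & (ALL z:S. h (1,z) = g z))"
  by (subst homotopic_with) auto
 also have "... \<longleftrightarrow> (EX h. ?R (%x z. h (x,z)))" by (auto simp: Pi_iff case_prod_beta')
 also have "... \<longleftrightarrow> (EX H. ?R H)"
 proof
  assume "EX H. ?R H"
  then obtain H where "?R H" by blast
  thus "EX h. ?R (%x z. h (x,z))" by (intro exI[of _ "%z. H (fst z) (snd z)"]) simp
 qed blast
 finally show ?thesis .
qed

text \<open>On \<open>?S\<close>, the bottom together with the cylinder over \<open>S\<close>,
  shrinking the interval shows the prescribed map homotopic to the one that ignores the time. The
  latter extends to the whole cylinder, and as \<open>P\<close> is an ANR, Borsuk's theorem extends
  the former too.\<close>

lemma (in cplx2) HEP:
 assumes S: "closed S" "S \<subseteq> P" and f: "cts P f" "f:P \<rightarrow> P"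
  and Th: "cts (I1 \<times> S) (%(x,z). Th x z)" "!!x z. x:I1 ==> z:S ==> Th x z:P" "!!z. z:S ==> Th 0 z = f z"
 shows "EX F. cts (I1 \<times> P) (%(x,z). F x z) & (ALL x:I1. ALL z:P. F x z:P) & (ALL z:P. F 0 z = f z) & (ALL x:I1. ALL z:S. F x z = Th x z)"
proof -
 let ?T = "I1 \<times> P" and ?S = "{0} \<times> P \<union> I1 \<times> S"
 define fh where "fh = (%z. if snd z:S then Th (fst z) (snd z) else f (snd z))"
 have clP: "closed P" using compact_P by (rule compact_imp_closed)
 have c1: "cts (I1 \<times> S) fh"
  by (rule continuous_on_eq[OF Th(1)]) (auto simp: fh_def)
 have "cts ({0} \<times> P) (%z. f (snd z))" by (rule continuous_on_compose2[OF f(1)]) (auto intro!: continuous_intros)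
 hence c0: "cts ({0} \<times> P) fh" by (rule continuous_on_eq) (use Th(3) in "auto simp: fh_def")
 have c: "cts ?S fh" by (rule continuous_on_closed_Un[OF closed_Times closed_Times c0 c1]) (use clP S in auto)
 have fhP: "fh z:P" if "z:?S" for z using that Th(2) f(2) S by (auto simp: fh_def)
 have hom: "homotopic_with_canon (%_. True) ?S P (%z. f (snd z)) fh"
 proof -
  have sc: "(fst z * fst (snd z),snd (snd z)):?S" if z: "z:I1 \<times> ?S" for z :: "real \<times> real \<times> 'a"
  proof -
   obtain x y w where "z = (x,y,w)" "x:I1" "(y = 0 & w:P) | (y:I1 & w:S)" using z by (cases z) auto
   thus ?thesis using mult_le_one[of x y] S(2) by auto
  qed
  have "cts (I1 \<times> ?S) (%z. fh (fst z * fst (snd z),snd (snd z)))"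
  proof (rule continuous_on_compose2[OF c])
   show "(%z. (fst z * fst (snd z),snd (snd z))) ` (I1 \<times> ?S) \<subseteq> ?S" using sc by blast
  qed (intro continuous_intros)
  thus ?thesis
   unfolding homotopic_canon_iff
  proof (intro exI[of _ "%x z. fh (x * fst z,snd z)"] conjI ballI)
   show "fh (x * fst z,snd z):P" if "x:I1" "z:?S" for x z using fhP[OF sc[of "(x,z)"]] that by simp
   show "fh (0 * fst z,snd z) = f (snd z)" for z using Th(3) by (simp add: fh_def)
  qed (simp_all add: case_prod_beta')
 qed
 have "ANR P" unfolding P by (rule ANR_finite_Union_convex_closed) (use finK compact_hull compact_imp_closed in auto)
 moreover have "closedin (tos ?T) ?S" by (rule closed_subset) (use S clP in "auto intro!: closed_Un closed_Times")
 moreover have "cts ?T (%z. f (snd z))" by (rule continuous_on_compose2[OF f(1)]) (auto intro!: continuous_intros)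
 moreover have "(%z. f (snd z)):?T \<rightarrow> P" using f(2) by auto
 ultimately obtain g where g: "cts ?T g" "g ` ?T \<subseteq> P" "!!z. z:?S ==> g z = fh z"
  using Borsuk_homotopy_extension_homotopic[OF _ _ _ _ hom] by metis
 have "g (0,z) = f z" if "z:P" for z using g(3)[of "(0,z)"] that Th(3) by (auto simp: fh_def)
 moreover have "g (x,z) = Th x z" if "x:I1" "z:S" for x z using g(3)[of "(x,z)"] that by (auto simp: fh_def)
 ultimately show ?thesis using g(1,2) by (intro exI[of _ "%x z. g (x,z)"]) (auto simp: image_subset_iff)
qed

text \<open>No simplex has vertices both in the component \<open>V\<close> and outside it, so the
  simplices of the two kinds form disjoint closed sets that cover the connected set
  \<open>P\<close>.\<close>

lemma (in pcplx) skel1_connected: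
 assumes v: "{v}:K" and v0: "{v0}:K" shows "EX l. pin skel1 v0 v l"
proof -
 define V where "V = {w. path_component skel1 v0 w}"
 have e: "w:V" if "S:K" "u:S" "w:S" "u:V" for S u w
 proof -
  have "path_component skel1 u w"
   unfolding path_component_def by (rule exI[of _ "lp u w"]) (use segment_skel1[OF that(1-3)] in auto)
  thus ?thesis using that(4) path_component_trans unfolding V_def by blast
 qed
 define A B where "A = (\<Union>S\<in>{S:K. S \<subseteq> V}. convex hull S)" and "B = (\<Union>S\<in>{S:K. S \<inter> V = {}}. convex hull S)"
 have AB: "S \<subseteq> V | S \<inter> V = {}" if "S:K" for S using e[OF that] by blast
 have "closed A" "closed B" unfolding A_def B_def using finK compact_imp_closed[OF compact_hull] by auto
 moreover have "P \<subseteq> A \<union> B" using AB unfolding P A_def B_def by blast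
 moreover have "A \<inter> B = {}"
 proof -
  have "convex hull S \<inter> convex hull T = {}" if "S:K" "T:K" "S \<subseteq> V" "T \<inter> V = {}" for S T
  proof -
   have "S \<inter> T = {}" using that(3,4) by blast
   thus ?thesis using inter[OF that(1,2)] by simp
  qed
  thus ?thesis unfolding A_def B_def by blast
 qed
 moreover have "v0:A"
 proof -
  have "v0:skel1" using v0 by (auto simp: skel1_def intro!: bexI[of _ "{v0}"])
  hence "v0:V" by (simp add: V_def path_component_refl)
  thus ?thesis using v0 by (auto simp: A_def intro!: bexI[of _ "{v0}"])
 qed
 moreover have "connected P" by (rule path_connected_imp_connected[OF pc])
 ultimately have "B \<inter> P = {}" using connected_closedD[of P A B] vertex_P[OF v0, of v0] by blast
 moreover have "v:P" by (rule vertex_P[OF v]) simp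
 moreover have "v:B" if "v ~: V" unfolding B_def using v that by (intro UN_I[of "{v}"]) auto
 ultimately have "v:V" by blast
 thus ?thesis unfolding V_def path_component_def pin_def by blast
qed

text \<open>By \<open>rel\<close> each edge has a square with \<open>f\<close> on the bottom, the
  edge on top and the tracks \<open>ta\<close> at the sides; \<open>sq\<close> makes it from a
  homotopy between the two ways around. A homotopy on the 1-skeleton is a map into a path space, so
  the squares are assembled by \<open>skeletal_extension\<close>, and \<open>HEP\<close> extends the
  result to \<open>P\<close>.\<close>

theorem (in pcplx) straighten:
 assumes f: "cts P f" "f:P \<rightarrow> P" and ta: "!!v. {v}:K ==> pin P (f v) v (ta v)"
  and rel: "!!v w. edge2 v w ==> hps P ((f o lp v w) +++ ta w) (ta v +++ lp v w)"
 shows "EX F. cts (I1 \<times> P) (%(x,z). F x z) & (ALL x:I1. ALL z:P. F x z:P) & (ALL z:P. F 0 z = f z) &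
  (ALL z:skel1. F 1 z = z) & (ALL v. {v}:K --> (ALL x:I1. F x v = ta v x))"
proof -
 have ed: "v:P" "w:P" "pin P v w (lp v w)" "{v}:K" "{w}:K" if "edge2 v w" for v w
  using vertex_P[of "{v,w}"] segment_skel1[of "{v,w}" v w] skel1_P face[of "{v,w}"] that by (auto simp: edge2_def intro!: pin_linepath)
 have ex: "EX Q. cts (I2) Q & Q ` (I2) \<subseteq> P & (ALL y:I1. Q (y,0) = f (lp v w y) & Q (y,1) = lp v w y & Q (0,y) = ta v y & Q (1,y) = ta w y)"
  if e: "edge2 v w" for v w
 proof -
  note t = ta[OF ed(4)[OF e]] ta[OF ed(5)[OF e]]
  obtain A where A: "hmap P (pathstart ((f o lp v w) +++ ta w)) (pathfinish ((f o lp v w) +++ ta w)) A"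
   "ALL t:I1. A 0 t = ((f o lp v w) +++ ta w) t & A 1 t = (ta v +++ lp v w) t"
   by (rule homotopic_hmap[OF rel[OF e]]) blast
  have "EX Q. ctm (tos (sq ` (I2))) (tos P) Q & (ALL z:I2. Q (sq z) = (%(s,t). A s t) z)"
  proof (rule factor_through)
   show "compact (I2)" by (intro compact_Times) auto
   show "cts (I2) sq" unfolding sq_def case_prod_unfold by (intro continuous_intros)
   show "ctm (tos (I2)) (tos P) (%(s,t). A s t)" using A(1) by (auto simp: hmap_def)
   fix x y assume "x:I2" "y:I2" "sq x = sq y"
   thus "(%(s,t). A s t) x = (%(s,t). A s t) y"
    using sq_fibres[of "fst x" "snd x" "fst y" "snd y"] A(1) by (auto simp: hmap_def)
  qed
  then obtain Q where Q: "cts (I2) Q" "Q ` (I2) \<subseteq> P" "ALL z:I2. Q (sq z) = (%(s,t). A s t) z"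
   unfolding sq_image by auto
  have Q3: "Q (sq (s,t)) = A s t" if "s:I1" "t:I1" for s t using Q(3) that by simp
  have "Q (y,0) = f (lp v w y) & Q (y,1) = lp v w y & Q (0,y) = ta v y & Q (1,y) = ta w y" if y: "y:I1" for y
  proof -
   have h: "y / 2:I1" "(1 + y) / 2:I1" "(0::real):I1" "(1::real):I1" using y by auto
   have e: "f w = ta w 0" "ta v 1 = v" using t by (auto simp: pin_def pathstart_def pathfinish_def)
   show ?thesis
    unfolding sq_edges[OF y, symmetric] Q3[OF h(3,1)] Q3[OF h(3,2)] Q3[OF h(4,1)] Q3[OF h(4,2)]
    using A(2) h y e by (cases "y = 0") (auto simp: joinpaths_def linepath_def field_simps)
  qed
  thus ?thesis using Q(1,2) by blast
 qed
 then obtain Q where Q: "!!v w. edge2 v w ==> cts (I2) (Q v w) & Q v w ` (I2) \<subseteq> P &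
   (ALL y:I1. Q v w (y,0) = f (lp v w y) & Q v w (y,1) = lp v w y & Q v w (0,y) = ta v y & Q v w (1,y) = ta w y)"
  by metis
 let ?K = "{S:K. card S <= 2}"
 interpret K1: cplx2 ?K skel1
 proof
  fix S F assume S: "S:?K" "F \<subseteq> S" "F ~= {}"
  have "card F <= card S" using simp[of S] S by (intro card_mono) auto
  thus "F:?K" using S face[of S F] by auto
 qed (use finK simp inter in "auto simp: skel1_def")
 \<comment> \<open>The orientations of an edge by \<open>ord\<close> and by \<open>K1.ord\<close>
   are not compared; \<open>E\<close> therefore covers both directions.\<close>
 define E where "E v w y = (if ord v < ord w then pf (%x. Q v w (y,x)) else pf (%x. Q w v (1 - y,x)))" for v w and y :: real
 have or: "edge2 v w | edge2 w v" if "K1.edge2 v w" for v w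
 proof -
  have vw: "{v,w}:K" "v ~= w" using that by (auto simp: K1.edge2_def)
  hence "ord v ~= ord w" using inj_onD[OF ord_inj, of v w] by blast
  thus ?thesis using vw by (auto simp: edge2_def insert_commute)
 qed
 have Qp: "path (%x. Q v w (y,x))" if "edge2 v w" "y:I1" for v w y
  unfolding path_def by (rule continuous_on_compose2[of "I2" "Q v w"]) (use Q[OF that(1)] that(2) in "auto intro!: continuous_intros")
 have Qc: "cts I1 (%y. pf (%x. Q v w (y,x)))" if "edge2 v w" for v w
  using continuous_pf[of I1 "%y x. Q v w (y,x)"] Q[OF that] by simp
 have "cts I1 (%y. pf (%x. Q v w (1 - y,x)))" if "edge2 v w" for v w
  by (rule continuous_on_compose2[OF Qc[OF that], of _ "%y. 1 - y"]) (auto intro!: continuous_intros)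
 hence Ec: "cts I1 (E v w)" if "K1.edge2 v w" for v w
  using or[OF that] Qc unfolding E_def by (auto simp: edge2_def)
 have Qv: "pf (%x. Q v w (0,x)) = pf (ta v) & pf (%x. Q v w (1,x)) = pf (ta w)" if "edge2 v w" for v w
  using Q[OF that] by (auto intro!: pf_cong)
 have Ev: "E v w 0 = pf (ta v) & E v w 1 = pf (ta w)" if "K1.edge2 v w" for v w
  using or[OF that] Qv unfolding E_def by (auto simp: edge2_def)
 have nf: "~ K1.face_tri a b c" for a b c
  by (auto simp: K1.face_tri_def card_insert_if)
 obtain F where F: "ctm (tos skel1) euclidean F" "!!v. {v}:?K ==> F v = pf (ta v)"
  "!!v w y. K1.edge2 v w ==> y:I1 ==> F (lp v w y) = E v w y"
  using K1.skeletal_extension[of "%v. pf (ta v)" euclidean E "%_ _ _ _. 0"] Ec Ev nf by auto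
 define Th where "Th x z = apply_bcontfun (F z) x" for x z
 have "cts (skel1 \<times> I1) (%(z,x). apply_bcontfun (F z) x)" by (rule continuous_unpf) (use F(1) in simp)
 hence u: "cts (skel1 \<times> I1) (%z. apply_bcontfun (F (fst z)) (snd z))" by (simp add: case_prod_beta')
 have s: "cts (I1 \<times> skel1) (%z. (snd z,fst z))" by (intro continuous_intros)
 have "(%z. (snd z,fst z)) ` (I1 \<times> skel1) \<subseteq> skel1 \<times> I1" by auto
 from continuous_on_compose2[OF u s this]
 have c: "cts (I1 \<times> skel1) (%(x,z). Th x z)" by (simp add: Th_def case_prod_beta')
 have Thv: "Th x v = ta v x" if "{v}:K" "x:I1" for x v
  using F(2)[of v] that ta[OF that(1)] pf_apply[of "ta v" x] by (simp add: Th_def pin_def)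
 have The: "Th x (lp v w y) = Q v w (y,x)" if "edge2 v w" "K1.edge2 v w | K1.edge2 w v" "x:I1" "y:I1" for v w x y
 proof -
  have o: "ord v < ord w" using that(1) by (simp add: edge2_def)
  have r: "lp v w y = lp w v (1 - y)" by (simp add: linepath_def algebra_simps)
  have "F (lp v w y) = pf (%x. Q v w (y,x))"
   using that(2) F(3)[of v w y] F(3)[of w v "1 - y"] that(4) o r by (auto simp: E_def)
  thus ?thesis using pf_apply[OF Qp[OF that(1,4)] that(3)] by (simp add: Th_def)
 qed
 have pt: "(EX v. {v}:K & z = v) | (EX v w y. edge2 v w & (K1.edge2 v w | K1.edge2 w v) & y:I1 & z = lp v w y)" if zs: "z:skel1" for z
 proof -
  obtain S where S: "S:?K" "z:convex hull S" using zs by (auto simp: skel1_def)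
  show ?thesis
  proof (cases rule: K1.simplex_cases[OF S(1)])
   case (1 v) thus ?thesis using S by auto
  next
   case (2 v w)
   have "z:closed_segment v w" "z:closed_segment w v" using S(2) 2(1) by (simp_all add: segment_convex_hull insert_commute)
   then obtain y y' where "y:I1" "z = lp v w y" "y':I1" "z = lp w v y'"
    unfolding path_image_linepath[symmetric] path_image_def by auto
   thus ?thesis using or[OF 2(2)] 2(2) by blast
  next
   case (3 a b c) thus ?thesis using nf by blast
  qed
 qed
 have "Th 0 z = f z & Th 1 z = z" if "z:skel1" for z
  using pt[OF that] Thv[of z] The Q ta[of z] by (auto simp: pin_def pathstart_def pathfinish_def)
 moreover have "Th x z:P" if "x:I1" "z:skel1" for x z
  using pt[OF that(2)]
 proof
  assume "EX v. {v}:K & z = v"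
  thus ?thesis using Thv[of z x] ta[of z] that(1) by (auto simp: pin_def path_image_def)
 next
  assume "EX v w y. edge2 v w & (K1.edge2 v w | K1.edge2 w v) & y:I1 & z = lp v w y"
  then obtain v w y where "edge2 v w" "K1.edge2 v w | K1.edge2 w v" "y:I1" "z = lp v w y" by blast
  thus ?thesis using The[of v w x y] Q[of v w] that(1) by (auto simp: image_subset_iff)
 qed
 moreover have "closed skel1" unfolding skel1_def using finK compact_imp_closed[OF compact_hull] by auto
 ultimately obtain F where F: "cts (I1 \<times> P) (%(x,z). F x z)" "ALL x:I1. ALL z:P. F x z:P" "ALL z:P. F 0 z = f z" "ALL x:I1. ALL z:skel1. F x z = Th x z"
  using HEP[OF _ skel1_P f c] by auto
 have vs: "v:skel1" if "{v}:K" for v using that by (auto simp: skel1_def intro!: bexI[of _ "{v}"])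
 show ?thesis using F Thv vs `!!z. z : skel1 ==> Th 0 z = f z & Th 1 z = z` by (intro exI[of _ F]) auto
qed

text \<open>In additive notation \<open>g\<close> replaces a triangle \<open>X\<close> by
  \<open>X - h X + X\<close>. The sphere \<open>X - h X\<close> has a class that \<open>h\<close>
  fixes, that is, \<open>h X - h h X = X - h X\<close>; so \<open>h g\<close> takes the triangle to
  \<open>h X - h h X + h X\<close>, which has the class of \<open>X\<close>.\<close>

theorem (in pcplx) right_homotopy_inverse:
 assumes v0K: "{v0}:K" and h: "selfmap h" and hs: "!!z. z:skel1 ==> h z = z" and hx: "!!x. x:carrier Pi ==> ind h x = x"
 shows "EX g. cts P g & g:P \<rightarrow> P & homotopic_with_canon (%_. True) P P (h o g) id"
proof -
 have hc: "cts P h" "h:P \<rightarrow> P" using h by (auto simp: selfmap_def)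
 define X where "X a b c t y = tri a b c (t,y)" for a b c :: 'a and t y :: real
 \<comment> \<open>The three discs fit together because \<open>h\<close> fixes the edges, and the
   first and last rows remain those of the triangle.\<close>
 define Y where "Y a b c = X a b c +++ (rp (%t. h o X a b c t) +++ X a b c)" for a b c
 have X01: "X a b c 0 y = lp a c y" "X a b c 1 y = jn (lp a b) (lp b c) y" if "y:I1" for a b c y
  using tri_edges(1)[OF that, of a b c] tri_edges(2)[of "2 * y" a b c] tri_edges(3)[of "2 * y - 1" a b c] that by (auto simp: X_def jn_def)
 have X: "hmap P a c (X a b c)" if "face_tri a b c" for a b c
 proof -
  have S: "{a,b,c}:K" using that by (simp add: face_tri_def)
  have "cts (I2) (%(t,y). X a b c t y)" unfolding X_def tri_def case_prod_beta' by (simp, intro continuous_intros)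
  moreover have "X a b c t y:P" if "t:I1" "y:I1" for t y using hull_sub[OF S] tri_image[of a b c] that by (auto simp: X_def)
  ultimately show ?thesis by (auto simp: hmap_def X_def tri_def)
 qed
 have seg: "closed_segment v w \<subseteq> skel1" if "edge2 v w" for v w by (rule segment_skel1[of "{v,w}"]) (use that in "auto simp: edge2_def")
 have ls: "lp v w y:skel1" if "edge2 v w" "y:I1" for v w y
  using seg[OF that(1)] that(2) path_image_linepath[of v w] by (auto simp: path_image_def)
 have sk: "X a b c 0 y:skel1" "X a b c 1 y:skel1" if "face_tri a b c" "y:I1" for a b c y
  using face_tri_edges[OF that(1)] that(2) ls unfolding X01[OF that(2)] by (auto simp: jn_def)
 have hX: "hmap P a c (%t. h o X a b c t)" if "face_tri a b c" for a b c
 proof -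
  have "a:skel1" "c:skel1" using sk(1)[OF that, of 0] sk(1)[OF that, of 1] by (auto simp: X_def tri_def)
  thus ?thesis using hmap_comp[OF X[OF that] hc] hs by simp
 qed
 have hx01: "h (X a b c 0 y) = X a b c 0 y" "h (X a b c 1 y) = X a b c 1 y" if "face_tri a b c" "y:I1" for a b c y
  using sk[OF that] hs by auto
 have Y: "hmap P a c (Y a b c)" if "face_tri a b c" for a b c
  unfolding Y_def using hx01[OF that]
  by (intro hmap_vjoin[OF X[OF that]] hmap_vjoin[OF hmap_reverse[OF hX[OF that]] X[OF that]]) (auto simp: reversepath_def joinpaths_def)
 have Y01: "Y a b c 0 = X a b c 0" "Y a b c 1 = X a b c 1" for a b c by (auto simp: Y_def joinpaths_def reversepath_def)
 have "EX g. ctm (tos P) (tos P) g & (ALL v. {v}:K --> g v = v) &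
   (ALL v w. edge2 v w --> (ALL y:I1. g (lp v w y) = lp v w y)) &
   (ALL a b c. face_tri a b c --> (ALL z:I2. g (tri a b c z) = (%(t,y). Y a b c t y) z))"
 proof (rule skeletal_extension)
  show "ctm (tos I1) (tos P) (lp v w)" if "edge2 v w" for v w
   using ls[OF that] skel1_P by (auto intro: continuous_on_linepath)
  show "ctm (tos (I2)) (tos P) (%(t,y). Y a b c t y)" if "face_tri a b c" for a b c
   using Y[OF that] by (auto simp: hmap_def)
  show "(case (0,y) of (t,y) => Y a b c t y) = lp a c y & (case (1,y) of (t,y) => Y a b c t y) = jn (lp a b) (lp b c) y &
    (case (y,0) of (t,y) => Y a b c t y) = a & (case (y,1) of (t,y) => Y a b c t y) = c" if "face_tri a b c" "y:I1" for a b c y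
   using Y[OF that(1)] X01[OF that(2)] that(2) by (auto simp: Y01 hmap_def)
 qed (auto intro: vertex_P simp: linepath_def)
 then obtain g where g: "cts P g" "g:P \<rightarrow> P" "ALL v. {v}:K --> g v = v"
  "ALL v w. edge2 v w --> (ALL y:I1. g (lp v w y) = lp v w y)"
  "ALL a b c. face_tri a b c --> (ALL z:I2. g (tri a b c z) = (%(t,y). Y a b c t y) z)" by auto
 have ex: "EX Z. hm3 (%_. a) (%_. c) Z & (ALL s:I1. ALL t:I1. Z 0 s t = h (Y a b c s t) & Z 1 s t = X a b c s t & Z s 0 t = X a b c 0 t & Z s 1 t = X a b c 1 t)"
  if f: "face_tri a b c" for a b c
 proof -
  note e = face_tri_edges[OF f]
  have "{a}:K" using face[of "{a,b,c}" "{a}"] f by (auto simp: face_tri_def)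
  then obtain l where l: "pin skel1 v0 a l" using skel1_connected[OF _ v0K] by blast
  let ?r = "rp (l +++ lp a c)"
  have ac: "pin skel1 a c (lp a c)" by (rule pin_linepath[OF seg]) (use e in simp)
  have r: "pin skel1 c v0 ?r" by (intro pin_reverse pin_join[OF l ac])
  have lr: "pin P v0 a l" "pin P c v0 ?r" "pin P a c (lp a c)"
   using l r ac skel1_P by (auto simp: pin_def)
  let ?X = "X a b c" let ?g = "%X s. gr l ?r (X s)"
  have X0l: "?X 0 = lp a c" by (auto simp: X_def tri_def linepath_def fun_eq_iff)
  have nl: "hps P (gr l ?r (lp a c)) c0"
   unfolding null_iff_hl[OF pin_gr[OF lr(1,3,2)]] hl_gr[OF lr(1,3,2)]
   using hl_reverse[OF pin_join[OF lr(1,3)]] hl_join[OF lr(1,3)] hl_closed[OF lr(1)] hl_closed[OF lr(3)] by (simp add: G.m_assoc[symmetric])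
  have om: "om (?g A)" if "hmap P a c A" "A 0 = lp a c" for A
   by (rule omI[OF hmap_gr[OF lr(1) that(1) lr(2)], of 0]) (use that(2) nl in auto)
  define hX' hhX where "hX' t = h o ?X t" and "hhX t = h o (h o ?X t)" for t
  have HX: "hmap P a c hX'" unfolding hX'_def by (rule hX[OF f])
  have fixac: "h a = a" "h c = c" using hs pin_mem[OF ac] by auto
  have HHX: "hmap P a c hhX" unfolding hhX_def using hmap_comp[OF HX hc] fixac by (simp add: hX'_def)
  have same: "hX' s t = ?X s t" "hhX s t = ?X s t" if "s = 0 | s = 1" "t:I1" for s t
   using hx01[OF f that(2)] that(1) by (auto simp: hX'_def hhX_def)
  have og: "om (?g ?X)" by (rule om[OF X[OF f] X0l])
  have gs: "?g A s t = ?g ?X s t" if "A = hX' | A = hhX" "s = 0 | s = 1" "t:I1" for A s t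
   using same[OF that(2)] that(1,3) by (auto simp: gr_def joinpaths_def)
  have oh: "om (?g A)" if "A = hX' | A = hhX" "hmap P a c A" for A
  proof (rule omI[OF hmap_gr[OF lr(1) that(2) lr(2)], of 0])
   show "hps P (?g A 0) c0"
    using homotopic_paths_trans[OF homotopic_paths_eq om_row(2)[OF og, of 0], of "?g A 0"] gs[OF that(1), of 0]
     pin_gr[OF lr(1) hmap_row[OF that(2)] lr(2), of 0] by (auto simp: pin_def)
  qed simp
  have o1: "om (?g hX')" "om (?g hhX)" using oh HX HHX by auto
  \<comment> \<open>The classes of the triangle and of its first and second image, closed by the
    same tails. That \<open>h\<close> fixes the class of \<open>?W\<close> reads aa - bb = bb -
    ga.\<close>
  define aa bb ga where "aa = hol (?g ?X)" and "bb = hol (?g hX')" and "ga = hol (?g hhX)"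
  have cl': "aa:carrier Pi" "bb:carrier Pi" "ga:carrier Pi" using hol_closed og o1 by (auto simp: aa_def bb_def ga_def)
  have rh: "hol (rp (?g A)) = inv\<^bsub>Pi\<^esub> hol (?g A)" "om (rp (?g A))" if "om (?g A)" for A by (rule hol_reverse[OF that])+
  have dif: "hol (?g A +++ rp (?g B)) = hol (?g A) \<otimes>\<^bsub>Pi\<^esub> inv\<^bsub>Pi\<^esub> hol (?g B)" "cl (?g A +++ rp (?g B))"
   if "om (?g A)" "om (?g B)" "!!s t. s = 0 | s = 1 ==> t:I1 ==> ?g A s t = ?g B s t" for A B
   using hol_join[OF that(1) rh(2)[OF that(2)]] rh(1)[OF that(2)] that(3) by (auto simp: cl_def joinpaths_def reversepath_def)
  let ?W = "?g ?X +++ rp (?g hX')"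
  have gX: "?g ?X s t = ?g hX' s t" "?g hX' s t = ?g hhX s t" if "s = 0 | s = 1" "t:I1" for s t
   using gs[of hX' s t] gs[of hhX s t] that by auto
  have W: "hol ?W = aa \<otimes>\<^bsub>Pi\<^esub> inv\<^bsub>Pi\<^esub> bb" "cl ?W" using dif[OF og o1(1) gX(1)] by (auto simp: aa_def bb_def)
  have W': "hol (?g hX' +++ rp (?g hhX)) = bb \<otimes>\<^bsub>Pi\<^esub> inv\<^bsub>Pi\<^esub> ga" "om (?g hX' +++ rp (?g hhX))"
   using dif[OF o1 gX(2)] by (auto simp: ga_def bb_def cl_def)
  have hl': "h (l t) = l t" "h (?r t) = ?r t" if "t:I1" for t
   using that hs l r by (auto simp: pin_def path_image_def image_subset_iff)
  have "hol (%s. h o ?W s) = hol (?g hX' +++ rp (?g hhX))"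
  proof (rule hol_cong[OF _ W'(2), symmetric])
   fix s t :: real assume "s:I1" "t:I1"
   thus "(?g hX' +++ rp (?g hhX)) s t = (h o ?W s) t"
    using hl'(1)[of "2 * t"] hl'(2)[of "2 * (2 * t - 1) - 1"] by (auto simp: joinpaths_def reversepath_def gr_def hX'_def hhX_def)
  qed
  hence "aa \<otimes>\<^bsub>Pi\<^esub> inv\<^bsub>Pi\<^esub> bb = bb \<otimes>\<^bsub>Pi\<^esub> inv\<^bsub>Pi\<^esub> ga" using hx[of "hol ?W"] ind_hol[OF h W(2)] cl' W W'(1) by simp
  hence "bb \<otimes>\<^bsub>Pi\<^esub> (inv\<^bsub>Pi\<^esub> ga \<otimes>\<^bsub>Pi\<^esub> bb) = (aa \<otimes>\<^bsub>Pi\<^esub> inv\<^bsub>Pi\<^esub> bb) \<otimes>\<^bsub>Pi\<^esub> bb" using cl' by (simp add: O.G.m_assoc)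
  hence key: "bb \<otimes>\<^bsub>Pi\<^esub> (inv\<^bsub>Pi\<^esub> ga \<otimes>\<^bsub>Pi\<^esub> bb) = aa" using cl' by (simp add: O.G.m_assoc)
  have hY: "(%s. ?g (%t. h o Y a b c t) s) = ?g hX' +++ (rp (?g hhX) +++ ?g hX')"
   by (auto simp: Y_def joinpaths_def reversepath_def hX'_def hhX_def fun_eq_iff)
  have "hol (?g (%t. h o Y a b c t)) = bb \<otimes>\<^bsub>Pi\<^esub> (inv\<^bsub>Pi\<^esub> ga \<otimes>\<^bsub>Pi\<^esub> bb)"
  proof -
   have 1: "hol (rp (?g hhX) +++ ?g hX') = inv\<^bsub>Pi\<^esub> ga \<otimes>\<^bsub>Pi\<^esub> bb" "om (rp (?g hhX) +++ ?g hX')"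
    using hol_join[OF rh(2)[OF o1(2)] o1(1)] rh(1)[OF o1(2)] gX(2)[of 0] by (auto simp: reversepath_def bb_def ga_def)
   show ?thesis
    unfolding hY using hol_join(1)[OF o1(1) 1(2)] 1(1) gX(2)[of 1] by (auto simp: joinpaths_def reversepath_def bb_def)
  qed
  with key have eq: "hol (?g (%t. h o Y a b c t)) = hol (?g ?X)" by (simp add: aa_def)
  have HY: "hmap P a c (%t. h o Y a b c t)" using hmap_comp[OF Y[OF f] hc] fixac by simp
  have ends: "(h o Y a b c 0) t = ?X 0 t" "(h o Y a b c 1) t = ?X 1 t" if "t:I1" for t
   using hx01[OF f that] by (auto simp: Y01)
  have n0: "hps P (gr l ?r (h o Y a b c 0)) c0"
   using homotopic_paths_trans[OF homotopic_paths_eq nl, of "gr l ?r (h o Y a b c 0)"] pin_gr[OF lr(1) hmap_row[OF HY] lr(2), of 0] ends(1)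
   by (auto simp: pin_def gr_def joinpaths_def X0l)
  obtain Z where Z: "hm3 (%_. a) (%_. c) Z" "ALL s:I1. ALL t:I1. Z 0 s t = (h o Y a b c s) t & Z 1 s t = ?X s t & Z s 0 t = (h o Y a b c 0) t & Z s 1 t = (h o Y a b c 1) t"
   using hol_rel[OF HY X[OF f] _ lr(1,2) n0 eq] ends by auto
  thus ?thesis using ends by (intro exI[of _ Z]) auto
 qed
 then obtain Z where Z: "!!a b c. face_tri a b c ==> hm3 (%_. a) (%_. c) (Z a b c) &
  (ALL s:I1. ALL t:I1. Z a b c 0 s t = h (Y a b c s t) & Z a b c 1 s t = X a b c s t & Z a b c s 0 t = X a b c 0 t & Z a b c s 1 t = X a b c 1 t)"
  by metis
 have Zc: "cts (I1 \<times> I2) (%(x,s,t). Z a b c x s t)" if "face_tri a b c" for a b c using Z[OF that] by (simp add: hm3_def)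
 have Zp: "path (%x. Z a b c x t y)" if "face_tri a b c" "t:I1" "y:I1" for a b c t y
  unfolding path_def by (rule cont3[OF Zc[OF that(1)]]) (use that in "auto intro!: continuous_intros")
 \<comment> \<open>The homotopy from \<open>h o g\<close> to the identity as a map of
   \<open>P\<close> into paths: constant on vertices and edges, given by \<open>Z\<close> on the
   triangles.\<close>
 have "EX F. ctm (tos P) euclidean F & (ALL v. {v}:K --> F v = pf (%_. v)) &
   (ALL v w. edge2 v w --> (ALL y:I1. F (lp v w y) = pf (%_. lp v w y))) &
   (ALL a b c. face_tri a b c --> (ALL z:I2. F (tri a b c z) = (%(t,y). pf (%x. Z a b c x t y)) z))"
 proof (rule skeletal_extension)
  show "ctm (tos I1) euclidean (%y. pf (%_. lp v w y))" for v w
   using continuous_pf[of I1 "%y _. lp v w y"]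
   by (simp add: linepath_def case_prod_beta' continuous_intros)
  show "ctm (tos (I2)) euclidean (%(t,y). pf (%x. Z a b c x t y))" if "face_tri a b c" for a b c
  proof -
   have "cts ((I2) \<times> I1) (%z. Z a b c (snd z) (fst (fst z)) (snd (fst z)))"
    by (rule cont3[OF Zc[OF that]]) (auto intro!: continuous_intros)
   thus ?thesis using continuous_pf[of "I2" "%(t,y) x. Z a b c x t y"] by (simp add: case_prod_beta')
  qed
  fix a b c y assume f: "face_tri a b c" and y: "y:(I1 :: real set)"
  have "Z a b c x 0 y = lp a c y & Z a b c x 1 y = jn (lp a b) (lp b c) y & Z a b c x y 0 = a & Z a b c x y 1 = c" if "x:I1" for x
   using Z[OF f] X01[OF y] that y by (auto simp: hm3_def)
  thus "(case (0,y) of (t,y) => pf (%x. Z a b c x t y)) = pf (%_. lp a c y) &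
   (case (1,y) of (t,y) => pf (%x. Z a b c x t y)) = jn (%y. pf (%_. lp a b y)) (%y. pf (%_. lp b c y)) y &
   (case (y,0) of (t,y) => pf (%x. Z a b c x t y)) = pf (%_. a) & (case (y,1) of (t,y) => pf (%x. Z a b c x t y)) = pf (%_. c)"
   by (auto simp: jn_def intro!: pf_cong)
 qed (auto simp: linepath_def)
 then obtain F where F: "cts P F" "ALL v. {v}:K --> F v = pf (%_. v)"
  "ALL v w. edge2 v w --> (ALL y:I1. F (lp v w y) = pf (%_. lp v w y))"
  "ALL a b c. face_tri a b c --> (ALL z:I2. F (tri a b c z) = (%(t,y). pf (%x. Z a b c x t y)) z)" by auto
 define Th where "Th x z = apply_bcontfun (F z) x" for x z
 have "cts (P \<times> I1) (%(z,x). apply_bcontfun (F z) x)" by (rule continuous_unpf[OF F(1)])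
 hence u: "cts (P \<times> I1) (%z. apply_bcontfun (F (fst z)) (snd z))" by (simp add: case_prod_beta')
 have s: "cts (I1 \<times> P) (%z. (snd z,fst z))" by (intro continuous_intros)
 have "(%z. (snd z,fst z)) ` (I1 \<times> P) \<subseteq> P \<times> I1" by auto
 from continuous_on_compose2[OF u s this]
 have c: "cts (I1 \<times> P) (%(x,z). Th x z)" by (simp add: Th_def case_prod_beta')
 have cst: "Th x z = z" if "F z = pf (%_. z)" "x:I1" for x z using pf_apply[of "%_. z" x] that by (simp add: Th_def path_def)
 have "Th 0 z = (h o g) z & Th 1 z = id z & (ALL x:I1. Th x z:P)" if zP: "z:P" for z
 proof -
  obtain S where S: "S:K" "z:convex hull S" using zP P by auto
  show ?thesis
  proof (cases rule: simplex_cases[OF S(1)])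
   case (1 v)
   have "z = v" "{v}:K" using S 1 by auto
   moreover have "v:skel1" using `{v} : K` by (auto simp: skel1_def intro!: bexI[of _ "{v}"])
   ultimately show ?thesis using cst[of v] F(2) g(3) hs zP by simp
  next
   case (2 v w)
   obtain y where "y:I1" "z = lp v w y"
    using S(2) unfolding 2(1) segment_convex_hull[symmetric] path_image_linepath[symmetric] path_image_def by auto
   thus ?thesis using cst[of z] F(3) g(4) hs ls[OF 2(2)] 2(2) zP by simp
  next
   case (3 a b c)
   obtain t y where ty: "t:I1" "y:I1" "z = tri a b c (t,y)"
    using S(2) unfolding 3(1) tri_image[symmetric] by auto
   have Th: "Th x z = Z a b c x t y" if "x:I1" for x
    using F(4) 3(2) ty pf_apply[OF Zp[OF 3(2) ty(1,2)] that] by (simp add: Th_def)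
   have "g z = Y a b c t y" using g(5) 3(2) ty by simp
   thus ?thesis using Th Z[OF 3(2)] ty by (auto simp: X_def hm3_def)
  qed
 qed
 hence "homotopic_with_canon (%_. True) P P (h o g) id"
  unfolding homotopic_canon_iff using c by (intro exI[of _ Th]) auto
 thus ?thesis using g(1,2) by blast
qed

section \<open>Loop groups of arbitrary topological spaces\<close>

definition lps :: "'z topology => 'z => (real => 'z) set" where
 "lps Z z = {p. ctm (tos I1) Z p & p 0 = z & p 1 = z}"

definition hk :: "'z topology => (real => 'z) => (real => 'z) => bool" where
 "hk Z p q \<longleftrightarrow> homotopic_with (%r. r 0 = p 0 & r 1 = p 1) (tos I1) Z p q"

definition lrel :: "'z topology => 'z => ((real => 'z) \<times> (real => 'z)) set" where
 "lrel Z z = {(p,q). p:lps Z z & q:lps Z z & hk Z p q}"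

text \<open>The fundamental group for a space that is not given inside a normed space, as is the
  presentation complex. By \<open>fundamental_group_eq\<close> it coincides with the other notion
  where both make sense.\<close>

definition loop_group :: "'z topology => 'z => (real => 'z) set monoid" where
 "loop_group Z z = quotient_monoid (lps Z z) (lrel Z z) jn (%_. z)"

lemma hk_iff:
 "hk Z p q \<longleftrightarrow> (EX H. ctm (tos (I2)) Z H & (ALL t:I1. H (0,t) = p t & H (1,t) = q t) &
  (ALL x:I1. H (x,0) = p 0 & H (x,1) = p 1))"
 unfolding hk_def by (subst homotopic_with) auto

lemma hk_through:
 fixes C :: "'b::real_normed_vector set"
 assumes C: "convex C" and F: "ctm (tos C) Z F" and p: "pin C u w p" and q: "pin C u w q"
 shows "hk Z (F o p) (F o q)"
proof -
 have l: "hmap C u w (LIN p q)" by (rule hmap_LIN[OF C p q])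
 hence "ctm (tos (I2)) (tos C) (%z. LIN p q (fst z) (snd z))"
  by (auto simp: hmap_def case_prod_beta')
 from continuous_map_compose[OF this F] show ?thesis
  using l p unfolding hk_iff by (intro exI[of _ "F o (%z. LIN p q (fst z) (snd z))"])
   (auto simp: LIN_ends hmap_def pin_def pathstart_def pathfinish_def)
qed

lemma hk_eq: "ctm (tos I1) Z p ==> (!!t. t:I1 ==> p t = q t) ==> hk Z p q"
 unfolding hk_def by (rule homotopic_with_equal) auto

lemma hk_sym: "hk Z p q ==> hk Z q p"
 using homotopic_with_imp_property[of "%r. r 0 = p 0 & r 1 = p 1" "tos I1" Z p q] homotopic_with_sym unfolding hk_def by fastforce

lemma hk_trans: "hk Z p q ==> hk Z q r ==> hk Z p r"
 using homotopic_with_imp_property[of "%r. r 0 = p 0 & r 1 = p 1" "tos I1" Z p q] homotopic_with_trans unfolding hk_def by fastforce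

lemma continuous_map_jn:
 assumes p: "ctm (tos (X \<times> I1)) Z (%(x,t). p x t)" and q: "ctm (tos (X \<times> I1)) Z (%(x,t). q x t)"
  and m: "!!x. x:X ==> p x 1 = q x 0"
 shows "ctm (tos (X \<times> I1)) Z (%(x,t). jn (p x) (q x) t)"
proof -
 let ?h = "%z. if snd z <= 1 / 2 then (%(x,t). p x t) (fst z,2 * snd z) else (%(x,t). q x t) (fst z,2 * snd z - 1)"
 have "ctm (tos (X \<times> I1)) Z ?h"
 proof (rule continuous_map_cases_le)
  show "ctm (tos (X \<times> I1)) euclideanreal snd" "ctm (tos (X \<times> I1)) euclideanreal (%_. 1 / 2)"
   by (auto intro: continuous_intros)
  have "ctm (tos (X \<times> {t:I1. t <= 1 / 2})) (tos (X \<times> I1)) (%z. (fst z,2 * snd z))"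
   "ctm (tos (X \<times> {t:I1. 1 / 2 <= t})) (tos (X \<times> I1)) (%z. (fst z,2 * snd z - 1))"
   by (auto intro!: continuous_intros)
  from continuous_map_compose[OF this(1) p] continuous_map_compose[OF this(2) q]
  show "ctm (subtopology (tos (X \<times> I1)) {z:topspace (tos (X \<times> I1)). snd z <= 1 / 2}) Z (%z. (%(x,t). p x t) (fst z,2 * snd z))"
   "ctm (subtopology (tos (X \<times> I1)) {z:topspace (tos (X \<times> I1)). 1 / 2 <= snd z}) Z (%z. (%(x,t). q x t) (fst z,2 * snd z - 1))"
   by (auto simp: o_def subtopology_subtopology elim!: back_subst[of "%S. ctm (tos S) Z _"])
  fix z assume z: "z:topspace (tos (X \<times> I1))" and h: "snd z = 1 / 2"
  thus "(%(x,t). p x t) (fst z,2 * snd z) = (%(x,t). q x t) (fst z,2 * snd z - 1)" unfolding h using m[of "fst z"] z by (simp add: mem_Times_iff)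
 qed
 thus ?thesis by (rule continuous_map_eq) (auto simp: jn_def)
qed

lemma lps_jn: assumes "p:lps Z z" "q:lps Z z" shows "jn p q:lps Z z"
proof -
 have c: "ctm (tos ({0::real} \<times> I1)) Z (%(x,t). r t)" if "r:lps Z z" for r
 proof -
  have "ctm (tos ({0::real} \<times> I1)) (tos I1) snd" by (auto intro: continuous_on_snd continuous_on_id)
  from continuous_map_compose[OF this, of Z r] show ?thesis using that by (simp add: lps_def o_def case_prod_beta')
 qed
 have "ctm (tos I1) (tos ({0::real} \<times> I1)) (%t. (0,t))" by (auto intro!: continuous_intros)
 from continuous_map_compose[OF this continuous_map_jn[OF c[OF assms(1)] c[OF assms(2)]]] show ?thesis
  using assms by (auto simp: lps_def o_def jn_def[abs_def])
qed

lemma hk_jn: assumes "hk Z p p'" "hk Z q q'" "p 1 = q 0" shows "hk Z (jn p q) (jn p' q')"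
proof -
 obtain H where H: "ctm (tos (I2)) Z H" "ALL t:I1. H (0,t) = p t & H (1,t) = p' t" "ALL x:I1. H (x,0) = p 0 & H (x,1) = p 1"
  using assms(1) unfolding hk_iff by blast
 obtain J where J: "ctm (tos (I2)) Z J" "ALL t:I1. J (0,t) = q t & J (1,t) = q' t" "ALL x:I1. J (x,0) = q 0 & J (x,1) = q 1"
  using assms(2) unfolding hk_iff by blast
 have "ctm (tos (I2)) Z (%(x,t). jn (%t. H (x,t)) (%t. J (x,t)) t)"
  by (rule continuous_map_jn) (use H J assms(3) in auto)
 thus ?thesis
  unfolding hk_iff using H(2,3) J(2,3) assms(3) by (intro exI[of _ "%(x,t). jn (%t. H (x,t)) (%t. J (x,t)) t"]) (auto simp: jn_def)
qed

lemma lps_cont: "p:lps Z z ==> ctm (tos I1) Z p" by (simp add: lps_def)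

text \<open>Two paths in the interval with the same ends are homotopic there; \<open>F\<close>
  carries the homotopy along.\<close>

lemma hk_reparam:
 assumes p: "ctm (tos I1) Z F" and ss: "pin I1 0 u ss" "pin I1 0 u rr" and pq: "!!t. t:I1 ==> p t = F (ss t)" "!!t. t:I1 ==> q t = F (rr t)"
 shows "hk Z p q"
proof -
 have h: "hk Z (F o ss) (F o rr)" by (rule hk_through[OF _ p ss]) simp
 have "ctm (tos I1) (tos I1) ta" if "pin I1 a b ta" for ta a b
  using that by (auto simp: pin_def path_def path_image_def)
 from this[OF ss(1)] this[OF ss(2)] have c: "ctm (tos I1) Z (F o ss)" "ctm (tos I1) Z (F o rr)"
  using continuous_map_compose[OF _ p] by blast+
 show ?thesis using hk_trans[OF hk_sym[OF hk_eq[OF c(1)]] hk_trans[OF h hk_eq[OF c(2)]]] pq by simp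
qed

lemma equiv_lrel: "equiv (lps Z z) (lrel Z z)"
 by (rule equivI) (auto simp: lrel_def refl_on_def sym_def trans_def intro: hk_sym hk_trans hk_eq lps_cont)

lemma pathI: "cts I1 ss ==> ss:I1 \<rightarrow> I1 ==> ss 0 = u ==> ss 1 = w ==> pin I1 u w ss"
 by (auto simp: pin_def path_def path_image_def pathstart_def pathfinish_def)

lemma group_loop_group: assumes z: "z:topspace Z" shows "group (loop_group Z z)"
 unfolding loop_group_def
proof (rule group_quotient_monoid[where i = "%p t. p (1 - t)"])
 show "equiv (lps Z z) (lrel Z z)" by (rule equiv_lrel)
 show k: "(%_. z):lps Z z" using z by (simp add: lps_def)
 show jl: "jn p q:lps Z z" if "p:lps Z z" "q:lps Z z" for p q using lps_jn that .
 show "(jn p q,jn p' q'):lrel Z z" if "(p,p'):lrel Z z" "(q,q'):lrel Z z" for p p' q q'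
  using that jl by (auto simp: lrel_def lps_def intro!: hk_jn)
 show "(jn (jn p q) r,jn p (jn q r)):lrel Z z" if "p:lps Z z" "q:lps Z z" "r:lps Z z" for p q r
 proof -
  let ?ss = "%t. min (2 * t) (min (t + 1 / 4) (t / 2 + 1 / 2))"
  have "hk Z (jn (jn p q) r) (jn p (jn q r))"
  proof (rule hk_reparam[OF lps_cont[OF jl[OF that(1) jl[OF that(2,3)]]]])
   show "pin I1 0 1 ?ss" by (rule pathI, intro continuous_intros, auto simp: min_def)
   show "pin I1 0 1 (%t. t)" by (rule pathI) (auto intro!: continuous_intros)
   fix t :: real
   have e: "p 1 = z" "q 0 = z" "q 1 = z" "r 0 = z" using that by (auto simp: lps_def)
   consider "t <= 1 / 4" | "1 / 4 < t" "t <= 1 / 2" | "1 / 2 < t" by linarith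
   thus "jn (jn p q) r t = jn p (jn q r) (?ss t)"
    by cases (simp_all add: jn_def min_def field_simps, (rule arg_cong[where f = q], simp add: field_simps)?)
  qed simp
  thus ?thesis using jl that by (auto simp: lrel_def)
 qed
 fix p assume p: "p:lps Z z"
 have "hk Z (jn (%_. z) p) p"
 proof (rule hk_reparam[OF lps_cont[OF p]])
  show "pin I1 0 1 (%t. max 0 (2 * t - 1))" by (rule pathI) (auto intro!: continuous_intros)
  show "pin I1 0 1 (%t. t)" by (rule pathI) (auto intro!: continuous_intros)
  show "jn (%_. z) p t = p (max 0 (2 * t - 1))" for t
   using p by (cases "t <= 1 / 2") (simp_all add: jn_def lps_def max_absorb1 max_absorb2)
 qed simp
 thus "(jn (%_. z) p,p):lrel Z z" using p jl k by (simp add: lrel_def)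
 have "ctm (tos I1) (tos I1) (%t. 1 - t)" by (auto intro!: continuous_intros)
 from continuous_map_compose[OF this lps_cont[OF p]] have i: "(%t. p (1 - t)):lps Z z" using p by (auto simp: lps_def o_def)
 have "hk Z (jn (%t. p (1 - t)) p) (%_. z)"
 proof (rule hk_reparam[OF lps_cont[OF i], where u = 0])
  show "pin I1 0 0 (%t. min (2 * t) (2 - 2 * t))" by (rule pathI, intro continuous_intros, auto simp: min_def)
  show "pin I1 0 0 (%t. 0)" by (rule pathI) (auto intro!: continuous_intros)
 qed (use p in "auto simp: jn_def lps_def min_def algebra_simps")
 thus "(%t. p (1 - t)):lps Z z & (jn (%t. p (1 - t)) p,%_. z):lrel Z z" using i k jl[OF i p] by (simp add: lrel_def)
qed

definition lcl :: "'z topology => 'z => (real => 'z) => (real => 'z) set" where "lcl Z z p = lrel Z z `` {p}"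

lemma lcl_closed: "p:lps Z z ==> lcl Z z p:carrier (loop_group Z z)"
 by (auto simp: loop_group_def quotient_monoid_def lcl_def intro: quotientI)

lemma lcl_surj: "y:carrier (loop_group Z z) ==> EX p:lps Z z. y = lcl Z z p"
 by (auto simp: loop_group_def quotient_monoid_def lcl_def quotient_def)

lemma lcl_eq: "p:lps Z z ==> q:lps Z z ==> lcl Z z p = lcl Z z q \<longleftrightarrow> hk Z p q"
 using eq_equiv_class_iff[OF equiv_lrel, of p Z z q] by (auto simp: lcl_def lrel_def)

lemma lcl_jn:
 assumes "p:lps Z z" "q:lps Z z" shows "lcl Z z (jn p q) = lcl Z z p \<otimes>\<^bsub>loop_group Z z\<^esub> lcl Z z q"
proof -
 have jj: "(jn a c,jn b d):lrel Z z" if "(a,b):lrel Z z" "(c,d):lrel Z z" for a b c d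
 proof -
  have "a 1 = c 0" using that by (auto simp: lrel_def lps_def)
  thus ?thesis using that lps_jn[of a Z z c] lps_jn[of b Z z d] hk_jn[of Z a b c d] by (auto simp: lrel_def)
 qed
 have "congruent2 (lrel Z z) (lrel Z z) (%a b. lrel Z z `` {jn a b})"
  by (auto simp: congruent2_def intro!: equiv_class_eq[OF equiv_lrel] jj)
 from UN_equiv_class2[OF equiv_lrel equiv_lrel this assms] show ?thesis by (simp add: loop_group_def quotient_monoid_def lcl_def)
qed

lemma lcl_one: "\<one>\<^bsub>loop_group Z z\<^esub> = lcl Z z (%_. z)" by (simp add: loop_group_def quotient_monoid_def lcl_def)

lemma fundamental_group_eq: "fundamental_group S x = loop_group (tos S) x" "cls S x = lcl (tos S) x"
proof -
 have l: "based_loops S x = lps (tos S) x" by (auto simp: based_loops_def lps_def path_def path_image_def pathstart_def pathfinish_def)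
 have r: "loop_homotopy_rel S x = lrel (tos S) x"
  unfolding loop_homotopy_rel_def lrel_def l hk_def homotopic_paths_def pathstart_def pathfinish_def ..
 have "(+++) = (jn :: _ => _ => real => 'a)" "lp x x = (%_. x)" by (auto simp: joinpaths_def jn_def linepath_def algebra_simps fun_eq_iff)
 thus "fundamental_group S x = loop_group (tos S) x" unfolding fundamental_group_def loop_group_def l r by simp
 show "cls S x = lcl (tos S) x" unfolding cls_def lcl_def r by simp
qed

text \<open>At \<open>t = 1\<close> the index would lie beyond the end of the word, hence the
  separate value. On [0,1) this is the loop of the attaching maps.\<close>

definition wl :: "('l => real => 'z) => 'z => 'l list => real => 'z" where
 "wl qq z w t = (if w = [] | t = 1 then z else qq (w ! nat \<lfloor>real (length w) * t\<rfloor>) (frac (real (length w) * t)))"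

definition evw :: "('m,'k) monoid_scheme => ('l => 'm) => 'l list => 'm" where
 "evw M f w = foldr (%l y. f l \<otimes>\<^bsub>M\<^esub> y) w \<one>\<^bsub>M\<^esub>"

text \<open>In the loop of the longer word the first letter gets one of \<open>length w + 1\<close>
  equal shares, in \<open>jn\<close> it gets one half; the formulas are the two changes of
  parameter.\<close>

lemma wl_Cons:
 assumes l: "qq l 0 = z" "qq l 1 = z" "ALL k:set w. qq k 0 = z" and t: "t:I1"
 shows "jn (qq l) (wl qq z w) t = wl qq z (l # w) (if t <= 1 / 2 then 2 * t / (real (length w) + 1) else (1 + real (length w) * (2 * t - 1)) / (real (length w) + 1))"
  and "wl qq z (l # w) t = jn (qq l) (wl qq z w) (if t * (real (length w) + 1) <= 1 then t * (real (length w) + 1) / 2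
    else (1 + (t * (real (length w) + 1) - 1) / real (length w)) / 2)"
proof -
 define n where "n = real (length w)"
 have n: "n >= 0" "w ~= [] ==> n > 0" "w = [] ==> n = 0" by (auto simp: n_def)
 have w0: "qq (w ! 0) 0 = z" if "w ~= []" using l(3) that by (cases w) auto
 have A: "wl qq z (l # w) (s / (n + 1)) = qq l s" if "0 <= s" "s <= 1" for s
 proof (cases "s = 1")
  case True
  show ?thesis
  proof (cases "w = []")
   case False
   have "(n + 1) * (1 / (n + 1)) = 1" "1 / (n + 1) ~= 1" using n False by (auto simp: field_simps)
   thus ?thesis using True w0[OF False] l(2) by (simp add: wl_def n_def[symmetric] add.commute)
  qed (use True l(2) n in "simp add: wl_def")
 next
  case False
  hence s: "s < 1" "\<lfloor>s\<rfloor> = 0" "frac s = s" using that by (auto simp: frac_eq floor_eq_iff)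
  have "(n + 1) * (s / (n + 1)) = s" "s / (n + 1) ~= 1" using n s(1) by (auto simp: field_simps)
  thus ?thesis using s n(1) by (auto simp: wl_def n_def[symmetric] add.commute)
 qed
 have B: "wl qq z (l # w) ((1 + s) / (n + 1)) = wl qq z w (s / n)" if "0 <= s" "s <= n" "w ~= []" for s
 proof (cases "s = n")
  case False
  have "(n + 1) * ((1 + s) / (n + 1)) = 1 + s" "(1 + s) / (n + 1) ~= 1" "n * (s / n) = s" "s / n ~= 1"
   using n that False by (auto simp: field_simps)
  moreover have "nat (1 + \<lfloor>s\<rfloor>) = Suc (nat \<lfloor>s\<rfloor>)" using that by (simp add: Suc_nat_eq_nat_zadd1)
  ultimately show ?thesis using that(3) False by (auto simp: wl_def n_def[symmetric] add.commute[of 1] frac_1_eq)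
 qed (use n that in "simp add: wl_def add.commute")
 have e: "wl qq z w s = z" "wl qq z (l # w) 1 = z" if "w = []" for s using that by (simp_all add: wl_def)
 show "jn (qq l) (wl qq z w) t = wl qq z (l # w) (if t <= 1 / 2 then 2 * t / (real (length w) + 1) else (1 + real (length w) * (2 * t - 1)) / (real (length w) + 1))"
  unfolding n_def[symmetric] using A[of "2 * t"] B[of "n * (2 * t - 1)"] t n e mult_left_le[of "2 * t - 1" n]
  by (cases "w = []") (auto simp: jn_def)
 show "wl qq z (l # w) t = jn (qq l) (wl qq z w) (if t * (real (length w) + 1) <= 1 then t * (real (length w) + 1) / 2
    else (1 + (t * (real (length w) + 1) - 1) / real (length w)) / 2)"
 proof (cases "t * (n + 1) <= 1")
  case True
  thus ?thesis unfolding n_def[symmetric] using A[of "t * (n + 1)"] t n by (simp add: jn_def)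
 next
  case False
  hence w: "w ~= []" using t n by auto
  have "t * (n + 1) <= n + 1" by (rule mult_left_le_one_le) (use t n in auto)
  hence "t * (n + 1) - 1 <= n" by linarith
  hence B': "wl qq z (l # w) t = wl qq z w ((t * (n + 1) - 1) / n)" using B[of "t * (n + 1) - 1"] False w n by simp
  define q where "q = (t * (n + 1) - 1) / n"
  have "q > 0" using False n(2)[OF w] by (simp add: q_def)
  hence "~ (1 + q) / 2 <= 1 / 2" "2 * ((1 + q) / 2) - 1 = q" by argo+
  thus ?thesis unfolding n_def[symmetric] B' q_def[symmetric] using False unfolding jn_def by (simp only: if_False)
 qed
qed

lemma wl_lps:
 assumes "ALL l:set w. qq l:lps Z z" "z:topspace Z"
 shows "wl qq z w:lps Z z & lcl Z z (wl qq z w) = evw (loop_group Z z) (%l. lcl Z z (qq l)) w"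
 using assms(1)
proof (induction w)
 case Nil
 have "wl qq z [] = (%_. z)" by (simp add: wl_def fun_eq_iff)
 thus ?case using assms(2) by (simp add: evw_def lcl_one lps_def)
next
 case (Cons l w)
 hence IH: "wl qq z w:lps Z z" "lcl Z z (wl qq z w) = evw (loop_group Z z) (%l. lcl Z z (qq l)) w" and l: "qq l:lps Z z" by auto
 define n where "n = real (length w)"
 have n: "n >= 0" "n = 0 | n >= 1" by (cases w; auto simp: n_def)+
 have p: "qq l 0 = z" "qq l 1 = z" "ALL k:set w. qq k 0 = z" using l Cons.prems by (auto simp: lps_def)
 let ?rr = "%t. (min (2 * t) 1 + n * max 0 (2 * t - 1)) / (n + 1)"
 let ?rr' = "%t. if t * (n + 1) <= 1 then t * (n + 1) / 2 else (1 + (t * (n + 1) - 1) / n) / 2"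
 note W = wl_Cons[OF p, folded n_def]
 have J: "jn (qq l) (wl qq z w):lps Z z" by (rule lps_jn[OF l IH(1)])
 have "cts I1 ?rr'"
 proof (cases "n = 0")
  case True
  have "cts I1 (%t::real. t / 2)" by (intro continuous_intros) auto
  thus ?thesis by (rule continuous_on_eq) (use True in auto)
 next
  case False
  show ?thesis
   by (rule continuous_on_cases_le) (use False in "auto intro!: continuous_intros")
 qed
 moreover have "?rr' t:I1" if "t:I1" for t
  using that n mult_left_le_one_le[of "n + 1" t] by (auto simp: divide_simps algebra_simps)
 ultimately have "ctm (tos I1) (tos I1) ?rr'" by auto
 from continuous_map_compose[OF this lps_cont[OF J]]
 have "ctm (tos I1) Z (wl qq z (l # w))" by (rule continuous_map_eq) (use W(2) in auto)
 moreover have "wl qq z (l # w) 0 = z" "wl qq z (l # w) 1 = z" using p by (auto simp: wl_def)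
 ultimately have L: "wl qq z (l # w):lps Z z" by (simp add: lps_def)
 have "hk Z (jn (qq l) (wl qq z w)) (wl qq z (l # w))"
 proof (rule hk_reparam[OF lps_cont[OF L]])
  show "pin I1 0 1 ?rr"
  proof (rule pathI)
   show "cts I1 ?rr" by (intro continuous_intros) (use n in auto)
   show "?rr:I1 \<rightarrow> I1"
   proof
    fix t :: real assume t: "t:I1"
    have "n * max 0 (2 * t - 1) <= n" by (rule mult_left_le) (use t n in auto)
    hence "min (2 * t) 1 + n * max 0 (2 * t - 1) <= n + 1" by linarith
    thus "?rr t:I1" using t n by (auto simp: divide_simps)
   qed
  qed (use n in auto)
  show "pin I1 0 1 (%t. t)" by (rule pathI) (auto intro!: continuous_intros)
  show "jn (qq l) (wl qq z w) t = wl qq z (l # w) (?rr t)" if "t:I1" for t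
   unfolding W(1)[OF that] using that by (intro arg_cong[where f = "wl qq z (l # w)"]) (auto simp: min_def max_def)
 qed simp
 thus ?case
  using L lcl_eq[OF J L] lcl_jn[OF l IH(1)] IH(2) by (simp add: evw_def)
qed

section \<open>Presented groups\<close>

abbreviation rcl where "rcl X R == normal_closure (free_group X) ((%w. free_rel X `` {w}) ` R)"

definition pw :: "'g set => 'g word set => 'g word => 'g word set set" where
 "pw X R w = rcl X R #>\<^bsub>free_group X\<^esub> (free_rel X `` {w})"

lemma free_mult:
 assumes "u:words X" "v:words X"
 shows "free_rel X `` {u} \<otimes>\<^bsub>free_group X\<^esub> free_rel X `` {v} = free_rel X `` {u @ v}"
proof -
 have a: "(a @ c,b @ d):free_rel X" if "(a,b):free_rel X" "(c,d):free_rel X" for a b c d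
 proof -
  have f: "freely_equal X a b" "freely_equal X c d" using that by (auto simp: free_rel_def)
  note w = freely_equal_words[OF f(1)] freely_equal_words[OF f(2)]
  have "freely_equal X (a @ c) (b @ c)" "freely_equal X (b @ c) (b @ d)"
   using freely_equal_append[OF f(1), of "[]" c] freely_equal_append[OF f(2), of b "[]"] w by (auto simp: in_words_iff)
  thus ?thesis using freely_equal.trans by (auto simp: free_rel_def)
 qed
 have "congruent2 (free_rel X) (free_rel X) (%a b. free_rel X `` {a @ b})"
  by (auto simp: congruent2_def intro!: equiv_class_eq[OF equiv_free_rel] a)
 from UN_equiv_class2[OF equiv_free_rel equiv_free_rel this assms] show ?thesis by (simp add: free_group_def quotient_monoid_def)
qed

lemma free_carrier: "carrier (free_group X) = (%w. free_rel X `` {w}) ` words X"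
 by (auto simp: free_group_def quotient_monoid_def quotient_def)

context
 fixes X :: "'g set" and R :: "'g word set"
 assumes R: "R \<subseteq> words X"
begin

interpretation F: group "free_group X" by (rule group_free_group)

interpretation N: normal "rcl X R" "free_group X"
 by (rule normal_normal_closure[OF group_free_group]) (use R in "auto simp: free_carrier")

lemma pw_closed: "w:words X ==> pw X R w:carrier (presented_group X R)"
 unfolding presented_group_def pw_def FactGroup_def using F.rcosetsI[OF N.subset, of "free_rel X `` {w}"] by (simp add: free_carrier)

lemma pw_surj: "y:carrier (presented_group X R) ==> EX w:words X. y = pw X R w"
 by (auto simp: presented_group_def FactGroup_def RCOSETS_def free_carrier pw_def)

lemma pw_append: "u:words X ==> v:words X ==> pw X R (u @ v) = pw X R u \<otimes>\<^bsub>presented_group X R\<^esub> pw X R v"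
 unfolding presented_group_def pw_def FactGroup_def by (simp add: N.rcos_sum free_carrier free_mult)

lemma pw_one: "pw X R [] = \<one>\<^bsub>presented_group X R\<^esub>" "r:R ==> pw X R r = \<one>\<^bsub>presented_group X R\<^esub>"
proof -
 have "free_rel X `` {[]}:rcl X R" using N.one_closed by (simp add: free_group_def quotient_monoid_def)
 thus "pw X R [] = \<one>\<^bsub>presented_group X R\<^esub>" by (simp add: presented_group_def FactGroup_def pw_def N.rcos_const)
 assume "r:R"
 hence "free_rel X `` {r}:rcl X R" by (auto simp: normal_closure_def)
 thus "pw X R r = \<one>\<^bsub>presented_group X R\<^esub>" by (simp add: presented_group_def FactGroup_def pw_def N.rcos_const)
qed

lemma ev_append:
 assumes "group M" "!!l. l:set (u @ v) ==> f l:carrier M" shows "evw M f (u @ v) = evw M f u \<otimes>\<^bsub>M\<^esub> evw M f v & evw M f u:carrier M & evw M f v:carrier M"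
proof -
 interpret M: group M by fact
 have "evw M f w:carrier M" if "!!l. l:set w ==> f l:carrier M" for w using that by (induction w) (auto simp: evw_def)
 hence v: "evw M f v:carrier M" using assms(2) by simp
 have "evw M f (u @ v) = evw M f u \<otimes>\<^bsub>M\<^esub> evw M f v & evw M f u:carrier M" if "!!l. l:set u ==> f l:carrier M"
  using that v by (induction u) (auto simp: evw_def M.m_assoc)
 thus ?thesis using v assms(2) by simp
qed

lemma ev_hom:
 assumes fh: "fh:hom (presented_group X R) M" and M: "group M" and w: "w:words X"
 shows "fh (pw X R w) = evw M (%l. fh (pw X R [l])) w"
 using w
proof (induction w)
 case Nil
 thus ?case using hom_one[OF fh group_presented_group[OF R] M] by (simp add: pw_one evw_def)
next
 case (Cons l w)
 hence "[l]:words X" "w:words X" by (auto simp: in_words_iff)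
 thus ?case using pw_append[of "[l]" w] hom_mult[OF fh pw_closed pw_closed, of "[l]" w] Cons.IH by (simp add: evw_def)
qed

text \<open>Evaluation of words factors through the free group, and its kernel there, being normal,
  contains the normal closure of the relators. The result is put in terms of words because that is
  how loops are given.\<close>

lemma von_Dyck:
 assumes M: "group M" and f: "!!g b. g:X ==> f (g,b):carrier M & f (g,b) \<otimes>\<^bsub>M\<^esub> f (g,~ b) = \<one>\<^bsub>M\<^esub>"
  and rel: "!!r. r:R ==> evw M f r = \<one>\<^bsub>M\<^esub>" and uv: "u:words X" "v:words X" "pw X R u = pw X R v"
 shows "evw M f u = evw M f v"
proof -
 interpret M: group M by fact
 have fc: "f l:carrier M" if "w:words X" "l:set w" for l w using f[of "fst l" "snd l"] that by (auto simp: in_words_iff)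
 have ap: "evw M f (u @ v) = evw M f u \<otimes>\<^bsub>M\<^esub> evw M f v" "evw M f u:carrier M" if "u:words X" "v:words X" for u v
  using ev_append[OF M, of u v f] fc that by auto
 have fe: "evw M f a = evw M f b" if "freely_equal X a b" for a b
  using that
 proof induction
  case (cancel u v g b)
  have "[(g,b),(g,~ b)]:words X" "[(g,b),(g,~ b)] @ v:words X" using cancel by (auto simp: in_words_iff)
  moreover have "evw M f [(g,b),(g,~ b)] = \<one>\<^bsub>M\<^esub>" using f[of g b] f[of g "~ b"] cancel by (simp add: evw_def)
  ultimately show ?case using ap[of u "[(g,b),(g,~ b)] @ v"] ap[of "[(g,b),(g,~ b)]" v] ap[of u v] ap(2)[of v u] cancel by simp
 qed auto
 define Ps where "Ps c = evw M f (SOME w. w:c)" for c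
 have Ps: "Ps (free_rel X `` {w}) = evw M f w" if "w:words X" for w
 proof -
  have "w:free_rel X `` {w}" using that by (simp add: free_rel_def freely_equal.refl)
  from someI[of "%v. v:free_rel X `` {w}", OF this] show ?thesis using fe by (simp add: Ps_def free_rel_def)
 qed
 have app: "a @ b:words X" if "a:words X" "b:words X" for a b using that by (auto simp: in_words_iff)
 have "Ps:hom (free_group X) M"
  by (rule homI) (auto simp: free_carrier free_mult Ps app ap)
 then interpret H: group_hom "free_group X" M Ps by unfold_locales
 have "(%w. free_rel X `` {w}) ` R \<subseteq> kernel (free_group X) M Ps" using R rel Ps by (auto simp: kernel_def free_carrier)
 hence sub: "rcl X R \<subseteq> kernel (free_group X) M Ps" using H.normal_kernel unfolding normal_closure_def by blast
 let ?u = "free_rel X `` {u}" and ?v = "free_rel X `` {v}"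
 have c: "?u:carrier (free_group X)" "?v:carrier (free_group X)" using uv by (auto simp: free_carrier)
 have "?u:rcl X R #>\<^bsub>free_group X\<^esub> ?v" using F.rcos_self[OF c(1) N.subgroup_axioms] uv(3) by (simp add: pw_def)
 then obtain n where n: "n:rcl X R" "?u = n \<otimes>\<^bsub>free_group X\<^esub> ?v" by (auto simp: r_coset_def)
 hence "Ps ?u = Ps ?v" using sub c(2) by (auto simp: kernel_def)
 thus ?thesis using Ps uv by simp
qed

end

section \<open>Maps to and from the presentation complex\<close>

definition lK :: "'g \<times> bool => real => 'g complex_point" where
 "lK l t = edge_map (fst l) (if snd l then t else 1 - t)"

lemma lps_reverse: "p:lps Z z ==> (%t. p (1 - t)):lps Z z"
proof -
 assume p: "p:lps Z z"
 have "ctm (tos I1) (tos I1) (%t. 1 - t)" by (auto intro!: continuous_intros)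
 from continuous_map_compose[OF this lps_cont[OF p]] show ?thesis using p by (auto simp: lps_def o_def)
qed

lemma lcl_reverse:
 assumes p: "p:lps Z z" shows "lcl Z z p \<otimes>\<^bsub>loop_group Z z\<^esub> lcl Z z (%t. p (1 - t)) = \<one>\<^bsub>loop_group Z z\<^esub>"
proof -
 note r = lps_reverse[OF p]
 have k: "(%_. z):lps Z z" using p continuous_map_image_subset_topspace[OF lps_cont[OF p]] by (auto simp: lps_def image_subset_iff)
 have "hk Z (jn p (%t. p (1 - t))) (%_. z)"
 proof (rule hk_reparam[OF lps_cont[OF p], where u = 0])
  show "pin I1 0 0 (%t. min (2 * t) (2 - 2 * t))" by (rule pathI, intro continuous_intros, auto simp: min_def)
  show "pin I1 0 0 (%t. 0)" by (rule pathI) (auto intro!: continuous_intros)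
 qed (use p in "auto simp: jn_def lps_def min_def algebra_simps")
 thus ?thesis using lcl_jn[OF p r] lcl_eq[OF lps_jn[OF p r] k] by (simp add: lcl_one)
qed

lemma word_loop_wl: "t ~= 1 ==> word_loop w t = wl lK Vertex w t"
 by (auto simp: word_loop_def wl_def lK_def Let_def case_prod_beta')

context
 fixes X :: "'g set" and R :: "'g word set"
 assumes R: "R \<subseteq> words X"
begin

abbreviation KX where "KX == presentation_complex X R"

lemma topKX: "topspace KX = complex_points X R" by (rule topspace_presentation_complex[OF R])

lemma cont_edge: "g:X ==> ctm (tos I1) KX (edge_map g)"
 by (auto simp: continuous_map_def topKX edge_map_in_points openin_presentation_complex)

lemma cont_face: "r:R ==> ctm (tos (cball 0 1)) KX (face_map r)"
 using R by (auto simp: continuous_map_def topKX face_map_in_points openin_presentation_complex)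

lemma lK_lps: assumes "fst l:X" shows "lK l:lps KX Vertex"
proof -
 have "edge_map (fst l):lps KX Vertex" using cont_edge[OF assms] by (auto simp: lps_def edge_map_def)
 thus ?thesis using lps_reverse[of "edge_map (fst l)"] by (cases "snd l") (simp_all add: lK_def[abs_def])
qed

lemma Vertex_KX: "Vertex:topspace KX" by (simp add: topKX complex_points_def)

lemma group_KX: "group (loop_group KX Vertex)" by (rule group_loop_group[OF Vertex_KX])

lemma wlK: assumes "w:words X"
 shows "wl lK Vertex w:lps KX Vertex" "lcl KX Vertex (wl lK Vertex w) = evw (loop_group KX Vertex) (%l. lcl KX Vertex (lK l)) w"
 using wl_lps[of w lK KX Vertex] lK_lps Vertex_KX assms by (auto simp: in_words_iff)

text \<open>The boundary circle contracts in the closed disc, and the characteristic map of the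
  2-cell carries the contraction to the complex.\<close>

lemma relator_null: assumes r: "r:R" shows "evw (loop_group KX Vertex) (%l. lcl KX Vertex (lK l)) r = \<one>\<^bsub>loop_group KX Vertex\<^esub>"
proof -
 have rw: "r:words X" using r R by auto
 let ?c = "%t. cis (2 * pi * t)"
 have c: "pin (cball 0 1) 1 1 ?c" "pin (cball 0 1) 1 1 (%_. 1 :: complex)"
  by (auto simp: pin_def path_def path_image_def pathstart_def pathfinish_def intro!: continuous_intros)
 have V: "face_map r 1 = Vertex" using Arg2pi_of_real[of 1] by (simp add: face_map_def word_loop_def edge_map_def Let_def case_prod_beta')
 have fc: "face_map r (?c t) = wl lK Vertex r t" if "t:I1" for t
 proof (cases "t = 1")
  case True thus ?thesis using V by (simp add: wl_def)
 next
  case False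
  have "Arg2pi (?c t) = 2 * pi * t"
   by (rule Arg2pi_unique[of 1]) (use that False in "auto simp: cis_conv_exp mult.commute")
  thus ?thesis using False word_loop_wl[of t r] by (simp add: face_map_def)
 qed
 have "hk KX (face_map r o ?c) (face_map r o (%_. 1))" by (rule hk_through[OF _ cont_face[OF r] c]) simp
 moreover have "hk KX (wl lK Vertex r) (face_map r o ?c)" by (rule hk_eq[OF lps_cont[OF wlK(1)[OF rw]]]) (simp add: fc)
 ultimately have "hk KX (wl lK Vertex r) (%_. Vertex)" using V hk_trans by (fastforce simp: o_def)
 thus ?thesis
  using lcl_eq[OF wlK(1)[OF rw], of "%_. Vertex"] Vertex_KX wlK(2)[OF rw] by (simp add: lcl_one lps_def)
qed

text \<open>This is what extends a map of the 1-skeleton of \<open>P\<close> to the presentation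
  complex over the triangles.\<close>

lemma pw_eq_hk:
 assumes "u:words X" "v:words X" "pw X R u = pw X R v" shows "lcl KX Vertex (wl lK Vertex u) = lcl KX Vertex (wl lK Vertex v)"
 unfolding wlK(2)[OF assms(1)] wlK(2)[OF assms(2)]
proof (rule von_Dyck[OF R group_KX _ relator_null assms])
 fix g b assume g: "g:X"
 have "(%t. lK (g,b) (1 - t)) = lK (g,~ b)" by (auto simp: lK_def fun_eq_iff)
 thus "lcl KX Vertex (lK (g,b)):carrier (loop_group KX Vertex) &
   lcl KX Vertex (lK (g,b)) \<otimes>\<^bsub>loop_group KX Vertex\<^esub> lcl KX Vertex (lK (g,~ b)) = \<one>\<^bsub>loop_group KX Vertex\<^esub>"
  using lcl_reverse[OF lK_lps, of "(g,b)"] lcl_closed[OF lK_lps, of "(g,b)"] g by simp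
qed

lemma ev_wl_append:
 assumes "u:words X" "v:words X"
 shows "lcl KX Vertex (wl lK Vertex (u @ v)) = lcl KX Vertex (jn (wl lK Vertex u) (wl lK Vertex v))"
proof -
 have uv: "u @ v:words X" using assms by (auto simp: in_words_iff)
 have "lcl KX Vertex (lK l):carrier (loop_group KX Vertex)" if "l:set (u @ v)" for l
  by (rule lcl_closed[OF lK_lps]) (use uv that in "auto simp: in_words_iff")
 thus ?thesis
  using ev_append[OF R group_KX, of u v "%l. lcl KX Vertex (lK l)"] wlK[OF assms(1)] wlK[OF assms(2)] wlK(2)[OF uv] by (simp add: lcl_jn)
qed

end

text \<open>The map into \<open>P\<close> is given by a loop for every generator and by an extension over the disc for every relator.\<close>

lemma map_from_presentation_complex:
 fixes S :: "'a::euclidean_space set"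
 assumes R: "R \<subseteq> words X" and lam: "!!g. g:X ==> lm g:lps (tos S) x"
  and null: "!!r. r:R ==> lcl (tos S) x (wl (%l t. lm (fst l) (if snd l then t else 1 - t)) x r) = \<one>\<^bsub>loop_group (tos S) x\<^esub>"
  and x: "x:S"
 shows "EX b. ctm (presentation_complex X R) (tos S) b & b Vertex = x & (ALL g:X. ALL t:I1. b (edge_map g t) = lm g t)"
proof -
 let ?P = "%l t. lm (fst l) (if snd l then t else 1 - t)"
 have ex: "EX D. cts (cball 0 1) D & D:cball 0 1 \<rightarrow> S & (ALL z:sphere 0 1. D z = wl ?P x r (Arg2pi z / (2 * pi)))" if r: "r:R" for r
 proof -
  have "ALL l:set r. ?P l:lps (tos S) x"
  proof
   fix l assume "l:set r"
   hence "fst l:X" using r R by (auto simp: in_words_iff)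
   thus "?P l:lps (tos S) x" using lam[of "fst l"] lps_reverse[OF lam[of "fst l"]] by (cases "snd l") simp_all
  qed
  hence w: "wl ?P x r:lps (tos S) x" using wl_lps[of r ?P "tos S" x] x by simp
  have "hk (tos S) (wl ?P x r) (%_. x)"
   using null[OF r] lcl_eq[OF w, of "%_. x"] x by (simp add: lcl_one lps_def)
  hence "homotopic_loops S (wl ?P x r) (%_. x)"
   using w unfolding hk_def homotopic_loops_def pathstart_def pathfinish_def
   by (auto simp: lps_def elim!: homotopic_with_mono)
  from homotopic_loops_imp_homotopic_circlemaps[OF this]
  have "homotopic_with_canon (%_. True) (sphere 0 1) S (wl ?P x r o (%z. Arg2pi z / (2 * pi))) (%_. x)" by (simp add: o_def)
  thus ?thesis
   using nullhomotopic_from_sphere_extension[of 0 1 S "wl ?P x r o (%z. Arg2pi z / (2 * pi))"] by auto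
 qed
 hence "ALL r:R. EX D. cts (cball 0 1) D & D:cball 0 1 \<rightarrow> S & (ALL z:sphere 0 1. D z = wl ?P x r (Arg2pi z / (2 * pi)))" by blast
 from bchoice[OF this] obtain D
  where "ALL r:R. cts (cball 0 1) (D r) & D r:cball 0 1 \<rightarrow> S & (ALL z:sphere 0 1. D r z = wl ?P x r (Arg2pi z / (2 * pi)))" ..
 note D = this[rule_format]
 define b where "b y = (case y of Vertex => x | Edge g t => lm g t | Face r z => D r z)" for y
 have be: "b (edge_map g t) = lm g t" if "g:X" "t:I1" for g t
  using lam[OF that(1)] that(2) by (cases "t = 0 | t = 1") (auto simp: b_def edge_map_def lps_def)
 have bf: "b (face_map r z) = D r z" if "r:R" "z:cball 0 1" for r z
 proof (cases "norm z < 1")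
  case False
  define t where "t = Arg2pi z / (2 * pi)"
  have t: "0 <= t" "t < 1" using Arg2pi_ge_0[of z] Arg2pi_lt_2pi[of z] by (simp_all add: t_def divide_simps)
  have "b (wl lK Vertex r t) = wl ?P x r t"
  proof (cases "r = []")
   case False
   let ?i = "nat \<lfloor>real (length r) * t\<rfloor>" and ?f = "frac (real (length r) * t)"
   have "real (length r) * t < real (length r)" using False t by simp
   hence "?i < length r" using t by (simp add: nat_less_iff floor_less_iff)
   hence "fst (r ! ?i):X" using that(1) R nth_mem[of ?i r] by (auto simp: in_words_iff)
   moreover have "?f:I1" using frac_ge_0[of "real (length r) * t"] frac_lt_1[of "real (length r) * t"] by simp
   ultimately show ?thesis using False t be by (simp add: wl_def lK_def)
  qed (simp add: wl_def b_def)
  thus ?thesis using D[OF that(1)] False that(2) t word_loop_wl[of t r] by (simp add: face_map_def t_def)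
 qed (simp add: face_map_def b_def)
 have "ctm (presentation_complex X R) (tos S) b"
  unfolding continuous_map_def
 proof (intro conjI allI impI)
  show "b:topspace (presentation_complex X R) \<rightarrow> topspace (tos S)"
  proof
   fix y assume "y:topspace (presentation_complex X R)"
   then consider "y = Vertex" | g t where "g:X" "0 < t" "t < 1" "y = Edge g t" | r z where "r:R" "norm z < 1" "y = Face r z"
    unfolding topKX[OF R] complex_points_def by blast
   thus "b y:topspace (tos S)"
   proof cases
    case 2
    thus ?thesis using continuous_map_image_subset_topspace[OF lps_cont[OF lam[OF 2(1)]]] by (auto simp: b_def image_subset_iff)
   next
    case 3
    thus ?thesis using D[OF 3(1)] by (auto simp: b_def)
   qed (use x in "simp add: b_def")
  qed
  fix U assume U: "openin (tos S) U"
  have "openin (tos I1) {t:I1. lm g t:U}" if "g:X" for g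
   using openin_continuous_map_preimage[OF lps_cont[OF lam[OF that]] U] by simp
  moreover have "openin (tos (cball 0 1)) {z:cball 0 1. D r z:U}" if "r:R" for r
   using openin_continuous_map_preimage[of "tos (cball 0 1)" "tos S" "D r" U] D[OF that] U by simp
  moreover have "{t:I1. edge_map g t:{y:complex_points X R. b y:U}} = {t:I1. lm g t:U}" if "g:X" for g
   using be[OF that] edge_map_in_points[OF that] by auto
  moreover have "{z:cball 0 1. face_map r z:{y:complex_points X R. b y:U}} = {z:cball 0 1. D r z:U}" if "r:R" for r
   using bf[OF that] face_map_in_points[OF that] that R by auto
  ultimately show "openin (presentation_complex X R) {y:topspace (presentation_complex X R). b y:U}"
   unfolding topKX[OF R] openin_presentation_complex by auto
 qed
 thus ?thesis using be by (intro exI[of _ b]) (auto simp: b_def)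
qed

context pcplx begin

lemma spheroid_square: "ctm (tos (I2)) (cube 2) (%(s,t). \<lambda>i\<in>{..<2}. if i = 0 then s else t)"
 unfolding cube_def continuous_map_componentwise
 by (auto simp: case_prod_beta' less_2_cases_iff numeral_2_eq_2 lessThan_Suc intro!: continuous_intros)

text \<open>The sphere \<open>a o A\<close> is null-homotopic in \<open>Z\<close> by asphericity,
  and \<open>b\<close> carries the contraction to \<open>P\<close>.\<close>

lemma killing_map:
 assumes v0K: "{v0}:K" and a: "ctm (tos P) Z a" "a v0 = z" and b: "ctm Z (tos P) b" "b z = v0"
  and asph: "is_singleton (homotopy_set 2 Z z)" and x: "x:carrier Pi"
 shows "ind (b o a) x = \<one>\<^bsub>Pi\<^esub>"
proof -
 obtain A where A: "cl A" "ALL t:I1. A 0 t = v0 & A 1 t = v0" "hol A = x" by (rule Pi_surj[OF x]) blast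
 have hA: "hmap P v0 v0 A" using A(1) by (auto simp: cl_def om_def)
 have sm: "selfmap (b o a)" using continuous_map_compose[OF a(1) b(1)] a(2) b(2) by (auto simp: selfmap_def)
 have zZ: "z:topspace Z" using continuous_map_image_subset_topspace[OF a(1)] a(2) v0 by auto
 let ?f = "%p :: nat => real. a (A (p 0) (p 1))" and ?g = "%p :: nat => real. z"
 have pr: "ctm (cube 2) (tos (I2)) (%p. (p 0,p 1))"
 proof -
  have "ctm (cube 2) (prod_topology (tos I1) (tos I1)) (%p. (p 0,p 1))"
   unfolding continuous_map_pairwise o_def fst_conv snd_conv cube_def by (intro conjI continuous_map_product_projection) auto
  thus ?thesis by simp
 qed
 have "ctm (tos (I2)) (tos P) (%(s,t). A s t)" using hA by (auto simp: hmap_def)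
 from continuous_map_compose[OF pr continuous_map_compose[OF this a(1)]] have "ctm (cube 2) Z ?f" by (simp add: o_def)
 moreover have "?f p = z" if pb: "p:cube_boundary 2" for p
 proof -
  obtain i where p: "p:topspace (cube 2)" "i < 2" "p i = 0 | p i = 1" using pb by (auto simp: cube_boundary_def)
  have "p 0:I1" "p 1:I1" using p(1) by (auto simp: cube_def PiE_def Pi_def)
  moreover have "i = 0 | i = 1" using p(2) by auto
  ultimately have "A (p 0) (p 1) = v0" using p(3) A(2) hA unfolding hmap_def by auto
  thus ?thesis using a(2) by simp
 qed
 ultimately have f: "?f:spheroids 2 Z z" "?g:spheroids 2 Z z" using zZ by (auto simp: spheroids_def)
 let ?r = "{(f,g). f:spheroids 2 Z z & g:spheroids 2 Z z & homotopic_with (%h. ALL p:cube_boundary 2. h p = z) (cube 2) Z f g}"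
 have "?r `` {?f} = ?r `` {?g}" using asph quotientI[OF f(1), of ?r] quotientI[OF f(2), of ?r] unfolding homotopy_set_def is_singleton_def by auto
 moreover have "?g:?r `` {?g}" using f(2) by (auto simp: spheroids_def intro!: homotopic_with_refl[THEN iffD2])
 ultimately have "(?f,?g):?r" by blast
 hence "homotopic_with (%h. ALL p:cube_boundary 2. h p = z) (cube 2) Z ?f ?g" by blast
 then obtain h where h: "ctm (prod_topology (tos I1) (cube 2)) Z h" "ALL p. h (0,p) = ?f p" "ALL p. h (1,p) = z"
  "ALL x:I1. ALL p:cube_boundary 2. h (x,p) = z" unfolding homotopic_with_def by auto
 let ?q = "%s t. \<lambda>i\<in>{..<2::nat}. if i = 0 then s else t :: real"
 have "ctm (tos (I1 \<times> I2)) (prod_topology (tos I1) (cube 2)) (%z. (fst z,?q (fst (snd z)) (snd (snd z))))"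
 proof -
  have "ctm (tos (I1 \<times> I2)) (tos (I2)) snd" "ctm (tos (I1 \<times> I2)) (tos I1) fst"
   by (auto intro!: continuous_on_snd continuous_on_fst continuous_on_id)
  from this(2) continuous_map_compose[OF this(1) spheroid_square] show ?thesis by (simp add: continuous_map_pairwise o_def case_prod_beta')
 qed
 from continuous_map_compose[OF continuous_map_compose[OF this h(1)] b(1)]
 have c: "ctm (tos (I1 \<times> I2)) (tos P) (%z. b (h (fst z,?q (fst (snd z)) (snd (snd z)))))" by (simp add: o_def)
 have bd: "?q s t:cube_boundary 2" if "s:I1" "t:I1" "s = 0 | s = 1 | t = 0 | t = 1" for s t
  using that unfolding cube_boundary_def cube_def by (auto intro: exI[of _ 0] exI[of _ 1])
 define H where "H x s t = b (h (x,?q s t))" for x s t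
 have Hb: "H x s t = v0" if "x:I1" "s:I1" "t:I1" "s = 0 | s = 1 | t = 0 | t = 1" for x s t
  using h(4) bd[OF that(2-4)] that(1) b(2) by (simp add: H_def)
 have "ALL z:I1 \<times> I2. b (h (fst z,?q (fst (snd z)) (snd (snd z)))):P" using c by (simp add: Pi_iff)
 from bspec[OF this, of "(_,_,_)", unfolded fst_conv snd_conv]
 have HP: "H x s t:P" if "x:I1" "s:I1" "t:I1" for x s t using that unfolding H_def by blast
 have "cts (I1 \<times> I2) (%(x,s,t). H x s t)" using c by (simp add: H_def case_prod_beta')
 hence s3: "sph3 H" unfolding sph3_def using HP Hb by simp
 have H01: "H 0 s t = (b o a) (A s t)" "H 1 s t = v0" for s t using h(2,3) b(2) by (auto simp: H_def)
 have c1: "cl (%s. (b o a) o A s)" by (rule selfmap_cl[OF sm A(1)])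
 have "ind (b o a) x = hol (%s. (b o a) o A s)" using ind_hol[OF sm A(1)] A(3) by simp
 also have "... = hol (H 0)" by (rule hol_cong) (use c1 H01 in "auto simp: cl_def")
 also have "... = hol (H 1)"
 proof (rule hol_free[OF s3])
  have "om (H 0)" by (rule om_cong[of "%s. (b o a) o A s"]) (use c1 H01 in "auto simp: cl_def")
  thus "hps P (H 0 0) c0" by (rule om_row(2)) simp
 qed (use Hb in auto)
 also have "H 1 = (%s. c0)" using H01(2) by (auto simp: fun_eq_iff)
 also have "hol (%s. c0) = \<one>\<^bsub>Pi\<^esub>" by (rule om_const(2)[OF pin_c0]) (use pin_c0 in "auto simp: pin_def")
 finally show ?thesis .
qed

text \<open>An edge is sent by \<open>a\<close> to the loop of a word \<open>ww u v\<close> for its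
  class \<open>eg u v\<close>. These classes multiply along triangles, so \<open>a\<close> extends
  over them, and \<open>b\<close> returns the edge as a loop of the same class. Hence
  \<open>straighten\<close> applies to \<open>b o a\<close> with tracks of trivial holonomy and
  yields the identity on the 1-skeleton.\<close>

theorem killing_exists:
 assumes v0K: "{v0}:K" and R: "R \<subseteq> words X" and fh: "fh:iso (presented_group X R) G"
  and asph: "is_singleton (homotopy_set 2 (presentation_complex X R) Vertex)"
 shows "EX e. killing K P v0 e"
proof -
 let ?Z = "presentation_complex X R" and ?P = "tos P"
 have Geq: "G = loop_group ?P v0" by (rule fundamental_group_eq(1))
 have fhh: "fh:hom (presented_group X R) G" and fhb: "bij_betw fh (carrier (presented_group X R)) (carrier G)"
  using fh by (auto simp: iso_def)
 have gl: "[(g,b)]:words X" if "g:X" for g b using that by (auto simp: in_words_iff)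
 have "EX p. p:lps ?P v0 & lcl ?P v0 p = fh (pw X R [(g,True)])" if "g:X" for g
  using lcl_surj hom_in_carrier[OF fhh pw_closed[OF R gl[OF that]]] unfolding Geq by metis
 then obtain lm where lm: "!!g. g:X ==> lm g:lps ?P v0 & lcl ?P v0 (lm g) = fh (pw X R [(g,True)])" by metis
 let ?l = "%l t. lm (fst l) (if snd l then t else 1 - t)"
 have ll: "?l l:lps ?P v0 & lcl ?P v0 (?l l) = fh (pw X R [l])" if lX: "fst l:X" for l
 proof (cases "snd l")
  case True thus ?thesis using lm[OF lX] by (cases l) simp
 next
  case False
  then obtain g where l: "l = (g,False)" "g:X" using lX by (cases l) simp
  note p = lm[OF l(2)]
  have "freely_equal X ([] @ [(g,True),(g,~ True)] @ []) ([] @ [])" by (rule freely_equal.cancel) (use l in "auto simp: in_words_iff")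
  hence "free_rel X `` {[(g,True),(g,False)]} = free_rel X `` {[]}"
   by (intro equiv_class_eq[OF equiv_free_rel]) (simp add: free_rel_def)
  hence "pw X R ([(g,True)] @ [(g,False)]) = \<one>\<^bsub>presented_group X R\<^esub>" using pw_one(1)[OF R] by (simp add: pw_def)
  hence "pw X R [(g,True)] \<otimes>\<^bsub>presented_group X R\<^esub> pw X R [(g,False)] = \<one>\<^bsub>presented_group X R\<^esub>"
   unfolding pw_append[OF R gl[OF l(2)] gl[OF l(2)]] .
  from arg_cong[OF this, of fh] have "fh (pw X R [(g,True)]) \<otimes>\<^bsub>G\<^esub> fh (pw X R [(g,False)]) = \<one>\<^bsub>G\<^esub>"
   unfolding hom_mult[OF fhh pw_closed[OF R gl[OF l(2)]] pw_closed[OF R gl[OF l(2)]]] hom_one[OF fhh group_presented_group[OF R] G.is_group] .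
  note e1 = this and pl = conjunct1[OF p]
  note q = lps_reverse[OF pl]
  have fg: "fh (pw X R [(g,False)]):carrier G" by (rule hom_in_carrier[OF fhh pw_closed[OF R gl[OF l(2)]]])
  have e2: "fh (pw X R [(g,True)]) \<otimes>\<^bsub>G\<^esub> lcl ?P v0 (%t. lm g (1 - t)) = \<one>\<^bsub>G\<^esub>"
   using lcl_reverse[OF pl, folded Geq] unfolding conjunct2[OF p] .
  have "lcl ?P v0 (%t. lm g (1 - t)) = fh (pw X R [(g,False)])"
  proof -
   note c = lcl_closed[OF pl, folded Geq, unfolded conjunct2[OF p]] lcl_closed[OF q, folded Geq]
   show ?thesis using G.inv_equality[OF G.inv_comm[OF e1 c(1) fg] c(1) fg] G.inv_equality[OF G.inv_comm[OF e2 c] c] by simp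
  qed
  thus ?thesis using l q by simp
 qed
 have wlP: "wl ?l v0 w:lps ?P v0 & lcl ?P v0 (wl ?l v0 w) = fh (pw X R w)" if "w:words X" for w
 proof -
  have l: "ALL l:set w. fst l:X" using that by (simp add: in_words_iff)
  have "evw G (%l. lcl ?P v0 (?l l)) w = evw G (%l. fh (pw X R [l])) w"
   unfolding evw_def by (rule foldr_cong) (use l ll in auto)
  thus ?thesis using wl_lps[of w ?l ?P v0] l ll v0 ev_hom[OF R fhh G.is_group that] unfolding Geq by auto
 qed
 obtain b where b: "ctm ?Z ?P b" "b Vertex = v0" "ALL g:X. ALL t:I1. b (edge_map g t) = lm g t"
 proof -
  have "EX b. ctm ?Z ?P b & b Vertex = v0 & (ALL g:X. ALL t:I1. b (edge_map g t) = lm g t)"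
  proof (rule map_from_presentation_complex[OF R _ _ v0])
   fix r assume r: "r:R"
   thus "lcl ?P v0 (wl ?l v0 r) = \<one>\<^bsub>loop_group ?P v0\<^esub>"
    using wlP[of r] R pw_one(2)[OF R r] hom_one[OF fhh group_presented_group[OF R] G.is_group] unfolding Geq by auto
  qed (use lm in auto)
  thus ?thesis using that by blast
 qed
 have bw: "b (wl lK Vertex w t) = wl ?l v0 w t" if w: "w:words X" and t: "t:I1" for w t
 proof (cases "w = [] | t = 1")
  case False
  let ?i = "nat \<lfloor>real (length w) * t\<rfloor>" and ?f = "frac (real (length w) * t)"
  have "real (length w) * t < real (length w)" using False t by simp
  hence "?i < length w" using t by (simp add: nat_less_iff floor_less_iff)
  hence "fst (w ! ?i):X" using w nth_mem[of ?i w] by (auto simp: in_words_iff)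
  moreover have "?f:I1" using frac_ge_0[of "real (length w) * t"] frac_lt_1[of "real (length w) * t"] by simp
  ultimately show ?thesis using False b(3) by (simp add: wl_def lK_def)
 qed (use b(2) in "auto simp: wl_def")
 have egc: "eg v w:carrier G" if "edge2 v w" for v w by (rule eg_closed[of "{v,w}"]) (use that in "auto simp: edge2_def intro: hull_inc")
 have "EX w:words X. fh (pw X R w) = eg u v" if uv: "edge2 u v" for u v
 proof -
  obtain y where "y:carrier (presented_group X R)" "fh y = eg u v" using egc[OF uv] bij_betw_imp_surj_on[OF fhb] by (metis imageE)
  thus ?thesis using pw_surj[OF R] by blast
 qed
 then obtain ww where ww: "!!u v. edge2 u v ==> ww u v:words X & fh (pw X R (ww u v)) = eg u v" by metis
 define E where "E u v = wl lK Vertex (ww u v)" for u v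
 have E: "E u v:lps ?Z Vertex" if "edge2 u v" for u v unfolding E_def by (rule wlK(1)[OF R]) (use ww[OF that] in simp)
 have "EX Ph. ctm (tos (I2)) ?Z Ph & (ALL y:I1. Ph (0,y) = E u w y & Ph (1,y) = jn (E u v) (E v w) y & Ph (y,0) = Vertex & Ph (y,1) = Vertex)"
  if f: "face_tri u v w" for u v w
 proof -
  note e = face_tri_edges[OF f]
  have o: "ww u v:words X" "ww v w:words X" "ww u w:words X" "ww u v @ ww v w:words X" using ww e by (auto simp: in_words_iff)
  have "eg u w = eg u v \<otimes>\<^bsub>G\<^esub> eg v w"
   by (rule eg_mult[of "{u,v,w}", symmetric]) (use f in "auto simp: face_tri_def intro: hull_inc")
  also have "... = fh (pw X R (ww u v @ ww v w))"
   using ww e pw_append[OF R o(1,2)] hom_mult[OF fhh pw_closed[OF R o(1)] pw_closed[OF R o(2)]] by simp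
  finally have "pw X R (ww u w) = pw X R (ww u v @ ww v w)"
   using ww e inj_onD[OF bij_betw_imp_inj_on[OF fhb]] pw_closed[OF R o(3)] pw_closed[OF R o(4)] by simp
  from pw_eq_hk[OF R o(3,4) this] have "lcl ?Z Vertex (E u w) = lcl ?Z Vertex (jn (E u v) (E v w))"
   using ev_wl_append[OF R o(1,2)] by (simp add: E_def)
  hence "hk ?Z (E u w) (jn (E u v) (E v w))" using lcl_eq[OF E lps_jn[OF E E]] e by blast
  thus ?thesis using E[of u w] e unfolding hk_iff lps_def by (elim exE conjE) auto
 qed
 then obtain Ph where Ph: "!!u v w. face_tri u v w ==> ctm (tos (I2)) ?Z (Ph u v w) &
  (ALL y:I1. Ph u v w (0,y) = E u w y & Ph u v w (1,y) = jn (E u v) (E v w) y & Ph u v w (y,0) = Vertex & Ph u v w (y,1) = Vertex)" by metis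
 have "EX a. ctm ?P ?Z a & (ALL v. {v}:K --> a v = Vertex) & (ALL v w. edge2 v w --> (ALL y:I1. a (lp v w y) = E v w y)) &
   (ALL u v w. face_tri u v w --> (ALL z:I2. a (tri u v w z) = Ph u v w z))"
  by (rule skeletal_extension) (use Vertex_KX[OF R] E Ph in "auto simp: lps_def")
 then obtain a where a: "ctm ?P ?Z a" "ALL v. {v}:K --> a v = Vertex" "ALL v w. edge2 v w --> (ALL y:I1. a (lp v w y) = E v w y)" by blast
 let ?e = "b o a"
 have av: "?e v = v0" if "{v}:K" for v using a(2) b(2) that by simp
 have ec: "cts P ?e" "?e:P \<rightarrow> P" using continuous_map_compose[OF a(1) b(1)] by auto
 have "EX p. pin P v0 v p & hl p = \<one>\<^bsub>G\<^esub>" if "{v}:K" for v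
  by (rule hl_surj[OF G.one_closed v0]) (rule vertex_P[OF that], simp)
 then obtain ta where ta: "!!v. {v}:K ==> pin P v0 v (ta v) & hl (ta v) = \<one>\<^bsub>G\<^esub>" by metis
 have rel: "hps P ((?e o lp v w) +++ ta w) (ta v +++ lp v w)" if e: "edge2 v w" for v w
 proof -
  have vw: "{v}:K" "{w}:K" "v:P" "w:P" using face[of "{v,w}"] vertex_P[of "{v,w}"] e by (auto simp: edge2_def)
  have l: "pin P v w (lp v w)"
   by (rule pin_linepath) (use segment_skel1[of "{v,w}" v w] skel1_P e in "auto simp: edge2_def")
  have el: "pin P v0 v0 (?e o lp v w)" using pin_image[OF l ec] av[OF vw(1)] av[OF vw(2)] by simp
  have "hps P (wl ?l v0 (ww v w)) (?e o lp v w)"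
   by (rule homotopic_paths_sym[OF homotopic_paths_eq]) (use el a(3) e bw ww[OF e] in "auto simp: pin_def E_def")
  from hl_homotopic[OF this] have "hl (?e o lp v w) = hl (wl ?l v0 (ww v w))" by simp
  also have "... = eg v w"
   using hl_based[of "wl ?l v0 (ww v w)"] wlP ww[OF e] pin_homotopic[OF `homotopic_paths P (wl ?l v0 (ww v w)) (?e o linepath v w)`] el
   by (simp add: fundamental_group_eq(2))
  finally show ?thesis
   using hl_inject[OF pin_join[OF el] pin_join[OF _ l]] hl_join[OF el] hl_join[OF _ l] ta[OF vw(1)] ta[OF vw(2)] egc[OF e]
   by (simp add: eg_def)
 qed
 have "EX F. cts (I1 \<times> P) (%(x,z). F x z) & (ALL x:I1. ALL z:P. F x z:P) & (ALL z:P. F 0 z = ?e z) &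
  (ALL z:skel1. F 1 z = z) & (ALL v. {v}:K --> (ALL x:I1. F x v = ta v x))"
  by (rule straighten[OF ec _ rel]) (use ta av in auto)
 then obtain F where F: "cts (I1 \<times> P) (%(x,z). F x z)" "!!x z. x:I1 ==> z:P ==> F x z:P" "!!z. z:P ==> F 0 z = ?e z"
  "!!z. z:skel1 ==> F 1 z = z" "!!v x. {v}:K ==> x:I1 ==> F x v = ta v x" by blast
 have Fc: "cts P (F x)" if "x:I1" for x by (rule cont2[OF F(1)]) (use that in "auto intro!: continuous_intros")
 have t1: "pin P v0 v0 (ta v0)" "hl (ta v0) = \<one>\<^bsub>G\<^esub>" using ta[OF v0K] by auto
 have v1: "F 1 v0 = v0" "F 0 v0 = v0" using F(5)[OF v0K] t1(1) by (auto simp: pin_def pathstart_def pathfinish_def)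
 have sm: "selfmap (F 0)" "selfmap (F 1)" using Fc F(2) v1 by (auto simp: selfmap_def)
 have "hps P (%x. F x v0) (ta v0)"
  by (rule homotopic_paths_sym[OF homotopic_paths_eq]) (use t1(1) F(5)[OF v0K] in "auto simp: pin_def")
 hence null: "hps P (%x. F x v0) c0" using null_iff_hl[OF t1(1)] t1(2) homotopic_paths_trans by blast
 have se: "selfmap ?e" using ec av[OF v0K] by (simp add: selfmap_def)
 have "killing K P v0 (F 1)"
 proof (unfold_locales)
  show "selfmap (F 1)" by (rule sm)
  show "F 1 z = z" if "z:skel1" for z by (rule F(4)[OF that])
  fix x assume x: "x:carrier Pi"
  obtain A where A: "cl A" "hol A = x" using Pi_cl[OF x] by blast
  have "ind (F 1) x = ind (F 0) x" using homotopy_track(1)[OF F(1,2) sm null x] by simp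
  also have "... = hol (%s. F 0 o A s)" using ind_hol[OF sm(1) A(1)] A(2) by simp
  also have "... = hol (%s. ?e o A s)"
   by (rule hol_cong) (use A(1) F(3) selfmap_cl[OF sm(1) A(1)] in "auto simp: cl_def om_def hmap_def")
  also have "... = ind ?e x" using ind_hol[OF se A(1)] A(2) by simp
  finally show "ind (F 1) x = \<one>\<^bsub>Pi\<^esub>" using killing_map[OF v0K a(1) _ b(1,2) asph x] a(2) v0K by simp
 qed
 thus ?thesis by blast
qed

end

section \<open>Weakly Hopfian groups and the theorem\<close>

text \<open>The kernel of \<open>r\<close> and the image of \<open>i\<close> decompose
  \<open>G\<close> as a semidirect product, and the image of \<open>i\<close> is a copy of
  \<open>G\<close>; so the kernel is trivial.\<close>

lemma weakly_hopfian_retraction: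
 assumes wh: "weakly_hopfian G" and G: "group G" and i: "i:hom G G" and r: "r:hom G G"
  and ri: "!!x. x:carrier G ==> r (i x) = x" and x: "x:carrier G"
 shows "i (r x) = x"
proof -
 interpret group G by fact
 interpret R: group_hom G G r using r by unfold_locales
 interpret I: group_hom G G i using i by unfold_locales
 let ?K = "kernel G G r" and ?H = "i ` carrier G"
 have H: "subgroup ?H G" by (rule I.img_is_subgroup)
 have ker: "y \<otimes>\<^bsub>G\<^esub> inv\<^bsub>G\<^esub> (i (r y)):?K" if "y:carrier G" for y
  using that ri by (simp add: kernel_def)
 have "?K <#>\<^bsub>G\<^esub> ?H = carrier G"
 proof
  show "?K <#>\<^bsub>G\<^esub> ?H \<subseteq> carrier G" by (auto simp: set_mult_def kernel_def)
  show "carrier G \<subseteq> ?K <#>\<^bsub>G\<^esub> ?H"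
  proof
   fix y assume y: "y:carrier G"
   have e: "y = (y \<otimes>\<^bsub>G\<^esub> inv\<^bsub>G\<^esub> (i (r y))) \<otimes>\<^bsub>G\<^esub> i (r y)" using y by (simp add: m_assoc)
   have h: "i (r y):?H" by (rule imageI) (use y in simp)
   show "y:?K <#>\<^bsub>G\<^esub> ?H" unfolding set_mult_def by (rule UN_I[OF ker[OF y] UN_I[OF h]]) (use e in simp)
  qed
 qed
 moreover have "?K \<inter> ?H = {\<one>\<^bsub>G\<^esub>}"
 proof
  show "?K \<inter> ?H \<subseteq> {\<one>\<^bsub>G\<^esub>}" using ri by (auto simp: kernel_def)
  show "{\<one>\<^bsub>G\<^esub>} \<subseteq> ?K \<inter> ?H" by (auto simp: kernel_def intro!: image_eqI[of _ _ "\<one>\<^bsub>G\<^esub>"])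
 qed
 moreover have "G\<lparr>carrier := ?H\<rparr> \<cong> G"
 proof -
  have "r:iso (G\<lparr>carrier := ?H\<rparr>) G"
   unfolding iso_def bij_betw_def hom_def using ri by (auto simp: inj_on_def image_image)
  thus ?thesis by (auto simp: is_iso_def)
 qed
 ultimately have "?K = {\<one>\<^bsub>G\<^esub>}" using wh H R.normal_kernel unfolding weakly_hopfian_def by blast
 hence "x \<otimes>\<^bsub>G\<^esub> inv\<^bsub>G\<^esub> (i (r x)) = \<one>\<^bsub>G\<^esub>" using ker[OF x] by blast
 thus ?thesis using inv_equality[of x "inv\<^bsub>G\<^esub> (i (r x))"] x by simp
qed

lemma (in pconn) base_change:
 assumes y: "y:S" shows "EX bb. bb:iso (fundamental_group S y) G"
proof -
 interpret Y: pconn S y using pc y by unfold_locales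
 define bb where "bb g = hl (SOME p. pin S y y p & Y.hl p = g)" for g
 have bb: "bb (Y.hl p) = hl p" if "pin S y y p" for p
 proof -
  have "pin S y y (SOME q. pin S y y q & Y.hl q = Y.hl p) & Y.hl (SOME q. pin S y y q & Y.hl q = Y.hl p) = Y.hl p"
   by (rule someI[of _ p]) (use that in simp)
  thus ?thesis unfolding bb_def using Y.hl_inject[OF _ that] hl_homotopic by blast
 qed
 have ex: "EX p. pin S y y p & Y.hl p = g" if "g:carrier Y.G" for g by (rule Y.hl_surj_based[OF that])
 have "bb:hom Y.G G"
 proof (rule homI)
  fix g h assume "g:carrier Y.G" "h:carrier Y.G"
  then obtain p q where pq: "pin S y y p" "Y.hl p = g" "pin S y y q" "Y.hl q = h" using ex by meson
  thus "bb (g \<otimes>\<^bsub>Y.G\<^esub> h) = bb g \<otimes>\<^bsub>G\<^esub> bb h"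
   using bb[OF pq(1)] bb[OF pq(3)] bb[OF pin_join[OF pq(1,3)]] Y.hl_join[OF pq(1,3)] hl_join[OF pq(1,3)] by simp
 next
  fix g assume "g:carrier Y.G"
  thus "bb g:carrier G" using ex[of g] bb hl_closed by metis
 qed
 moreover have "bij_betw bb (carrier Y.G) (carrier G)"
  unfolding bij_betw_def
 proof
  show "inj_on bb (carrier Y.G)"
  proof (rule inj_onI)
   fix g h assume "g:carrier Y.G" "h:carrier Y.G" and eq: "bb g = bb h"
   then obtain p q where "pin S y y p" "Y.hl p = g" "pin S y y q" "Y.hl q = h" using ex by meson
   thus "g = h" using eq bb hl_inject[of y y p q] Y.hl_homotopic by auto
  qed
  show "bb ` carrier Y.G = carrier G"
  proof
   show "bb ` carrier Y.G \<subseteq> carrier G" using hom_in_carrier[OF `bb : hom Y.G G`] by blast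
   show "carrier G \<subseteq> bb ` carrier Y.G"
   proof
    fix g assume "g:carrier G"
    then obtain p where "pin S y y p" "hl p = g" using hl_surj[OF _ y y] by blast
    thus "g:bb ` carrier Y.G" using bb[of p] Y.hl_closed[of y y p] by (metis image_eqI)
   qed
  qed
 qed
 ultimately show ?thesis by (auto simp: iso_def)
qed

text \<open>Simplices are passed to their vertex sets. Faces of a simplex are hulls of subsets of
  its vertices, and vertices are recovered as extreme points; so a common face of two simplices is
  spanned by common vertices.\<close>

lemma cplx2_simplicial_complex:
 fixes P :: "'a::euclidean_space set"
 assumes T: "simplicial_complex T" "T ~= {}" "\<Union>T = P" "Max (aff_dim ` T) = 2"
 shows "cplx2 {S. S ~= {} & ~ affine_dependent S & convex hull S:T} P"
proof
 let ?K = "{S. S ~= {} & ~ affine_dependent S & convex hull S:T}"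
 have T': "finite T" "!!S. S:T ==> EX n. n simplex S" "!!F S. S:T ==> F face_of S ==> F:T" "!!S S'. S:T ==> S':T ==> (S \<inter> S') face_of S"
  using T(1) by (auto simp: simplicial_complex_def)
 have ext: "S = {x. x extreme_point_of (convex hull S)}" if "~ affine_dependent S" for S :: "'a set"
  using extreme_point_of_convex_hull_affine_independent[OF that] by auto
 show "finite ?K"
 proof (rule finite_subset)
  show "?K \<subseteq> (%C. {x. x extreme_point_of C}) ` T"
  proof
   fix S assume S: "S:?K"
   thus "S:(%C. {x. x extreme_point_of C}) ` T" by (intro image_eqI[of _ _ "convex hull S"] ext) auto
  qed
 qed (use T'(1) in simp)
 fix S assume S: "S:?K"
 have "aff_dim S <= 2"
  using Max_ge[OF finite_imageI[OF T'(1)] imageI[of "convex hull S" T aff_dim]] T(4) S by (simp add: aff_dim_convex_hull)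
 thus "finite S & S ~= {} & ~ affine_dependent S & card S <= 3"
  using S aff_independent_finite[of S] aff_dim_affine_independent[of S] by simp
 show F: "F:?K" if "F \<subseteq> S" "F ~= {}" for F
  using T'(3)[of "convex hull S" "convex hull F"] face_of_convex_hull_affine_independent[of S "convex hull F"] S that affine_dependent_subset[of F S] by blast
 fix S' assume S': "S':?K"
 have "(convex hull S \<inter> convex hull S') face_of convex hull S" "(convex hull S \<inter> convex hull S') face_of convex hull S'"
  using T'(4)[of "convex hull S" "convex hull S'"] T'(4)[of "convex hull S'" "convex hull S"] S S' by (auto simp: Int_commute)
 then obtain c d where c: "c \<subseteq> S" "convex hull S \<inter> convex hull S' = convex hull c" and d: "d \<subseteq> S'" "convex hull S \<inter> convex hull S' = convex hull d"
  using face_of_convex_hull_affine_independent S S' by (metis (no_types, lifting) mem_Collect_eq)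
 have ind: "~ affine_dependent c" "~ affine_dependent d" using c(1) d(1) S S' affine_dependent_subset[of c S] affine_dependent_subset[of d S'] by auto
 have "convex hull c = convex hull d" using c d by simp
 hence "{x. x extreme_point_of (convex hull c)} = {x. x extreme_point_of (convex hull d)}" by (simp only:)
 from box_equals[OF this ext[OF ind(1), symmetric] ext[OF ind(2), symmetric]] have "c = d" .
 hence "convex hull S \<inter> convex hull S' \<subseteq> convex hull (S \<inter> S')" using c d hull_mono[of c "S \<inter> S'"] by auto
 thus "convex hull S \<inter> convex hull S' = convex hull (S \<inter> S')"
  using hull_mono[of "S \<inter> S'" S] hull_mono[of "S \<inter> S'" S'] by blast
next
 let ?K = "{S. S ~= {} & ~ affine_dependent S & convex hull S:T}"
 show "P = (\<Union>S\<in>?K. convex hull S)"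
 proof (intro equalityI subsetI)
  fix x assume "x:P"
  then obtain A where A: "A:T" "x:A" using T(3) by blast
  then obtain C where "~ affine_dependent C" "A = convex hull C" using T(1) by (auto simp: simplicial_complex_def simplex_def)
  thus "x:(\<Union>S\<in>?K. convex hull S)" using A by (intro UN_I[of C]) auto
 qed (use T(3) in auto)
qed

section \<open>Free and based homotopies, and dominations\<close>

context pcplx begin

abbreviation hm where "hm == homotopic_with_canon (%_. True) P P"

lemma hm_comp: "hm f f' ==> hm g g' ==> hm (g o f) (g' o f')"
 using homotopic_with_compose_continuous_map_left[of "%_. True" "tos P" "tos P" f f' "tos P" g "%_. True"]
  homotopic_with_compose_continuous_map_right[of "%_. True" "tos P" "tos P" g g' "tos P" f' "%_. True"]
  homotopic_with_imp_continuous_maps[of "%_. True" "tos P" "tos P" f f']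
  homotopic_with_imp_continuous_maps[of "%_. True" "tos P" "tos P" g g'] homotopic_with_trans by blast

lemma drag:
 assumes f: "cts P f" "f:P \<rightarrow> P" and ga: "pin P (f v0) y ga"
 shows "EX F. cts (I1 \<times> P) (%(x,z). F x z) & (ALL x:I1. ALL z:P. F x z:P) & (ALL z:P. F 0 z = f z) & (ALL x:I1. F x v0 = ga x)"
proof -
 have "cts (I1 \<times> {v0}) (%(x,z). ga x)"
  using continuous_on_compose2[of I1 ga "I1 \<times> {v0}" fst] ga by (auto simp: pin_def path_def case_prod_beta' continuous_on_fst)
 from HEP[OF _ _ f this] show ?thesis using ga v0 by (auto simp: pin_def path_image_def pathstart_def image_subset_iff)
qed

lemma canon_drag:
 assumes "cts (I1 \<times> P) (%(x,z). F x z)" "ALL x:I1. ALL z:P. F x z:P" "ALL z:P. F 0 z = f z"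
 shows "hm f (F 1)" "cts P (F 1)" "F 1:P \<rightarrow> P"
proof -
 show "hm f (F 1)" unfolding homotopic_canon_iff using assms by (intro exI[of _ F]) auto
 thus "cts P (F 1)" "F 1:P \<rightarrow> P" using homotopic_with_imp_continuous_maps by force+
qed

text \<open>\<open>homotopy_track\<close> for given end maps, with which \<open>F 0\<close> and
  \<open>F 1\<close> agree on \<open>P\<close> but perhaps not elsewhere.\<close>

lemma track_eq:
 assumes F: "cts (I1 \<times> P) (%(x,z). F x z)" "!!x z. x:I1 ==> z:P ==> F x z:P"
  and fg: "selfmap f" "selfmap g" "!!z. z:P ==> F 0 z = f z & F 1 z = g z" and null: "hps P (%x. F x v0) c0"
 shows "x:carrier Pi ==> ind f x = ind g x" and "ga:carrier G ==> ind1 f ga = ind1 g ga"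
proof -
 have sm: "selfmap k" if "selfmap f" "!!z. z:P ==> k z = f z" for f k
  using that v0 continuous_on_cong[of P P k f] unfolding selfmap_def by (auto simp: Pi_iff)
 have s01: "selfmap (F 0)" "selfmap (F 1)" using sm[OF fg(1), of "F 0"] sm[OF fg(2), of "F 1"] fg(3) by auto
 have c: "ind k x = ind f x" if k: "selfmap f" "selfmap k" "!!z. z:P ==> k z = f z" and x: "x:carrier Pi" for f k x
 proof -
  obtain A where A: "cl A" "hol A = x" using Pi_cl[OF x] by blast
  have "hol (%s. k o A s) = hol (%s. f o A s)"
   by (rule hol_cong) (use A(1) k(3) selfmap_cl[OF k(2) A(1)] in "auto simp: cl_def om_def hmap_def")
  thus ?thesis using ind_hol[OF k(1) A(1)] ind_hol[OF k(2) A(1)] A(2) by simp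
 qed
 have c1: "ind1 k ga = ind1 f ga" if k: "selfmap f" "selfmap k" "!!z. z:P ==> k z = f z" and g: "ga:carrier G" for f k ga
 proof -
  obtain p where p: "pin P v0 v0 p" "hl p = ga" using hl_surj_based[OF g] by blast
  have "hps P (k o p) (f o p)"
   by (rule homotopic_paths_eq) (use selfmap_path[OF k(2) p(1)] p(1) k(3) in "auto simp: pin_def path_image_def image_subset_iff")
  thus ?thesis using ind1_hl[OF k(1) p(1)] ind1_hl[OF k(2) p(1)] p(2) hl_homotopic by simp
 qed
 show "ind f x = ind g x" if "x:carrier Pi"
  using homotopy_track(1)[OF F s01 null that] c[OF fg(1) s01(1) _ that] c[OF fg(2) s01(2) _ that] fg(3) by simp
 show "ind1 f ga = ind1 g ga" if g: "ga:carrier G"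
 proof -
  obtain p where p: "pin P v0 v0 p" "hl p = ga" using hl_surj_based[OF g] by blast
  show ?thesis using homotopy_track(2)[OF F s01 null p(1)] ind1_hl[OF s01(1) p(1)] ind1_hl[OF s01(2) p(1)] p(2) c1[OF fg(1) s01(1) _ g] c1[OF fg(2) s01(2) _ g] fg(3) by simp
 qed
qed

text \<open>Once both maps fix \<open>v0\<close>, the homotopy from their composite to the identity
  may still move \<open>v0\<close> along a loop \<open>mm\<close>. Dragging \<open>d1\<close> along
  \<open>mm\<close> cures this: the new homotopy moves \<open>v0\<close> first back along
  \<open>mm\<close> and then forth, which is null-homotopic.\<close>

lemma normalise_domination:
 assumes d: "cts P d" "d:P \<rightarrow> P" and u: "cts P u" "u:P \<rightarrow> P" and du: "hm (d o u) id"
 shows "EX d' u'. hm d d' & hm u u' & selfmap d' & selfmap u' & (ALL x:carrier Pi. ind (d' o u') x = ind id x) & (ALL g:carrier G. ind1 (d' o u') g = ind1 id g)"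
proof -
 have path: "EX ga. pin P a v0 ga" if "a:P" for a using hl_surj[OF G.one_closed that v0] by blast
 have fx: "EX f'. hm f f' & selfmap f'" if f: "cts P f" "f:P \<rightarrow> P" for f
 proof -
  obtain ga where ga: "pin P (f v0) v0 ga" using path f(2) v0 by blast
  obtain F where F: "cts (I1 \<times> P) (%(x,z). F x z)" "ALL x:I1. ALL z:P. F x z:P" "ALL z:P. F 0 z = f z" "ALL x:I1. F x v0 = ga x"
   using drag[OF f ga] by blast
  have "F 1 v0 = v0" using F(4) ga by (simp add: pin_def pathfinish_def)
  thus ?thesis using canon_drag[OF F(1-3)] by (auto simp: selfmap_def)
 qed
 obtain u' where u': "hm u u'" "selfmap u'" using fx[OF u] by blast
 obtain d1 where d1: "hm d d1" "selfmap d1" using fx[OF d] by blast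
 have "hm (d1 o u') id" using homotopic_with_trans[OF homotopic_with_symD[OF hm_comp[OF u'(1) d1(1)]] du] .
 then obtain H where H: "cts (I1 \<times> P) (%(x,z). H x z)" "ALL x:I1. ALL z:P. H x z:P" "ALL z:P. H 0 z = (d1 o u') z & H 1 z = id z"
  unfolding homotopic_canon_iff by blast
 define mm where "mm x = H x v0" for x
 have "cts I1 mm" unfolding mm_def by (rule cont2[OF H(1)]) (use v0 in "auto intro!: continuous_intros")
 hence mm: "pin P v0 v0 mm"
  using H(2,3) v0 d1(2) u'(2) by (auto simp: pin_def path_def path_image_def pathstart_def pathfinish_def mm_def selfmap_def)
 have d1c: "cts P d1" "d1:P \<rightarrow> P" "d1 v0 = v0" using d1(2) by (auto simp: selfmap_def)
 obtain D where D: "cts (I1 \<times> P) (%(x,z). D x z)" "ALL x:I1. ALL z:P. D x z:P" "ALL z:P. D 0 z = d1 z" "ALL x:I1. D x v0 = mm x"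
  using drag[OF d1c(1,2)] mm d1c(3) by metis
 note cD = canon_drag[OF D(1-3)]
 have D1: "selfmap (D 1)" using cD(2,3) D(4) mm by (auto simp: selfmap_def pin_def pathfinish_def)
 have uc: "cts P u'" "u':P \<rightarrow> P" "u' v0 = v0" using u'(2) by (auto simp: selfmap_def)
 define F where "F x z = (if x <= 1 / 2 then D (1 - 2 * x) (u' z) else H (2 * x - 1) z)" for x z
 have "cts (I1 \<times> P) (%(x,z). F x z)"
  unfolding F_def case_prod_beta'
 proof (rule continuous_on_cases_le)
  have "cts {z:I1 \<times> P. fst z <= 1 / 2} (%z. u' (snd z))" by (rule continuous_on_compose2[OF uc(1)]) (auto intro!: continuous_intros)
  thus "cts {z:I1 \<times> P. fst z <= 1 / 2} (%z. D (1 - 2 * fst z) (u' (snd z)))"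
   by (intro cont2[OF D(1)] continuous_intros) (use uc(2) in auto)
  show "cts {z:I1 \<times> P. 1 / 2 <= fst z} (%z. H (2 * fst z - 1) (snd z))"
   by (intro cont2[OF H(1)] continuous_intros) auto
  fix z assume z: "z:I1 \<times> P" and h: "fst z = 1 / 2"
  thus "D (1 - 2 * fst z) (u' (snd z)) = H (2 * fst z - 1) (snd z)" unfolding h using D(3) H(3) uc(2) by auto
 qed (intro continuous_intros)
 moreover have "F x z:P" if "x:I1" "z:P" for x z using that D(2) H(2) funcset_mem[OF uc(2) that(2)] by (auto simp: F_def)
 moreover have "F 0 z = (D 1 o u') z & F 1 z = id z" if "z:P" for z using that H(3) by (simp add: F_def)
 moreover have "hps P (%x. F x v0) c0"
 proof -
  have e: "(%x. F x v0) t = (rp mm +++ mm) t" if "t:I1" for t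
   using that D(4) uc(3) by (auto simp: F_def joinpaths_def reversepath_def mm_def)
  have r: "pin P v0 v0 (rp mm +++ mm)" by (rule pin_join[OF pin_reverse[OF mm] mm])
  have "hps P (rp mm +++ mm) (%x. F x v0)" by (rule homotopic_paths_eq) (use r e in "auto simp: pin_def")
  moreover have "hps P (rp mm +++ mm) c0"
   unfolding null_iff_hl[OF r] using hl_join[OF pin_reverse[OF mm] mm] hl_reverse[OF mm] hl_closed[OF mm] by simp
  ultimately show ?thesis using homotopic_paths_sym homotopic_paths_trans by blast
 qed
 moreover have "selfmap (D 1 o u')" using D1 u'(2) by (auto simp: selfmap_def intro: continuous_on_compose2)
 moreover have "selfmap id" using v0 by (simp add: selfmap_def)
 ultimately have "ALL x:carrier Pi. ind (D 1 o u') x = ind id x" "ALL g:carrier G. ind1 (D 1 o u') g = ind1 id g"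
  using track_eq[of F "D 1 o u'" id] by blast+
 thus ?thesis using homotopic_with_trans[OF d1(1) cD(1)] u' D1 by blast
qed

end

theorem (in pcplx) domination_equivalence:
 assumes v0K: "{v0}:K" and R: "R \<subseteq> words X" and fh: "fh:iso (presented_group X R) G"
  and asph: "is_singleton (homotopy_set 2 (presentation_complex X R) Vertex)"
  and hopf: "!!i r g. i:hom G G ==> r:hom G G ==> (!!g. g:carrier G ==> r (i g) = g) ==> g:carrier G ==> i (r g) = g"
  and d: "cts P d" "d:P \<rightarrow> P" and u: "cts P u" "u:P \<rightarrow> P" and du: "hm (d o u) id"
 shows "hm (u o d) id"
proof -
 obtain e where e: "killing K P v0 e" using killing_exists[OF v0K R fh asph] by blast
 interpret killing K P v0 e by (rule e)
 obtain d' u' where du': "hm d d'" "hm u u'" "selfmap d'" "selfmap u'"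
  and i: "ALL x:carrier Pi. ind (d' o u') x = ind id x" "ALL g:carrier G. ind1 (d' o u') g = ind1 id g"
  using normalise_domination[OF d u du] by blast
 have sid: "selfmap id" using v0 by (simp add: selfmap_def)
 have idx: "ind id x = x" if x: "x:carrier Pi" for x
 proof -
  obtain A where "cl A" "hol A = x" using Pi_cl[OF x] by blast
  thus ?thesis using ind_hol[OF sid, of A] unfolding id_comp by simp
 qed
 have idg: "ind1 id g = g" if g: "g:carrier G" for g
 proof -
  obtain p where "pin P v0 v0 p" "hl p = g" using hl_surj_based[OF g] by blast
  thus ?thesis using ind1_hl[OF sid, of p] unfolding id_comp by simp
 qed
 have i1c: "ind1 (f o f') g = ind1 f (ind1 f' g)" if that: "selfmap f" "selfmap f'" and g: "g:carrier G" for f f' g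
 proof -
  obtain p where p: "pin P v0 v0 p" "hl p = g" using hl_surj_based[OF g] by blast
  have p': "pin P v0 v0 (f' o p)" using selfmap_path[OF that(2) p(1)] that(2) by (simp add: selfmap_def)
  have "selfmap (f o f')" using that(1,2) by (auto simp: selfmap_def intro: continuous_on_compose2)
  from ind1_hl[OF this p(1)] show ?thesis unfolding p(2) comp_assoc using ind1_hl[OF that(1) p'] ind1_hl[OF that(2) p(1)] p(2) by simp
 qed
 have x1: "ind d' (ind u' x) = x" if "x:carrier Pi" for x using ind_comp[OF du'(3,4) that] i(1) idx that by simp
 have g1: "ind1 d' (ind1 u' g) = g" if "g:carrier G" for g using i1c[OF du'(3,4) that] i(2) idg that by simp
 have g2: "ind1 u' (ind1 d' g) = g" if "g:carrier G" for g by (rule hopf[OF ind1_hom[OF du'(4)] ind1_hom[OF du'(3)] g1 that])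
 have x2: "ind u' (ind d' x) = x" if "x:carrier Pi" for x by (rule right_inverse_pi2[OF du'(4,3) x1 g2 g1 that])
 define h where "h = u' o d'"
 have sh: "selfmap h" using du'(3,4) by (auto simp: h_def selfmap_def intro: continuous_on_compose2)
 have hx: "ind h x = x" if "x:carrier Pi" for x unfolding h_def using ind_comp[OF du'(4,3) that] x2[OF that] by simp
 have hp: "hl (h o p) = hl p" if "pin P v0 v0 p" for p
  using ind1_hl[OF sh that] i1c[OF du'(4,3) hl_closed[OF that]] g2[OF hl_closed[OF that]] by (simp add: h_def)
 have hc: "cts P h" "h:P \<rightarrow> P" "h v0 = v0" using sh by (auto simp: selfmap_def)
 have vP: "v:P" if "{v}:K" for v by (rule vertex_P[OF that]) simp
 define k where "k v = hl (h o ka v)" for v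
 have kv: "pin P v0 (h v) (h o ka v)" "k v:carrier G" "hl (ka v):carrier G" if "v:P" for v
  using selfmap_path[OF sh ka[OF that]] hc(3) hl_closed[OF ka[OF that]] hl_closed by (auto simp: k_def)
 \<comment> \<open>The class is chosen so that \<open>h o ka v\<close> followed by the track is
   homotopic to \<open>ka v\<close>. As \<open>h\<close> acts trivially on loops made of
   \<open>ka v\<close>, an edge and the reverse of \<open>ka w\<close>, the tracks at the two ends
   of an edge are then compatible.\<close>
 have "EX p. pin P (h v) v p & hl p = inv\<^bsub>G\<^esub> k v \<otimes>\<^bsub>G\<^esub> hl (ka v)" if "v:P" for v
  by (rule hl_surj) (use kv[OF that] hc(2) that in auto)
 then obtain ta where ta: "!!v. v:P ==> pin P (h v) v (ta v) & hl (ta v) = inv\<^bsub>G\<^esub> k v \<otimes>\<^bsub>G\<^esub> hl (ka v)" by metis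
 have rel: "hps P ((h o lp v w) +++ ta w) (ta v +++ lp v w)" if ed: "edge2 v w" for v w
 proof -
  have vw: "v:P" "w:P" "{v,w}:K" using vertex_P[of "{v,w}"] ed by (auto simp: edge2_def)
  have l: "pin P v w (lp v w)" using edge_facts(1)[OF vw(3)] by simp
  have hlw: "pin P (h v) (h w) (h o lp v w)" by (rule selfmap_path[OF sh l])
  let ?q = "ka v +++ (lp v w +++ rp (ka w))"
  note r = pin_reverse[OF ka[OF vw(2)]]
  have rh: "pin P (h w) v0 (rp (h o ka w))" by (rule pin_reverse[OF kv(1)[OF vw(2)]])
  have q: "pin P v0 v0 ?q" by (rule pin_join[OF ka[OF vw(1)] pin_join[OF l r]])
  have "h o ?q = (h o ka v) +++ ((h o lp v w) +++ rp (h o ka w))"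
   by (simp add: path_compose_join path_compose_reversepath)
  hence eq: "k v \<otimes>\<^bsub>G\<^esub> (hl (h o lp v w) \<otimes>\<^bsub>G\<^esub> inv\<^bsub>G\<^esub> k w) = hl (ka v) \<otimes>\<^bsub>G\<^esub> (hl (lp v w) \<otimes>\<^bsub>G\<^esub> inv\<^bsub>G\<^esub> hl (ka w))"
   using hp[OF q] hl_join[OF kv(1)[OF vw(1)] pin_join[OF hlw rh]] hl_join[OF hlw rh] hl_reverse[OF kv(1)[OF vw(2)]]
    hl_join[OF ka[OF vw(1)] pin_join[OF l r]] hl_join[OF l r] hl_reverse[OF ka[OF vw(2)]] by (simp add: k_def)
  note c = kv(2,3)[OF vw(1)] kv(2,3)[OF vw(2)] hl_closed[OF l] hl_closed[OF hlw]
  have "hl (h o lp v w) \<otimes>\<^bsub>G\<^esub> (inv\<^bsub>G\<^esub> k w \<otimes>\<^bsub>G\<^esub> hl (ka w)) =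
    inv\<^bsub>G\<^esub> k v \<otimes>\<^bsub>G\<^esub> (k v \<otimes>\<^bsub>G\<^esub> (hl (h o lp v w) \<otimes>\<^bsub>G\<^esub> inv\<^bsub>G\<^esub> k w)) \<otimes>\<^bsub>G\<^esub> hl (ka w)"
   using c by (simp add: G.m_assoc[symmetric])
  also have "... = inv\<^bsub>G\<^esub> k v \<otimes>\<^bsub>G\<^esub> hl (ka v) \<otimes>\<^bsub>G\<^esub> hl (lp v w)" unfolding eq using c by (simp add: G.m_assoc)
  finally show ?thesis
   using ta[OF vw(1)] ta[OF vw(2)] hl_join[OF hlw] hl_join[OF _ l] hl_inject[OF pin_join[OF hlw] pin_join[OF _ l]] by auto
 qed
 obtain F where F: "cts (I1 \<times> P) (%(x,z). F x z)" "ALL x:I1. ALL z:P. F x z:P" "ALL z:P. F 0 z = h z"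
  "ALL z:skel1. F 1 z = z" "ALL v. {v}:K --> (ALL x:I1. F x v = ta v x)"
  using straighten[OF hc(1,2) conjunct1[OF ta[OF vP]] rel] by blast
 note cF = canon_drag[OF F(1-3)]
 have t0: "pin P v0 v0 (ta v0)" using ta[OF v0] hc(3) by simp
 have "hl (ka v0) = \<one>\<^bsub>G\<^esub>" "k v0 = \<one>\<^bsub>G\<^esub>"
  using hl_const[OF v0] hp[OF ka[OF v0]] by (simp_all add: k_def ka_def)
 hence "hps P (ta v0) c0" using null_iff_hl[OF t0] ta[OF v0] by simp
 moreover have "hps P (ta v0) (%x. F x v0)"
  by (rule homotopic_paths_eq) (use t0 F(5) v0K in "auto simp: pin_def")
 ultimately have null: "hps P (%x. F x v0) c0" using homotopic_paths_sym homotopic_paths_trans by blast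
 have F1: "selfmap (F 1)" using cF(2,3) F(5) v0K t0 by (auto simp: selfmap_def pin_def pathfinish_def)
 have "ind (F 1) x = x" if "x:carrier Pi" for x
  using track_eq(1)[OF F(1) _ sh F1 _ null that] F(2,3) hx[OF that] by simp
 then obtain g where g: "cts P g" "g:P \<rightarrow> P" "hm (F 1 o g) id"
  using right_homotopy_inverse[OF v0K F1] F(4) by blast
 have rf: "hm f f" if "cts P f" "f:P \<rightarrow> P" for f using that by (simp add: homotopic_with_refl)
 note gr = rf[OF g(1,2)]
 have hg: "hm (h o g) id" using homotopic_with_trans[OF hm_comp[OF gr cF(1)] g(3)] .
 have sm: "cts P d'" "d':P \<rightarrow> P" "cts P u'" "u':P \<rightarrow> P" using du'(3,4) by (auto simp: selfmap_def)
 have d'u': "hm (d' o u') id" using homotopic_with_trans[OF homotopic_with_symD[OF hm_comp[OF du'(2,1)]] du] .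
 \<comment> \<open>\<open>d'\<close> is homotopic to \<open>d' u' d' g\<close>, because
   \<open>h g\<close> is homotopic to the identity, and hence to \<open>d' g\<close>; composition
   with \<open>u'\<close> then gives \<open>h\<close> and \<open>h g\<close>.\<close>
 have "hm (d' o (u' o (d' o g))) (d' o id)" using hm_comp[OF hg rf[OF sm(1,2)]] by (simp add: h_def comp_assoc)
 moreover have "hm ((d' o u') o (d' o g)) (id o (d' o g))" by (rule hm_comp[OF hm_comp[OF gr rf[OF sm(1,2)]] d'u'])
 ultimately have "hm d' (d' o g)" by (metis comp_assoc comp_id homotopic_with_symD homotopic_with_trans id_comp)
 from hm_comp[OF this rf[OF sm(3,4)]] have "hm h (h o g)" by (simp add: h_def comp_assoc)
 hence "hm h id" using hg homotopic_with_trans by blast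
 thus ?thesis using homotopic_with_trans[OF hm_comp[OF du'(1,2)]] by (simp add: h_def)
qed

theorem theorem1:
  fixes P :: "'a::euclidean_space set" and x0 :: 'a
  assumes "finite_polyhedron P 2" and "connected P" and "x0 \<in> P"
    and "has_finite_aspherical_presentation (fundamental_group P x0)"
    and "weakly_hopfian (fundamental_group P x0)"
  shows "\<forall>d. homotopy_domination (top_of_set P) (top_of_set P) d \<longrightarrow>
             homotopy_equivalence (top_of_set P) (top_of_set P) d"
proof (intro allI impI)
 fix d assume d: "homotopy_domination (tos P) (tos P) d"
 obtain T where T: "simplicial_complex T" "T ~= {}" "\<Union>T = P" "Max (aff_dim ` T) = 2"
  using assms(1) by (auto simp: finite_polyhedron_def)
 define K where "K = {S. S ~= {} & ~ affine_dependent S & convex hull S:T}"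
 interpret C: cplx2 K P unfolding K_def by (rule cplx2_simplicial_complex[OF T])
 have "ANR P" unfolding C.P by (rule ANR_finite_Union_convex_closed) (use C.finK C.compact_hull compact_imp_closed in auto)
 hence pc: "path_connected P"
  using assms(2) path_component_eq_connected_component[OF ANR_imp_locally_path_connected, of P]
  by (simp add: path_connected_component connected_iff_connected_component)
 obtain S where "S:K" using assms(3) C.P by blast
 \<comment> \<open>The base point moves to a vertex, since the labels at the base point have to be
   the base point itself.\<close>
 then obtain v0 where v0K: "{v0}:K" using C.simp[of S] C.face[of S "{_}"] by blast
 hence v0P: "v0:P" using C.vertex_P by blast
 interpret pcplx K P v0 by unfold_locales (use pc v0P v0K in auto)
 let ?X0 = "fundamental_group P x0"
 have gX0: "group ?X0" by (rule group_fundamental_group[OF assms(3)])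
 obtain bb where bb: "bb:iso ?X0 G" using base_change[OF assms(3)] by blast
 obtain X :: "nat set" and R where XR: "R \<subseteq> words X" "presented_group X R \<cong> ?X0" "aspherical_space (presentation_complex X R)"
  using assms(4) by (auto simp: has_finite_aspherical_presentation_def)
 obtain qq where "qq:iso (presented_group X R) ?X0" using XR(2) by (auto simp: is_iso_def)
 from iso_set_trans[OF this bb] have fh: "bb o qq:iso (presented_group X R) G" .
 have asph: "is_singleton (homotopy_set 2 (presentation_complex X R) Vertex)"
  using XR(3) Vertex_KX[OF XR(1)] by (simp add: aspherical_space_def)
 obtain aa where aa: "aa:iso G ?X0" "!!x. x:carrier ?X0 ==> aa (bb x) = x" "!!x. x:carrier G ==> bb (aa x) = x"
  using group.iso_set_sym[OF gX0 bb] bb by (auto simp: iso_def bij_betw_def f_inv_into_f inv_into_f_f)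
 have ab: "aa:hom G ?X0" "bb:hom ?X0 G" using aa(1) bb by (auto simp: iso_def)
 have hopf: "i (r g) = g" if i: "i:hom G G" "r:hom G G" "!!g. g:carrier G ==> r (i g) = g" "g:carrier G" for i r g
 proof -
  note c = hom_in_carrier[OF ab(1)] hom_in_carrier[OF ab(2)] hom_in_carrier[OF i(1)] hom_in_carrier[OF i(2)]
  have "aa o i o bb:hom ?X0 ?X0" "aa o r o bb:hom ?X0 ?X0"
   using hom_compose[OF hom_compose[OF ab(2) i(1)] ab(1)] hom_compose[OF hom_compose[OF ab(2) i(2)] ab(1)] by (simp_all add: comp_assoc)
  from weakly_hopfian_retraction[OF assms(5) gX0 this _ c(1)[OF i(4)]]
  have "aa (i (r g)) = aa g" using aa(2,3) i(3,4) c by simp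
  hence "bb (aa (i (r g))) = bb (aa g)" by simp
  thus ?thesis using aa(3)[OF i(4)] aa(3)[OF c(3)[OF c(4)[OF i(4)]]] by simp
 qed
 obtain u where u: "ctm (tos P) (tos P) d" "ctm (tos P) (tos P) u" "hm (d o u) id"
  using d by (auto simp: homotopy_domination_def)
 have "hm (u o d) id"
 proof (rule domination_equivalence[OF v0K XR(1) fh asph _ _ _ _ _ u(3)])
  show "cts P d" "d:P \<rightarrow> P" "cts P u" "u:P \<rightarrow> P" using u(1,2) by simp_all
 qed (rule hopf)
 thus "homotopy_equivalence (tos P) (tos P) d"
  unfolding homotopy_equivalence_def using u by blast
qed

end
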